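(* Let $w\geq 0$ be an integer, $r\geq 1$ a real number, and let $E=\mathbb{R}$ or $E=\mathbb{C}$. The following are equivalent: (i) there is a nonnegative test function $F$ satisfying (POS) and such that the quadratic form $U\mapsto\langle U,U\rangle_F^E-F(0)\frac{[E:\mathbb{R}]}{2}\log r\,(\dim U)^2$ is positive definite on $\mathrm{K}_E^{\le w}$; (ii) the quadratic form $U\mapsto\langle U,U\rangle_{\mathrm{F}_\lambda}^E-\frac{[E:\mathbb{R}]}{2}\log r\,(\dim U)^2$ is positive definite on $\mathrm{K}_E^{\le w}$ for $\lambda$ big enough; (iii) the inequality $r<\mathrm{r}(w)$ holds. More precisely, if $r>\mathrm{r}(w)$, then there is an effective element $U$ in $\mathrm{K}_E^{\le w}$ such that for every nonzero nonnegative test function $F$ satisfying (POS) we have $\langle U,U\rangle_F^E-F(0)\frac{[E:\mathbb{R}]}{2}\log r\,(\dim U)^2<0$.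
   Context: Test functions. A test function is an even function $F:\mathbb{R}\to\mathbb{R}$ such that: (TFa) there is $\epsilon>1/2$ such that $x\mapsto F(x)e^{\epsilon|x|}$ is in $\mathrm{L}^1(\mathbb{R})$ and of bounded variation; (TFb) $x\mapsto(F(x)-F(0))/x$ is of bounded variation on $\mathbb{R}-\{0\}$; (TFc) at each point $F$ is the arithmetic mean of its left and right limits. Fourier transform: $\widehat{F}(\xi)=\int_\mathbb{R}F(x)e^{-2i\pi x\xi}\,\mathrm{d}x$. A test function $F$ satisfies (POS) if $\mathrm{Re}\,\widehat{F}(s)\ge0$ for all $s\in\mathbb{C}$ with $|\mathrm{Im}\,s|\le\frac1{4\pi}$ (equivalently $G(x)=F(x)\cosh\frac{x}{2}$ satisfies $\widehat{G}(\xi)\ge0$ for all $\xi\in\mathbb{R}$). Let $\mathrm{g}$ be twice the convolution square of the function equal to $\cos(\pi x)$ for $|x|\le1/2$ and $0$ otherwise; for $\lambda>0$ set $\mathrm{F}_\lambda(x)=\mathrm{g}(x/\lambda)\cosh(x/2)^{-1}$. Grothendieck rings. $\mathrm{W}_\mathbb{C}=\mathbb{C}^\times$ and $\mathrm{W}_\mathbb{R}=\mathbb{C}^\times\coprod j\mathbb{C}^\times$ with $j^2=-1$ and $jzj^{-1}=\overline{z}$. For $E=\mathbb{R},\mathbb{C}$, $\mathrm{K}_E$ is the Grothendieck ring of finite dimensional continuous complex representations of $\mathrm{W}_E$ trivial on the central subgroup $\mathbb{R}_{>0}$. Thus $\mathrm{K}_\mathbb{C}=\mathbb{Z}[\eta,\eta^{-1}]$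 with $\eta(z)=z/|z|$ ($|z|$ the usual modulus), and $\mathrm{K}_\mathbb{R}$ has $\mathbb{Z}$-basis $1$, $\epsilon_{\mathbb{C}/\mathbb{R}}$ (the order $2$ character with kernel $\mathbb{C}^\times$) and $\mathrm{I}_v=\mathrm{Ind}_{\mathbb{C}^\times}^{\mathrm{W}_\mathbb{R}}\eta^v$ for $v>0$; also $\mathrm{I}_0=1+\epsilon_{\mathbb{C}/\mathbb{R}}$. The subgroup $\mathrm{K}_\mathbb{C}^{\le w}$ is generated by the $\eta^v$ with $|v|\le w$, $v\equiv w\bmod 2$; $\mathrm{K}_\mathbb{R}^{\le w}$ is generated by the $\mathrm{I}_v$ with $0\le v\le w$, $v\equiv w\bmod2$, and also by $1$ if $w$ is even. An element of $\mathrm{K}_E$ is effective if it is the class of an actual representation. $\dim:\mathrm{K}_E\to\mathbb{Z}$ is the virtual dimension and $U\mapsto U^\vee$ is the duality involution. A real valued quadratic form on the free abelian group $\mathrm{K}_E^{\le w}$ is called positive definite if its extension to $\mathrm{K}_E^{\le w}\otimes\mathbb{R}$ is. The forms. For a function $F$ (defined at least on $[0,+\infty[$) put $H(t)=F(t)e^{-t/2}$ for $t\ge0$ and, for $\mathrm{Re}\,s\ge0$, $\psi_H(s)=\int_0^\infty\left(H(0)\frac{e^{-t}}{t}-H(t)\frac{e^{-st}}{1-e^{-t}}\right)\mathrm{d}t$. The $\mathbb{Z}$-linear maps $\mathrm{J}_F^E:\mathrm{K}_E\to\mathbb{R}$ are determined by $\mathrm{J}_F^\mathbb{C}(\eta^v)=\mathrm{J}_F^\mathbb{R}(\mathrm{I}_v)=F(0)\log2\pi-\psi_H(|v|/2)$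 for all $v\in\mathbb{Z}$ and $\mathrm{J}_F^\mathbb{R}(1-\epsilon_{\mathbb{C}/\mathbb{R}})=\int_0^\infty F(t)\frac{e^{-t/2}}{1+e^{-t}}\mathrm{d}t$. Set $\langle U,V\rangle_F^E=\mathrm{J}_F^E(U\cdot V^\vee)$. The number $\mathrm{r}(w)$. With $\psi=\Gamma'/\Gamma$, let $\mathrm{M}(w)=\left(\log\pi-\psi\left(\frac{1+|i-j|}{2}\right)\right)_{0\le i,j\le w}$; then $\mathrm{r}(w)=\exp\left(1/\mathrm{c}(\mathrm{M}(w)^{-1})\right)$, where $\mathrm{c}(M)$ is the sum of all coefficients of $M$. *)

theory Defs
  imports
    "HOL-Analysis.Analysis"
    "HOL-Number_Theory.Cong"
    "HOL-Algebra.Free_Abelian_Groups"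
    "Jordan_Normal_Form.Gauss_Jordan_Elimination"
begin

section \<open>Test functions\<close>

definition bounded_variation_on :: "(real \<Rightarrow> real) \<Rightarrow> real set \<Rightarrow> bool" where
  "bounded_variation_on f S \<longleftrightarrow>
     (\<exists>C. \<forall>n (t :: nat \<Rightarrow> real).
        (\<forall>i\<le>n. t i \<in> S) \<and> (\<forall>i<n. t i \<le> t (Suc i)) \<longrightarrow>
        (\<Sum>i<n. \<bar>f (t (Suc i)) - f (t i)\<bar>) \<le> C)"

definition test_function :: "(real \<Rightarrow> real) \<Rightarrow> bool" where
  "test_function F \<longleftrightarrow>
     (\<forall>x. F (- x) = F x) \<and>
     (\<exists>\<epsilon>>1/2. integrable lborel (\<lambda>x. F x * exp (\<epsilon> * \<bar>x\<bar>)) \<and>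
        bounded_variation_on (\<lambda>x. F x * exp (\<epsilon> * \<bar>x\<bar>)) UNIV) \<and>
     bounded_variation_on (\<lambda>x. (F x - F 0) / x) (UNIV - {0}) \<and>
     (\<forall>x. \<exists>l r. (F \<longlongrightarrow> l) (at_left x) \<and> (F \<longlongrightarrow> r) (at_right x) \<and> F x = (l + r) / 2)"

definition fourier :: "(real \<Rightarrow> real) \<Rightarrow> complex \<Rightarrow> complex" where
  "fourier F \<xi> = (\<integral>x. complex_of_real (F x) * exp (- 2 * \<i> * of_real pi * of_real x * \<xi>) \<partial>lborel)"

definition POS :: "(real \<Rightarrow> real) \<Rightarrow> bool" where
  "POS F \<longleftrightarrow> (\<forall>s. \<bar>Im s\<bar> \<le> 1 / (4 * pi) \<longrightarrow> 0 \<le> Re (fourier F s))"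

definition cos_bump :: "real \<Rightarrow> real" where
  "cos_bump x = (if \<bar>x\<bar> \<le> 1/2 then cos (pi * x) else 0)"

definition odlyzko_g :: "real \<Rightarrow> real" where
  "odlyzko_g x = 2 * (\<integral>y. cos_bump y * cos_bump (x - y) \<partial>lborel)"

definition odlyzko_F :: "real \<Rightarrow> real \<Rightarrow> real" where
  "odlyzko_F l x = odlyzko_g (x / l) * inverse (cosh (x / 2))"

section \<open>Weil groups and their representations\<close>

datatype arch_field = Real_field | Complex_field

definition field_degree :: "arch_field \<Rightarrow> nat" where
  "field_degree E = (case E of Real_field \<Rightarrow> 1 | Complex_field \<Rightarrow> 2)"

text \<open>
  The pair \<open>(b, z)\<close> with \<open>z \<noteq> 0\<close> stands for \<open>z\<close> if \<open>b\<close> is false and for \<open>j z\<close> if \<open>b\<close> is true; the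
  Weil group of the complex field is the subgroup \<open>b = False\<close>. The product formula comes from
  \<open>z j = j (cnj z)\<close> and \<open>j\<^sup>2 = -1\<close>. As \<open>bool\<close> is a discrete space, the product topology on the
  pairs is that of a disjoint union of two copies of the multiplicative group of \<open>complex\<close>.
\<close>

type_synonym weil = "bool \<times> complex"

definition weil_group :: "arch_field \<Rightarrow> weil monoid" where
  "weil_group E =
     \<lparr>carrier = {(b, z). z \<noteq> 0 \<and> (b \<longrightarrow> E = Real_field)},
      monoid.mult = (\<lambda>(a, z) (b, w).
        (a \<noteq> b, (if a \<and> b then - 1 else 1) * (if b then cnj z else z) * w)),
      one = (False, 1)\<rparr>"

type_synonym weil_rep = "weil \<Rightarrow> complex mat"

definition is_rep :: "arch_field \<Rightarrow> nat \<Rightarrow> weil_rep \<Rightarrow> bool" where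
  "is_rep E n \<rho> \<longleftrightarrow>
     (\<forall>g\<in>carrier (weil_group E). \<rho> g \<in> carrier_mat n n) \<and>
     \<rho> \<one>\<^bsub>weil_group E\<^esub> = 1\<^sub>m n \<and>
     (\<forall>g\<in>carrier (weil_group E). \<forall>h\<in>carrier (weil_group E).
        \<rho> (g \<otimes>\<^bsub>weil_group E\<^esub> h) = \<rho> g * \<rho> h) \<and>
     (\<forall>i<n. \<forall>k<n. continuous_on (carrier (weil_group E)) (\<lambda>g. \<rho> g $$ (i, k))) \<and>
     (\<forall>t>0. \<rho> (False, complex_of_real t) = 1\<^sub>m n)"

definition reps :: "arch_field \<Rightarrow> weil_rep set" where
  "reps E = {\<rho>. \<exists>n. is_rep E n \<rho>}"

definition rep_dim :: "weil_rep \<Rightarrow> nat" where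
  "rep_dim \<rho> = dim_row (\<rho> (False, 1))"

definition short_exact :: "arch_field \<Rightarrow> weil_rep \<Rightarrow> weil_rep \<Rightarrow> weil_rep \<Rightarrow> bool" where
  "short_exact E \<rho>' \<rho> \<rho>'' \<longleftrightarrow>
     (\<exists>m n k. \<exists>A\<in>carrier_mat n m. \<exists>B\<in>carrier_mat k n.
        is_rep E m \<rho>' \<and> is_rep E n \<rho> \<and> is_rep E k \<rho>'' \<and>
        (\<forall>g\<in>carrier (weil_group E). A * \<rho>' g = \<rho> g * A \<and> B * \<rho> g = \<rho>'' g * B) \<and>
        inj_on (\<lambda>v. A *\<^sub>v v) (carrier_vec m) \<and>
        (\<lambda>v. A *\<^sub>v v) ` carrier_vec m = {v \<in> carrier_vec n. B *\<^sub>v v = 0\<^sub>v k} \<and>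
        (\<lambda>v. B *\<^sub>v v) ` carrier_vec n = carrier_vec k)"

definition kronecker :: "complex mat \<Rightarrow> complex mat \<Rightarrow> complex mat" where
  "kronecker A B = Matrix.mat (dim_row A * dim_row B) (dim_col A * dim_col B)
     (\<lambda>(i, k). A $$ (i div dim_row B, k div dim_col B) * B $$ (i mod dim_row B, k mod dim_col B))"

definition rep_tensor :: "weil_rep \<Rightarrow> weil_rep \<Rightarrow> weil_rep" where
  "rep_tensor \<rho> \<sigma> = (\<lambda>g. kronecker (\<rho> g) (\<sigma> g))"

definition rep_dual :: "arch_field \<Rightarrow> weil_rep \<Rightarrow> weil_rep" where
  "rep_dual E \<rho> = (\<lambda>g. transpose_mat (\<rho> (inv\<^bsub>weil_group E\<^esub> g)))"

definition rep_trivial :: weil_rep where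
  "rep_trivial = (\<lambda>_. 1\<^sub>m 1)"

definition rep_sign :: weil_rep where
  "rep_sign = (\<lambda>(b, z). Matrix.mat 1 1 (\<lambda>_. if b then - 1 else 1))"

definition eta :: "complex \<Rightarrow> complex" where
  "eta z = z / complex_of_real (cmod z)"

definition rep_eta :: "int \<Rightarrow> weil_rep" where
  "rep_eta v = (\<lambda>(b, z). Matrix.mat 1 1 (\<lambda>_. eta z powi v))"

text \<open>
  Frobenius' formula for a representation induced from the subgroup \<open>b = False\<close>, with coset
  representatives \<open>1\<close> and \<open>j\<close>: the entry of index \<open>(i, k)\<close> at \<open>g\<close> is the value of the character at
  \<open>t\<^sub>i\<inverse> g t\<^sub>k\<close>, extended by zero.
\<close>

definition rep_induced :: "int \<Rightarrow> weil_rep" where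
  "rep_induced v = (\<lambda>g. Matrix.mat 2 2 (\<lambda>(i, k).
     let t = (\<lambda>l::nat. (l = 1, 1));
         h = inv\<^bsub>weil_group Real_field\<^esub> (t i) \<otimes>\<^bsub>weil_group Real_field\<^esub> g \<otimes>\<^bsub>weil_group Real_field\<^esub> t k
     in if fst h then 0 else eta (snd h) powi v))"

section \<open>The Grothendieck ring\<close>

definition virtual_group :: "arch_field \<Rightarrow> (weil_rep \<Rightarrow>\<^sub>0 int) monoid" where
  "virtual_group E = free_Abelian_group (reps E)"

definition exact_relations :: "arch_field \<Rightarrow> (weil_rep \<Rightarrow>\<^sub>0 int) set" where
  "exact_relations E = generate (virtual_group E)
     {frag_of \<rho> - frag_of \<rho>' - frag_of \<rho>'' | \<rho>' \<rho> \<rho>''. short_exact E \<rho>' \<rho> \<rho>''}"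

definition virtual_tensor ::
    "(weil_rep \<Rightarrow>\<^sub>0 int) \<Rightarrow> (weil_rep \<Rightarrow>\<^sub>0 int) \<Rightarrow> (weil_rep \<Rightarrow>\<^sub>0 int)" where
  "virtual_tensor x y = frag_extend (\<lambda>\<rho>. frag_extend (\<lambda>\<sigma>. frag_of (rep_tensor \<rho> \<sigma>)) y) x"

definition virtual_dual :: "arch_field \<Rightarrow> (weil_rep \<Rightarrow>\<^sub>0 int) \<Rightarrow> (weil_rep \<Rightarrow>\<^sub>0 int)" where
  "virtual_dual E x = frag_extend (\<lambda>\<rho>. frag_of (rep_dual E \<rho>)) x"

definition virtual_dim :: "(weil_rep \<Rightarrow>\<^sub>0 int) \<Rightarrow> int" where
  "virtual_dim x = (\<Sum>\<rho>\<in>Poly_Mapping.keys x. Poly_Mapping.lookup x \<rho> * int (rep_dim \<rho>))"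

type_synonym weil_class = "(weil_rep \<Rightarrow>\<^sub>0 int) set"

definition virtual_class :: "arch_field \<Rightarrow> (weil_rep \<Rightarrow>\<^sub>0 int) \<Rightarrow> weil_class" where
  "virtual_class E x = exact_relations E #>\<^bsub>virtual_group E\<^esub> x"

definition rep_class :: "arch_field \<Rightarrow> weil_rep \<Rightarrow> weil_class" where
  "rep_class E \<rho> = virtual_class E (frag_of \<rho>)"

text \<open>
  Elements are cosets. As for \<open>rcoset_mult\<close> in HOL-Algebra, an operation on cosets is the union of the
  cosets obtained from all choices of representatives.
\<close>

definition K_ring :: "arch_field \<Rightarrow> weil_class ring" where
  "K_ring E =
     \<lparr>carrier = carrier (virtual_group E Mod exact_relations E),
      monoid.mult = (\<lambda>U V. \<Union>x\<in>U. \<Union>y\<in>V. virtual_class E (virtual_tensor x y)),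
      one = rep_class E rep_trivial,
      zero = \<one>\<^bsub>virtual_group E Mod exact_relations E\<^esub>,
      add = (\<lambda>U V. U \<otimes>\<^bsub>virtual_group E Mod exact_relations E\<^esub> V)\<rparr>"

definition K_dual :: "arch_field \<Rightarrow> weil_class \<Rightarrow> weil_class" where
  "K_dual E U = (\<Union>x\<in>U. virtual_class E (virtual_dual E x))"

definition K_dim :: "weil_class \<Rightarrow> int" where
  "K_dim U = the_elem (virtual_dim ` U)"

definition effective :: "arch_field \<Rightarrow> weil_class \<Rightarrow> bool" where
  "effective E U \<longleftrightarrow> (\<exists>\<rho>\<in>reps E. U = rep_class E \<rho>)"

definition eta_class :: "int \<Rightarrow> weil_class" where
  "eta_class v = rep_class Complex_field (rep_eta v)"

definition sign_class :: weil_class where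
  "sign_class = rep_class Real_field rep_sign"

definition I_class :: "int \<Rightarrow> weil_class" where
  "I_class v = (if v = 0 then \<one>\<^bsub>K_ring Real_field\<^esub> \<oplus>\<^bsub>K_ring Real_field\<^esub> sign_class
                else rep_class Real_field (rep_induced v))"

definition K_le :: "arch_field \<Rightarrow> nat \<Rightarrow> weil_class set" where
  "K_le E w = generate (add_monoid (K_ring E))
     (case E of
        Complex_field \<Rightarrow> {eta_class v | v. \<bar>v\<bar> \<le> int w \<and> [v = int w] (mod 2)}
      | Real_field \<Rightarrow> {I_class v | v. 0 \<le> v \<and> v \<le> int w \<and> [v = int w] (mod 2)} \<union>
          (if even w then {\<one>\<^bsub>K_ring Real_field\<^esub>} else {}))"

section \<open>Positive definite quadratic forms\<close>

definition Z_basis :: "('a, 'm) ring_scheme \<Rightarrow> 'a set \<Rightarrow> 'a set \<Rightarrow> bool" where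
  "Z_basis R A S \<longleftrightarrow> finite S \<and> S \<subseteq> A \<and>
     (\<forall>a\<in>A. \<exists>!c. c \<in> S \<rightarrow>\<^sub>E (UNIV :: int set) \<and>
        a = finsum R (\<lambda>s. add_pow R (c s) s) S)"

definition polar_form :: "('a, 'm) ring_scheme \<Rightarrow> ('a \<Rightarrow> real) \<Rightarrow> 'a \<Rightarrow> 'a \<Rightarrow> real" where
  "polar_form R q u v = (q (u \<oplus>\<^bsub>R\<^esub> v) - q u - q v) / 2"

text \<open>
  For a quadratic form \<open>q\<close> on an additive subgroup \<open>A\<close> of \<open>R\<close> that is free of finite rank, with
  basis \<open>S\<close>, the extension of \<open>q\<close> to the tensor product of \<open>A\<close> with \<open>real\<close> takes the value
  \<open>\<Sum>s\<in>S. \<Sum>t\<in>S. x s * x t * polar_form R q s t\<close> at the element of coordinates \<open>x\<close>. Positivity of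
  this expression for nonzero \<open>x\<close> does not depend on the basis.
\<close>

definition positive_definite_on ::
    "('a, 'm) ring_scheme \<Rightarrow> 'a set \<Rightarrow> ('a \<Rightarrow> real) \<Rightarrow> bool" where
  "positive_definite_on R A q \<longleftrightarrow>
     (\<exists>S. Z_basis R A S \<and>
        (\<forall>x :: 'a \<Rightarrow> real. (\<exists>s\<in>S. x s \<noteq> 0) \<longrightarrow>
           0 < (\<Sum>s\<in>S. \<Sum>t\<in>S. x s * x t * polar_form R q s t)))"

section \<open>The forms attached to a function\<close>

text \<open>Only real arguments of \<open>\<psi>\<^sub>H\<close> are needed.\<close>

definition psi_H :: "(real \<Rightarrow> real) \<Rightarrow> real \<Rightarrow> real" where
  "psi_H H s = (LBINT t:{0<..}. H 0 * (exp (- t) / t) - H t * (exp (- s * t) / (1 - exp (- t))))"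

definition J_eta :: "(real \<Rightarrow> real) \<Rightarrow> int \<Rightarrow> real" where
  "J_eta F v = F 0 * ln (2 * pi) - psi_H (\<lambda>t. F t * exp (- t / 2)) (\<bar>of_int v\<bar> / 2)"

definition is_J :: "arch_field \<Rightarrow> (real \<Rightarrow> real) \<Rightarrow> (weil_class \<Rightarrow> real) \<Rightarrow> bool" where
  "is_J E F J \<longleftrightarrow>
     (\<forall>U\<in>carrier (K_ring E). \<forall>V\<in>carrier (K_ring E). J (U \<oplus>\<^bsub>K_ring E\<^esub> V) = J U + J V) \<and>
     (case E of
        Complex_field \<Rightarrow> \<forall>v. J (eta_class v) = J_eta F v
      | Real_field \<Rightarrow> (\<forall>v. J (I_class v) = J_eta F v) \<and>
          J (\<one>\<^bsub>K_ring E\<^esub> \<ominus>\<^bsub>K_ring E\<^esub> sign_class) =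
            (LBINT t:{0<..}. F t * (exp (- t / 2) / (1 + exp (- t)))))"

text \<open>
  The choice only matters outside the carrier: the subgroup generated by the classes at which \<open>is_J\<close>
  prescribes the value has index at most 2, so that an additive real valued map is determined by
  these values.
\<close>

definition J_form :: "arch_field \<Rightarrow> (real \<Rightarrow> real) \<Rightarrow> weil_class \<Rightarrow> real" where
  "J_form E F = (SOME J. is_J E F J)"

definition K_pairing :: "arch_field \<Rightarrow> (real \<Rightarrow> real) \<Rightarrow> weil_class \<Rightarrow> weil_class \<Rightarrow> real" where
  "K_pairing E F U V = J_form E F (U \<otimes>\<^bsub>K_ring E\<^esub> K_dual E V)"

section \<open>The number r(w)\<close>

definition M_mat :: "nat \<Rightarrow> real mat" where
  "M_mat w = Matrix.mat (w + 1) (w + 1)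
     (\<lambda>(i, k). ln pi - Digamma ((1 + \<bar>real i - real k\<bar>) / 2))"

text \<open>
  The inverse is totalised by the zero matrix, so that the value is \<open>exp (1 / 0) = 1\<close> should the
  matrix be singular.
\<close>

definition r_bound :: "nat \<Rightarrow> real" where
  "r_bound w = exp (1 / sum_mat (case mat_inverse (M_mat w) of
     Some N \<Rightarrow> N | None \<Rightarrow> 0\<^sub>m (w + 1) (w + 1)))"

end

theory Submission
  imports Defs
    "HOL-Probability.Probability"
    "HOL-Complex_Analysis.Complex_Analysis"
    "HOL-Library.Function_Algebras"
    "Jordan_Normal_Form.Determinant"
begin

text \<open>
  Let \<open>x\<^sub>i\<close> be the multiplicity of \<open>\<eta>\<^bsup>w - 2 i\<^esup>\<close> in the restriction of \<open>U\<close> to \<open>\<complex>\<^sup>\<times>\<close>. Then \<open>\<langle>U, U\<rangle>\<^sub>F\<close> is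
  \<open>[E : \<real>] / 2\<close> times the Toeplitz form \<open>\<Sum>i j. x\<^sub>i x\<^sub>j J\<^sub>F (\<eta>\<^bsup>2 (i - j)\<^esup>)\<close>, plus a nonnegative contribution of the
  sign character if \<open>E = \<real>\<close>. For \<open>F = 1 / cosh (t / 2)\<close>, the limit of the functions \<open>F\<^sub>\<lambda>\<close>, this is the
  form of the matrix \<open>M = M(w)\<close>.

  The form \<open>M\<close> is positive definite on vectors of sum \<open>0\<close>, and its entries are convex in \<open>|i - j|\<close>. Hence
  its minimiser \<open>x\<close> on the simplex has constant potential, \<open>M x = \<mu> 1\<close>, so that \<open>r(w) = exp \<mu>\<close>, and the
  form \<open>M - t 1 1\<^sup>T\<close> is positive definite if and only if \<open>t < \<mu>\<close>.

  A test function with (POS) satisfies \<open>F x \<le> F 0 / cosh (x / 2)\<close>, so that on vectors with nonnegative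
  coordinates its form is at most \<open>F 0\<close> times the limit form. For \<open>log r \<ge> \<mu>\<close> this excludes positivity at the
  equilibrium vector \<open>x\<close>; for \<open>log r > \<mu>\<close> a multiple of \<open>x\<close> is approximated by natural coordinates, those of
  an effective element.
\<close>

section \<open>The integrals defining the forms\<close>

text \<open>The limit function \<open>1 / cosh (t / 2)\<close> decays only like
  \<open>exp (- |t| / 2)\<close>, so it violates (TFa) and cannot itself be the function asked for.
  Sufficiency is therefore a perturbation argument: positive definiteness is an open condition and
  the coefficients of the forms converge as \<lambda> grows. For \<open>E = \<real>\<close> two
  features of restriction to the subgroup of index 2 shape the proof. Its image consists of
  symmetric vectors, so the equilibrium vector has to be symmetrised, and its middle coordinate is
  halved because \<open>I_0\<close> restricts to twice the trivial character; this is why the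
  natural coordinates are taken even. Its kernel consists of the multiples of
  \<open>1 - \<epsilon>\<close>, on which only the integral of the sign character can make the form
  positive. Two definitions demand more than matrix computations. The functional is a choice among
  additive maps with prescribed values, so such a map has to be constructed on a group generated by
  all continuous representations; and positivity refers to some basis over the integers, so the
  converse direction must handle an arbitrary one.\<close>

definition psi_integrand :: "(real \<Rightarrow> real) \<Rightarrow> real \<Rightarrow> real \<Rightarrow> real" where
  "psi_integrand F s t = F 0 * (exp (- t) / t) - F t * exp (- t / 2) * (exp (- s * t) / (1 - exp (- t)))"

lemma J_eta_integrand:
  "J_eta F v = F 0 * ln (2 * pi) - (LBINT t:{0<..}. psi_integrand F (\<bar>of_int v\<bar> / 2) t)"
  by (simp add: J_eta_def psi_H_def psi_integrand_def)

section \<open>Integrability of the integrand at 0 and at infinity\<close>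

lemma inverse_one_minus_exp_bounds:
  fixes t :: real
  assumes t: "t > 0"
  shows "1 / t \<le> 1 / (1 - exp (- t))" "1 / (1 - exp (- t)) \<le> 1 / t + 1"
proof -
  have pos: "0 < 1 - exp (- t)" using t by simp
  have "1 - exp (- t) \<le> t" using exp_ge_add_one_self[of "- t"] by simp
  then show "1 / t \<le> 1 / (1 - exp (- t))" using pos by (simp add: frac_le)
  have "1 + t \<le> exp t" by (rule exp_ge_add_one_self)
  then have "exp (- t) * (1 + t) \<le> 1" by (simp add: exp_minus divide_simps)
  then have "t \<le> (1 + t) * (1 - exp (- t))" by (simp add: algebra_simps)
  then show "1 / (1 - exp (- t)) \<le> 1 / t + 1" using pos t by (simp add: field_simps)
qed

lemma exp_diff_bound:
  fixes x y a :: real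
  assumes "a \<le> x" "a \<le> y"
  shows "\<bar>exp (- x) - exp (- y)\<bar> \<le> \<bar>x - y\<bar> * exp (- a)"
proof -
  have *: "\<bar>exp (- x) - exp (- y)\<bar> \<le> \<bar>x - y\<bar> * exp (- a)" if "a \<le> x" "x \<le> y" for x y
  proof -
    have "exp (- x) - exp (- y) = exp (- x) * (1 - exp (x - y))"
      by (simp add: algebra_simps flip: exp_add)
    also have "\<dots> \<le> exp (- a) * (y - x)"
    proof (rule mult_mono)
      show "1 - exp (x - y) \<le> y - x" using exp_ge_add_one_self[of "x - y"] by linarith
    qed (use that in auto)
    finally show ?thesis using that by (simp add: mult.commute)
  qed
  show ?thesis
  proof (cases "x \<le> y")
    case False
    then show ?thesis using *[of y x] assms by (simp add: abs_minus_commute)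
  qed (use * assms in blast)
qed

text \<open>At 0 the pole \<open>F 0 / t\<close> of the first term cancels that of the second,
  because \<open>F\<close> is Lipschitz at 0 and \<open>1 / (1 - exp (- t))\<close> stays within 1
  of \<open>1 / t\<close>. The bound sees \<open>F\<close> only through \<open>F 0\<close> and
  \<open>C\<close>, so it can dominate a whole family of functions at once.\<close>

lemma psi_integrand_bound:
  assumes t: "t > 0" and s: "s \<ge> 0" and C: "\<bar>F t - F 0\<bar> \<le> C * t"
  shows "\<bar>psi_integrand F s t\<bar> \<le> (\<bar>F 0\<bar> * (s + 2) + 4 * C) * exp (- (t / 4))"
proof -
  define q where "q = 1 / (1 - exp (- t))"
  define b where "b = 1 / 2 + s"
  have q: "1 / t \<le> q" "q \<le> 1 / t + 1" "0 \<le> q"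
    using inverse_one_minus_exp_bounds[OF t] t unfolding q_def by auto
  have C0: "0 \<le> C" using C t by (metis abs_ge_zero order_trans zero_le_mult_iff not_less)
  have eb: "exp (- t / 2) * exp (- s * t) = exp (- (b * t))"
    by (simp add: b_def algebra_simps flip: exp_add)
  \<comment> \<open>The first summand gathers what is proportional to \<open>F 0\<close>, with the
    poles \<open>1 / t\<close> matched; the second carries the variation of \<open>F\<close>, which
    supplies a factor \<open>t\<close> against the pole of \<open>q\<close>.\<close>
  have eq: "psi_integrand F s t =
      F 0 * ((exp (- t) - exp (- (b * t))) / t - exp (- (b * t)) * (q - 1 / t)) - (F t - F 0) * exp (- (b * t)) * q"
  proof -
    have "F t * exp (- t / 2) * (exp (- s * t) / (1 - exp (- t))) = F t * exp (- (b * t)) * q"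
      unfolding q_def eb[symmetric] by simp
    then show ?thesis
      unfolding psi_integrand_def by (simp add: algebra_simps diff_divide_distrib)
  qed
  have half: "t / 2 \<le> t" "t / 2 \<le> b * t" using t s by (auto simp: b_def algebra_simps)
  have e2: "exp (- (b * t)) \<le> exp (- (t / 2))" using half by simp
  have "\<bar>exp (- t) - exp (- (b * t))\<bar> \<le> \<bar>t - b * t\<bar> * exp (- (t / 2))"
    using exp_diff_bound[OF half] .
  also have "\<bar>t - b * t\<bar> = \<bar>1 - b\<bar> * t"
  proof -
    have "t - b * t = (1 - b) * t" by (simp add: algebra_simps)
    then show ?thesis using t by (simp add: abs_mult)
  qed
  finally have "\<bar>(exp (- t) - exp (- (b * t))) / t\<bar> \<le> \<bar>1 - b\<bar> * exp (- (t / 2))"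
    using t by (simp add: divide_simps mult_ac)
  also have "\<dots> \<le> (s + 1) * exp (- (t / 2))"
    using s by (intro mult_right_mono) (auto simp: b_def)
  finally have A: "\<bar>(exp (- t) - exp (- (b * t))) / t\<bar> \<le> (s + 1) * exp (- (t / 2))" .
  have "\<bar>exp (- (b * t)) * (q - 1 / t)\<bar> = exp (- (b * t)) * (q - 1 / t)" using q by simp
  also have "\<dots> \<le> exp (- (t / 2)) * 1" using q e2 by (intro mult_mono) auto
  finally have B: "\<bar>exp (- (b * t)) * (q - 1 / t)\<bar> \<le> exp (- (t / 2))" by simp
  have AB: "\<bar>(exp (- t) - exp (- (b * t))) / t - exp (- (b * t)) * (q - 1 / t)\<bar> \<le> (s + 2) * exp (- (t / 2))"
  proof -
    have "\<bar>(exp (- t) - exp (- (b * t))) / t - exp (- (b * t)) * (q - 1 / t)\<bar> \<le>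
        (s + 1) * exp (- (t / 2)) + exp (- (t / 2))"
      using abs_triangle_ineq4[of "(exp (- t) - exp (- (b * t))) / t" "exp (- (b * t)) * (q - 1 / t)"] A B
      by linarith
    then show ?thesis by (simp add: algebra_simps)
  qed
  have "\<bar>F 0 * ((exp (- t) - exp (- (b * t))) / t - exp (- (b * t)) * (q - 1 / t))\<bar> \<le>
      \<bar>F 0\<bar> * ((s + 2) * exp (- (t / 2)))"
    unfolding abs_mult by (rule mult_left_mono[OF AB]) simp
  also have "\<dots> \<le> \<bar>F 0\<bar> * ((s + 2) * exp (- (t / 4)))"
    using t s by (intro mult_left_mono) auto
  finally have T1: "\<bar>F 0 * ((exp (- t) - exp (- (b * t))) / t - exp (- (b * t)) * (q - 1 / t))\<bar> \<le>
      \<bar>F 0\<bar> * (s + 2) * exp (- (t / 4))" by (simp add: mult.assoc)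
  \<comment> \<open>Half of the decay \<open>exp (- (t / 2))\<close> is spent on absorbing the
    linear factor, whence the rate \<open>1 / 4\<close> and the constant 4.\<close>
  have "1 + t \<le> 4 * exp (t / 4)" using exp_ge_add_one_self[of "t / 4"] t by linarith
  then have "(1 + t) * exp (- (t / 2)) \<le> 4 * exp (t / 4) * exp (- (t / 2))"
    by (intro mult_right_mono) auto
  also have "\<dots> = 4 * exp (- (t / 4))" by (simp flip: exp_add)
  finally have et: "(1 + t) * exp (- (t / 2)) \<le> 4 * exp (- (t / 4))" .
  have "\<bar>(F t - F 0) * exp (- (b * t)) * q\<bar> = \<bar>F t - F 0\<bar> * exp (- (b * t)) * q"
    using q by (simp add: abs_mult)
  also have "\<dots> \<le> (C * t) * exp (- (t / 2)) * (1 / t + 1)"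
    using C q e2 C0 t by (intro mult_mono) auto
  also have "\<dots> = C * ((1 + t) * exp (- (t / 2)))" using t by (simp add: field_simps)
  also have "\<dots> \<le> C * (4 * exp (- (t / 4)))" using et C0 by (intro mult_left_mono) auto
  finally have T2: "\<bar>(F t - F 0) * exp (- (b * t)) * q\<bar> \<le> 4 * C * exp (- (t / 4))" by (simp add: mult_ac)
  show ?thesis unfolding eq using T1 T2 by (simp add: algebra_simps)
qed

lemma exp_integral:
  fixes u :: real
  assumes "u > 0"
  shows "set_integrable lborel {0<..} (\<lambda>t. exp (- (u * t)))" "(LBINT t:{0<..}. exp (- (u * t))) = 1 / u"
  using integrable_I0i_exp_mscale[OF assms] LBINT_I0i_exp_mscale[OF assms]
  by (simp_all add: interval_lebesgue_integral_0_infty mult.commute)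

lemma psi_integrand_measurable:
  assumes [measurable]: "F \<in> borel_measurable borel"
  shows "psi_integrand F s \<in> borel_measurable borel"
  unfolding psi_integrand_def[abs_def] by measurable

lemma psi_integrand_integrable:
  assumes F: "F \<in> borel_measurable borel" and s: "s \<ge> 0" and C: "\<And>t. t > 0 \<Longrightarrow> \<bar>F t - F 0\<bar> \<le> C * t"
  shows "set_integrable lborel {0<..} (psi_integrand F s)"
proof (rule set_integrable_bound)
  show "set_integrable lborel {0<..} (\<lambda>t. (\<bar>F 0\<bar> * (s + 2) + 4 * C) * exp (- (1 / 4 * t)))"
    by (intro set_integrable_mult_right exp_integral(1)) simp
  show "set_borel_measurable lborel {0<..} (psi_integrand F s)"
    using psi_integrand_measurable[OF F, of s] unfolding set_borel_measurable_def by measurable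
  show "AE t in lborel. t \<in> {0<..} \<longrightarrow> norm (psi_integrand F s t) \<le> norm ((\<bar>F 0\<bar> * (s + 2) + 4 * C) * exp (- (1 / 4 * t)))"
  proof (intro AE_I2 impI)
    fix t :: real assume "t \<in> {0<..}"
    then have t: "t > 0" by simp
    from psi_integrand_bound[OF t s C[OF t]]
    show "norm (psi_integrand F s t) \<le> norm ((\<bar>F 0\<bar> * (s + 2) + 4 * C) * exp (- (1 / 4 * t)))"
      by simp
  qed
qed

section \<open>The limit function and its digamma values\<close>

definition sech_half :: "real \<Rightarrow> real" where
  "sech_half t = inverse (cosh (t / 2))"

lemma sech_half_simps: "sech_half 0 = 1" "0 < sech_half t" "sech_half t \<le> 1" "sech_half (- t) = sech_half t"
  using cosh_real_ge_1[of "t / 2"] cosh_real_pos[of "t / 2"]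
  by (auto simp: sech_half_def inverse_le_1_iff)

lemma sech_half_measurable [measurable]: "sech_half \<in> borel_measurable borel"
proof -
  have "continuous_on UNIV sech_half"
    unfolding sech_half_def[abs_def] by (intro continuous_intros) (auto simp: cosh_real_nonzero)
  then show ?thesis by (rule borel_measurable_continuous_onI)
qed

lemma sech_half_lipschitz: "\<bar>sech_half t - sech_half 0\<bar> \<le> t" if "t > 0" for t
proof -
  have "1 - t \<le> sech_half t"
  proof -
    have "cosh (t / 2) \<le> exp (t / 2)"
      using that by (simp add: cosh_def field_simps)
    then have "inverse (exp (t / 2)) \<le> sech_half t"
      unfolding sech_half_def by (intro le_imp_inverse_le) (auto simp: cosh_real_pos)
    moreover have "1 - t / 2 \<le> inverse (exp (t / 2))"
      using exp_ge_add_one_self[of "- (t / 2)"] by (simp add: exp_minus)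
    ultimately show ?thesis using that by linarith
  qed
  then show ?thesis using sech_half_simps(3)[of t] by (simp add: sech_half_simps)
qed

text \<open>With \<open>x = exp (- t / 2)\<close> the function is \<open>2 x / (1 + x^2)\<close>,
  and \<open>(1 + x^2) (1 - x^2) = 1 - x^4\<close> merges the two denominators. The resulting
  \<open>exp (- 2 * t)\<close> is the origin of the recursion of step 2 and of the half-integral
  arguments of \<open>Digamma\<close>.\<close>

lemma psi_integrand_sech_half:
  assumes t: "t > 0"
  shows "psi_integrand sech_half s t = exp (- t) / t - 2 * exp (- (1 + s) * t) / (1 - exp (- 2 * t))"
proof -
  define x where "x = exp (- t / 2)"
  have x: "0 < x" "x < 1" using t by (auto simp: x_def)
  have e: "exp (t / 2) = inverse x" "exp (- t) = x\<^sup>2" "exp (- 2 * t) = x\<^sup>2 * x\<^sup>2" "exp (- (1 + s) * t) = x\<^sup>2 * exp (- s * t)"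
    by (simp_all add: x_def power2_eq_square algebra_simps flip: exp_add exp_minus)
  have y: "0 < x\<^sup>2" "x\<^sup>2 < 1" using x by (simp_all add: power_less_one_iff)
  have "x\<^sup>2 * x\<^sup>2 < 1 * 1" by (rule mult_strict_mono) (use y in auto)
  then have n: "1 - x\<^sup>2 \<noteq> 0" "1 + x\<^sup>2 \<noteq> 0" "1 - x\<^sup>2 * x\<^sup>2 \<noteq> 0"
    using y by linarith+
  have "exp (- (t / 2)) = x" by (simp add: x_def)
  then have sech: "sech_half t = 2 * x / (1 + x\<^sup>2)"
    using x n by (simp add: sech_half_def cosh_def e x_def[symmetric] field_simps power2_eq_square)
  have "sech_half t * x * (exp (- s * t) / (1 - x\<^sup>2)) = 2 * (x\<^sup>2 * exp (- s * t)) / (1 - x\<^sup>2 * x\<^sup>2)"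
    unfolding sech using n by (simp add: divide_simps) (simp add: algebra_simps power2_eq_square power4_eq_xxxx)
  then show ?thesis
    unfolding psi_integrand_def e sech_half_simps(1) x_def[symmetric] by simp
qed

definition D_int :: "nat \<Rightarrow> real" where
  "D_int k = (LBINT t:{0<..}. psi_integrand sech_half (real k) t)"

lemma sech_integrable: "s \<ge> 0 \<Longrightarrow> set_integrable lborel {0<..} (psi_integrand sech_half s)"
  by (rule psi_integrand_integrable[where C = 1]) (use sech_half_lipschitz in auto)

text \<open>Passing from \<open>k\<close> to \<open>k + 2\<close> multiplies the exponential by
  \<open>exp (- 2 * t)\<close>, so the difference of the integrands cancels the denominator and
  leaves a pure exponential. This is the recursion of \<open>Digamma\<close> at
  \<open>(1 + k) / 2\<close>.\<close>

lemma D_int_rec: "D_int (k + 2) = D_int k + 2 / (1 + real k)"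
proof -
  have "D_int (k + 2) - D_int k =
      (LBINT t:{0<..}. psi_integrand sech_half (real (k + 2)) t - psi_integrand sech_half (real k) t)"
    unfolding D_int_def by (intro set_integral_diff(2)[symmetric] sech_integrable) auto
  also have "\<dots> = (LBINT t:{0<..}. 2 * exp (- ((1 + real k) * t)))"
  proof (rule set_lebesgue_integral_cong)
    show "\<forall>t. t \<in> {0<..} \<longrightarrow> psi_integrand sech_half (real (k + 2)) t - psi_integrand sech_half (real k) t =
        2 * exp (- ((1 + real k) * t))"
    proof (intro allI impI)
      fix t :: real assume "t \<in> {0<..}"
      then have t: "t > 0" by simp
      have e: "exp (- (1 + real (k + 2)) * t) = exp (- (1 + real k) * t) * exp (- 2 * t)"
        by (simp add: algebra_simps flip: exp_add)
      have "1 - exp (- 2 * t) \<noteq> 0" using t by simp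
      then show "psi_integrand sech_half (real (k + 2)) t - psi_integrand sech_half (real k) t =
          2 * exp (- ((1 + real k) * t))"
        unfolding psi_integrand_sech_half[OF t] e by (simp add: divide_simps) (simp add: algebra_simps)
    qed
  qed simp
  also have "\<dots> = 2 * (LBINT t:{0<..}. exp (- ((1 + real k) * t)))" by simp
  also have "\<dots> = 2 / (1 + real k)"
    using exp_integral(2)[of "1 + real k"] by simp
  finally show ?thesis by simp
qed

text \<open>The quotient is the integral of \<open>exp (- (x * t))\<close> over \<open>x\<close>
  between 1 and \<open>b\<close>; Tonelli reduces the claim to the integral of \<open>1 / x\<close>.
  This is the source of the logarithm in the asymptotics of \<open>D_int\<close>.\<close>

lemma frullani:
  fixes b :: real
  assumes b: "b \<ge> 1"
  shows "has_bochner_integral lborel (\<lambda>t. indicator {0<..} t *\<^sub>R ((exp (- t) - exp (- (b * t))) / t)) (ln b)"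
proof (rule has_bochner_integral_nn_integral)
  show "(\<lambda>t. indicator {0<..} t *\<^sub>R ((exp (- t) - exp (- (b * t))) / t)) \<in> borel_measurable lborel"
    by measurable
  show "AE t in lborel. 0 \<le> indicator {0<..} t *\<^sub>R ((exp (- t) - exp (- (b * t))) / t)"
    using b by (intro AE_I2) (auto simp: indicator_def mult_le_cancel_right1)
  show "0 \<le> ln b" using b by simp
  have inner: "ennreal (indicator {0<..} t *\<^sub>R ((exp (- t) - exp (- (b * t))) / t)) =
      (\<integral>\<^sup>+x. ennreal (exp (- (x * t))) * indicator {1..b} x * indicator {0<..} t \<partial>lborel)" for t :: real
  proof (cases "t > 0")
    case True
    have "(\<integral>\<^sup>+x. ennreal (exp (- (x * t))) * indicator {1..b} x \<partial>lborel) = - exp (- (b * t)) / t - (- exp (- (1 * t)) / t)"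
      using True b by (intro nn_integral_FTC_Icc) (auto intro!: derivative_eq_intros)
    then show ?thesis using True by (simp add: diff_divide_distrib)
  qed simp
  have "(\<integral>\<^sup>+t. ennreal (indicator {0<..} t *\<^sub>R ((exp (- t) - exp (- (b * t))) / t)) \<partial>lborel) =
      (\<integral>\<^sup>+t. \<integral>\<^sup>+x. ennreal (exp (- (x * t))) * indicator {1..b} x * indicator {0<..} t \<partial>lborel \<partial>lborel)"
    unfolding inner ..
  also have "\<dots> = (\<integral>\<^sup>+x. \<integral>\<^sup>+t. ennreal (exp (- (x * t))) * indicator {1..b} x * indicator {0<..} t \<partial>lborel \<partial>lborel)"
    by (rule lborel_pair.Fubini'[symmetric]) measurable
  also have "\<dots> = (\<integral>\<^sup>+x. ennreal (1 / x) * indicator {1..b} x \<partial>lborel)"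
  proof (rule nn_integral_cong)
    fix x :: real
    show "(\<integral>\<^sup>+t. ennreal (exp (- (x * t))) * indicator {1..b} x * indicator {0<..} t \<partial>lborel) =
        ennreal (1 / x) * indicator {1..b} x"
    proof (cases "x \<in> {1..b}")
      case True
      then have x: "x > 0" by simp
      have "(\<integral>\<^sup>+t. ennreal (exp (- (x * t))) * indicator {1..b} x * indicator {0<..} t \<partial>lborel) =
          (\<integral>\<^sup>+t. ennreal (indicator {0<..} t *\<^sub>R exp (- (x * t))) \<partial>lborel)"
        using True by (intro nn_integral_cong) (auto simp: indicator_def)
      also have "\<dots> = ennreal (\<integral>t. indicator {0<..} t *\<^sub>R exp (- (x * t)) \<partial>lborel)"
        using exp_integral(1)[OF x] by (intro nn_integral_eq_integral) (auto simp: set_integrable_def)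
      also have "\<dots> = ennreal (1 / x)"
        using exp_integral(2)[OF x] by (simp add: set_lebesgue_integral_def)
      finally show ?thesis using True by simp
    qed simp
  qed
  also have "\<dots> = ln b - ln 1"
    using b by (intro nn_integral_FTC_Icc) (auto intro!: derivative_eq_intros simp: divide_simps)
  finally show "(\<integral>\<^sup>+t. ennreal (indicator {0<..} t *\<^sub>R ((exp (- t) - exp (- (b * t))) / t)) \<partial>lborel) = ennreal (ln b)"
    by simp
qed

text \<open>Subtracting Frullani's integrand with \<open>b = 1 + k\<close> removes the pole at 0:
  what remains is \<open>exp (- (b * t))\<close> times a factor between -2 and 0.\<close>

lemma D_int_asymptotic: "\<bar>D_int k - ln (1 + real k)\<bar> \<le> 2 / (1 + real k)"
proof -
  define b where "b = 1 + real k"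
  have b: "b \<ge> 1" by (simp add: b_def)
  let ?f = "\<lambda>t. (exp (- t) - exp (- (b * t))) / t"
  have f: "set_integrable lborel {0<..} ?f" "(LBINT t:{0<..}. ?f t) = ln b"
    using frullani[OF b]
    by (auto simp: set_integrable_def set_lebesgue_integral_def has_bochner_integral_iff)
  let ?g = "\<lambda>t. psi_integrand sech_half (real k) t - ?f t"
  have int: "set_integrable lborel {0<..} ?g"
    by (intro set_integral_diff(1) sech_integrable f(1)) simp
  have "D_int k - ln b = (LBINT t:{0<..}. ?g t)"
    unfolding D_int_def f(2)[symmetric] by (intro set_integral_diff(2)[symmetric] sech_integrable f(1)) simp
  also have "\<bar>\<dots>\<bar> \<le> (LBINT t:{0<..}. 2 * exp (- (b * t)))"
  proof -
    have "\<bar>LBINT t:{0<..}. ?g t\<bar> \<le> (LBINT t:{0<..}. \<bar>?g t\<bar>)"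
      using set_integral_norm_bound[OF int] by simp
    also have "\<dots> \<le> (LBINT t:{0<..}. 2 * exp (- (b * t)))"
    proof (rule set_integral_mono)
      show "set_integrable lborel {0<..} (\<lambda>t. \<bar>?g t\<bar>)" using int by (rule set_integrable_abs)
      show "set_integrable lborel {0<..} (\<lambda>t. 2 * exp (- (b * t)))"
        using b by (intro set_integrable_mult_right exp_integral(1)) simp
      fix t :: real assume "t \<in> {0<..}"
      then have t: "t > 0" by simp
      have q: "0 \<le> 2 / (1 - exp (- 2 * t)) - 1 / t" "2 / (1 - exp (- 2 * t)) - 1 / t \<le> 2"
        using inverse_one_minus_exp_bounds[of "2 * t"] t by (auto simp: field_simps)
      have "?g t = - (exp (- (b * t)) * (2 / (1 - exp (- 2 * t)) - 1 / t))"
        unfolding psi_integrand_sech_half[OF t] b_def by (simp add: algebra_simps diff_divide_distrib)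
      then have "\<bar>?g t\<bar> = exp (- (b * t)) * (2 / (1 - exp (- 2 * t)) - 1 / t)"
        using q by (simp add: abs_mult)
      also have "\<dots> \<le> exp (- (b * t)) * 2" using q by (intro mult_left_mono) auto
      finally show "\<bar>?g t\<bar> \<le> 2 * exp (- (b * t))" by simp
    qed
    finally show ?thesis .
  qed
  also have "\<dots> = 2 / b" using exp_integral(2)[of b] b by simp
  finally show ?thesis by (simp add: b_def)
qed

lemma D_int_mono: "k \<le> l \<Longrightarrow> D_int k \<le> D_int l"
  unfolding D_int_def
proof (rule set_integral_mono)
  fix t :: real assume "k \<le> l" "t \<in> {0<..}"
  then have t: "t > 0" by simp
  have "exp (- (1 + real l) * t) \<le> exp (- (1 + real k) * t)"
    using \<open>k \<le> l\<close> t by simp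
  then show "psi_integrand sech_half (real k) t \<le> psi_integrand sech_half (real l) t"
    unfolding psi_integrand_sech_half[OF t] using t by (simp add: divide_right_mono)
qed (simp_all add: sech_integrable)

text \<open>
  Both sides satisfy the same recursion of step 2, and agree asymptotically at the odd arguments, where
  the digamma function is a harmonic number; monotonicity transfers this to the even arguments.
\<close>

lemma D_int_Digamma: "D_int k = Digamma ((1 + real k) / 2) + ln 2"
proof -
  define E where "E k = D_int k - Digamma ((1 + real k) / 2)" for k
  have rec: "E (k + 2) = E k" for k
  proof -
    have eq: "(1 + real (k + 2)) / 2 = (1 + real k) / 2 + 1" by simp
    have "Digamma ((1 + real (k + 2)) / 2) = Digamma ((1 + real k) / 2) + 1 / ((1 + real k) / 2)"
      unfolding eq by (rule Digamma_plus1) simp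
    then have "Digamma ((1 + real (k + 2)) / 2) = Digamma ((1 + real k) / 2) + 2 / (1 + real k)"
      by simp
    then show ?thesis unfolding E_def D_int_rec by simp
  qed
  have per: "E (k + 2 * n) = E k" for k n
  proof (induction n)
    case (Suc n)
    have "E (k + 2 * Suc n) = E (k + 2 * n + 2)" by (simp add: algebra_simps)
    then show ?case using rec[of "k + 2 * n"] Suc by simp
  qed simp
  have odd: "E 1 = ln 2"
  proof -
    have "(\<lambda>n. E (1 + 2 * n)) \<longlonglongrightarrow> ln 2"
    proof -
      have lim1: "(\<lambda>n. D_int (1 + 2 * n) - ln (1 + real (1 + 2 * n))) \<longlonglongrightarrow> 0"
      proof (rule Lim_null_comparison)
        show "\<forall>\<^sub>F n in sequentially. norm (D_int (1 + 2 * n) - ln (1 + real (1 + 2 * n))) \<le> 2 / (1 + real (1 + 2 * n))"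
          unfolding real_norm_def by (intro always_eventually allI D_int_asymptotic)
        show "(\<lambda>n. 2 / (1 + real (1 + 2 * n))) \<longlonglongrightarrow> 0" by real_asymp
      qed
      have lim2: "(\<lambda>n. ln (1 + real (1 + 2 * n)) - ln (real n)) \<longlonglongrightarrow> ln 2" by real_asymp
      have "(\<lambda>n. (D_int (1 + 2 * n) - ln (1 + real (1 + 2 * n))) + (ln (1 + real (1 + 2 * n)) - ln (real n))
          - (harm n - ln (real n)) + euler_mascheroni) \<longlonglongrightarrow> 0 + ln 2 - euler_mascheroni + euler_mascheroni"
        by (intro tendsto_intros lim1 lim2 euler_mascheroni_LIMSEQ)
      moreover have "E (1 + 2 * n) = (D_int (1 + 2 * n) - ln (1 + real (1 + 2 * n))) +
          (ln (1 + real (1 + 2 * n)) - ln (real n)) - (harm n - ln (real n)) + euler_mascheroni" for n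
      proof -
        have "(1 + real (1 + 2 * n)) / 2 = of_nat (Suc n)" by simp
        then have "Digamma ((1 + real (1 + 2 * n)) / 2) = harm n - euler_mascheroni"
          by (simp only: Digamma_of_nat)
        then show ?thesis by (simp add: E_def)
      qed
      ultimately show ?thesis by simp
    qed
    then show ?thesis using per[of 1] by (simp add: LIMSEQ_const_iff)
  qed
  have even: "E 0 = ln 2"
  proof -
    \<comment> \<open>From \<open>k = 2 * n - 1\<close> to \<open>k = 2 * n + 1\<close> both
      \<open>D_int k\<close> and \<open>Digamma ((1 + k) / 2)\<close> grow by exactly
      \<open>1 / n\<close>, and at both ends they differ by \<open>ln 2\<close>. Being monotone,
      they differ by \<open>ln 2\<close> up to \<open>1 / n\<close> at
      \<open>k = 2 * n\<close>.\<close>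
    have bd: "\<bar>E 0 - ln 2\<bar> \<le> 1 / real n" if n: "n \<ge> 1" for n
    proof -
      have Dp: "Digamma (real n + 1) = Digamma (real n) + 1 / real n"
        using Digamma_plus1[of "real n"] n by simp
      have eq1: "(1 + real (1 + 2 * n)) / 2 = real n + 1" by simp
      obtain p where p: "n = Suc p" using n by (cases n) auto
      have eq2: "(1 + real (1 + 2 * p)) / 2 = real n" unfolding p by simp
      have O1: "D_int (1 + 2 * n) - Digamma (real n + 1) = ln 2"
        using per[of 1 n] odd unfolding E_def[of "1 + 2 * n"] eq1 by simp
      have O2: "D_int (1 + 2 * p) - Digamma (real n) = ln 2"
        using per[of 1 p] odd unfolding E_def[of "1 + 2 * p"] eq2 by simp
      have m: "D_int (1 + 2 * p) \<le> D_int (2 * n)" "D_int (2 * n) \<le> D_int (1 + 2 * n)"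
        by (intro D_int_mono; simp add: p)+
      have "Digamma (real n) \<le> Digamma ((1 + real (2 * n)) / 2)" "Digamma ((1 + real (2 * n)) / 2) \<le> Digamma (real n + 1)"
        using n by (intro Digamma_real_mono; simp)+
      then show ?thesis
        using per[of 0 n] O1 O2 m Dp unfolding E_def[of "0 + 2 * n"] by simp
    qed
    have "(\<lambda>n. E 0 - ln 2) \<longlonglongrightarrow> 0"
    proof (rule Lim_null_comparison)
      show "\<forall>\<^sub>F n in sequentially. norm (E 0 - ln 2) \<le> 1 / real n"
        using bd by (auto simp: eventually_sequentially)
      show "(\<lambda>n. 1 / real n) \<longlonglongrightarrow> 0" by real_asymp
    qed
    then show ?thesis by (simp add: LIMSEQ_const_iff)
  qed
  have "E k = ln 2"
  proof (cases "even k")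
    case True
    then show ?thesis using per[of 0 "k div 2"] even by simp
  next
    case False
    then have "k = 1 + 2 * (k div 2)" by presburger
    then show ?thesis using per[of 1 "k div 2"] odd by metis
  qed
  then show ?thesis by (simp add: E_def)
qed

section \<open>Convexity and conditional positivity of the limit coefficients\<close>

definition m_val :: "nat \<Rightarrow> real" where
  "m_val k = ln pi - Digamma ((1 + real k) / 2)"

lemma m_val_D_int: "m_val k = ln (2 * pi) - D_int k"
  by (simp add: m_val_def D_int_Digamma ln_mult)

lemma m_val_antimono: "k \<le> l \<Longrightarrow> m_val l \<le> m_val k"
  using D_int_mono by (simp add: m_val_D_int)

text \<open>Weights of sum 0 cancel the constant \<open>ln (2 * pi)\<close> and the common term
  \<open>exp (- t) / t\<close>. What is left is a sum of powers of \<open>exp (- t)\<close> against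
  a positive weight, so that inequalities between values of \<open>m_val\<close> follow from
  pointwise inequalities for such sums.\<close>

lemma psi_integrand_combination:
  fixes c :: "'a \<Rightarrow> real" and d :: "'a \<Rightarrow> nat"
  assumes "finite S" "sum c S = 0"
  shows "(\<Sum>s\<in>S. c s * m_val (d s)) =
      (LBINT t:{0<..}. 2 * exp (- t) / (1 - exp (- 2 * t)) * (\<Sum>s\<in>S. c s * exp (- t) ^ d s))"
    and "set_integrable lborel {0<..}
      (\<lambda>t. 2 * exp (- t) / (1 - exp (- 2 * t)) * (\<Sum>s\<in>S. c s * exp (- t) ^ d s))"
proof -
  have eq: "2 * exp (- t) / (1 - exp (- 2 * t)) * (\<Sum>s\<in>S. c s * exp (- t) ^ d s) =
      - (\<Sum>s\<in>S. c s * psi_integrand sech_half (real (d s)) t)" if t: "t > 0" for t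
  proof -
    have "exp (- (1 + real k) * t) = exp (- t) * exp (- t) ^ k" for k
      by (simp add: algebra_simps exp_add exp_of_nat_mult[symmetric] flip: exp_add)
    then have term_eq: "c s * psi_integrand sech_half (real (d s)) t =
        c s * (exp (- t) / t) - 2 * exp (- t) / (1 - exp (- 2 * t)) * (c s * exp (- t) ^ d s)" for s
      unfolding psi_integrand_sech_half[OF t] by (simp add: algebra_simps)
    have "(\<Sum>s\<in>S. c s * (exp (- t) / t)) = 0"
      unfolding sum_distrib_right[symmetric] assms(2) by simp
    then show ?thesis
      unfolding term_eq sum_subtractf sum_distrib_left by simp
  qed
  have int: "set_integrable lborel {0<..} (\<lambda>t. - (\<Sum>s\<in>S. c s * psi_integrand sech_half (real (d s)) t))"
    using sech_integrable unfolding set_integrable_def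
    by (simp add: sum_distrib_left mult.left_commute Bochner_Integration.integrable_sum)
  show "set_integrable lborel {0<..}
      (\<lambda>t. 2 * exp (- t) / (1 - exp (- 2 * t)) * (\<Sum>s\<in>S. c s * exp (- t) ^ d s))"
  proof -
    have "set_integrable lborel {0<..}
        (\<lambda>t. 2 * exp (- t) / (1 - exp (- 2 * t)) * (\<Sum>s\<in>S. c s * exp (- t) ^ d s)) =
        set_integrable lborel {0<..} (\<lambda>t. - (\<Sum>s\<in>S. c s * psi_integrand sech_half (real (d s)) t))"
      by (rule set_integrable_cong) (simp_all only: greaterThan_iff eq)
    then show ?thesis using int by simp
  qed
  have "(LBINT t:{0<..}. 2 * exp (- t) / (1 - exp (- 2 * t)) * (\<Sum>s\<in>S. c s * exp (- t) ^ d s)) =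
      (LBINT t:{0<..}. - (\<Sum>s\<in>S. c s * psi_integrand sech_half (real (d s)) t))"
  proof (rule set_lebesgue_integral_cong)
    show "\<forall>t. t \<in> {0<..} \<longrightarrow> 2 * exp (- t) / (1 - exp (- 2 * t)) * (\<Sum>s\<in>S. c s * exp (- t) ^ d s) =
        - (\<Sum>s\<in>S. c s * psi_integrand sech_half (real (d s)) t)"
    proof (intro allI impI)
      fix t :: real assume "t \<in> {0<..}"
      then show "2 * exp (- t) / (1 - exp (- 2 * t)) * (\<Sum>s\<in>S. c s * exp (- t) ^ d s) =
          - (\<Sum>s\<in>S. c s * psi_integrand sech_half (real (d s)) t)"
        by (intro eq) simp
    qed
  qed simp
  also have "\<dots> = - (\<Sum>s\<in>S. c s * D_int (d s))"
    using sech_integrable unfolding D_int_def set_lebesgue_integral_def set_integrable_def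
    by (simp add: sum_distrib_left mult.left_commute Bochner_Integration.integral_sum)
  also have "\<dots> = (\<Sum>s\<in>S. c s * m_val (d s))"
    using assms(2) by (simp add: m_val_D_int right_diff_distrib sum_subtractf flip: sum_distrib_right)
  finally show "(\<Sum>s\<in>S. c s * m_val (d s)) =
      (LBINT t:{0<..}. 2 * exp (- t) / (1 - exp (- 2 * t)) * (\<Sum>s\<in>S. c s * exp (- t) ^ d s))" by simp
qed

text \<open>The weights 1, -2, 1 have sum 0, and their sum of powers is
  \<open>exp (- t) ^ k * (1 - exp (- t))\<^sup>2\<close>.\<close>

lemma m_val_convex: "2 * m_val (k + 1) \<le> m_val k + m_val (k + 2)"
proof -
  define c :: "nat \<Rightarrow> real" where "c j = (if j = 1 then - 2 else 1)" for j
  have S: "{..2::nat} = {0, 1, 2}" by auto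
  have "(\<Sum>j\<in>{..2::nat}. c j * m_val (k + j)) =
      (LBINT t:{0<..}. 2 * exp (- t) / (1 - exp (- 2 * t)) * (\<Sum>j\<in>{..2}. c j * exp (- t) ^ (k + j)))"
    by (rule psi_integrand_combination) (auto simp: S c_def)
  also have "\<dots> \<ge> 0"
    unfolding set_lebesgue_integral_def
  proof (rule Bochner_Integration.integral_nonneg)
    fix t :: real
    have "(\<Sum>j\<in>{..2}. c j * exp (- t) ^ (k + j)) = exp (- t) ^ k * (1 - exp (- t))\<^sup>2"
      by (simp add: S c_def power_add power2_eq_square algebra_simps)
    then show "0 \<le> indicator {0<..} t *\<^sub>R (2 * exp (- t) / (1 - exp (- 2 * t)) *
        (\<Sum>j\<in>{..2}. c j * exp (- t) ^ (k + j)))"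
      by (cases "t > 0") auto
  qed
  finally show ?thesis by (simp add: S c_def)
qed

text \<open>The matrix \<open>\<rho> ^ |i - j|\<close> is, up to a factor, the covariance of a
  first-order autoregression (the Kac-Murdock-Szego matrix). The filter
  \<open>z (k + 1) = \<rho> * z k + y (k + 1)\<close> diagonalises it, one square being completed at
  each step of the induction.\<close>

lemma kms_form_identity:
  fixes y :: "nat \<Rightarrow> real" and \<rho> :: real
  defines "z \<equiv> \<lambda>k. \<Sum>i\<le>k. \<rho> ^ (k - i) * y i"
  shows "(\<Sum>i\<le>w. \<Sum>j\<le>w. y i * y j * \<rho> ^ nat \<bar>int i - int j\<bar>) =
    (z w)\<^sup>2 + (1 - \<rho>\<^sup>2) * (\<Sum>k<w. (z k)\<^sup>2)"
proof (induction w)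
  case (Suc w)
  have zS: "z (Suc w) = \<rho> * z w + y (Suc w)"
  proof -
    have "(\<Sum>i\<le>w. \<rho> ^ (Suc w - i) * y i) = \<rho> * z w"
      unfolding z_def sum_distrib_left by (intro sum.cong refl) (simp add: Suc_diff_le)
    then show ?thesis by (simp add: z_def)
  qed
  have cross: "(\<Sum>j\<le>w. y (Suc w) * y j * \<rho> ^ nat \<bar>int (Suc w) - int j\<bar>) = y (Suc w) * (\<rho> * z w)"
    "(\<Sum>i\<le>w. y i * y (Suc w) * \<rho> ^ nat \<bar>int i - int (Suc w)\<bar>) = y (Suc w) * (\<rho> * z w)"
  proof -
    have e: "nat \<bar>int (Suc w) - int j\<bar> = Suc (w - j)" "nat \<bar>int j - int (Suc w)\<bar> = Suc (w - j)" if "j \<le> w" for j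
      using that by auto
    show "(\<Sum>j\<le>w. y (Suc w) * y j * \<rho> ^ nat \<bar>int (Suc w) - int j\<bar>) = y (Suc w) * (\<rho> * z w)"
      "(\<Sum>i\<le>w. y i * y (Suc w) * \<rho> ^ nat \<bar>int i - int (Suc w)\<bar>) = y (Suc w) * (\<rho> * z w)"
      unfolding z_def sum_distrib_left by (intro sum.cong refl; simp only: atMost_iff e; simp)+
  qed
  have "(\<Sum>i\<le>Suc w. \<Sum>j\<le>Suc w. y i * y j * \<rho> ^ nat \<bar>int i - int j\<bar>) =
      (\<Sum>i\<le>w. \<Sum>j\<le>w. y i * y j * \<rho> ^ nat \<bar>int i - int j\<bar>) +
      (\<Sum>i\<le>w. y i * y (Suc w) * \<rho> ^ nat \<bar>int i - int (Suc w)\<bar>) +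
      (\<Sum>j\<le>w. y (Suc w) * y j * \<rho> ^ nat \<bar>int (Suc w) - int j\<bar>) + (y (Suc w))\<^sup>2"
    by (simp add: sum.distrib power2_eq_square del: of_nat_Suc)
  then show ?case
    unfolding cross Suc zS by (simp add: power2_eq_square algebra_simps)
qed (simp add: z_def power2_eq_square)

lemma kms_form_pos:
  fixes y :: "nat \<Rightarrow> real"
  assumes rho: "0 < \<rho>" "\<rho> < 1" and nz: "\<exists>i\<le>w. y i \<noteq> 0"
  shows "0 < (\<Sum>i\<le>w. \<Sum>j\<le>w. y i * y j * \<rho> ^ nat \<bar>int i - int j\<bar>)"
proof -
  define z where "z k = (\<Sum>i\<le>k. \<rho> ^ (k - i) * y i)" for k
  have r2: "0 < 1 - \<rho>\<^sup>2" using rho by (simp add: power_less_one_iff)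
  have eq: "(\<Sum>i\<le>w. \<Sum>j\<le>w. y i * y j * \<rho> ^ nat \<bar>int i - int j\<bar>) =
    (z w)\<^sup>2 + (1 - \<rho>\<^sup>2) * (\<Sum>k<w. (z k)\<^sup>2)"
    unfolding z_def by (rule kms_form_identity)
  \<comment> \<open>At the first nonzero coordinate nothing earlier has entered the filter, so
    \<open>z k = y k\<close> and one of the squares is positive.\<close>
  define k where "k = (LEAST i. i \<le> w \<and> y i \<noteq> 0)"
  have "k \<le> w \<and> y k \<noteq> 0" unfolding k_def by (rule LeastI_ex[OF nz])
  then have k: "k \<le> w" "y k \<noteq> 0" by auto
  have min: "y i = 0" if "i < k" for i
    using not_less_Least[OF that[unfolded k_def]] k that by auto
  have "z k = (\<Sum>i\<le>k. if i = k then y k else 0)"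
    unfolding z_def using min by (intro sum.cong) (auto simp: le_less)
  then have zk: "z k \<noteq> 0" using k by simp
  show ?thesis
  proof (cases "k = w")
    case True
    then have "0 < (z w)\<^sup>2" using zk by simp
    moreover have "0 \<le> (1 - \<rho>\<^sup>2) * (\<Sum>k<w. (z k)\<^sup>2)" using r2 by (intro mult_nonneg_nonneg sum_nonneg) auto
    ultimately show ?thesis unfolding eq by linarith
  next
    case False
    then have "(z k)\<^sup>2 \<le> (\<Sum>k<w. (z k)\<^sup>2)" using k by (intro member_le_sum) auto
    moreover have "0 < (z k)\<^sup>2" using zk by simp
    ultimately have "0 < (\<Sum>k<w. (z k)\<^sup>2)" by linarith
    then have "0 < (1 - \<rho>\<^sup>2) * (\<Sum>k<w. (z k)\<^sup>2)" by (intro mult_pos_pos r2)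
    then show ?thesis unfolding eq by (simp add: add_nonneg_pos)
  qed
qed

text \<open>
  On vectors of sum \<open>0\<close> the logarithmic divergence of the integrals cancels, and the form becomes a
  superposition of the positive definite forms \<open>\<rho>\<^bsup>|i - j|\<^esup>\<close> with \<open>\<rho> = exp (- t)\<close>.
\<close>

lemma m_val_conditionally_positive:
  fixes y :: "nat \<Rightarrow> real"
  assumes sum0: "(\<Sum>i\<le>w. y i) = 0" and nz: "\<exists>i\<le>w. y i \<noteq> 0"
  shows "0 < (\<Sum>i\<le>w. \<Sum>j\<le>w. y i * y j * m_val (nat \<bar>int i - int j\<bar>))"
proof -
  let ?S = "{..w} \<times> {..w}"
  define c where "c = (\<lambda>(i, j). y i * y j)"
  define d where "d = (\<lambda>(i, j). nat \<bar>int i - int j\<bar>)"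
  define f where "f t = indicator {0<..} t *\<^sub>R (2 * exp (- t) / (1 - exp (- 2 * t)) *
      (\<Sum>s\<in>?S. c s * exp (- t) ^ d s))" for t :: real
  have cz: "sum c ?S = 0"
  proof -
    have "sum c ?S = (\<Sum>i\<le>w. \<Sum>j\<le>w. y i * y j)"
      by (simp add: c_def sum.cartesian_product)
    also have "\<dots> = (\<Sum>i\<le>w. y i) * (\<Sum>j\<le>w. y j)" by (rule sum_product[symmetric])
    finally show ?thesis using sum0 by simp
  qed
  have "(\<Sum>i\<le>w. \<Sum>j\<le>w. y i * y j * m_val (nat \<bar>int i - int j\<bar>)) = (\<Sum>s\<in>?S. c s * m_val (d s))"
    by (simp add: c_def d_def sum.cartesian_product case_prod_unfold)
  also have "\<dots> = integral\<^sup>L lborel f"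
    unfolding f_def[abs_def] set_lebesgue_integral_def[symmetric]
    by (intro psi_integrand_combination(1) cz) simp
  finally have eq: "(\<Sum>i\<le>w. \<Sum>j\<le>w. y i * y j * m_val (nat \<bar>int i - int j\<bar>)) = integral\<^sup>L lborel f" .
  have int: "integrable lborel f"
    unfolding f_def[abs_def] set_integrable_def[symmetric]
    by (intro psi_integrand_combination(2) cz) simp
  have pos: "0 < f t" if t: "t > 0" for t
  proof -
    have "(\<Sum>s\<in>?S. c s * exp (- t) ^ d s) = (\<Sum>i\<le>w. \<Sum>j\<le>w. y i * y j * exp (- t) ^ nat \<bar>int i - int j\<bar>)"
      by (simp add: c_def d_def sum.cartesian_product case_prod_unfold)
    also have "\<dots> > 0" using t by (intro kms_form_pos nz) auto
    finally show ?thesis using t by (simp add: f_def)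
  qed
  have nonneg: "0 \<le> f t" for t
    using pos[of t] by (cases "t > 0") (auto simp: f_def)
  have "integral\<^sup>L lborel f \<noteq> 0"
  proof
    assume "integral\<^sup>L lborel f = 0"
    then have "AE t in lborel. f t = 0"
      using integral_nonneg_eq_0_iff_AE[OF int] nonneg by simp
    then have "AE t in lborel. t \<notin> {0<..<1::real}"
      by eventually_elim (use pos in force)
    then have "{0<..<1::real} \<in> null_sets lborel"
      using AE_iff_null_sets[of "{0<..<1::real}" lborel] by simp
    then show False by (simp add: null_sets_def)
  qed
  moreover have "0 \<le> integral\<^sup>L lborel f" by (rule Bochner_Integration.integral_nonneg) (rule nonneg)
  ultimately show ?thesis unfolding eq by linarith
qed

section \<open>Toeplitz forms and the equilibrium vector\<close>

definition toeplitz_form :: "nat \<Rightarrow> (int \<Rightarrow> real) \<Rightarrow> (nat \<Rightarrow> real) \<Rightarrow> real" where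
  "toeplitz_form w T x = (\<Sum>i\<le>w. \<Sum>j\<le>w. x i * x j * T (int i - int j))"

definition toeplitz_apply :: "nat \<Rightarrow> (int \<Rightarrow> real) \<Rightarrow> (nat \<Rightarrow> real) \<Rightarrow> nat \<Rightarrow> real" where
  "toeplitz_apply w T x i = (\<Sum>j\<le>w. x j * T (int i - int j))"

definition M_seq :: "int \<Rightarrow> real" where
  "M_seq k = m_val (nat \<bar>k\<bar>)"

lemma toeplitz_form_apply: "toeplitz_form w T x = (\<Sum>i\<le>w. x i * toeplitz_apply w T x i)"
  by (simp add: toeplitz_form_def toeplitz_apply_def sum_distrib_left mult.assoc)

lemma toeplitz_form_cong: "(\<And>i. i \<le> w \<Longrightarrow> x i = y i) \<Longrightarrow> toeplitz_form w T x = toeplitz_form w T y"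
  unfolding toeplitz_form_def by (intro sum.cong) auto

lemma toeplitz_form_scale: "toeplitz_form w T (\<lambda>i. c * x i) = c\<^sup>2 * toeplitz_form w T x"
  unfolding toeplitz_form_def sum_distrib_left
  by (intro sum.cong refl) (simp add: power2_eq_square)

lemma toeplitz_form_combine:
  assumes even: "\<And>k. T (- k) = T k"
  shows "toeplitz_form w T (\<lambda>i. a * x i + b * y i) =
    a\<^sup>2 * toeplitz_form w T x + 2 * a * b * (\<Sum>i\<le>w. y i * toeplitz_apply w T x i) + b\<^sup>2 * toeplitz_form w T y"
proof -
  have sym: "(\<Sum>i\<le>w. \<Sum>j\<le>w. x i * y j * T (int i - int j)) = (\<Sum>i\<le>w. y i * toeplitz_apply w T x i)"
  proof -
    have "T (int i - int j) = T (int j - int i)" for i j using even[of "int i - int j"] by simp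
    then show ?thesis
      unfolding toeplitz_apply_def sum_distrib_left
      by (subst sum.swap) (intro sum.cong refl, simp add: mult_ac)
  qed
  have "toeplitz_form w T (\<lambda>i. a * x i + b * y i) =
      (\<Sum>i\<le>w. \<Sum>j\<le>w. a\<^sup>2 * (x i * x j * T (int i - int j)) + a * b * (x i * y j * T (int i - int j)) +
        a * b * (y i * (x j * T (int i - int j))) + b\<^sup>2 * (y i * y j * T (int i - int j)))"
    unfolding toeplitz_form_def by (intro sum.cong refl) (simp add: algebra_simps power2_eq_square)
  also have "\<dots> = a\<^sup>2 * toeplitz_form w T x + a * b * (\<Sum>i\<le>w. \<Sum>j\<le>w. x i * y j * T (int i - int j)) +
      a * b * (\<Sum>i\<le>w. y i * toeplitz_apply w T x i) + b\<^sup>2 * toeplitz_form w T y"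
    by (simp only: sum.distrib toeplitz_form_def toeplitz_apply_def sum_distrib_left)
  finally show ?thesis by (simp add: sym)
qed

lemma toeplitz_form_shift:
  "toeplitz_form w (\<lambda>k. T k - t) x = toeplitz_form w T x - t * (\<Sum>i\<le>w. x i)\<^sup>2"
proof -
  have "(\<Sum>i\<le>w. x i)\<^sup>2 = (\<Sum>i\<le>w. \<Sum>j\<le>w. x i * x j)"
    unfolding power2_eq_square by (rule sum_product)
  moreover have "toeplitz_form w (\<lambda>k. T k - t) x =
      (\<Sum>i\<le>w. \<Sum>j\<le>w. x i * x j * T (int i - int j) - t * (x i * x j))"
    unfolding toeplitz_form_def by (intro sum.cong refl) (simp add: algebra_simps)
  ultimately show ?thesis
    by (simp only: sum_subtractf sum_distrib_left toeplitz_form_def)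
qed

lemma M_seq_minus: "M_seq (- k) = M_seq k"
  by (simp add: M_seq_def)

lemma M_seq_conditionally_positive:
  "(\<Sum>i\<le>w. y i) = 0 \<Longrightarrow> \<exists>i\<le>w. y i \<noteq> 0 \<Longrightarrow> 0 < toeplitz_form w M_seq y"
  unfolding toeplitz_form_def M_seq_def by (rule m_val_conditionally_positive)

text \<open>The reflected sequence is convex on either side of 0 but has its maximum at 0, hence the
  restriction on \<open>k\<close>.\<close>

lemma M_seq_convex:
  assumes "k \<noteq> 0"
  shows "2 * M_seq k \<le> M_seq (k - 1) + M_seq (k + 1)"
proof -
  define n where "n = nat \<bar>k\<bar> - 1"
  have n: "nat \<bar>k\<bar> = n + 1" using assms by (simp add: n_def)
  have "M_seq (k - 1) + M_seq (k + 1) = m_val n + m_val (n + 2)"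
  proof (cases "k > 0")
    case True
    then have "nat \<bar>k - 1\<bar> = n" "nat \<bar>k + 1\<bar> = n + 2" by (auto simp: n_def)
    then show ?thesis by (simp only: M_seq_def)
  next
    case False
    then have "nat \<bar>k - 1\<bar> = n + 2" "nat \<bar>k + 1\<bar> = n" using assms by (auto simp: n_def)
    then show ?thesis by (simp only: M_seq_def add.commute)
  qed
  then show ?thesis using m_val_convex[of n] by (simp add: M_seq_def n)
qed

text \<open>Vectors are functions on all of \<open>nat\<close>. Fixing the coordinates beyond
  \<open>w\<close> to 0 makes the cube a product of compact sets, to which Tychonoff
  applies.\<close>

lemma compact_cube: "compact {x :: nat \<Rightarrow> real. (\<forall>i\<le>w. \<bar>x i\<bar> \<le> 1) \<and> (\<forall>i>w. x i = 0)}"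
proof -
  have eq: "{x :: nat \<Rightarrow> real. (\<forall>i\<le>w. \<bar>x i\<bar> \<le> 1) \<and> (\<forall>i>w. x i = 0)} =
      PiE UNIV (\<lambda>i. if i \<le> w then {-1..1} else {0})"
  proof (rule Set.set_eqI)
    fix x :: "nat \<Rightarrow> real"
    have "x i \<in> (if i \<le> w then {-1..1} else {0}) \<longleftrightarrow> (i \<le> w \<longrightarrow> \<bar>x i\<bar> \<le> 1) \<and> (i > w \<longrightarrow> x i = 0)" for i
      by (auto simp: abs_le_iff)
    then show "x \<in> {x. (\<forall>i\<le>w. \<bar>x i\<bar> \<le> 1) \<and> (\<forall>i>w. x i = 0)} \<longleftrightarrow>
        x \<in> PiE UNIV (\<lambda>i. if i \<le> w then {-1..1} else {0})"
      unfolding PiE_UNIV_domain Pi_iff mem_Collect_eq by blast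
  qed
  have "compactin (product_topology (\<lambda>i. euclidean) UNIV) (PiE UNIV (\<lambda>i::nat. if i \<le> w then {-1..1::real} else {0}))"
    unfolding compactin_PiE by auto
  then show ?thesis unfolding eq euclidean_product_topology by simp
qed

lemma continuous_on_coordinate: "continuous_on S (\<lambda>x :: nat \<Rightarrow> real. x i)"
  by (rule continuous_on_subset[OF continuous_on_product_coordinates]) simp

lemma continuous_on_toeplitz_form: "continuous_on S (toeplitz_form w T)"
  unfolding toeplitz_form_def[abs_def]
  by (intro continuous_intros continuous_on_coordinate)

definition unit_simplex :: "nat \<Rightarrow> (nat \<Rightarrow> real) set" where
  "unit_simplex w = {x. (\<forall>i\<le>w. 0 \<le> x i) \<and> (\<forall>i>w. x i = 0) \<and> (\<Sum>i\<le>w. x i) = 1}"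

lemma compact_unit_simplex: "compact (unit_simplex w)"
proof -
  have eq: "unit_simplex w = {x :: nat \<Rightarrow> real. (\<forall>i\<le>w. \<bar>x i\<bar> \<le> 1) \<and> (\<forall>i>w. x i = 0)} \<inter>
      ({x. \<forall>i\<in>{..w}. 0 \<le> x i} \<inter> {x. (\<Sum>i\<le>w. x i) = 1})"
  proof (intro equalityI subsetI)
    fix x assume x: "x \<in> unit_simplex w"
    have "x i \<le> 1" if "i \<le> w" for i
      using member_le_sum[of i "{..w}" x] x that by (auto simp: unit_simplex_def)
    then show "x \<in> {x :: nat \<Rightarrow> real. (\<forall>i\<le>w. \<bar>x i\<bar> \<le> 1) \<and> (\<forall>i>w. x i = 0)} \<inter>
      ({x. \<forall>i\<in>{..w}. 0 \<le> x i} \<inter> {x. (\<Sum>i\<le>w. x i) = 1})"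
      using x by (auto simp: unit_simplex_def)
  qed (auto simp: unit_simplex_def)
  have "closed (\<Inter>i\<in>{..w}. {x :: nat \<Rightarrow> real. 0 \<le> x i})"
    by (intro closed_INT ballI closed_Collect_le continuous_on_coordinate continuous_on_const)
  also have "(\<Inter>i\<in>{..w}. {x :: nat \<Rightarrow> real. 0 \<le> x i}) = {x. \<forall>i\<in>{..w}. 0 \<le> x i}" by auto
  finally have "closed {x :: nat \<Rightarrow> real. \<forall>i\<in>{..w}. 0 \<le> x i}" .
  moreover have "closed {x :: nat \<Rightarrow> real. (\<Sum>i\<le>w. x i) = 1}"
    by (intro closed_Collect_eq continuous_on_sum continuous_on_coordinate continuous_on_const)
  ultimately show ?thesis
    unfolding eq by (intro compact_Int_closed compact_cube closed_Int)
qed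

text \<open>
  The minimiser of the form over the simplex. Convexity of \<open>M_seq\<close> away from \<open>0\<close> forces its potential
  to be constant: at a point of zero mass where the potential exceeds its minimum, a maximum of the
  potential would propagate to all indices.
\<close>

lemma equilibrium_vector:
  obtains x \<mu> where "\<And>i. i \<le> w \<Longrightarrow> 0 \<le> x i" "\<And>i. i \<le> w \<Longrightarrow> x (w - i) = x i" "(\<Sum>i\<le>w. x i) = 1"
    "\<And>i. i \<le> w \<Longrightarrow> toeplitz_apply w M_seq x i = \<mu>"
proof -
  have "unit_simplex w \<noteq> {}"
  proof -
    have "(\<lambda>i. if i = 0 then 1 else 0) \<in> unit_simplex w"
      by (auto simp: unit_simplex_def)
    then show ?thesis by blast
  qed
  then obtain x where x: "x \<in> unit_simplex w"
    and min: "\<And>y. y \<in> unit_simplex w \<Longrightarrow> toeplitz_form w M_seq x \<le> toeplitz_form w M_seq y"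
    using continuous_attains_inf[OF compact_unit_simplex _ continuous_on_toeplitz_form] by metis
  have x0: "\<And>i. i \<le> w \<Longrightarrow> 0 \<le> x i" and x1: "(\<Sum>i\<le>w. x i) = 1" and xz: "\<And>i. i > w \<Longrightarrow> x i = 0"
    using x by (auto simp: unit_simplex_def)
  define g where "g = toeplitz_apply w M_seq x"
  define \<mu> where "\<mu> = toeplitz_form w M_seq x"
  have \<mu>g: "\<mu> = (\<Sum>i\<le>w. x i * g i)" by (simp add: \<mu>_def g_def toeplitz_form_apply)
  \<comment> \<open>First-order condition toward the vertex \<open>k\<close> of the simplex: along
    the segment from \<open>x\<close> to \<open>e\<close> the form has derivative
    \<open>2 * (g k - \<mu>)\<close> at \<open>x\<close>, and its quadratic coefficient is
    \<open>- b\<close>.\<close>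
  have ge: "\<mu> \<le> g k" if k: "k \<le> w" for k
  proof (rule ccontr)
    assume "\<not> \<mu> \<le> g k"
    then have a: "g k - \<mu> < 0" by simp
    define e where "e = (\<lambda>i. if i = k then 1 else 0 :: real)"
    define b where "b = 2 * g k - \<mu> - toeplitz_form w M_seq e"
    have ineq: "s * b \<le> 2 * (g k - \<mu>)" if s: "0 < s" "s \<le> 1" for s
    proof -
      let ?y = "\<lambda>i. (1 - s) * x i + s * e i"
      have "(\<Sum>i\<le>w. ?y i) = (1 - s) * (\<Sum>i\<le>w. x i) + s * (\<Sum>i\<le>w. e i)"
        by (simp add: sum.distrib sum_distrib_left)
      also have "\<dots> = 1" using k by (simp add: x1 e_def)
      finally have "?y \<in> unit_simplex w"
        using s x0 xz k by (auto simp: unit_simplex_def e_def)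
      from min[OF this] have "\<mu> \<le> (1 - s)\<^sup>2 * \<mu> + 2 * (1 - s) * s * (\<Sum>i\<le>w. e i * g i) + s\<^sup>2 * toeplitz_form w M_seq e"
        unfolding toeplitz_form_combine[of M_seq, OF M_seq_minus] \<mu>_def[symmetric] g_def[symmetric] .
      moreover have "(\<Sum>i\<le>w. e i * g i) = g k"
      proof -
        have "(\<Sum>i\<le>w. e i * g i) = (\<Sum>i\<le>w. if i = k then g i else 0)"
          by (intro sum.cong) (auto simp: e_def)
        then show ?thesis using k by simp
      qed
      ultimately have "0 \<le> s * (2 * (g k - \<mu>) - s * b)"
        by (simp add: b_def power2_eq_square algebra_simps)
      then show ?thesis using s by (simp add: zero_le_mult_iff)
    qed
    \<comment> \<open>Small enough that the quadratic term costs at most half of the linear gain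
      \<open>2 * (\<mu> - g k)\<close>.\<close>
    define s where "s = min 1 ((\<mu> - g k) / (\<bar>b\<bar> + 1))"
    have s: "0 < s" "s \<le> 1" using a by (auto simp: s_def)
    have "s * \<bar>b\<bar> \<le> (\<mu> - g k) / (\<bar>b\<bar> + 1) * \<bar>b\<bar>" by (intro mult_right_mono) (auto simp: s_def)
    also have "\<dots> \<le> \<mu> - g k" using a by (simp add: divide_simps mult_left_mono)
    finally have "- (s * b) \<le> \<mu> - g k" using s abs_ge_minus_self[of "s * b"] by (simp add: abs_mult)
    from add_mono[OF this ineq[OF s]] have "0 \<le> g k - \<mu>" by simp
    then show False using a by linarith
  qed
  \<comment> \<open>Complementary slackness: the mean of \<open>g - \<mu>\<close> with weights
    \<open>x\<close> is 0, and all its terms are nonnegative.\<close>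
  have on_supp: "x k = 0" if k: "k \<le> w" "g k \<noteq> \<mu>" for k
  proof -
    have "(\<Sum>i\<le>w. x i * (g i - \<mu>)) = 0"
      using x1 \<mu>g by (simp add: right_diff_distrib sum_subtractf flip: sum_distrib_right)
    then have "\<forall>i\<in>{..w}. x i * (g i - \<mu>) = 0"
      by (subst (asm) sum_nonneg_eq_0_iff) (use x0 ge in auto)
    then show ?thesis using k by auto
  qed
  have g_eq: "g k = \<mu>" if k: "k \<le> w" for k
  proof (rule ccontr)
    assume "g k \<noteq> \<mu>"
    then have gk: "\<mu> < g k" using ge[OF k] by simp
    define G where "G = Max (g ` {..w})"
    have Gmax: "g i \<le> G" if "i \<le> w" for i using that by (simp add: G_def)
    have "G > \<mu>" using Gmax[OF k] gk by simp
    have zero: "x i = 0" if "i \<le> w" "g i = G" for i using on_supp that \<open>G > \<mu>\<close> by auto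
    have "G \<in> g ` {..w}" unfolding G_def by (intro Max_in) auto
    then obtain k0 where k0: "k0 \<le> w" "g k0 = G" by auto
    have diff: "g (i - 1) + g (i + 1) - 2 * g i =
        (\<Sum>j\<le>w. x j * (M_seq (int i - int j - 1) + M_seq (int i - int j + 1) - 2 * M_seq (int i - int j)))"
      if "i \<ge> 1" for i
      using that unfolding g_def toeplitz_apply_def
      by (simp add: sum_subtractf sum.distrib sum_distrib_left algebra_simps of_nat_diff)
    \<comment> \<open>Zero mass at \<open>i\<close> removes the term \<open>j = i\<close>, the only
      one for which convexity fails. So the second difference of \<open>g\<close> is nonnegative at
      the maximum \<open>i\<close>, and the neighbours are maximal too.\<close>
    have down: "g (i - 1) = G" if i: "1 \<le> i" "i \<le> w" "g i = G" for i
    proof (cases "i = w")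
      case False
      have "0 \<le> x j * (M_seq (int i - int j - 1) + M_seq (int i - int j + 1) - 2 * M_seq (int i - int j))"
        if j: "j \<le> w" for j
      proof (cases "j = i")
        case False
        then show ?thesis using M_seq_convex[of "int i - int j"] x0[OF j] by simp
      qed (simp add: zero i)
      then have "0 \<le> g (i - 1) + g (i + 1) - 2 * g i" unfolding diff[OF i(1)] by (intro sum_nonneg) auto
      moreover have "g (i + 1) \<le> G" "g (i - 1) \<le> G" using i False Gmax[of "i + 1"] Gmax[of "i - 1"] by auto
      ultimately show ?thesis using i(3) by linarith
    next
      case True
      \<comment> \<open>At the right end no second difference is available. All the mass lies to the
        left of \<open>w\<close>, and a step to the left approaches it, which raises the potential
        because \<open>m_val\<close> is decreasing.\<close>
      have "g i \<le> g (i - 1)"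
        unfolding g_def toeplitz_apply_def
      proof (rule sum_mono)
        fix j assume j: "j \<in> {..w}"
        show "x j * M_seq (int i - int j) \<le> x j * M_seq (int (i - 1) - int j)"
        proof (cases "j = i")
          case False
          then have "nat \<bar>int (i - 1) - int j\<bar> \<le> nat \<bar>int i - int j\<bar>" using True j i(1) by auto
          then show ?thesis
            using x0 j by (auto simp: M_seq_def intro!: mult_left_mono m_val_antimono)
        qed (simp add: zero i)
      qed
      then show ?thesis using Gmax[of "i - 1"] i by simp
    qed
    have "g (k0 - n) = G" for n
    proof (induction n)
      case (Suc n)
      show ?case
      proof (cases "k0 - n = 0")
        case False
        then show ?thesis using down[of "k0 - n"] Suc k0(1) by simp
      qed (use Suc in simp)
    qed (use k0 in simp)
    from this[of k0] have g0: "g 0 = G" by simp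
    \<comment> \<open>Where the potential is \<open>G > \<mu>\<close> there is no mass. Hence all of
      it lies beyond \<open>n\<close>, and a step to the right approaches it. At the end no mass is
      left, against the total mass 1.\<close>
    have up: "\<forall>i\<le>n. g i = G" if "n \<le> w" for n
      using that
    proof (induction n)
      case (Suc n)
      then have IH: "\<forall>i\<le>n. g i = G" by simp
      have "g n \<le> g (Suc n)"
        unfolding g_def toeplitz_apply_def
      proof (rule sum_mono)
        fix j assume j: "j \<in> {..w}"
        show "x j * M_seq (int n - int j) \<le> x j * M_seq (int (Suc n) - int j)"
        proof (cases "j \<le> n")
          case False
          then have "nat \<bar>int (Suc n) - int j\<bar> \<le> nat \<bar>int n - int j\<bar>" by auto
          then show ?thesis
            using x0 j by (auto simp: M_seq_def intro!: mult_left_mono m_val_antimono)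
        next
          case True
          then show ?thesis using zero[of j] IH j by simp
        qed
      qed
      then have "g (Suc n) = G" using IH Gmax[of "Suc n"] Suc.prems by force
      then show ?case using IH le_Suc_eq by auto
    qed (simp add: g0)
    have "(\<Sum>i\<le>w. x i) = 0" using up[of w] zero by simp
    then show False using x1 by simp
  qed
  \<comment> \<open>Averaging with the reversal keeps the potential constant, since
    \<open>M_seq\<close> is even. The symmetry lets the vector come from classes of the real Weil
    group.\<close>
  define x' where "x' i = (1 / 2) * x i + (1 / 2) * x (w - i)" for i
  have flip: "(\<Sum>j\<le>w. f (w - j)) = (\<Sum>j\<le>w. f j)" for f :: "nat \<Rightarrow> real"
    by (rule sum.reindex_bij_witness[of _ "\<lambda>j. w - j" "\<lambda>j. w - j"]) auto
  show ?thesis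
  proof (rule that[of x' \<mu>])
    fix i assume i: "i \<le> w"
    show "0 \<le> x' i" "x' (w - i) = x' i"
      using x0[OF i] x0[of "w - i"] i by (auto simp: x'_def)
    have "toeplitz_apply w M_seq x' i = (1 / 2) * g i + (1 / 2) * (\<Sum>j\<le>w. x (w - j) * M_seq (int i - int j))"
      by (simp add: toeplitz_apply_def g_def x'_def sum.distrib sum_distrib_left algebra_simps)
    also have "(\<Sum>j\<le>w. x (w - j) * M_seq (int i - int j)) = (\<Sum>j\<le>w. x (w - j) * M_seq (int (w - i) - int (w - j)))"
    proof (rule sum.cong[OF refl])
      fix j assume "j \<in> {..w}"
      then have "int (w - i) - int (w - j) = - (int i - int j)" using i by (simp add: of_nat_diff)
      then show "x (w - j) * M_seq (int i - int j) = x (w - j) * M_seq (int (w - i) - int (w - j))"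
        by (simp only: M_seq_minus)
    qed
    also have "\<dots> = g (w - i)"
      unfolding g_def toeplitz_apply_def by (rule flip[of "\<lambda>j. x j * M_seq (int (w - i) - int j)"])
    finally show "toeplitz_apply w M_seq x' i = \<mu>"
      using g_eq[OF i] g_eq[of "w - i"] by simp
  next
    show "(\<Sum>i\<le>w. x' i) = 1"
      using x1 flip[of x] by (simp add: x'_def sum.distrib flip: sum_divide_distrib sum_distrib_left)
  qed
qed

section \<open>The number \<open>r(w)\<close> and the threshold of positivity\<close>

lemma M_mat_index: "i \<le> w \<Longrightarrow> k \<le> w \<Longrightarrow> M_mat w $$ (i, k) = M_seq (int i - int k)"
proof -
  assume "i \<le> w" "k \<le> w"
  moreover have "real (nat \<bar>int i - int k\<bar>) = \<bar>real i - real k\<bar>" by simp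
  ultimately show ?thesis by (simp add: M_mat_def M_seq_def m_val_def)
qed

text \<open>If the matrix is invertible, \<open>x\<close> is \<mu> times its inverse applied to the
  constant vector 1, and summing coordinates gives \<open>1 = \<mu> * sum_mat N\<close>. If it is
  singular, a kernel vector has nonzero sum by conditional positivity, and pairing it with
  \<open>x\<close> gives \<open>\<mu> = 0\<close>, in agreement with the default value
  \<open>exp (1 / 0) = 1\<close>.\<close>

lemma r_bound_equilibrium:
  assumes sum1: "(\<Sum>i\<le>w. x i) = 1" and eq: "\<And>i. i \<le> w \<Longrightarrow> toeplitz_apply w M_seq x i = \<mu>"
  shows "r_bound w = exp \<mu>"
proof -
  have M: "M_mat w \<in> carrier_mat (w + 1) (w + 1)" by (simp add: M_mat_def)
  have rng: "{0..<Suc w} = {..w}" by auto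
  define xv where "xv = Matrix.vec (w + 1) x"
  define ov where "ov = Matrix.vec (w + 1) (\<lambda>_. 1 :: real)"
  have Mx: "M_mat w *\<^sub>v xv = \<mu> \<cdot>\<^sub>v ov"
  proof (rule eq_vecI)
    fix i assume "i < dim_vec (\<mu> \<cdot>\<^sub>v ov)"
    then have i: "i \<le> w" by (simp add: ov_def)
    have "(M_mat w *\<^sub>v xv) $ i = (\<Sum>j\<le>w. M_mat w $$ (i, j) * x j)"
      using i M by (simp add: scalar_prod_def xv_def rng del: sum.op_ivl_Suc)
    also have "\<dots> = toeplitz_apply w M_seq x i"
      unfolding toeplitz_apply_def using i by (intro sum.cong refl) (simp add: M_mat_index)
    finally show "(M_mat w *\<^sub>v xv) $ i = (\<mu> \<cdot>\<^sub>v ov) $ i" using eq[OF i] i by (simp add: ov_def)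
  qed (use M in \<open>simp add: ov_def\<close>)
  show ?thesis
  proof (cases "mat_inverse (M_mat w)")
    case (Some N)
    then have N: "N * M_mat w = 1\<^sub>m (w + 1)" "N \<in> carrier_mat (w + 1) (w + 1)"
      using mat_inverse(2)[OF M] by auto
    have "xv = N *\<^sub>v (M_mat w *\<^sub>v xv)"
      using assoc_mult_mat_vec[OF N(2) M, of xv] N(1) by (simp add: xv_def)
    also have "\<dots> = \<mu> \<cdot>\<^sub>v (N *\<^sub>v ov)"
      unfolding Mx using N(2) by (intro mult_mat_vec) (auto simp: ov_def)
    finally have xN: "xv = \<mu> \<cdot>\<^sub>v (N *\<^sub>v ov)" .
    have xi: "x i = \<mu> * (\<Sum>j\<le>w. N $$ (i, j))" if "i \<le> w" for i
    proof -
      have "xv $ i = (\<mu> \<cdot>\<^sub>v (N *\<^sub>v ov)) $ i" using xN by simp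
      then show ?thesis using that N(2) by (simp add: xv_def ov_def scalar_prod_def rng del: sum.op_ivl_Suc)
    qed
    have "1 = (\<Sum>i\<le>w. \<mu> * (\<Sum>j\<le>w. N $$ (i, j)))"
      unfolding sum1[symmetric] by (intro sum.cong refl) (simp add: xi)
    also have "\<dots> = \<mu> * sum_mat N"
      using N(2) by (simp add: sum_mat_def rng sum.cartesian_product sum_distrib_left case_prod_unfold del: sum.op_ivl_Suc)
    finally have "1 / sum_mat N = \<mu>" by (metis nonzero_divide_eq_eq mult_zero_right zero_neq_one)
    then show ?thesis by (simp add: r_bound_def Some)
  next
    case None
    then have "M_mat w \<notin> Units (ring_mat TYPE(real) (w + 1) ())" by (rule mat_inverse(1)[OF M])
    then have "Determinant.det (M_mat w) = 0" using det_non_zero_imp_unit[OF M, of "()"] by blast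
    then obtain v where v: "v \<in> carrier_vec (w + 1)" "v \<noteq> 0\<^sub>v (w + 1)" "M_mat w *\<^sub>v v = 0\<^sub>v (w + 1)"
      using det_0_iff_vec_prod_zero_field[OF M] by blast
    define y where "y i = v $ i" for i
    have My: "toeplitz_apply w M_seq y i = 0" if i: "i \<le> w" for i
    proof -
      have "toeplitz_apply w M_seq y i = (\<Sum>j\<le>w. M_mat w $$ (i, j) * y j)"
        unfolding toeplitz_apply_def using i by (intro sum.cong refl) (simp add: M_mat_index)
      also have "\<dots> = (M_mat w *\<^sub>v v) $ i"
        using i M v(1) by (simp add: scalar_prod_def y_def carrier_vecD rng del: sum.op_ivl_Suc)
      finally show ?thesis using v(3) i by simp
    qed
    have "\<exists>i\<le>w. y i \<noteq> 0"
    proof (rule ccontr)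
      assume "\<not> (\<exists>i\<le>w. y i \<noteq> 0)"
      then have "v = 0\<^sub>v (w + 1)" using v(1) by (intro eq_vecI) (auto simp: y_def)
      with v(2) show False by simp
    qed
    moreover have "toeplitz_form w M_seq y = 0"
      unfolding toeplitz_form_apply using My by simp
    ultimately have s: "(\<Sum>i\<le>w. y i) \<noteq> 0"
      using M_seq_conditionally_positive[of y w] by auto
    have "\<mu> * (\<Sum>i\<le>w. y i) = (\<Sum>i\<le>w. y i * toeplitz_apply w M_seq x i)"
      unfolding sum_distrib_left by (intro sum.cong refl) (simp add: eq)
    also have "\<dots> = (\<Sum>j\<le>w. x j * toeplitz_apply w M_seq y j)"
    proof -
      have "M_seq (int i - int j) = M_seq (int j - int i)" for i j
        using M_seq_minus[of "int i - int j"] by simp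
      then show ?thesis
        unfolding toeplitz_apply_def sum_distrib_left
        by (subst sum.swap) (intro sum.cong refl, simp add: mult_ac)
    qed
    also have "\<dots> = 0" using My by simp
    finally have "\<mu> = 0" using s by simp
    then show ?thesis by (simp add: r_bound_def None)
  qed
qed

lemma toeplitz_form_equilibrium:
  assumes sum1: "(\<Sum>i\<le>w. x i) = 1" and eq: "\<And>i. i \<le> w \<Longrightarrow> toeplitz_apply w M_seq x i = \<mu>"
  shows "toeplitz_form w (\<lambda>k. M_seq k - t) x = \<mu> - t"
proof -
  have "toeplitz_form w M_seq x = (\<Sum>i\<le>w. x i) * \<mu>"
    unfolding toeplitz_form_apply sum_distrib_right by (intro sum.cong refl) (simp add: eq)
  then show ?thesis by (simp add: toeplitz_form_shift sum1)
qed

text \<open>Write \<open>z = \<sigma> * x + y\<close> with \<open>y\<close> of sum 0. The constant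
  potential of \<open>x\<close> kills the cross term, which leaves
  \<open>\<sigma>\<^sup>2 * (\<mu> - t)\<close> and the conditionally positive form at
  \<open>y\<close>; the two do not vanish together.\<close>

lemma toeplitz_form_shift_pos:
  assumes sum1: "(\<Sum>i\<le>w. x i) = 1" and eq: "\<And>i. i \<le> w \<Longrightarrow> toeplitz_apply w M_seq x i = \<mu>"
    and t: "t < \<mu>" and nz: "\<exists>i\<le>w. z i \<noteq> 0"
  shows "0 < toeplitz_form w (\<lambda>k. M_seq k - t) z"
proof -
  define \<sigma> where "\<sigma> = (\<Sum>i\<le>w. z i)"
  define y where "y i = z i - \<sigma> * x i" for i
  have y0: "(\<Sum>i\<le>w. y i) = 0"
    by (simp add: y_def sum_subtractf sum1 \<sigma>_def flip: sum_distrib_left)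
  have z: "z = (\<lambda>i. \<sigma> * x i + 1 * y i)" by (simp add: y_def)
  have cross: "(\<Sum>i\<le>w. y i * toeplitz_apply w M_seq x i) = 0"
  proof -
    have "(\<Sum>i\<le>w. y i * toeplitz_apply w M_seq x i) = (\<Sum>i\<le>w. y i) * \<mu>"
      unfolding sum_distrib_right by (intro sum.cong refl) (simp add: eq)
    then show ?thesis by (simp add: y0)
  qed
  have "toeplitz_form w M_seq x = \<mu>"
    using toeplitz_form_equilibrium[OF sum1 eq, where t = 0] by simp
  then have "toeplitz_form w M_seq z = \<sigma>\<^sup>2 * \<mu> + toeplitz_form w M_seq y"
    by (subst z, subst toeplitz_form_combine[of M_seq, OF M_seq_minus]) (simp add: cross)
  then have form: "toeplitz_form w (\<lambda>k. M_seq k - t) z = \<sigma>\<^sup>2 * (\<mu> - t) + toeplitz_form w M_seq y"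
    by (simp add: toeplitz_form_shift \<sigma>_def algebra_simps)
  show ?thesis
  proof (cases "\<exists>i\<le>w. y i \<noteq> 0")
    case True
    then have "0 < toeplitz_form w M_seq y" by (intro M_seq_conditionally_positive y0)
    then show ?thesis unfolding form using t by (intro add_nonneg_pos) auto
  next
    case False
    then have "toeplitz_form w M_seq y = 0" by (simp add: toeplitz_form_def)
    moreover have "\<sigma> \<noteq> 0" using False nz by (auto simp: y_def)
    ultimately show ?thesis unfolding form using t by simp
  qed
qed

text \<open>On the compact unit sphere the form of \<open>T\<close> has a positive minimum, while
  the form of \<open>S l\<close> differs from it there by at most \<open>\<delta> l\<close>, which
  tends to 0. Homogeneity extends this to all other vectors.\<close>

lemma toeplitz_pos_eventually:
  fixes S :: "real \<Rightarrow> int \<Rightarrow> real"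
  assumes pos: "\<And>x. \<exists>i\<le>w. x i \<noteq> 0 \<Longrightarrow> 0 < toeplitz_form w T x"
    and lim: "\<And>k. ((\<lambda>l. S l k) \<longlongrightarrow> T k) at_top"
  shows "\<forall>\<^sub>F l in at_top. \<forall>x. (\<exists>i\<le>w. x i \<noteq> 0) \<longrightarrow> 0 < toeplitz_form w (S l) x"
proof -
  define K where "K = {x :: nat \<Rightarrow> real. (\<forall>i\<le>w. \<bar>x i\<bar> \<le> 1) \<and> (\<forall>i>w. x i = 0)} \<inter> {x. (\<Sum>i\<le>w. (x i)\<^sup>2) = 1}"
  have "closed {x :: nat \<Rightarrow> real. (\<Sum>i\<le>w. (x i)\<^sup>2) = 1}"
    by (intro closed_Collect_eq continuous_on_sum continuous_on_power continuous_on_coordinate continuous_on_const)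
  then have "compact K" unfolding K_def by (intro compact_Int_closed compact_cube)
  moreover have "K \<noteq> {}"
  proof -
    have "(\<Sum>i\<le>w. (if i = 0 then 1 else 0 :: real)\<^sup>2) = (\<Sum>i\<le>w. if i = 0 then 1 else 0)"
      by (intro sum.cong) auto
    then have "(\<lambda>i. if i = 0 then 1 else 0) \<in> K"
      by (auto simp: K_def)
    then show ?thesis by blast
  qed
  ultimately obtain y where y: "y \<in> K" and ymin: "\<And>x. x \<in> K \<Longrightarrow> toeplitz_form w T y \<le> toeplitz_form w T x"
    using continuous_attains_inf[OF _ _ continuous_on_toeplitz_form] by metis
  have c: "0 < toeplitz_form w T y"
  proof (rule pos, rule ccontr)
    assume "\<not> (\<exists>i\<le>w. y i \<noteq> 0)"
    then have "(\<Sum>i\<le>w. (y i)\<^sup>2) = 0" by simp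
    then show False using y by (simp add: K_def)
  qed
  define \<delta> where "\<delta> l = (\<Sum>i\<le>w. \<Sum>j\<le>w. \<bar>S l (int i - int j) - T (int i - int j)\<bar>)" for l
  have "(\<delta> \<longlongrightarrow> (\<Sum>i\<le>w. \<Sum>j\<le>w. \<bar>T (int i - int j) - T (int i - int j)\<bar>)) at_top"
    unfolding \<delta>_def[abs_def] by (intro tendsto_intros lim)
  then have "(\<delta> \<longlongrightarrow> 0) at_top" by simp
  then have ev: "\<forall>\<^sub>F l in at_top. \<delta> l < toeplitz_form w T y"
    using c by (rule order_tendstoD(2))
  then show ?thesis
  proof eventually_elim
    case (elim l)
    show ?case
    proof (intro allI impI)
      fix x :: "nat \<Rightarrow> real" assume nz: "\<exists>i\<le>w. x i \<noteq> 0"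
      define n where "n = sqrt (\<Sum>i\<le>w. (x i)\<^sup>2)"
      have "0 < (\<Sum>i\<le>w. (x i)\<^sup>2)" using nz by (auto intro!: sum_pos2)
      then have n: "0 < n" "n\<^sup>2 = (\<Sum>i\<le>w. (x i)\<^sup>2)" by (simp_all add: n_def)
      define u where "u i = (if i \<le> w then x i / n else 0)" for i
      have usum: "(\<Sum>i\<le>w. (u i)\<^sup>2) = 1"
      proof -
        have "(\<Sum>i\<le>w. (u i)\<^sup>2) = (\<Sum>i\<le>w. (x i)\<^sup>2) / n\<^sup>2"
          unfolding sum_divide_distrib by (intro sum.cong refl) (simp add: u_def power_divide)
        also have "\<dots> = n\<^sup>2 / n\<^sup>2" using n(2) by simp
        finally show ?thesis using n(1) by simp
      qed
      have u1: "\<bar>u i\<bar> \<le> 1" if "i \<le> w" for i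
      proof -
        have "(u i)\<^sup>2 \<le> (\<Sum>i\<le>w. (u i)\<^sup>2)" using that by (intro member_le_sum) auto
        then show ?thesis using usum by (simp add: abs_square_le_1)
      qed
      have uK: "u \<in> K" using usum u1 by (auto simp: K_def u_def)
      have "\<bar>toeplitz_form w (S l) u - toeplitz_form w T u\<bar> =
          \<bar>\<Sum>i\<le>w. \<Sum>j\<le>w. u i * u j * (S l (int i - int j) - T (int i - int j))\<bar>"
        unfolding toeplitz_form_def by (simp add: right_diff_distrib sum_subtractf)
      also have "\<dots> \<le> (\<Sum>i\<le>w. \<Sum>j\<le>w. \<bar>u i * u j * (S l (int i - int j) - T (int i - int j))\<bar>)"
        by (rule order_trans[OF sum_abs sum_mono[OF sum_abs]])
      also have "\<dots> \<le> \<delta> l"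
        unfolding \<delta>_def
      proof (intro sum_mono)
        fix i j assume "i \<in> {..w}" "j \<in> {..w}"
        then have "\<bar>u i * u j\<bar> \<le> 1" using u1[of i] u1[of j] by (simp add: abs_mult mult_le_one)
        then show "\<bar>u i * u j * (S l (int i - int j) - T (int i - int j))\<bar> \<le> \<bar>S l (int i - int j) - T (int i - int j)\<bar>"
          by (simp add: abs_mult mult_left_le_one_le)
      qed
      finally have "0 < toeplitz_form w (S l) u" using ymin[OF uK] elim by linarith
      moreover have "toeplitz_form w (S l) x = n\<^sup>2 * toeplitz_form w (S l) u"
        unfolding toeplitz_form_scale[symmetric] using n(1) by (intro toeplitz_form_cong) (simp add: u_def)
      ultimately show "0 < toeplitz_form w (S l) x" using n(1) by simp
    qed
  qed
qed

text \<open>Rounding \<open>n * x\<close> down and dividing by \<open>n\<close> approximates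
  \<open>x\<close>, so by continuity negativity survives for large \<open>n\<close>. Clearing the
  denominator yields natural numbers; the extra factor 2 makes them even, so that a middle
  coordinate can be halved later.\<close>

lemma toeplitz_negative_nat:
  assumes x: "\<And>i. i \<le> w \<Longrightarrow> 0 \<le> x i" and sym: "\<And>i. i \<le> w \<Longrightarrow> x (w - i) = x i"
    and neg: "toeplitz_form w T x < 0"
  obtains N :: "nat \<Rightarrow> nat" where "\<And>i. i \<le> w \<Longrightarrow> N (w - i) = N i" "\<And>i. i \<le> w \<Longrightarrow> even (N i)"
    "toeplitz_form w T (\<lambda>i. real (N i)) < 0"
proof -
  define a where "a n i = real (nat \<lfloor>real n * x i\<rfloor>) / real n" for n i
  have lim: "(\<lambda>n. a n i) \<longlonglongrightarrow> x i" if i: "i \<le> w" for i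
  proof (rule LIM_zero_cancel, rule Lim_null_comparison)
    show "\<forall>\<^sub>F n in sequentially. norm (a n i - x i) \<le> 1 / real n"
      unfolding eventually_sequentially
    proof (intro exI[of _ 1] allI impI)
      fix n :: nat assume n: "1 \<le> n"
      have r: "real (nat \<lfloor>real n * x i\<rfloor>) = of_int \<lfloor>real n * x i\<rfloor>"
        using x[OF i] by simp
      have "\<bar>of_int \<lfloor>real n * x i\<rfloor> - real n * x i\<bar> \<le> 1" by linarith
      then have "\<bar>of_int \<lfloor>real n * x i\<rfloor> - real n * x i\<bar> / real n \<le> 1 / real n"
        using n by (intro divide_right_mono) auto
      also have "\<bar>of_int \<lfloor>real n * x i\<rfloor> - real n * x i\<bar> / real n = \<bar>a n i - x i\<bar>"
        unfolding a_def r using n by (simp add: field_simps flip: abs_divide)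
      finally show "norm (a n i - x i) \<le> 1 / real n" by simp
    qed
    show "(\<lambda>n. 1 / real n) \<longlonglongrightarrow> 0" by real_asymp
  qed
  have "(\<lambda>n. toeplitz_form w T (a n)) \<longlonglongrightarrow> toeplitz_form w T x"
    unfolding toeplitz_form_def by (intro tendsto_sum tendsto_mult lim tendsto_const) auto
  then have "\<forall>\<^sub>F n in sequentially. toeplitz_form w T (a n) < 0"
    using neg by (rule order_tendstoD(2))
  then obtain n where n: "n \<ge> 1" "toeplitz_form w T (a n) < 0"
    unfolding eventually_sequentially by (metis max.cobounded1 max.cobounded2)
  define N where "N i = 2 * nat \<lfloor>real n * x i\<rfloor>" for i
  have "toeplitz_form w T (\<lambda>i. real (N i)) = (2 * real n)\<^sup>2 * toeplitz_form w T (a n)"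
    unfolding toeplitz_form_scale[symmetric] using n(1) by (intro toeplitz_form_cong) (simp add: N_def a_def)
  also have "\<dots> < 0" using n by (simp add: mult_pos_neg)
  finally show ?thesis
    by (intro that[of N]) (auto simp: N_def sym)
qed

section \<open>Test functions satisfying (POS)\<close>

lemma bounded_variation_diff_bound:
  assumes "bounded_variation_on f S"
  obtains C where "\<And>x y. x \<in> S \<Longrightarrow> y \<in> S \<Longrightarrow> \<bar>f x - f y\<bar> \<le> C"
proof -
  obtain C where C: "\<And>n (t :: nat \<Rightarrow> real). (\<forall>i\<le>n. t i \<in> S) \<and> (\<forall>i<n. t i \<le> t (Suc i)) \<Longrightarrow>
      (\<Sum>i<n. \<bar>f (t (Suc i)) - f (t i)\<bar>) \<le> C"
    using assms unfolding bounded_variation_on_def by blast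
  have "\<bar>f x - f y\<bar> \<le> C" if xy: "x \<in> S" "y \<in> S" for x y
  proof -
    define t where "t i = (if i = 0 then min x y else max x y)" for i :: nat
    have "(\<Sum>i<Suc 0. \<bar>f (t (Suc i)) - f (t i)\<bar>) \<le> C"
      by (rule C) (use xy in \<open>auto simp: t_def min_def max_def\<close>)
    then show ?thesis by (auto simp: t_def min_def max_def abs_minus_commute split: if_splits)
  qed
  then show ?thesis using that by blast
qed

lemma even_integral_reflect:
  fixes f :: "real \<Rightarrow> real"
  shows "(\<integral>x. f (- x) \<partial>lborel) = (\<integral>x. f x \<partial>lborel)"
  using lborel_integral_real_affine[of "- 1" f 0] by simp

lemma integrable_reflect:
  fixes f :: "real \<Rightarrow> real"
  assumes "integrable lborel f"
  shows "integrable lborel (\<lambda>x. f (- x))"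
  using lborel_integrable_real_affine[OF assms, of "- 1" 0] by simp

lemma test_function_measurable:
  assumes "test_function F"
  shows "F \<in> borel_measurable borel"
proof -
  obtain \<epsilon> where "integrable lborel (\<lambda>x. F x * exp (\<epsilon> * \<bar>x\<bar>))"
    using assms unfolding test_function_def by blast
  then have [measurable]: "(\<lambda>x. F x * exp (\<epsilon> * \<bar>x\<bar>)) \<in> borel_measurable borel"
    using borel_measurable_integrable by force
  have "(\<lambda>x. F x * exp (\<epsilon> * \<bar>x\<bar>) * exp (- (\<epsilon> * \<bar>x\<bar>))) \<in> borel_measurable borel"
    by measurable
  then show ?thesis by (simp add: mult.assoc flip: exp_add)
qed

text \<open>By (TFb) the difference quotient at \<open>t\<close> stays within a constant of the one
  at 1. This provides the Lipschitz constant required for the convergence of the integrals.\<close>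

lemma test_function_near_0:
  assumes "test_function F"
  obtains C where "\<And>t. t > 0 \<Longrightarrow> \<bar>F t - F 0\<bar> \<le> C * t"
proof -
  have "bounded_variation_on (\<lambda>x. (F x - F 0) / x) (UNIV - {0})"
    using assms unfolding test_function_def by blast
  then obtain C where C: "\<And>x y. x \<in> UNIV - {0} \<Longrightarrow> y \<in> UNIV - {0} \<Longrightarrow>
      \<bar>(F x - F 0) / x - (F y - F 0) / y\<bar> \<le> C"
    using bounded_variation_diff_bound by blast
  have "\<bar>F t - F 0\<bar> \<le> (C + \<bar>F 1 - F 0\<bar>) * t" if t: "t > 0" for t
  proof -
    have "\<bar>(F t - F 0) / t\<bar> \<le> C + \<bar>F 1 - F 0\<bar>"
      using C[of t 1] t by auto
    then show ?thesis using t by (simp add: abs_divide pos_divide_le_eq)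
  qed
  then show ?thesis using that by blast
qed

lemma cosh_half_le: "cosh (x / 2 :: real) \<le> exp (\<bar>x\<bar> / 2)"
proof -
  define a b c where "a = exp (x / 2)" and "b = exp (- (x / 2))" and "c = exp (\<bar>x\<bar> / 2)"
  have "a \<le> c" "b \<le> c" by (auto simp: a_def b_def c_def)
  then have "(a + b) / 2 \<le> c" by simp
  then show ?thesis by (simp add: cosh_field_def a_def b_def c_def)
qed

lemma test_function_exp_half:
  assumes "test_function F"
  shows "integrable lborel (\<lambda>x. F x * exp (\<bar>x\<bar> / 2))"
    and "\<exists>C. \<forall>x. \<bar>F x * exp (\<bar>x\<bar> / 2)\<bar> \<le> C"
proof -
  obtain \<epsilon> where e: "\<epsilon> > 1 / 2" "integrable lborel (\<lambda>x. F x * exp (\<epsilon> * \<bar>x\<bar>))"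
    "bounded_variation_on (\<lambda>x. F x * exp (\<epsilon> * \<bar>x\<bar>)) UNIV"
    using assms unfolding test_function_def by blast
  have le: "\<bar>F x * exp (\<bar>x\<bar> / 2)\<bar> \<le> \<bar>F x * exp (\<epsilon> * \<bar>x\<bar>)\<bar>" for x
  proof -
    have "\<bar>x\<bar> * (1 / 2) \<le> \<bar>x\<bar> * \<epsilon>" using e(1) by (intro mult_left_mono) auto
    then have "exp (\<bar>x\<bar> / 2) \<le> exp (\<epsilon> * \<bar>x\<bar>)" by (simp add: mult.commute)
    then show ?thesis by (simp add: abs_mult mult_left_mono)
  qed
  note [measurable] = test_function_measurable[OF assms]
  show "integrable lborel (\<lambda>x. F x * exp (\<bar>x\<bar> / 2))"
    by (rule Bochner_Integration.integrable_bound[OF e(2)]) (use le in auto)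
  obtain C where C: "\<And>x y. \<bar>F x * exp (\<epsilon> * \<bar>x\<bar>) - F y * exp (\<epsilon> * \<bar>y\<bar>)\<bar> \<le> C"
    using bounded_variation_diff_bound[OF e(3)] by auto
  have "\<bar>F x * exp (\<bar>x\<bar> / 2)\<bar> \<le> C + \<bar>F 0\<bar>" for x
    using C[of x 0] le[of x] by auto
  then show "\<exists>C. \<forall>x. \<bar>F x * exp (\<bar>x\<bar> / 2)\<bar> \<le> C" by blast
qed

lemma integrable_cosh_half:
  fixes F h :: "real \<Rightarrow> real"
  assumes F: "F \<in> borel_measurable borel" and int: "integrable lborel (\<lambda>x. F x * exp (\<bar>x\<bar> / 2))"
    and h: "h \<in> borel_measurable borel" "\<And>x. \<bar>h x\<bar> \<le> 1"
  shows "integrable lborel (\<lambda>x. F x * cosh (x / 2) * h x)"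
proof (rule Bochner_Integration.integrable_bound[OF int])
  have [measurable]: "(\<lambda>x::real. cosh (x / 2) :: real) \<in> borel_measurable borel"
    by (intro borel_measurable_continuous_onI continuous_intros) auto
  note [measurable] = F h(1)
  show "(\<lambda>x. F x * cosh (x / 2) * h x) \<in> borel_measurable lborel" by measurable
  show "AE x in lborel. norm (F x * cosh (x / 2) * h x) \<le> norm (F x * exp (\<bar>x\<bar> / 2))"
  proof (intro AE_I2)
    fix x :: real
    have "\<bar>cosh (x / 2)\<bar> * \<bar>h x\<bar> \<le> exp (\<bar>x\<bar> / 2) * 1"
      using cosh_half_le[of x] cosh_real_nonneg[of "x / 2"] h(2)[of x] by (intro mult_mono) auto
    then show "norm (F x * cosh (x / 2) * h x) \<le> norm (F x * exp (\<bar>x\<bar> / 2))"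
      by (simp add: abs_mult mult.assoc mult_left_mono)
  qed
qed

text \<open>The strip is where \<open>exp (2 * pi * x * Im s)\<close> is at most
  \<open>exp (\<bar>x\<bar> / 2)\<close> for all \<open>x\<close>, a weight whose product with a
  test function is integrable by (TFa).\<close>

lemma Re_fourier:
  assumes F: "F \<in> borel_measurable borel" and int: "integrable lborel (\<lambda>x. F x * exp (\<bar>x\<bar> / 2))"
    and s: "\<bar>Im s\<bar> \<le> 1 / (4 * pi)"
  shows "Re (fourier F s) = (\<integral>x. F x * (exp (2 * pi * x * Im s) * cos (2 * pi * x * Re s)) \<partial>lborel)"
    and "integrable lborel (\<lambda>x. F x * (exp (2 * pi * x * Im s) * cos (2 * pi * x * Re s)))"
    and "cmod (fourier F s) \<le> (\<integral>x. \<bar>F x * exp (\<bar>x\<bar> / 2)\<bar> \<partial>lborel)"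
proof -
  note [measurable] = F
  let ?f = "\<lambda>x. complex_of_real (F x) * exp (- 2 * \<i> * of_real pi * of_real x * s)"
  have le: "exp (2 * pi * x * Im s) \<le> exp (\<bar>x\<bar> / 2)" for x
  proof -
    have "2 * pi * x * Im s \<le> \<bar>2 * pi * x * Im s\<bar>" by simp
    also have "\<dots> = 2 * pi * \<bar>x\<bar> * \<bar>Im s\<bar>" by (simp add: abs_mult)
    also have "\<dots> \<le> 2 * pi * \<bar>x\<bar> * (1 / (4 * pi))" by (intro mult_left_mono s) auto
    also have "\<dots> = \<bar>x\<bar> / 2" by simp
    finally show ?thesis by simp
  qed
  have nrm: "cmod (?f x) = \<bar>F x\<bar> * exp (2 * pi * x * Im s)" for x
    by (simp add: norm_mult)
  have nrm_le: "cmod (?f x) \<le> \<bar>F x * exp (\<bar>x\<bar> / 2)\<bar>" for x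
    unfolding nrm using le[of x] by (simp add: abs_mult mult_left_mono)
  have I: "integrable lborel ?f"
  proof (rule Bochner_Integration.integrable_bound[OF int])
    have [measurable]: "(\<lambda>x::real. exp (- 2 * \<i> * of_real pi * of_real x * s)) \<in> borel_measurable borel"
      by (intro borel_measurable_continuous_onI continuous_intros)
    show "?f \<in> borel_measurable lborel" by measurable
  qed (use nrm_le in auto)
  have Re: "Re (?f x) = F x * (exp (2 * pi * x * Im s) * cos (2 * pi * x * Re s))" for x
    by (simp add: Re_exp)
  show "Re (fourier F s) = (\<integral>x. F x * (exp (2 * pi * x * Im s) * cos (2 * pi * x * Re s)) \<partial>lborel)"
    unfolding fourier_def Re[symmetric] by (rule integral_Re[OF I, symmetric])
  show "integrable lborel (\<lambda>x. F x * (exp (2 * pi * x * Im s) * cos (2 * pi * x * Re s)))"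
    unfolding Re[symmetric] by (rule integrable_Re[OF I])
  have "cmod (fourier F s) \<le> (\<integral>x. cmod (?f x) \<partial>lborel)"
    unfolding fourier_def by (rule integral_norm_bound)
  also have "\<dots> \<le> (\<integral>x. \<bar>F x * exp (\<bar>x\<bar> / 2)\<bar> \<partial>lborel)"
    by (intro integral_mono integrable_norm I integrable_abs int nrm_le)
  finally show "cmod (fourier F s) \<le> (\<integral>x. \<bar>F x * exp (\<bar>x\<bar> / 2)\<bar> \<partial>lborel)" .
qed

text \<open>Averaging over \<open>x\<close> and \<open>- x\<close> turns the exponential into
  \<open>cosh\<close>, and \<open>1 / (4 * pi)\<close> is the height at which this becomes
  \<open>cosh (x / 2)\<close>. On the edges of the strip (POS) thus speaks of the cosine transform
  of \<open>F x * cosh (x / 2)\<close>.\<close>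

lemma Re_fourier_boundary:
  assumes F: "F \<in> borel_measurable borel" and int: "integrable lborel (\<lambda>x. F x * exp (\<bar>x\<bar> / 2))"
    and even: "\<And>x. F (- x) = F x" and s: "\<bar>Im s\<bar> = 1 / (4 * pi)"
  shows "Re (fourier F s) = (\<integral>x. F x * cosh (x / 2) * cos (2 * pi * Re s * x) \<partial>lborel)"
proof -
  let ?g = "\<lambda>x. F x * (exp (2 * pi * x * Im s) * cos (2 * pi * x * Re s))"
  note R = Re_fourier[OF F int, of s, OF eq_refl[OF s]]
  have "2 * (\<integral>x. ?g x \<partial>lborel) = (\<integral>x. ?g x \<partial>lborel) + (\<integral>x. ?g (- x) \<partial>lborel)"
    by (simp only: even_integral_reflect[of ?g])
  also have "\<dots> = (\<integral>x. ?g x + ?g (- x) \<partial>lborel)"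
    by (intro Bochner_Integration.integral_add[symmetric] R(2) integrable_reflect[of ?g])
  also have "\<dots> = (\<integral>x. 2 * (F x * cosh (x / 2) * cos (2 * pi * Re s * x)) \<partial>lborel)"
  proof (rule Bochner_Integration.integral_cong[OF refl])
    fix x :: real
    have c: "cosh (2 * pi * x * Im s) = cosh (x / 2)"
    proof -
      have "\<bar>2 * pi * x * Im s\<bar> = \<bar>x / 2\<bar>" by (simp add: abs_mult s)
      then show ?thesis by (metis cosh_real_abs)
    qed
    have "?g x + ?g (- x) = F x * (2 * cosh (2 * pi * x * Im s)) * cos (2 * pi * x * Re s)"
      by (simp add: even cosh_def algebra_simps)
    then show "?g x + ?g (- x) = 2 * (F x * cosh (x / 2) * cos (2 * pi * Re s * x))"
      unfolding c by (simp add: mult_ac)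
  qed
  finally show ?thesis unfolding R(1) by simp
qed

lemma std_normal_cos_integral:
  "(\<integral>t. cos (y * t) * std_normal_density t \<partial>lborel) = exp (- (y\<^sup>2 / 2))"
  "integrable lborel (\<lambda>t. cos (y * t) * std_normal_density t)"
proof -
  have int: "integrable lborel (\<lambda>t. cos (y * t) * std_normal_density t)" for y :: real
    by (rule Bochner_Integration.integrable_bound[of lborel std_normal_density])
      (auto intro!: mult_left_le_one_le simp: abs_mult)
  then show "integrable lborel (\<lambda>t. cos (y * t) * std_normal_density t)" .
  have "char std_normal_distribution y = complex_of_real (exp (- (y\<^sup>2) / 2))"
    by (simp add: char_std_normal_distribution)
  moreover have "char std_normal_distribution y = (CLINT t|lborel. complex_of_real (std_normal_density t) * iexp (y * t))"
    unfolding char_def by (subst integral_density) (auto simp: scaleR_conv_of_real)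
  moreover have "integrable lborel (\<lambda>t. complex_of_real (std_normal_density t) * iexp (y * t))"
    by (rule Bochner_Integration.integrable_bound[of lborel std_normal_density]) (auto simp: norm_mult)
  ultimately have "exp (- (y\<^sup>2) / 2) = (\<integral>t. Re (complex_of_real (std_normal_density t) * iexp (y * t)) \<partial>lborel)"
    by (subst integral_Re) auto
  then show "(\<integral>t. cos (y * t) * std_normal_density t \<partial>lborel) = exp (- (y\<^sup>2 / 2))"
    by (simp add: Re_exp mult.commute)
qed

text \<open>A Gaussian is a cosine transform of a Gaussian, so by Fubini the mean at
  \<open>x\<close> is the integral of \<open>cos (a * x * t) * \<Gamma> (a * t) * k t\<close>. As
  \<Gamma> is nonnegative, this is largest when the cosine is 1. The density \<open>k\<close>
  ensures convergence whatever the decay of the transform of \<open>G\<close>.\<close>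

lemma gaussian_mean_le:
  fixes G :: "real \<Rightarrow> real"
  assumes G: "integrable lborel G" and even: "\<And>x. G (- x) = G x"
    and pos: "\<And>a. 0 \<le> (\<integral>u. G u * cos (a * u) \<partial>lborel)"
  shows "(\<integral>u. G u * exp (- ((a * (x - u))\<^sup>2 / 2)) \<partial>lborel) \<le> (\<integral>u. G u * exp (- ((a * (0 - u))\<^sup>2 / 2)) \<partial>lborel)"
proof -
  have [measurable]: "G \<in> borel_measurable borel" using G borel_measurable_integrable by force
  define k where "k = std_normal_density"
  have [measurable]: "k \<in> borel_measurable borel" by (simp add: k_def)
  have k: "integrable lborel k" "\<And>t. 0 \<le> k t" by (simp_all add: k_def)
  define \<Gamma> where "\<Gamma> a = (\<integral>u. G u * cos (a * u) \<partial>lborel)" for a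
  let ?h = "\<lambda>x u t. G u * (cos (a * (x - u) * t) * k t)"
  have int2: "integrable (lborel \<Otimes>\<^sub>M lborel) (\<lambda>(u, t). ?h x u t)" for x
  proof (rule Bochner_Integration.integrable_bound)
    show "integrable (lborel \<Otimes>\<^sub>M lborel) (\<lambda>(u, t). G u * k t)"
      using lborel_pair.integrable_product_swap_iff G k(1)
      by (subst lborel_pair.Fubini_integrable)
        (auto simp: abs_mult k(2) intro!: AE_I2 integrable_mult_right integrable_mult_left)
    show "(\<lambda>(u, t). ?h x u t) \<in> borel_measurable (lborel \<Otimes>\<^sub>M lborel)" by measurable
    show "AE p in lborel \<Otimes>\<^sub>M lborel. norm (case p of (u, t) \<Rightarrow> ?h x u t) \<le> norm (case p of (u, t) \<Rightarrow> G u * k t)"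
      by (intro AE_I2) (auto simp: abs_mult k(2) intro!: mult_left_mono mult_left_le_one_le)
  qed
  have inner: "(\<integral>u. ?h x u t \<partial>lborel) = cos (a * x * t) * \<Gamma> (a * t) * k t" for x t
  proof -
    have ic: "integrable lborel (\<lambda>u. G u * cos (a * t * u))" "integrable lborel (\<lambda>u. G u * sin (a * t * u))"
      by (rule Bochner_Integration.integrable_bound[OF G];
        simp add: abs_mult mult_left_le)+
    have s0: "(\<integral>u. G u * sin (a * t * u) \<partial>lborel) = 0"
      using even_integral_reflect[of "\<lambda>u. G u * sin (a * t * u)"] by (simp add: even)
    have "(\<integral>u. ?h x u t \<partial>lborel) =
        (\<integral>u. (cos (a * x * t) * k t) * (G u * cos (a * t * u)) + (sin (a * x * t) * k t) * (G u * sin (a * t * u)) \<partial>lborel)"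
    proof (rule Bochner_Integration.integral_cong[OF refl])
      fix u
      have "a * (x - u) * t = a * x * t - a * t * u" by (simp add: algebra_simps)
      then show "?h x u t = (cos (a * x * t) * k t) * (G u * cos (a * t * u)) + (sin (a * x * t) * k t) * (G u * sin (a * t * u))"
        by (simp add: cos_diff algebra_simps)
    qed
    also have "\<dots> = (cos (a * x * t) * k t) * \<Gamma> (a * t) + (sin (a * x * t) * k t) * 0"
      unfolding s0[symmetric] \<Gamma>_def using ic by simp
    finally show ?thesis by simp
  qed
  have repr: "(\<integral>u. G u * exp (- ((a * (x - u))\<^sup>2 / 2)) \<partial>lborel) = (\<integral>t. cos (a * x * t) * \<Gamma> (a * t) * k t \<partial>lborel)"
    "integrable lborel (\<lambda>t. cos (a * x * t) * \<Gamma> (a * t) * k t)" for x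
  proof -
    have "(\<integral>u. G u * exp (- ((a * (x - u))\<^sup>2 / 2)) \<partial>lborel) = (\<integral>u. \<integral>t. ?h x u t \<partial>lborel \<partial>lborel)"
      unfolding k_def by (simp add: std_normal_cos_integral(1)[symmetric])
    also have "\<dots> = (\<integral>t. \<integral>u. ?h x u t \<partial>lborel \<partial>lborel)"
      using lborel_pair.Fubini_integral[OF int2[of x]] by simp
    finally show "(\<integral>u. G u * exp (- ((a * (x - u))\<^sup>2 / 2)) \<partial>lborel) = (\<integral>t. cos (a * x * t) * \<Gamma> (a * t) * k t \<partial>lborel)"
      by (simp only: inner)
    show "integrable lborel (\<lambda>t. cos (a * x * t) * \<Gamma> (a * t) * k t)"
      using lborel_pair.integrable_snd[OF int2[of x]] by (simp only: inner)
  qed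
  show ?thesis
    unfolding repr(1)
  proof (rule integral_mono[OF repr(2) repr(2)])
    fix t
    have "0 \<le> \<Gamma> (a * t) * k t" using pos k(2) by (simp add: \<Gamma>_def)
    then have "cos (a * x * t) * (\<Gamma> (a * t) * k t) \<le> 1 * (\<Gamma> (a * t) * k t)"
      by (intro mult_right_mono) auto
    then show "cos (a * x * t) * \<Gamma> (a * t) * k t \<le> cos (a * 0 * t) * \<Gamma> (a * t) * k t"
      by (simp add: mult.assoc)
  qed
qed

text \<open>After rescaling around \<open>x\<close>, positive \<open>y\<close> see the right limit
  and negative \<open>y\<close> the left one, and each half-line carries half of the Gaussian mass.
  The factor \<open>sqrt (2 * pi)\<close> is the total mass of the unnormalised Gaussian.\<close>

lemma gaussian_mean_limit:
  fixes G :: "real \<Rightarrow> real"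
  assumes G [measurable]: "G \<in> borel_measurable borel" and bd: "\<And>x. \<bar>G x\<bar> \<le> C"
    and L: "(G \<longlongrightarrow> l) (at_left x)" and R: "(G \<longlongrightarrow> r) (at_right x)"
  shows "(\<lambda>n. real (Suc n) * (\<integral>u. G u * exp (- ((real (Suc n) * (x - u))\<^sup>2 / 2)) \<partial>lborel)) \<longlonglongrightarrow>
    sqrt (2 * pi) * ((l + r) / 2)"
proof -
  define k where "k = std_normal_density"
  have [measurable]: "k \<in> borel_measurable borel" by (simp add: k_def)
  have k: "integrable lborel k" "\<And>t. 0 \<le> k t" "(\<integral>t. k t \<partial>lborel) = 1" "\<And>t. k (- t) = k t"
  proof -
    show "k (- t) = k t" for t by (simp add: k_def std_normal_density_def)
  qed (simp_all add: k_def)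
  have ek: "exp (- (y\<^sup>2 / 2)) = sqrt (2 * pi) * k y" for y
    by (simp add: k_def std_normal_density_def)
  define f where "f y = (if y > 0 then r else l) * k y" for y
  have [measurable]: "f \<in> borel_measurable borel" unfolding f_def[abs_def] by measurable
  have sub: "real (Suc n) * (\<integral>u. G u * exp (- ((real (Suc n) * (x - u))\<^sup>2 / 2)) \<partial>lborel) =
      sqrt (2 * pi) * (\<integral>y. G (x + y / real (Suc n)) * k y \<partial>lborel)" for n
  proof -
    define a where "a = real (Suc n)"
    have a: "a > 0" by (simp add: a_def)
    have "(\<integral>u. G u * exp (- ((a * (x - u))\<^sup>2 / 2)) \<partial>lborel) =
        \<bar>1 / a\<bar> *\<^sub>R (\<integral>y. G (x + 1 / a * y) * exp (- ((a * (x - (x + 1 / a * y)))\<^sup>2 / 2)) \<partial>lborel)"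
      using a by (intro lborel_integral_real_affine) auto
    also have "\<dots> = (1 / a) * (\<integral>y. sqrt (2 * pi) * (G (x + y / a) * k y) \<partial>lborel)"
      using a by (simp add: ek mult_ac)
    also have "\<dots> = (1 / a) * (sqrt (2 * pi) * (\<integral>y. G (x + y / a) * k y \<partial>lborel))"
      by simp
    finally show ?thesis unfolding a_def[symmetric] using a by simp
  qed
  have lim: "(\<lambda>n. \<integral>y. G (x + y / real (Suc n)) * k y \<partial>lborel) \<longlonglongrightarrow> (\<integral>y. f y \<partial>lborel)"
  proof (rule integral_dominated_convergence[where w = "\<lambda>y. C * k y"])
    show "integrable lborel (\<lambda>y. C * k y)" using k(1) by simp
    show "AE y in lborel. norm (G (x + y / real (Suc n)) * k y) \<le> C * k y" for n
      using bd k(2) by (intro AE_I2) (auto simp: abs_mult intro!: mult_right_mono)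
    have "AE y in lborel. y \<noteq> (0::real)" by (rule AE_lborel_singleton)
    then show "AE y in lborel. (\<lambda>n. G (x + y / real (Suc n)) * k y) \<longlonglongrightarrow> f y"
    proof eventually_elim
      fix y :: real assume y: "y \<noteq> 0"
      have z: "(\<lambda>n. x + y / real (Suc n)) \<longlonglongrightarrow> x" by real_asymp
      show "(\<lambda>n. G (x + y / real (Suc n)) * k y) \<longlonglongrightarrow> f y"
      proof (cases "y > 0")
        case True
        then have "filterlim (\<lambda>n. x + y / real (Suc n)) (at_right x) sequentially"
          unfolding filterlim_at using z by auto
        then have "(\<lambda>n. G (x + y / real (Suc n))) \<longlonglongrightarrow> r" by (rule filterlim_compose[OF R])
        then show ?thesis unfolding f_def using True by (auto intro: tendsto_mult_right)
      next
        case False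
        then have "filterlim (\<lambda>n. x + y / real (Suc n)) (at_left x) sequentially"
          unfolding filterlim_at using z y by (auto simp: divide_less_0_iff)
        then have "(\<lambda>n. G (x + y / real (Suc n))) \<longlonglongrightarrow> l" by (rule filterlim_compose[OF L])
        then show ?thesis unfolding f_def using False by (auto intro: tendsto_mult_right)
      qed
    qed
  qed measurable
  have val: "(\<integral>y. f y \<partial>lborel) = (l + r) / 2"
  proof -
    have f: "integrable lborel f"
      by (rule Bochner_Integration.integrable_bound[of lborel "\<lambda>y. (\<bar>l\<bar> + \<bar>r\<bar>) * k y"])
        (use k in \<open>auto simp: f_def abs_mult intro!: mult_right_mono\<close>)
    have "2 * (\<integral>y. f y \<partial>lborel) = (\<integral>y. f y \<partial>lborel) + (\<integral>y. f (- y) \<partial>lborel)"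
      by (simp add: even_integral_reflect)
    also have "\<dots> = (\<integral>y. f y + f (- y) \<partial>lborel)"
      by (intro Bochner_Integration.integral_add[symmetric] f integrable_reflect)
    also have "\<dots> = (\<integral>y. (l + r) * k y \<partial>lborel)"
    proof (rule integral_cong_AE)
      have "AE y in lborel. y \<noteq> (0::real)" by (rule AE_lborel_singleton)
      then show "AE y in lborel. f y + f (- y) = (l + r) * k y"
        by eventually_elim (auto simp: f_def k(4) algebra_simps)
    qed measurable
    also have "\<dots> = l + r" using k(3) by simp
    finally show ?thesis by simp
  qed
  show ?thesis unfolding sub val[symmetric] by (intro tendsto_mult tendsto_const lim)
qed

text \<open>
  The function \<open>G x = F x cosh (x / 2)\<close> has a nonnegative Fourier transform, which need not be integrable.
  Its Gaussian means are largest at \<open>0\<close>, and by (TFc) they converge to \<open>G\<close> at every point.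
\<close>

lemma POS_bound:
  assumes F: "test_function F" and P: "POS F"
  shows "F x \<le> F 0 * sech_half x"
proof -
  note Fm = test_function_measurable[OF F] and Fi = test_function_exp_half(1)[OF F]
  note [measurable] = Fm
  have even: "F (- x) = F x" for x using F unfolding test_function_def by blast
  define G where "G x = F x * cosh (x / 2)" for x
  have Gi: "integrable lborel G"
    using integrable_cosh_half[OF Fm Fi, of "\<lambda>_. 1"] by (simp add: G_def[abs_def])
  have Ge: "G (- x) = G x" for x by (simp add: G_def even)
  have Gp: "0 \<le> (\<integral>u. G u * cos (a * u) \<partial>lborel)" for a
  proof -
    define s where "s = Complex (a / (2 * pi)) (1 / (4 * pi))"
    have "0 \<le> Re (fourier F s)" using P by (simp add: POS_def s_def)
    also have "\<dots> = (\<integral>u. F u * cosh (u / 2) * cos (2 * pi * Re s * u) \<partial>lborel)"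
      by (rule Re_fourier_boundary[OF Fm Fi even]) (simp add: s_def)
    finally show ?thesis by (simp add: G_def s_def)
  qed
  obtain C where C: "\<And>x. \<bar>F x * exp (\<bar>x\<bar> / 2)\<bar> \<le> C" using test_function_exp_half(2)[OF F] by blast
  have Gb: "\<bar>G x\<bar> \<le> C" for x
  proof -
    have "\<bar>G x\<bar> \<le> \<bar>F x * exp (\<bar>x\<bar> / 2)\<bar>"
      unfolding G_def abs_mult using cosh_half_le[of x] cosh_real_nonneg[of "x / 2"]
      by (intro mult_left_mono) auto
    then show ?thesis using C[of x] by linarith
  qed
  have Gm: "G \<in> borel_measurable borel" using Gi borel_measurable_integrable by force
  have lim: "(\<lambda>n. real (Suc n) * (\<integral>u. G u * exp (- ((real (Suc n) * (x - u))\<^sup>2 / 2)) \<partial>lborel)) \<longlonglongrightarrow>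
      sqrt (2 * pi) * G x" for x
  proof -
    obtain l r where lr: "(F \<longlongrightarrow> l) (at_left x)" "(F \<longlongrightarrow> r) (at_right x)" "F x = (l + r) / 2"
      using F unfolding test_function_def by blast
    have c: "((\<lambda>x::real. cosh (x / 2)) \<longlongrightarrow> cosh (x / 2)) (at x within S)" for S
      by (intro tendsto_intros) auto
    have "(G \<longlongrightarrow> l * cosh (x / 2)) (at_left x)" "(G \<longlongrightarrow> r * cosh (x / 2)) (at_right x)"
      unfolding G_def[abs_def] by (intro tendsto_mult lr c)+
    from gaussian_mean_limit[OF Gm Gb this] show ?thesis
      by (simp add: G_def lr(3) algebra_simps)
  qed
  have "sqrt (2 * pi) * G x \<le> sqrt (2 * pi) * G 0"
  proof (rule LIMSEQ_le[OF lim lim], intro exI allI impI)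
    fix n :: nat
    show "real (Suc n) * (\<integral>u. G u * exp (- ((real (Suc n) * (x - u))\<^sup>2 / 2)) \<partial>lborel) \<le>
        real (Suc n) * (\<integral>u. G u * exp (- ((real (Suc n) * (0 - u))\<^sup>2 / 2)) \<partial>lborel)"
      by (intro mult_left_mono gaussian_mean_le Gi Ge Gp) auto
  qed
  then have "G x \<le> G 0" by simp
  then show ?thesis
    by (simp add: G_def sech_half_def cosh_real_pos field_simps)
qed

section \<open>The functions of Odlyzko\<close>

text \<open>The closed form of \<open>odlyzko_g\<close> on the unit interval, beyond which that
  function vanishes.\<close>

definition bump_conv :: "real \<Rightarrow> real" where
  "bump_conv u = (1 - u) * cos (pi * u) + sin (pi * u) / pi"

lemma bump_conv_simps: "bump_conv 0 = 1" "bump_conv 1 = 0"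
  by (simp_all add: bump_conv_def)

lemma bump_conv_deriv: "(bump_conv has_real_derivative - pi * (1 - u) * sin (pi * u)) (at u within S)"
  unfolding bump_conv_def[abs_def]
  by (auto intro!: derivative_eq_intros simp: field_simps)

lemma sin_pi_bounds:
  assumes "0 \<le> u" "u \<le> 1"
  shows "0 \<le> sin (pi * u)" "sin (pi * u) \<le> pi * u"
  using assms by (auto intro!: sin_ge_zero sin_x_le_x simp: mult_left_le)

lemma bump_conv_antimono:
  assumes "0 \<le> u" "u \<le> v" "v \<le> 1"
  shows "bump_conv v \<le> bump_conv u"
proof (rule DERIV_nonpos_imp_nonincreasing[OF assms(2)])
  fix x assume x: "u \<le> x" "x \<le> v"
  show "\<exists>y. (bump_conv has_real_derivative y) (at x) \<and> y \<le> 0"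
    using sin_pi_bounds(1)[of x] x assms
    by (intro exI[of _ "- pi * (1 - x) * sin (pi * x)"] conjI bump_conv_deriv) (simp add: mult_nonneg_nonneg)
qed

lemma bump_conv_bounds:
  assumes "0 \<le> u" "u \<le> 1"
  shows "0 \<le> bump_conv u" "bump_conv u \<le> 1"
  using bump_conv_antimono[of u 1] bump_conv_antimono[of 0 u] assms by (auto simp: bump_conv_simps)

lemma bump_conv_deriv_bound:
  assumes "0 \<le> u" "u \<le> 1"
  shows "\<bar>- pi * (1 - u) * sin (pi * u)\<bar> \<le> pi\<^sup>2 * u"
proof -
  have "\<bar>- pi * (1 - u) * sin (pi * u)\<bar> = pi * (1 - u) * sin (pi * u)"
    using sin_pi_bounds[OF assms] assms by (simp add: abs_mult)
  also have "\<dots> \<le> pi * 1 * (pi * u)"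
    using sin_pi_bounds[OF assms] assms by (intro mult_mono) auto
  finally show ?thesis by (simp add: power2_eq_square)
qed

lemma bump_conv_near_0:
  assumes "0 \<le> u" "u \<le> 1"
  shows "\<bar>bump_conv u - 1\<bar> \<le> pi\<^sup>2 * u"
proof (cases "u = 0")
  case False
  then have "0 < u" using assms by simp
  then obtain z where z: "0 < z" "z < u" "bump_conv u - bump_conv 0 = (u - 0) * (- pi * (1 - z) * sin (pi * z))"
    using MVT2[of 0 u bump_conv "\<lambda>z. - pi * (1 - z) * sin (pi * z)"] bump_conv_deriv by blast
  have "0 < u" using z by linarith
  have "\<bar>bump_conv u - 1\<bar> = u * \<bar>- pi * (1 - z) * sin (pi * z)\<bar>"
    using z(3) \<open>0 < u\<close> by (simp add: bump_conv_simps abs_mult)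
  also have "\<dots> \<le> u * (pi\<^sup>2 * 1)"
  proof (intro mult_left_mono)
    have "\<bar>- pi * (1 - z) * sin (pi * z)\<bar> \<le> pi\<^sup>2 * z" using z assms by (intro bump_conv_deriv_bound) auto
    also have "\<dots> \<le> pi\<^sup>2 * 1" using z assms by (intro mult_left_mono) auto
    finally show "\<bar>- pi * (1 - z) * sin (pi * z)\<bar> \<le> pi\<^sup>2 * 1" .
  qed (use assms in auto)
  finally show ?thesis by (simp add: mult.commute)
qed (simp add: bump_conv_simps)

lemma cos_bump_even: "cos_bump (- x) = cos_bump x"
  by (simp add: cos_bump_def)

lemma cos_bump_bound: "\<bar>cos_bump x\<bar> \<le> indicator {-1/2..1/2} x"
  by (auto simp: cos_bump_def indicator_def abs_le_iff)

lemma cos_bump_measurable [measurable]: "cos_bump \<in> borel_measurable borel"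
  unfolding cos_bump_def[abs_def] by measurable

lemma cos_bump_integrable:
  assumes [measurable]: "h \<in> borel_measurable borel" and h: "\<And>x. \<bar>h x\<bar> \<le> 1"
  shows "integrable lborel (\<lambda>x. cos_bump x * h x)"
proof (rule Bochner_Integration.integrable_bound)
  show "integrable lborel (\<lambda>x. indicator {-1/2..1/2::real} x :: real)"
    by (rule integrable_real_indicator) auto
  show "AE x in lborel. norm (cos_bump x * h x) \<le> norm (indicator {-1/2..1/2::real} x :: real)"
  proof (intro AE_I2)
    fix x :: real
    have "\<bar>cos_bump x\<bar> * \<bar>h x\<bar> \<le> indicator {-1/2..1/2} x * 1"
      using cos_bump_bound[of x] h[of x] by (intro mult_mono) auto
    then show "norm (cos_bump x * h x) \<le> norm (indicator {-1/2..1/2::real} x :: real)"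
      by (simp add: abs_mult)
  qed
qed measurable

lemma odlyzko_g_even: "odlyzko_g (- x) = odlyzko_g x"
proof -
  have "cos_bump (- x - - y) = cos_bump (x - y)" for y
    using cos_bump_even[of "x - y"] by (simp add: algebra_simps)
  then have "(\<integral>y. cos_bump y * cos_bump (- x - y) \<partial>lborel) = (\<integral>y. cos_bump y * cos_bump (x - y) \<partial>lborel)"
    using even_integral_reflect[of "\<lambda>y. cos_bump y * cos_bump (- x - y)"] by (simp add: cos_bump_even)
  then show ?thesis by (simp add: odlyzko_g_def)
qed

text \<open>The supports of the two bumps overlap in \<open>{x - 1/2..1/2}\<close>, which is empty
  for \<open>x > 1\<close>; on it the product-to-sum formula makes \<open>?A\<close> an
  antiderivative of the product.\<close>

lemma odlyzko_g_nonneg_arg: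
  assumes x: "0 \<le> x"
  shows "odlyzko_g x = bump_conv (min x 1)"
proof (cases "x \<le> 1")
  case True
  let ?f = "\<lambda>y. cos (pi * y) * cos (pi * (x - y))"
  let ?A = "\<lambda>y. (y * cos (pi * x) + sin (pi * (2 * y - x)) / (2 * pi)) / 2"
  have "(\<integral>y. cos_bump y * cos_bump (x - y) \<partial>lborel) = (\<integral>y. ?f y * indicator {x - 1/2..1/2} y \<partial>lborel)"
  proof (rule Bochner_Integration.integral_cong[OF refl])
    fix y :: real
    show "cos_bump y * cos_bump (x - y) = ?f y * indicator {x - 1/2..1/2} y"
    proof -
      have "\<bar>y\<bar> \<le> 1/2 \<and> \<bar>x - y\<bar> \<le> 1/2 \<longleftrightarrow> y \<in> {x - 1/2..1/2}"
        using x True by (auto simp: abs_if split: if_splits)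
      then show ?thesis by (simp only: cos_bump_def indicator_def) auto
    qed
  qed
  also have "\<dots> = ?A (1/2) - ?A (x - 1/2)"
  proof (rule integral_FTC_Icc_real)
    show "x - 1/2 \<le> 1/2" using True by simp
    fix y :: real
    have f: "?f y = (cos (pi * x) + cos (pi * (2 * y - x))) / 2"
      by (simp add: cos_times_cos algebra_simps)
    show "(?A has_real_derivative ?f y) (at y)"
      unfolding f by (auto intro!: derivative_eq_intros)
    show "isCont ?f y" by (intro continuous_intros)
  qed
  also have "\<dots> = bump_conv x / 2"
  proof -
    have "pi * (2 * (1/2) - x) = pi - pi * x" "pi * (2 * (x - 1/2) - x) = - (pi - pi * x)"
      by (simp_all add: algebra_simps)
    then have "sin (pi * (2 * (1/2) - x)) = sin (pi * x)" "sin (pi * (2 * (x - 1/2) - x)) = - sin (pi * x)"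
      by (simp_all only: sin_minus sin_pi_minus)
    then have "?A (1/2) - ?A (x - 1/2) =
        ((1/2) * cos (pi * x) + sin (pi * x) / (2 * pi) - ((x - 1/2) * cos (pi * x) - sin (pi * x) / (2 * pi))) / 2"
      by (simp add: field_simps)
    also have "\<dots> = bump_conv x / 2"
      by (simp add: bump_conv_def field_simps)
    finally show ?thesis .
  qed
  finally show ?thesis using True by (simp add: odlyzko_g_def)
next
  case False
  have "cos_bump y * cos_bump (x - y) = 0" for y
    using False by (auto simp: cos_bump_def)
  then have "odlyzko_g x = 2 * (\<integral>y. 0 \<partial>(lborel :: real measure))" unfolding odlyzko_g_def by (simp only:)
  then show ?thesis using False by (simp add: bump_conv_simps)
qed

lemma odlyzko_g_eq: "odlyzko_g x = bump_conv (min \<bar>x\<bar> 1)"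
proof (cases "0 \<le> x")
  case False
  then show ?thesis using odlyzko_g_even[of x] odlyzko_g_nonneg_arg[of "- x"] by simp
qed (simp add: odlyzko_g_nonneg_arg)

lemma continuous_bump_conv: "continuous_on S bump_conv"
  unfolding bump_conv_def[abs_def] by (intro continuous_intros) auto

lemma continuous_odlyzko_g: "continuous_on S odlyzko_g"
proof -
  have "continuous_on S (\<lambda>x. bump_conv (min \<bar>x\<bar> 1))"
    by (rule continuous_on_compose2[OF continuous_bump_conv[of UNIV]]) (auto intro!: continuous_intros)
  then show ?thesis by (simp add: odlyzko_g_eq[abs_def])
qed

lemma odlyzko_g_bounds: "0 \<le> odlyzko_g x" "odlyzko_g x \<le> 1"
  unfolding odlyzko_g_eq by (rule bump_conv_bounds; simp)+

lemma odlyzko_F_eq: "odlyzko_F l x = odlyzko_g (x / l) * sech_half x"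
  by (simp add: odlyzko_F_def sech_half_def)

lemma continuous_sech_half: "continuous_on S sech_half"
  unfolding sech_half_def[abs_def] by (intro continuous_intros) (auto simp: cosh_real_nonzero)

lemma continuous_odlyzko_F: "continuous_on S (odlyzko_F l)"
  unfolding odlyzko_F_eq[abs_def] divide_inverse
  by (intro continuous_intros continuous_sech_half continuous_on_compose2[OF continuous_odlyzko_g[of UNIV]]) auto

lemma odlyzko_F_measurable [measurable]: "odlyzko_F l \<in> borel_measurable borel"
  by (rule borel_measurable_continuous_onI[OF continuous_odlyzko_F])

lemma odlyzko_F_simps:
  "odlyzko_F l 0 = 1" "0 \<le> odlyzko_F l x" "odlyzko_F l x \<le> sech_half x" "odlyzko_F l (- x) = odlyzko_F l x"
proof -
  show "odlyzko_F l 0 = 1" by (simp add: odlyzko_F_eq odlyzko_g_eq bump_conv_simps sech_half_simps)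
  show "0 \<le> odlyzko_F l x" "odlyzko_F l x \<le> sech_half x"
    using odlyzko_g_bounds[of "x / l"] sech_half_simps(2)[of x]
    by (auto simp: odlyzko_F_eq mult_left_le_one_le)
  show "odlyzko_F l (- x) = odlyzko_F l x"
    using odlyzko_g_even[of "x / l"] by (simp add: odlyzko_F_eq sech_half_simps)
qed

lemma odlyzko_F_support: "l > 0 \<Longrightarrow> \<bar>x\<bar> \<ge> l \<Longrightarrow> odlyzko_F l x = 0"
  by (simp add: odlyzko_F_eq odlyzko_g_eq bump_conv_simps abs_divide)

definition F_deriv :: "real \<Rightarrow> real \<Rightarrow> real" where
  "F_deriv l x = - pi * (1 - x / l) * sin (pi * (x / l)) / l * sech_half x
    - bump_conv (x / l) * (sinh (x / 2) / 2 * sech_half x * sech_half x)"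

lemma sech_half_deriv: "(sech_half has_real_derivative - (sinh (x / 2) / 2 * sech_half x * sech_half x)) (at x)"
  unfolding sech_half_def[abs_def]
  by (auto intro!: derivative_eq_intros simp: field_simps power2_eq_square cosh_real_nonzero)

lemma odlyzko_F_deriv:
  assumes l: "l > 0" and x: "0 < x" "x < l"
  shows "(odlyzko_F l has_real_derivative F_deriv l x) (at x)"
proof -
  have b: "((\<lambda>x. bump_conv (x / l)) has_real_derivative - pi * (1 - x / l) * sin (pi * (x / l)) * (1 / l)) (at x)"
    by (rule DERIV_chain2[where g = "\<lambda>x. x / l", OF bump_conv_deriv]) (use l in \<open>auto intro!: derivative_eq_intros\<close>)
  have "((\<lambda>x. bump_conv (x / l) * sech_half x) has_real_derivative F_deriv l x) (at x)"
  proof (rule DERIV_cong[OF DERIV_mult[OF b sech_half_deriv]])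
    have alg: "A * (1 / l) * s + - S * B = A / l * s - B * S" for A s S B :: real by simp
    show "- pi * (1 - x / l) * sin (pi * (x / l)) * (1 / l) * sech_half x +
        - (sinh (x / 2) / 2 * sech_half x * sech_half x) * bump_conv (x / l) = F_deriv l x"
      unfolding F_deriv_def by (rule alg)
  qed
  moreover have "\<forall>\<^sub>F y in nhds x. odlyzko_F l y = bump_conv (y / l) * sech_half y"
  proof -
    have "\<forall>\<^sub>F y in nhds x. y \<in> {0<..<l}" using x by (intro eventually_nhds_in_open) auto
    then show ?thesis
      by eventually_elim (use l in \<open>simp add: odlyzko_F_eq odlyzko_g_eq min_absorb1\<close>)
  qed
  ultimately show ?thesis by (simp add: DERIV_cong_ev[OF refl _ refl])
qed

lemma sinh_half_bound:
  fixes x :: real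
  assumes "0 \<le> x"
  shows "\<bar>sinh (x / 2) / 2 * sech_half x * sech_half x\<bar> \<le> x"
proof -
  have s: "0 \<le> sinh (x / 2)" using assms by simp
  have "sinh (x / 2) * sech_half x \<le> 2 * x"
  proof -
    have "sinh (x / 2) \<le> (x / 2) * cosh (x / 2)"
    proof -
      have "\<exists>z. sinh (x / 2) = (x / 2) * cosh z \<and> 0 \<le> z \<and> z \<le> x / 2"
      proof (cases "x = 0")
        case False
        then have "0 < x / 2" using assms by simp
        moreover have "\<And>y::real. (sinh has_real_derivative cosh y) (at y)"
          by (auto intro!: derivative_eq_intros)
        ultimately obtain z where "0 < z" "z < x / 2" "sinh (x / 2) - sinh 0 = (x / 2 - 0) * cosh z"
          using MVT2[of 0 "x / 2" sinh cosh] by blast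
        then show ?thesis by (intro exI[of _ z]) auto
      qed auto
      then obtain z where z: "sinh (x / 2) = (x / 2) * cosh z" "0 \<le> z" "z \<le> x / 2" by blast
      then have "cosh z \<le> cosh (x / 2)" by (simp add: cosh_real_nonneg_le_iff)
      then show ?thesis unfolding z(1) using assms by (intro mult_left_mono) auto
    qed
    then have "sinh (x / 2) * sech_half x \<le> (x / 2) * cosh (x / 2) * sech_half x"
      using sech_half_simps(2)[of x] by (intro mult_right_mono) auto
    also have "\<dots> = x / 2" by (simp add: sech_half_def cosh_real_nonzero)
    finally show ?thesis using assms by simp
  qed
  then have "sinh (x / 2) * sech_half x * sech_half x \<le> (2 * x) * 1"
    by (rule mult_mono) (use sech_half_simps(2,3)[of x] assms in \<open>auto intro: less_imp_le\<close>)
  moreover have "0 \<le> sinh (x / 2) * sech_half x * sech_half x"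
    using s sech_half_simps(2)[of x] by (intro mult_nonneg_nonneg) auto
  ultimately show ?thesis by (simp add: abs_of_nonneg)
qed

text \<open>Both factors of \<open>odlyzko_F\<close> are flat at 0, so the derivative vanishes there
  linearly. This rate, rather than mere boundedness, is what keeps the quotient of (TFb) Lipschitz
  near 0.\<close>

lemma F_deriv_bound:
  assumes l: "l > 0" and x: "0 \<le> x" "x \<le> l"
  shows "\<bar>F_deriv l x\<bar> \<le> (pi\<^sup>2 / l\<^sup>2 + 1) * x"
proof -
  have u: "0 \<le> x / l" "x / l \<le> 1" using l x by auto
  have "\<bar>- pi * (1 - x / l) * sin (pi * (x / l)) / l * sech_half x\<bar> =
      \<bar>- pi * (1 - x / l) * sin (pi * (x / l))\<bar> / l * sech_half x"
    using l sech_half_simps(2)[of x] by (simp add: abs_mult abs_divide)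
  also have "\<dots> \<le> pi\<^sup>2 * (x / l) / l * 1"
    using bump_conv_deriv_bound[OF u] l sech_half_simps(2,3)[of x] x
    by (intro mult_mono divide_right_mono) (auto intro: less_imp_le)
  finally have A: "\<bar>- pi * (1 - x / l) * sin (pi * (x / l)) / l * sech_half x\<bar> \<le> pi\<^sup>2 / l\<^sup>2 * x"
    by (simp add: power2_eq_square)
  have B: "\<bar>bump_conv (x / l) * (sinh (x / 2) / 2 * sech_half x * sech_half x)\<bar> \<le> 1 * x"
    unfolding abs_mult[where a = "bump_conv (x / l)"]
    using bump_conv_bounds[OF u] sinh_half_bound[OF x(1)] by (intro mult_mono) auto
  show ?thesis
    unfolding F_deriv_def distrib_right by (rule order_trans[OF abs_triangle_ineq4 add_mono[OF A B]])
qed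

section \<open>The conditions (TFa) and (TFb) for the functions of Odlyzko\<close>

lemma bounded_variation_onI:
  assumes "\<And>x y. x \<in> S \<Longrightarrow> y \<in> S \<Longrightarrow> x \<le> y \<Longrightarrow> \<bar>f y - f x\<bar> \<le> \<phi> y - \<phi> x" and C: "\<And>x. x \<in> S \<Longrightarrow> \<bar>\<phi> x\<bar> \<le> C"
  shows "bounded_variation_on f S"
  unfolding bounded_variation_on_def
proof (intro exI[of _ "2 * C"] allI impI)
  fix n and t :: "nat \<Rightarrow> real"
  assume t: "(\<forall>i\<le>n. t i \<in> S) \<and> (\<forall>i<n. t i \<le> t (Suc i))"
  have "(\<Sum>i<n. \<bar>f (t (Suc i)) - f (t i)\<bar>) \<le> (\<Sum>i<n. \<phi> (t (Suc i)) - \<phi> (t i))"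
    using t assms(1) by (intro sum_mono) auto
  also have "\<dots> = \<phi> (t n) - \<phi> (t 0)" by (rule sum_lessThan_telescope)
  also have "\<dots> \<le> 2 * C" using C[of "t n"] C[of "t 0"] t by auto
  finally show "(\<Sum>i<n. \<bar>f (t (Suc i)) - f (t i)\<bar>) \<le> 2 * C" .
qed

lemma lipschitz_from_deriv:
  fixes f f' :: "real \<Rightarrow> real"
  assumes cont: "continuous_on {a..b} f" and d: "\<And>z. a < z \<Longrightarrow> z < b \<Longrightarrow> (f has_real_derivative f' z) (at z)"
    and L: "\<And>z. a < z \<Longrightarrow> z < b \<Longrightarrow> \<bar>f' z\<bar> \<le> L" and xy: "a \<le> x" "x \<le> y" "y \<le> b"
  shows "\<bar>f y - f x\<bar> \<le> L * (y - x)"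
proof (cases "x = y")
  case False
  then have "x < y" using xy by simp
  moreover have "continuous_on {x..y} f" using cont by (rule continuous_on_subset) (use xy in auto)
  moreover have "\<And>z. x < z \<Longrightarrow> z < y \<Longrightarrow> (f has_derivative (*) (f' z)) (at z)"
    using d xy by (auto simp: has_field_derivative_def)
  ultimately obtain z where z: "x < z" "z < y" "f y - f x = f' z * (y - x)"
    using mvt[of x y f "\<lambda>z. (*) (f' z)"] by blast
  then show ?thesis
    using L[of z] xy by (simp add: abs_mult mult_right_mono)
qed simp

text \<open>The function is even, vanishes beyond \<open>l\<close> and is Lipschitz on
  \<open>{0..l}\<close>. Hence its increments are controlled by those of \<open>L\<close> times the
  clamping \<open>cl\<close> of the argument to \<open>{- l..l}\<close>, a bounded monotone
  function.\<close>

lemma odlyzko_F_exp_bv: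
  assumes l: "l > 0"
  shows "bounded_variation_on (\<lambda>x. odlyzko_F l x * exp (1 * \<bar>x\<bar>)) UNIV"
proof -
  define f where "f x = odlyzko_F l x * exp (1 * \<bar>x\<bar>)" for x
  define K where "K = pi\<^sup>2 / l\<^sup>2 + 1"
  define L where "L = (K * l + 1) * exp l"
  define cl where "cl x = max (- l) (min l x)" for x
  have K: "K \<ge> 0" by (simp add: K_def)
  have L0: "L \<ge> 0" using K l by (simp add: L_def)
  have lip: "\<bar>f y - f x\<bar> \<le> L * (y - x)" if "0 \<le> x" "x \<le> y" "y \<le> l" for x y
  proof (rule lipschitz_from_deriv[where f' = "\<lambda>z. F_deriv l z * exp z + exp z * odlyzko_F l z" and a = 0 and b = l])
    show "continuous_on {0..l} f"
      unfolding f_def[abs_def] by (intro continuous_intros continuous_odlyzko_F)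
    fix z assume z: "0 < z" "z < l"
    have "((\<lambda>x. odlyzko_F l x * exp x) has_real_derivative F_deriv l z * exp z + exp z * odlyzko_F l z) (at z)"
      by (rule DERIV_mult[OF odlyzko_F_deriv[OF l z] DERIV_exp])
    moreover have "\<forall>\<^sub>F y in nhds z. f y = odlyzko_F l y * exp y"
    proof -
      have "\<forall>\<^sub>F y in nhds z. y \<in> {0<..}" using z by (intro eventually_nhds_in_open) auto
      then show ?thesis by eventually_elim (simp add: f_def)
    qed
    ultimately show "(f has_real_derivative F_deriv l z * exp z + exp z * odlyzko_F l z) (at z)"
      by (simp add: DERIV_cong_ev[OF refl _ refl])
    have "\<bar>F_deriv l z\<bar> \<le> K * z" unfolding K_def using z by (intro F_deriv_bound l) auto
    also have "\<dots> \<le> K * l" using z K by (intro mult_left_mono) auto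
    finally have "\<bar>F_deriv l z + odlyzko_F l z\<bar> \<le> K * l + 1"
      using odlyzko_F_simps(2,3)[of l z] sech_half_simps(3)[of z] by (simp add: abs_le_iff)
    then have "\<bar>F_deriv l z + odlyzko_F l z\<bar> * exp z \<le> (K * l + 1) * exp l"
      using z K l by (intro mult_mono) auto
    moreover have "F_deriv l z * exp z + exp z * odlyzko_F l z = (F_deriv l z + odlyzko_F l z) * exp z"
      by (simp add: algebra_simps)
    ultimately show "\<bar>F_deriv l z * exp z + exp z * odlyzko_F l z\<bar> \<le> L"
      by (simp add: abs_mult L_def)
  qed (use that in auto)
  have f_abs: "f x = f \<bar>x\<bar>" for x
    by (cases "x \<ge> 0") (auto simp: f_def odlyzko_F_simps)
  have f_cl: "f x = f (cl x)" for x
    using odlyzko_F_support[OF l, of x] odlyzko_F_support[OF l, of "cl x"] l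
    by (cases "\<bar>x\<bar> \<ge> l") (auto simp: f_def cl_def min_def max_def abs_if split: if_splits)
  show ?thesis
    unfolding f_def[symmetric]
  proof (rule bounded_variation_onI[where \<phi> = "\<lambda>x. L * cl x" and C = "L * l"])
    fix x y :: real assume xy: "x \<le> y"
    have b: "\<bar>cl x\<bar> \<le> l" "\<bar>cl y\<bar> \<le> l" using l by (auto simp: cl_def)
    have "\<bar>f y - f x\<bar> = \<bar>f \<bar>cl y\<bar> - f \<bar>cl x\<bar>\<bar>"
      using f_cl[of x] f_cl[of y] f_abs[of "cl x"] f_abs[of "cl y"] by simp
    also have "\<dots> \<le> L * \<bar>\<bar>cl y\<bar> - \<bar>cl x\<bar>\<bar>"
    proof (cases "\<bar>cl x\<bar> \<le> \<bar>cl y\<bar>")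
      case True
      then show ?thesis using lip[of "\<bar>cl x\<bar>" "\<bar>cl y\<bar>"] b by simp
    next
      case False
      then show ?thesis using lip[of "\<bar>cl y\<bar>" "\<bar>cl x\<bar>"] b by (simp add: abs_minus_commute)
    qed
    also have "\<dots> \<le> L * \<bar>cl y - cl x\<bar>" by (intro mult_left_mono L0 abs_triangle_ineq3)
    also have "\<bar>cl y - cl x\<bar> = cl y - cl x" using xy by (auto simp: cl_def)
    finally show "\<bar>f y - f x\<bar> \<le> L * cl y - L * cl x" by (simp add: right_diff_distrib)
  next
    fix x :: real
    have "\<bar>cl x\<bar> \<le> l" using l by (auto simp: cl_def)
    then show "\<bar>L * cl x\<bar> \<le> L * l" using L0 by (simp add: abs_mult mult_left_mono)
  qed
qed

lemma odlyzko_F_quotient_bv: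
  assumes l: "l > 0"
  shows "bounded_variation_on (\<lambda>x. (odlyzko_F l x - odlyzko_F l 0) / x) (UNIV - {0})"
proof -
  define h where "h x = (odlyzko_F l x - odlyzko_F l 0) / x" for x
  define K where "K = pi\<^sup>2 / l\<^sup>2 + 1"
  have K: "K \<ge> 0" by (simp add: K_def)
  have F1: "\<bar>odlyzko_F l x - 1\<bar> \<le> K * x * x" if x: "0 \<le> x" "x \<le> l" for x
  proof -
    have "\<bar>odlyzko_F l x - odlyzko_F l 0\<bar> \<le> (K * x) * (x - 0)"
    proof (rule lipschitz_from_deriv[where f' = "F_deriv l" and a = 0 and b = x])
      fix z assume z: "0 < z" "z < x"
      then show "(odlyzko_F l has_real_derivative F_deriv l z) (at z)"
        using x by (intro odlyzko_F_deriv l) auto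
      have "\<bar>F_deriv l z\<bar> \<le> K * z" unfolding K_def using z x by (intro F_deriv_bound l) auto
      also have "\<dots> \<le> K * x" using z K by (intro mult_left_mono) auto
      finally show "\<bar>F_deriv l z\<bar> \<le> K * x" .
    qed (use x continuous_odlyzko_F in auto)
    then show ?thesis by (simp add: odlyzko_F_simps)
  qed
  \<comment> \<open>Division by zero yields 0, which is also the limit of the quotient at 0, so that
    \<open>h\<close> is Lipschitz on the closed interval \<open>{0..l}\<close>.\<close>
  have h0: "h 0 = 0" by (simp add: h_def)
  have h_small: "\<bar>h x\<bar> \<le> K * x" if x: "0 \<le> x" "x \<le> l" for x
  proof (cases "x = 0")
    case False
    then show ?thesis using F1[OF x] x by (simp add: h_def odlyzko_F_simps abs_divide divide_le_eq)
  qed (simp add: h0)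
  have lip: "\<bar>h y - h x\<bar> \<le> 2 * K * (y - x)" if xy: "0 \<le> x" "x \<le> y" "y \<le> l" for x y
  proof (cases "x = 0")
    case True
    have "0 \<le> K * y" using K xy by (intro mult_nonneg_nonneg) auto
    then show ?thesis using h_small[of y] xy True by (simp add: h0)
  next
    case False
    then have x: "0 < x" using xy by simp
    show ?thesis
    proof (rule lipschitz_from_deriv[where f' = "\<lambda>z. (F_deriv l z * z - (odlyzko_F l z - 1)) / (z * z)" and a = x and b = y])
      show "continuous_on {x..y} h"
        unfolding h_def[abs_def] using x by (intro continuous_intros continuous_odlyzko_F) auto
      fix z assume z: "x < z" "z < y"
      then have z0: "0 < z" "z < l" using x xy by auto
      show "(h has_real_derivative (F_deriv l z * z - (odlyzko_F l z - 1)) / (z * z)) (at z)"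
        unfolding h_def[abs_def] odlyzko_F_simps(1)
        by (rule DERIV_cong[OF DERIV_divide[OF DERIV_diff[OF odlyzko_F_deriv[OF l z0] DERIV_const] DERIV_ident]])
          (use z0 in auto)
      have "\<bar>F_deriv l z\<bar> \<le> K * z" unfolding K_def using z0 by (intro F_deriv_bound l) auto
      then have "\<bar>F_deriv l z * z\<bar> \<le> K * z * z" using z0 by (simp add: abs_mult mult_right_mono)
      then have "\<bar>F_deriv l z * z - (odlyzko_F l z - 1)\<bar> \<le> 2 * K * (z * z)"
        using F1[of z] z0 abs_triangle_ineq4[of "F_deriv l z * z" "odlyzko_F l z - 1"]
        by (simp add: mult.assoc)
      then show "\<bar>(F_deriv l z * z - (odlyzko_F l z - 1)) / (z * z)\<bar> \<le> 2 * K"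
        using z0 by (simp add: abs_divide divide_le_eq)
    qed (use xy in auto)
  qed
  \<comment> \<open>A monotone majorant of the variation: the Lipschitz part up to \<open>l\<close>,
    and from there on the increment of \<open>- 1 / x\<close>, the value of the quotient beyond the
    support.\<close>
  define \<phi> where "\<phi> x = 2 * K * min x l + (1 / l - 1 / max x l)" for x
  have h_split: "h x = h (min x l) + (1 / l - 1 / max x l)" if x: "0 \<le> x" for x
  proof (cases "x \<le> l")
    case False
    then show ?thesis using l odlyzko_F_support[OF l, of x] odlyzko_F_support[OF l, of l]
      by (simp add: h_def odlyzko_F_simps)
  qed (use l in simp)
  have pos: "\<bar>h y - h x\<bar> \<le> \<phi> y - \<phi> x" if xy: "0 \<le> x" "x \<le> y" for x y
  proof -
    have A: "\<bar>h (min y l) - h (min x l)\<bar> \<le> 2 * K * (min y l - min x l)"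
      using xy l by (intro lip) auto
    have "max x l \<le> max y l" "0 < max x l" using xy l by auto
    then have "1 / max y l \<le> 1 / max x l" by (simp add: frac_le)
    then have B: "\<bar>(1 / l - 1 / max y l) - (1 / l - 1 / max x l)\<bar> = (1 / l - 1 / max y l) - (1 / l - 1 / max x l)"
      by simp
    have "\<bar>h y - h x\<bar> \<le> \<bar>h (min y l) - h (min x l)\<bar> + \<bar>(1 / l - 1 / max y l) - (1 / l - 1 / max x l)\<bar>"
      using h_split[of x] h_split[of y] xy by linarith
    also have "\<dots> \<le> \<phi> y - \<phi> x" using A unfolding B \<phi>_def by (simp add: algebra_simps)
    finally show ?thesis .
  qed
  have h_odd: "h (- x) = - h x" for x by (simp add: h_def odlyzko_F_simps)
  have \<phi>0: "\<phi> 0 = 0" using l by (simp add: \<phi>_def)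
  define \<Phi> where "\<Phi> x = (if x \<ge> 0 then \<phi> x else - \<phi> (- x))" for x
  have all: "\<bar>h y - h x\<bar> \<le> \<Phi> y - \<Phi> x" if "x \<le> y" for x y
  proof -
    consider "0 \<le> x" | "x < 0" "0 \<le> y" | "y < 0" by linarith
    then show ?thesis
    proof cases
      case 1
      then show ?thesis using pos[of x y] that by (simp add: \<Phi>_def)
    next
      case 2
      then show ?thesis using pos[of 0 y] pos[of 0 "- x"] by (simp add: \<Phi>_def h0 h_odd \<phi>0)
    next
      case 3
      then show ?thesis using pos[of "- y" "- x"] that by (simp add: \<Phi>_def h_odd)
    qed
  qed
  have "\<bar>\<phi> x\<bar> \<le> 2 * K * l + 1 / l" if x: "0 \<le> x" for x
  proof -
    have "0 \<le> \<phi> x" using pos[of 0 x] x \<phi>0 by linarith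
    moreover have "2 * K * min x l \<le> 2 * K * l" using K by (intro mult_left_mono) auto
    moreover have "0 \<le> 1 / max x l" using l by simp
    ultimately show ?thesis unfolding \<phi>_def by linarith
  qed
  then have "\<bar>\<Phi> x\<bar> \<le> 2 * K * l + 1 / l" for x by (simp add: \<Phi>_def)
  with all show ?thesis
    unfolding h_def[symmetric] by (intro bounded_variation_onI[where \<phi> = \<Phi>]) auto
qed

lemma odlyzko_F_exp_integrable:
  assumes l: "l > 0"
  shows "integrable lborel (\<lambda>x. odlyzko_F l x * exp (c * \<bar>x\<bar>))"
proof (rule Bochner_Integration.integrable_bound)
  show "integrable lborel (\<lambda>x. exp (\<bar>c\<bar> * l) * indicator {- l..l} x :: real)"
    using l by (intro integrable_mult_right integrable_real_indicator) (auto simp: emeasure_lborel_Icc_eq)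
  show "AE x in lborel. norm (odlyzko_F l x * exp (c * \<bar>x\<bar>)) \<le> norm (exp (\<bar>c\<bar> * l) * indicator {- l..l} x :: real)"
  proof (intro AE_I2)
    fix x :: real
    show "norm (odlyzko_F l x * exp (c * \<bar>x\<bar>)) \<le> norm (exp (\<bar>c\<bar> * l) * indicator {- l..l} x :: real)"
    proof (cases "\<bar>x\<bar> < l")
      case True
      have "c * \<bar>x\<bar> \<le> \<bar>c\<bar> * l" using True by (intro mult_mono) auto
      moreover have "odlyzko_F l x \<le> 1" using odlyzko_F_simps(3)[of l x] sech_half_simps(3)[of x] by linarith
      ultimately have "odlyzko_F l x * exp (c * \<bar>x\<bar>) \<le> 1 * exp (\<bar>c\<bar> * l)"
        using odlyzko_F_simps(2)[of l x] by (intro mult_mono) auto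
      then show ?thesis using True odlyzko_F_simps(2)[of l x] by (simp add: abs_less_iff)
    qed (use odlyzko_F_support[OF l] in simp)
  qed
qed measurable

lemma test_function_odlyzko_F:
  assumes l: "l > 0"
  shows "test_function (odlyzko_F l)"
  unfolding test_function_def
proof (intro conjI allI)
  show "\<exists>\<epsilon>>1 / 2. integrable lborel (\<lambda>x. odlyzko_F l x * exp (\<epsilon> * \<bar>x\<bar>)) \<and>
        bounded_variation_on (\<lambda>x. odlyzko_F l x * exp (\<epsilon> * \<bar>x\<bar>)) UNIV"
    by (intro exI[of _ 1] conjI odlyzko_F_exp_integrable odlyzko_F_exp_bv l) simp
  show "bounded_variation_on (\<lambda>x. (odlyzko_F l x - odlyzko_F l 0) / x) (UNIV - {0})"
    by (rule odlyzko_F_quotient_bv[OF l])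
  fix x
  have "isCont (odlyzko_F l) x"
    using continuous_odlyzko_F[of UNIV l] by (simp add: continuous_on_eq_continuous_at)
  then have "(odlyzko_F l \<longlongrightarrow> odlyzko_F l x) (at x)" by (simp add: isCont_def)
  then have "(odlyzko_F l \<longlongrightarrow> odlyzko_F l x) (at_left x)" "(odlyzko_F l \<longlongrightarrow> odlyzko_F l x) (at_right x)"
    by (simp_all add: filterlim_at_split)
  then show "\<exists>la r. (odlyzko_F l \<longlongrightarrow> la) (at_left x) \<and> (odlyzko_F l \<longlongrightarrow> r) (at_right x) \<and> odlyzko_F l x = (la + r) / 2"
    by (intro exI[of _ "odlyzko_F l x"]) auto
qed (rule odlyzko_F_simps(4))

text \<open>The cosine transform of a convolution square is the square of the transform
  \<open>c\<close> of the bump, up to the factor 2 in \<open>odlyzko_g\<close>; the sine parts drop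
  out because the bump is even.\<close>

lemma odlyzko_g_cos_transform: "0 \<le> (\<integral>x. odlyzko_g x * cos (a * x) \<partial>lborel)"
proof -
  define c where "c = (\<integral>y. cos_bump y * cos (a * y) \<partial>lborel)"
  let ?h = "\<lambda>x y. cos_bump y * cos_bump (x - y) * cos (a * x)"
  have ci: "integrable lborel (\<lambda>x. cos_bump (x - y))" for y
    using lborel_integrable_real_affine[OF cos_bump_integrable[of "\<lambda>_. 1"], of 1 "- y"] by simp
  have i1: "integrable lborel cos_bump" using cos_bump_integrable[of "\<lambda>_. 1"] by simp
  have prod: "integrable (lborel \<Otimes>\<^sub>M lborel) (\<lambda>(y, x). cos_bump y * cos_bump (x - y))"
  proof (rule lborel_pair.Fubini_integrable)
    show "(\<lambda>(y, x). cos_bump y * cos_bump (x - y)) \<in> borel_measurable (lborel \<Otimes>\<^sub>M lborel)" by measurable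
    have "(\<integral>x. \<bar>cos_bump y * cos_bump (x - y)\<bar> \<partial>lborel) = \<bar>cos_bump y\<bar> * (\<integral>x. \<bar>cos_bump x\<bar> \<partial>lborel)" for y
      using lborel_integral_real_affine[of 1 "\<lambda>x. \<bar>cos_bump x\<bar>" "- y"] by (simp add: abs_mult)
    then show "integrable lborel (\<lambda>y. \<integral>x. norm (case (y, x) of (y, x) \<Rightarrow> cos_bump y * cos_bump (x - y)) \<partial>lborel)"
      using i1 by simp
    show "AE y in lborel. integrable lborel (\<lambda>x. case (y, x) of (y, x) \<Rightarrow> cos_bump y * cos_bump (x - y))"
      using ci by (intro AE_I2) simp
  qed
  have int: "integrable (lborel \<Otimes>\<^sub>M lborel) (\<lambda>(y, x). ?h x y)"
  proof (rule Bochner_Integration.integrable_bound[OF prod])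
    show "AE p in lborel \<Otimes>\<^sub>M lborel. norm (case p of (y, x) \<Rightarrow> ?h x y) \<le>
        norm (case p of (y, x) \<Rightarrow> cos_bump y * cos_bump (x - y))"
      by (rule AE_I2) (auto simp: abs_mult intro!: mult_left_le)
  qed measurable
  have inner: "(\<integral>x. ?h x y \<partial>lborel) = cos_bump y * (cos (a * y) * c)" for y
  proof -
    have i2: "integrable lborel (\<lambda>x. cos_bump x * cos (a * x))" "integrable lborel (\<lambda>x. cos_bump x * sin (a * x))"
      by (rule cos_bump_integrable; simp)+
    have s0: "(\<integral>x. cos_bump x * sin (a * x) \<partial>lborel) = 0"
      using even_integral_reflect[of "\<lambda>x. cos_bump x * sin (a * x)"] by (simp add: cos_bump_even)
    have "(\<integral>x. ?h x y \<partial>lborel) = (\<integral>x. cos_bump y * cos_bump x * cos (a * (x + y)) \<partial>lborel)"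
      using lborel_integral_real_affine[of 1 "\<lambda>x. ?h x y" y] by (simp add: add.commute)
    also have "\<dots> = (\<integral>x. (cos_bump y * cos (a * y)) * (cos_bump x * cos (a * x)) -
        (cos_bump y * sin (a * y)) * (cos_bump x * sin (a * x)) \<partial>lborel)"
      by (intro Bochner_Integration.integral_cong refl) (simp add: distrib_left cos_add algebra_simps)
    also have "\<dots> = (cos_bump y * cos (a * y)) * c - (cos_bump y * sin (a * y)) * 0"
      unfolding s0[symmetric] c_def using i2 by simp
    finally show ?thesis by simp
  qed
  have "(\<integral>x. odlyzko_g x * cos (a * x) \<partial>lborel) = (\<integral>x. 2 * (\<integral>y. ?h x y \<partial>lborel) \<partial>lborel)"
    unfolding odlyzko_g_def by (intro Bochner_Integration.integral_cong refl) simp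
  also have "\<dots> = 2 * (\<integral>x. \<integral>y. ?h x y \<partial>lborel \<partial>lborel)" by simp
  also have "(\<integral>x. \<integral>y. ?h x y \<partial>lborel \<partial>lborel) = (\<integral>y. \<integral>x. ?h x y \<partial>lborel \<partial>lborel)"
    using lborel_pair.Fubini_integral[OF int] by simp
  also have "\<dots> = (\<integral>y. c * (cos_bump y * cos (a * y)) \<partial>lborel)"
    unfolding inner by (simp add: mult_ac)
  also have "\<dots> = c * c" by (simp add: c_def)
  finally show ?thesis by simp
qed

text \<open>Compact support turns the transform into an integral over \<open>{- l..l}\<close>, where
  differentiation under the integral sign is legitimate. The maximum principle on the strip rests on
  this.\<close>

lemma fourier_odlyzko_F_holomorphic:
  assumes l: "l > 0"
  shows "fourier (odlyzko_F l) holomorphic_on UNIV"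
proof -
  let ?f = "\<lambda>s x. complex_of_real (odlyzko_F l x) * exp (- 2 * \<i> * of_real pi * of_real x * s)"
  have cF: "continuous_on S (\<lambda>x. complex_of_real (odlyzko_F l x))" for S
    by (intro continuous_on_of_real continuous_odlyzko_F)
  have "fourier (odlyzko_F l) s = integral (cbox (- l) l) (?f s)" for s
  proof -
    have "fourier (odlyzko_F l) s = (\<integral>x. indicator {- l..l} x *\<^sub>R ?f s x \<partial>lborel)"
      unfolding fourier_def
    proof (rule Bochner_Integration.integral_cong[OF refl])
      fix x :: real
      show "?f s x = indicator {- l..l} x *\<^sub>R ?f s x"
        using odlyzko_F_support[OF l, of x] by (cases "x \<in> {- l..l}") (auto simp: abs_if)
    qed
    also have "\<dots> = integral {- l..l} (?f s)"
    proof -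
      have "continuous_on {- l..l} (?f s)" by (intro continuous_intros cF)
      then have "set_integrable lborel {- l..l} (?f s)" by (rule borel_integrable_atLeastAtMost')
      from set_borel_integral_eq_integral(2)[OF this] show ?thesis
        by (simp add: set_lebesgue_integral_def)
    qed
    finally show ?thesis by simp
  qed
  moreover have "(\<lambda>s. integral (cbox (- l) l) (?f s)) holomorphic_on UNIV"
  proof (rule leibniz_rule_holomorphic[where fx = "\<lambda>s x. ?f s x * (- 2 * \<i> * of_real pi * of_real x)"])
    fix s x
    show "((\<lambda>s. ?f s x) has_field_derivative ?f s x * (- 2 * \<i> * of_real pi * of_real x)) (at s within UNIV)"
      by (auto intro!: derivative_eq_intros)
    show "(?f s) integrable_on cbox (- l) l"
      by (intro integrable_continuous continuous_intros cF)
  next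
    have "continuous_on (UNIV \<times> cbox (- l) l) (\<lambda>p :: complex \<times> real. odlyzko_F l (snd p))"
      by (rule continuous_on_compose2[OF continuous_odlyzko_F[of UNIV]]) (auto intro!: continuous_intros)
    then show "continuous_on (UNIV \<times> cbox (- l) l) (\<lambda>(s, x). ?f s x * (- 2 * \<i> * of_real pi * of_real x))"
      unfolding case_prod_unfold
      by (intro continuous_intros)
  qed simp
  ultimately show ?thesis by (simp cong: holomorphic_cong)
qed

text \<open>
  On the boundary of the strip the real part is a cosine transform of a convolution square. Adding
  \<open>\<delta> cosh\<close>, whose real part \<open>Re (cos (\<i> z))\<close> grows at both ends of the strip, the maximum principle
  applies on large rectangles.
\<close>

lemma POS_odlyzko_F:
  assumes l: "l > 0"
  shows "POS (odlyzko_F l)"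
  unfolding POS_def
proof (intro allI impI)
  fix s :: complex assume s: "\<bar>Im s\<bar> \<le> 1 / (4 * pi)"
  let ?F = "odlyzko_F l"
  define h where "h = 1 / (4 * pi)"
  \<comment> \<open>Below \<open>pi / 2\<close> the factor \<open>cos (Im z)\<close> stays at least
    \<open>cos h > 0\<close> on the strip, so the auxiliary term is nonnegative there.\<close>
  have h: "0 < h" "h < pi / 2"
  proof -
    show "0 < h" by (simp add: h_def)
    have "1 / (4 * pi) < 1 / 4" using pi_gt3 by (simp add: field_simps)
    then show "h < pi / 2" using pi_gt3 unfolding h_def by linarith
  qed
  have int: "integrable lborel (\<lambda>x. ?F x * exp (\<bar>x\<bar> / 2))"
    using odlyzko_F_exp_integrable[OF l, of "1 / 2"] by simp
  define C where "C = (\<integral>x. \<bar>?F x * exp (\<bar>x\<bar> / 2)\<bar> \<partial>lborel)"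
  have C: "cmod (fourier ?F z) \<le> C" if "\<bar>Im z\<bar> \<le> h" for z
    unfolding C_def using that by (intro Re_fourier(3) int odlyzko_F_measurable) (simp add: h_def)
  have C0: "0 \<le> C" by (rule order_trans[OF norm_ge_zero C[of 0]]) (use h in simp)
  have bdry: "0 \<le> Re (fourier ?F z)" if z: "\<bar>Im z\<bar> = h" for z
  proof -
    have "Re (fourier ?F z) = (\<integral>x. ?F x * cosh (x / 2) * cos (2 * pi * Re z * x) \<partial>lborel)"
      using z by (intro Re_fourier_boundary int odlyzko_F_measurable odlyzko_F_simps) (simp add: h_def)
    also have "\<dots> = (\<integral>x. odlyzko_g (x / l) * cos (2 * pi * Re z * x) \<partial>lborel)"
      by (intro Bochner_Integration.integral_cong refl) (simp add: odlyzko_F_def cosh_real_nonzero)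
    also have "\<dots> = l * (\<integral>x. odlyzko_g x * cos ((2 * pi * Re z * l) * x) \<partial>lborel)"
      using l lborel_integral_real_affine[of l "\<lambda>x. odlyzko_g (x / l) * cos (2 * pi * Re z * x)" 0]
      by (simp add: mult_ac)
    also have "\<dots> \<ge> 0" using l by (intro mult_nonneg_nonneg odlyzko_g_cos_transform) auto
    finally show ?thesis .
  qed
  have Rc: "Re (cos (\<i> * z)) = cosh (Re z) * cos (Im z)" for z
    by (simp add: Re_cos cosh_field_def)
  have main: "0 \<le> Re (fourier ?F s) + \<delta> * (cosh (Re s) * cos (Im s))" if \<delta>: "\<delta> > 0" for \<delta>
  proof -
    have ch: "0 < cos h" using h by (intro cos_gt_zero_pi) auto
    \<comment> \<open>Wide enough that \<open>s\<close> lies inside the rectangle and that on its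
      vertical sides the auxiliary term alone outweighs the uniform bound \<open>C\<close> of the
      transform.\<close>
    define X where "X = \<bar>Re s\<bar> + 1 + 2 * C / (\<delta> * cos h)"
    have "0 \<le> 2 * C / (\<delta> * cos h)" using C0 \<delta> ch by simp
    then have X: "\<bar>Re s\<bar> < X" "0 < X" unfolding X_def by linarith+
    have big: "C \<le> \<delta> * (cosh X * cos h)"
    proof -
      have "2 * C / (\<delta> * cos h) \<le> X" by (simp add: X_def)
      also have "X \<le> exp X" using exp_ge_add_one_self[of X] by linarith
      also have "\<dots> \<le> 2 * cosh X" by (simp add: cosh_field_def)
      finally have "C / (\<delta> * cos h) \<le> cosh X" by simp
      then show ?thesis using \<delta> ch by (simp add: divide_le_eq mult_ac)
    qed
    let ?S = "cbox (Complex (- X) (- h)) (Complex X h)"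
    let ?f = "\<lambda>z. - (fourier ?F z + of_real \<delta> * cos (\<i> * z))"
    have hol: "?f holomorphic_on A" for A
      by (intro holomorphic_intros holomorphic_on_subset[OF fourier_odlyzko_F_holomorphic[OF l]]) auto
    have "Re (?f s) \<le> 0"
    proof (rule maximum_real_frontier[where S = ?S and f = ?f and B = 0])
      show "?f holomorphic_on interior ?S" by (rule hol)
      show "continuous_on (closure ?S) ?f" by (intro holomorphic_on_imp_continuous_on hol)
      show "bounded ?S" by simp
      show "s \<in> ?S" using X s by (auto simp: in_cbox_complex_iff h_def)
      fix z assume "z \<in> frontier ?S"
      then have "z \<in> ?S" "z \<notin> box (Complex (- X) (- h)) (Complex X h)" by (auto simp: frontier_cbox)
      then have z: "\<bar>Re z\<bar> \<le> X" "\<bar>Im z\<bar> \<le> h" and edge: "\<bar>Re z\<bar> = X \<or> \<bar>Im z\<bar> = h"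
        by (auto simp: in_cbox_complex_iff in_box_complex_iff abs_le_iff)
      have cm: "cos h \<le> cos (Im z)"
        using cos_monotone_0_pi_le[of "\<bar>Im z\<bar>" h] z h by simp
      have c0: "0 \<le> cosh (Re z) * cos (Im z)" using cm ch by (intro mult_nonneg_nonneg) auto
      have "0 \<le> Re (fourier ?F z) + \<delta> * (cosh (Re z) * cos (Im z))"
        using edge
      proof
        assume "\<bar>Im z\<bar> = h"
        then show ?thesis using bdry[of z] c0 \<delta> by simp
      next
        assume "\<bar>Re z\<bar> = X"
        then have cx: "cosh (Re z) = cosh X" by (metis cosh_real_abs)
        have "\<delta> * (cosh X * cos h) \<le> \<delta> * (cosh (Re z) * cos (Im z))"
          unfolding cx using \<delta> cm cosh_real_pos[of X] by (intro mult_left_mono) auto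
        then have "C \<le> \<delta> * (cosh (Re z) * cos (Im z))" using big by linarith
        then show ?thesis using C[OF z(2)] abs_Re_le_cmod[of "fourier ?F z"] by linarith
      qed
      then show "Re (?f z) \<le> 0" by (simp add: Rc)
    qed
    then show ?thesis by (simp add: Rc)
  qed
  show "0 \<le> Re (fourier ?F s)"
  proof (rule ccontr)
    assume "\<not> 0 \<le> Re (fourier ?F s)"
    then have neg: "Re (fourier ?F s) < 0" by simp
    define B where "B = cosh (Re s) * cos (Im s)"
    \<comment> \<open>With this choice the auxiliary term at \<open>s\<close> is at most half the
      size of the supposed negative value.\<close>
    define \<delta> where "\<delta> = - Re (fourier ?F s) / (2 * (\<bar>B\<bar> + 1))"
    have d: "\<delta> > 0" unfolding \<delta>_def using neg by (intro divide_pos_pos) auto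
    have "\<delta> * B \<le> \<delta> * (\<bar>B\<bar> + 1)" using d by (intro mult_left_mono) auto
    also have "\<dots> = - Re (fourier ?F s) / 2" by (simp add: \<delta>_def field_simps)
    finally show False using main[OF d] neg unfolding B_def by linarith
  qed
qed

section \<open>Quadratic forms on free abelian groups\<close>

definition additive_map :: "('a, 'm) ring_scheme \<Rightarrow> ('a \<Rightarrow> real) \<Rightarrow> bool" where
  "additive_map R h \<longleftrightarrow> (\<forall>u\<in>carrier R. \<forall>v\<in>carrier R. h (u \<oplus>\<^bsub>R\<^esub> v) = h u + h v)"

context abelian_group
begin

lemma additive_map_zero: "additive_map G h \<Longrightarrow> h \<zero> = 0"
  unfolding additive_map_def using zero_closed l_zero by (metis add_cancel_right_right)

lemma additive_map_minus:
  assumes "additive_map G h" "u \<in> carrier G"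
  shows "h (\<ominus> u) = - h u"
proof -
  have "h (u \<oplus> \<ominus> u) = h u + h (\<ominus> u)"
    using assms by (auto simp: additive_map_def)
  then show ?thesis using assms additive_map_zero[OF assms(1)] by (simp add: r_neg)
qed

lemma additive_map_nat_pow:
  assumes "additive_map G h" "u \<in> carrier G"
  shows "h (add_pow G (k::nat) u) = real k * h u"
proof (induction k)
  case (Suc k)
  have "h (add_pow G (Suc k) u) = h (add_pow G k u \<oplus> u)"
    by (simp add: add.nat_pow_Suc)
  also have "\<dots> = h (add_pow G k u) + h u"
    using assms by (auto simp: additive_map_def)
  finally show ?case by (simp add: Suc algebra_simps)
qed (simp add: additive_map_zero[OF assms(1)])

lemma add_pow_int_closed: "u \<in> carrier G \<Longrightarrow> add_pow G (k::int) u \<in> carrier G"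
  using group.int_pow_closed[OF a_group, of u k] by (simp add: add_pow_def)

lemma add_pow_int_0: "add_pow G (0::int) u = \<zero>"
  using int_pow_0[of "add_monoid G" u] by (simp add: add_pow_def)

lemma add_pow_int_add:
  "u \<in> carrier G \<Longrightarrow> add_pow G (i + j :: int) u = add_pow G i u \<oplus> add_pow G j u"
  using group.int_pow_mult[OF a_group, of u i j] by (simp add: add_pow_def)

lemma additive_map_int_pow:
  assumes "additive_map G h" "u \<in> carrier G"
  shows "h (add_pow G (k::int) u) = of_int k * h u"
proof (cases "k \<ge> 0")
  case True
  then show ?thesis
    using additive_map_nat_pow[OF assms, of "nat k"] by (simp add: add_pow_int_ge)
next
  case False
  then show ?thesis
    using additive_map_minus[OF assms(1), of "add_pow G (nat (- k)) u"]
      additive_map_nat_pow[OF assms, of "nat (- k)"] assms(2)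
    by (simp add: add_pow_int_lt)
qed

lemma additive_map_finsum:
  assumes h: "additive_map G h" and f: "f \<in> S \<rightarrow> carrier G"
  shows "finite S \<Longrightarrow> h (finsum G f S) = (\<Sum>s\<in>S. h (f s))"
proof -
  assume "finite S"
  then show ?thesis using f
  proof (induction S rule: finite_induct)
    case (insert x F)
    then have "h (f x \<oplus> finsum G f F) = h (f x) + h (finsum G f F)"
      using h by (auto simp: additive_map_def)
    then show ?case using insert by (simp add: Pi_def)
  qed (simp add: additive_map_zero[OF h])
qed

end

lemma symmetrized_sum:
  fixes x :: "'b \<Rightarrow> real"
  shows "(\<Sum>s\<in>S. \<Sum>t\<in>S. x s * x t * ((b s t + b t s) / 2)) = (\<Sum>s\<in>S. \<Sum>t\<in>S. x s * x t * b s t)"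
proof -
  have "(\<Sum>s\<in>S. \<Sum>t\<in>S. x s * x t * ((b s t + b t s) / 2)) =
      (\<Sum>s\<in>S. \<Sum>t\<in>S. x s * x t * b s t) / 2 + (\<Sum>s\<in>S. \<Sum>t\<in>S. x s * x t * b t s) / 2"
    by (simp add: sum_divide_distrib algebra_simps add_divide_distrib flip: sum.distrib)
  also have "(\<Sum>s\<in>S. \<Sum>t\<in>S. x s * x t * b t s) = (\<Sum>s\<in>S. \<Sum>t\<in>S. x s * x t * b s t)"
    by (subst sum.swap) (simp add: mult_ac)
  finally show ?thesis by simp
qed

text \<open>Additive real functionals that interpolate arbitrary values on the \<open>e i\<close>
  stand in for a structure theorem: they witness independence over the integers and over the reals
  at the same time.\<close>

locale separated_family = abelian_group R for R (structure) +
  fixes e :: "nat \<Rightarrow> 'a" and n :: nat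
  assumes e_carrier: "i < n \<Longrightarrow> e i \<in> carrier R"
    and separated: "\<exists>h. additive_map R h \<and> (\<forall>i<n. h (e i) = f i)"
begin

definition comb :: "(nat \<Rightarrow> int) \<Rightarrow> 'a" where
  "comb c = finsum R (\<lambda>i. add_pow R (c i) (e i)) {..<n}"

lemma comb_closed: "comb c \<in> carrier R"
  unfolding comb_def using e_carrier by (intro finsum_closed) (auto intro: add_pow_int_closed)

lemma e_inj: "inj_on e {..<n}"
proof (rule inj_onI, rule ccontr)
  fix i j assume ij: "i \<in> {..<n}" "j \<in> {..<n}" "e i = e j" "i \<noteq> j"
  obtain h where h: "\<forall>k<n. h (e k) = (if k = i then 1 else 0 :: real)"
    using separated[of "\<lambda>k. if k = i then 1 else 0"] by auto
  have "h (e i) = 1" using h ij(1) by simp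
  moreover have "h (e j) = 0" using h ij(2,4) by simp
  ultimately show False using ij(3) by simp
qed

lemma additive_map_comb: "additive_map R h \<Longrightarrow> h (comb c) = (\<Sum>i<n. of_int (c i) * h (e i))"
  unfolding comb_def using e_carrier
  by (subst additive_map_finsum) (auto simp: additive_map_int_pow add_pow_int_closed)

abbreviation span :: "'a set" where
  "span \<equiv> generate (add_monoid R) (e ` {..<n})"

lemma comb_add: "comb (\<lambda>i. c i + d i) = comb c \<oplus> comb d"
proof -
  have "comb (\<lambda>i. c i + d i) = finsum R (\<lambda>i. add_pow R (c i) (e i) \<oplus> add_pow R (d i) (e i)) {..<n}"
    unfolding comb_def using e_carrier
    by (intro finsum_cong') (auto simp: add_pow_int_add add_pow_int_closed)
  also have "\<dots> = comb c \<oplus> comb d"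
    unfolding comb_def using e_carrier by (intro finsum_addf) (auto intro: add_pow_int_closed)
  finally show ?thesis .
qed

lemma comb_minus: "comb (\<lambda>i. - c i) = \<ominus> comb c"
proof -
  have "comb (\<lambda>i. - c i) \<oplus> comb c = comb (\<lambda>i. 0)"
    by (simp flip: comb_add)
  also have "\<dots> = \<zero>" by (simp add: comb_def add_pow_int_0)
  finally show ?thesis using comb_closed by (metis minus_equality)
qed

lemma comb_delta:
  assumes "j < n"
  shows "comb (\<lambda>i. if i = j then 1 else 0) = e j"
proof -
  have "comb (\<lambda>i. if i = j then 1 else 0) = finsum R (\<lambda>i. if j = i then e i else \<zero>) {..<n}"
    unfolding comb_def using e_carrier by (intro finsum_cong') (auto simp: add_pow_int_0)
  also have "\<dots> = e j"
    using assms e_carrier by (subst finsum_singleton) auto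
  finally show ?thesis .
qed

lemma span_comb: "u \<in> span \<Longrightarrow> \<exists>c. u = comb c"
proof (induction rule: generate.induct)
  case one
  have "comb (\<lambda>i. 0) = \<zero>" by (simp add: comb_def add_pow_int_0)
  then show ?case by (metis monoid.select_convs(2))
next
  case (incl u)
  then show ?case using comb_delta by (metis imageE lessThan_iff)
next
  case (inv u)
  then obtain j where j: "j < n" "u = e j" by auto
  have "inv\<^bsub>add_monoid R\<^esub> u = \<ominus> u" by (simp add: a_inv_def)
  then show ?case using comb_minus comb_delta[OF j(1)] j(2) by metis
next
  case (eng u v)
  then show ?case using comb_add by (metis monoid.select_convs(1))
qed

lemma span_closed: "u \<in> span \<Longrightarrow> u \<in> carrier R"
  using span_comb comb_closed by metis

lemma comb_span: "comb c \<in> span"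
proof -
  have sub: "subgroup span (add_monoid R)"
    using e_carrier by (intro add.generate_is_subgroup) auto
  have "finsum R (\<lambda>i. add_pow R (c i) (e i)) S \<in> span" if "finite S" "S \<subseteq> {..<n}" for S
    using that
  proof (induction S rule: finite_induct)
    case empty
    then show ?case using generate.one[of "add_monoid R"] by simp
  next
    case (insert x F)
    have "e x \<in> span" using insert by (intro generate.incl) auto
    then have "pow (add_monoid R) (e x) (c x) \<in> span"
      by (rule group.subgroup_int_pow_closed[OF a_group sub])
    then have "add_pow R (c x) (e x) \<in> span" by (simp add: add_pow_def)
    moreover have "finsum R (\<lambda>i. add_pow R (c i) (e i)) (insert x F) =
        add_pow R (c x) (e x) \<oplus> finsum R (\<lambda>i. add_pow R (c i) (e i)) F"
      using insert e_carrier by (subst finsum_insert) (auto intro: add_pow_int_closed)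
    ultimately show ?case
      using generate.eng[of "add_pow R (c x) (e x)" "add_monoid R" "e ` {..<n}"
          "finsum R (\<lambda>i. add_pow R (c i) (e i)) F"] insert by simp
  qed
  from this[of "{..<n}"] show ?thesis by (simp add: comb_def)
qed

text \<open>Coordinates are read off by the functional that is 1 at \<open>e j\<close> and 0 at the
  other generators, which gives their uniqueness.\<close>

lemma Z_basis_span: "Z_basis R span (e ` {..<n})"
  unfolding Z_basis_def
proof (intro conjI ballI)
  show "e ` {..<n} \<subseteq> span" by (auto intro: generate.incl)
  fix a assume "a \<in> span"
  then obtain c where c: "a = comb c" using span_comb by blast
  let ?S = "e ` {..<n}"
  let ?P = "\<lambda>c'. c' \<in> ?S \<rightarrow>\<^sub>E (UNIV :: int set) \<and> a = finsum R (\<lambda>s. add_pow R (c' s) s) ?S"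
  have comb_eq: "finsum R (\<lambda>s. add_pow R (c' s) s) ?S = comb (\<lambda>i. c' (e i))" for c' :: "'a \<Rightarrow> int"
    unfolding comb_def using e_carrier by (subst finsum_reindex[OF _ e_inj]) (auto intro: add_pow_int_closed)
  define c0 where "c0 = restrict (\<lambda>s. c (inv_into {..<n} e s)) ?S"
  have "comb (\<lambda>i. c0 (e i)) = a"
    unfolding comb_def c c0_def using e_carrier e_inj
    by (intro finsum_cong') (auto simp: inv_into_f_f add_pow_int_closed)
  then have P0: "?P c0"
    unfolding comb_eq by (auto simp: c0_def)
  show "\<exists>!c'. ?P c'"
  proof (rule ex1I)
    show "?P c0" by (rule P0)
    fix c' assume P: "?P c'"
    show "c' = c0"
    proof (rule PiE_ext[where k = "?S" and s = "\<lambda>_. UNIV"])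
      fix s assume "s \<in> ?S"
      then obtain j where j: "j < n" "s = e j" by auto
      obtain h where h: "additive_map R h" "\<forall>i<n. h (e i) = (if i = j then 1 else 0 :: real)"
        using separated[of "\<lambda>i. if i = j then 1 else 0"] by auto
      have val: "h (comb d) = of_int (d j)" for d
      proof -
        have "h (comb d) = (\<Sum>i<n. of_int (d i) * (if i = j then 1 else 0))"
          unfolding additive_map_comb[OF h(1)] using h(2) by (intro sum.cong) auto
        also have "\<dots> = of_int (d j)" using j(1) by (simp add: if_distrib cong: if_cong)
        finally show ?thesis .
      qed
      have "comb (\<lambda>i. c' (e i)) = comb (\<lambda>i. c0 (e i))" using P P0 comb_eq by metis
      then show "c' s = c0 s" using val[of "\<lambda>i. c' (e i)"] val[of "\<lambda>i. c0 (e i)"] j(2) by simp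
    qed (use P P0 in auto)
  qed
qed simp

end

locale biadditive_form = separated_family R e n for R (structure) and e and n +
  fixes B :: "'a \<Rightarrow> 'a \<Rightarrow> real"
  assumes B_left: "w \<in> carrier R \<Longrightarrow> additive_map R (\<lambda>u. B u w)"
    and B_right: "w \<in> carrier R \<Longrightarrow> additive_map R (B w)"
begin

lemma B_comb: "B (comb c) (comb c) = (\<Sum>i<n. \<Sum>j<n. of_int (c i) * of_int (c j) * B (e i) (e j))"
proof -
  have "B (comb c) (comb c) = (\<Sum>i<n. of_int (c i) * B (e i) (comb c))"
    by (rule additive_map_comb[OF B_left[OF comb_closed]])
  also have "\<dots> = (\<Sum>i<n. of_int (c i) * (\<Sum>j<n. of_int (c j) * B (e i) (e j)))"
    using e_carrier by (intro sum.cong refl) (simp add: additive_map_comb[OF B_right])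
  finally show ?thesis by (simp add: sum_distrib_left mult_ac)
qed

lemma polar_form_B:
  assumes q: "\<And>u. u \<in> carrier R \<Longrightarrow> q u = B u u" and "u \<in> carrier R" "v \<in> carrier R"
  shows "polar_form R q u v = (B u v + B v u) / 2"
proof -
  have "B (u \<oplus> v) (u \<oplus> v) = B u (u \<oplus> v) + B v (u \<oplus> v)"
    using B_left[of "u \<oplus> v"] assms by (simp add: additive_map_def)
  also have "\<dots> = B u u + B u v + (B v u + B v v)"
    using B_right[of u] B_right[of v] assms by (simp add: additive_map_def)
  finally show ?thesis
    using assms by (simp add: polar_form_def)
qed

text \<open>In one direction the generators themselves serve as the basis. In the other the basis
  \<open>S\<close> is whatever the definition supplies, and a real vector is carried to its
  coordinates in \<open>S\<close>. The polar form is the symmetric part of \<open>B\<close>, which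
  leaves the double sums unchanged.\<close>

lemma positive_definite_on_iff:
  assumes q: "\<And>u. u \<in> carrier R \<Longrightarrow> q u = B u u"
  shows "positive_definite_on R span q \<longleftrightarrow>
    (\<forall>x :: nat \<Rightarrow> real. (\<exists>i<n. x i \<noteq> 0) \<longrightarrow> 0 < (\<Sum>i<n. \<Sum>j<n. x i * x j * B (e i) (e j)))"
proof
  assume pos: "\<forall>x :: nat \<Rightarrow> real. (\<exists>i<n. x i \<noteq> 0) \<longrightarrow> 0 < (\<Sum>i<n. \<Sum>j<n. x i * x j * B (e i) (e j))"
  show "positive_definite_on R span q"
    unfolding positive_definite_on_def
  proof (intro exI[of _ "e ` {..<n}"] conjI allI impI Z_basis_span)
    fix x :: "'a \<Rightarrow> real" assume "\<exists>s\<in>e ` {..<n}. x s \<noteq> 0"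
    then have "0 < (\<Sum>i<n. \<Sum>j<n. x (e i) * x (e j) * B (e i) (e j))"
      using pos[rule_format, of "\<lambda>i. x (e i)"] by auto
    also have "\<dots> = (\<Sum>i<n. \<Sum>j<n. x (e i) * x (e j) * ((B (e i) (e j) + B (e j) (e i)) / 2))"
      by (rule symmetrized_sum[where b = "\<lambda>i j. B (e i) (e j)" and x = "\<lambda>i. x (e i)", symmetric])
    also have "\<dots> = (\<Sum>i<n. \<Sum>j<n. x (e i) * x (e j) * polar_form R q (e i) (e j))"
      using e_carrier by (intro sum.cong refl) (simp add: polar_form_B[OF q])
    finally show "0 < (\<Sum>s\<in>e ` {..<n}. \<Sum>t\<in>e ` {..<n}. x s * x t * polar_form R q s t)"
      by (simp add: sum.reindex[OF e_inj])
  qed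
next
  assume "positive_definite_on R span q"
  then obtain S where S: "Z_basis R span S"
    and pos: "\<And>x :: 'a \<Rightarrow> real. \<exists>s\<in>S. x s \<noteq> 0 \<Longrightarrow> 0 < (\<Sum>s\<in>S. \<Sum>t\<in>S. x s * x t * polar_form R q s t)"
    unfolding positive_definite_on_def by blast
  have fin: "finite S" and Sc: "S \<subseteq> carrier R"
    using S span_closed by (auto simp: Z_basis_def)
  have "\<forall>i\<in>{..<n}. \<exists>c :: 'a \<Rightarrow> int. e i = finsum R (\<lambda>s. add_pow R (c s) s) S"
  proof
    fix i assume "i \<in> {..<n}"
    then have "e i \<in> span" by (auto intro: generate.incl)
    then show "\<exists>c :: 'a \<Rightarrow> int. e i = finsum R (\<lambda>s. add_pow R (c s) s) S"
      using S unfolding Z_basis_def by blast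
  qed
  then obtain c :: "nat \<Rightarrow> 'a \<Rightarrow> int" where c: "\<And>i. i < n \<Longrightarrow> e i = finsum R (\<lambda>s. add_pow R (c i s) s) S"
    using bchoice[of "{..<n}" "\<lambda>i c. e i = finsum R (\<lambda>s. add_pow R (c s) s) S"] by auto
  have he: "h (e i) = (\<Sum>s\<in>S. of_int (c i s) * h s)" if "additive_map R h" "i < n" for h i
    using that Sc fin by (simp add: c additive_map_finsum Pi_def subset_iff additive_map_int_pow add_pow_int_closed)
  show "\<forall>x :: nat \<Rightarrow> real. (\<exists>i<n. x i \<noteq> 0) \<longrightarrow> 0 < (\<Sum>i<n. \<Sum>j<n. x i * x j * B (e i) (e j))"
  proof (intro allI impI)
    fix x :: "nat \<Rightarrow> real" assume "\<exists>i<n. x i \<noteq> 0"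
    then obtain k where k: "k < n" "x k \<noteq> 0" by blast
    \<comment> \<open>The coordinates in \<open>S\<close> of the combination of the
      \<open>e i\<close> with real weights \<open>x i\<close>, an element of the tensor product with
      the reals only; \<open>lin\<close> expresses this change of basis through additive
      maps.\<close>
    define y where "y s = (\<Sum>i<n. x i * of_int (c i s))" for s
    have lin: "(\<Sum>i<n. x i * h (e i)) = (\<Sum>s\<in>S. y s * h s)" if h: "additive_map R h" for h
    proof -
      have "(\<Sum>i<n. x i * h (e i)) = (\<Sum>i<n. \<Sum>s\<in>S. x i * (of_int (c i s) * h s))"
        by (intro sum.cong refl) (simp add: he[OF h] sum_distrib_left)
      also have "\<dots> = (\<Sum>s\<in>S. y s * h s)"
        by (subst sum.swap) (simp add: y_def sum_distrib_right mult.assoc)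
      finally show ?thesis .
    qed
    have "\<exists>s\<in>S. y s \<noteq> 0"
    proof (rule ccontr)
      assume "\<not> (\<exists>s\<in>S. y s \<noteq> 0)"
      then have y0: "\<And>s. s \<in> S \<Longrightarrow> y s = 0" by auto
      \<comment> \<open>The functional with the values \<open>x i\<close> sends the combination to
        the sum of the squares of the \<open>x i\<close>, so that the change of basis is
        injective.\<close>
      obtain h where h: "additive_map R h" "\<forall>i<n. h (e i) = x i"
        using separated[of x] by auto
      have "(\<Sum>i<n. x i * x i) = (\<Sum>i<n. x i * h (e i))" using h(2) by simp
      also have "\<dots> = 0" using lin[OF h(1)] y0 by simp
      finally have "\<forall>i\<in>{..<n}. x i * x i = 0"
        by (subst (asm) sum_nonneg_eq_0_iff) auto
      then show False using k by auto
    qed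
    from pos[OF this]
    have "0 < (\<Sum>s\<in>S. \<Sum>t\<in>S. y s * y t * ((B s t + B t s) / 2))"
      using Sc by (simp add: polar_form_B[OF q] subset_iff)
    also have "\<dots> = (\<Sum>s\<in>S. \<Sum>t\<in>S. y s * y t * B s t)"
      by (rule symmetrized_sum[where b = B])
    also have "\<dots> = (\<Sum>s\<in>S. y s * (\<Sum>t\<in>S. y t * B s t))"
      by (simp add: sum_distrib_left mult.assoc)
    also have "\<dots> = (\<Sum>s\<in>S. y s * (\<Sum>j<n. x j * B s (e j)))"
      using Sc by (intro sum.cong refl) (simp add: lin[OF B_right] subset_iff)
    also have "\<dots> = (\<Sum>j<n. x j * (\<Sum>s\<in>S. y s * B s (e j)))"
      unfolding sum_distrib_left by (subst sum.swap) (simp add: mult_ac)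
    also have "\<dots> = (\<Sum>j<n. x j * (\<Sum>i<n. x i * B (e i) (e j)))"
      using e_carrier by (intro sum.cong refl) (simp add: lin[OF B_left])
    also have "\<dots> = (\<Sum>i<n. \<Sum>j<n. x i * x j * B (e i) (e j))"
      unfolding sum_distrib_left by (subst sum.swap) (simp add: mult_ac)
    finally show "0 < (\<Sum>i<n. \<Sum>j<n. x i * x j * B (e i) (e j))" .
  qed
qed

end

section \<open>Representations of the Weil groups\<close>

lemma weil_carrier: "(b, z) \<in> carrier (weil_group E) \<longleftrightarrow> z \<noteq> 0 \<and> (b \<longrightarrow> E = Real_field)"
  by (simp add: weil_group_def)

lemma weil_mult: "(a, z) \<otimes>\<^bsub>weil_group E\<^esub> (b, w) =
    (a \<noteq> b, (if a \<and> b then - 1 else 1) * (if b then cnj z else z) * w)"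
  by (simp add: weil_group_def)

lemma weil_one: "\<one>\<^bsub>weil_group E\<^esub> = (False, 1)"
  by (simp add: weil_group_def)

lemma weil_group_group: "group (weil_group E)"
proof (rule groupI)
  fix x y assume "x \<in> carrier (weil_group E)" "y \<in> carrier (weil_group E)"
  then show "x \<otimes>\<^bsub>weil_group E\<^esub> y \<in> carrier (weil_group E)"
    by (cases x; cases y) (auto simp: weil_carrier weil_mult)
next
  show "\<one>\<^bsub>weil_group E\<^esub> \<in> carrier (weil_group E)"
    by (simp add: weil_one weil_carrier)
next
  fix x y z
  show "x \<otimes>\<^bsub>weil_group E\<^esub> y \<otimes>\<^bsub>weil_group E\<^esub> z = x \<otimes>\<^bsub>weil_group E\<^esub> (y \<otimes>\<^bsub>weil_group E\<^esub> z)"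
    by (cases x; cases y; cases z) (auto simp: weil_mult)
next
  fix x
  show "\<one>\<^bsub>weil_group E\<^esub> \<otimes>\<^bsub>weil_group E\<^esub> x = x"
    by (cases x) (auto simp: weil_mult weil_one)
next
  fix x assume x: "x \<in> carrier (weil_group E)"
  obtain b z where [simp]: "x = (b, z)" by (cases x)
  show "\<exists>y\<in>carrier (weil_group E). y \<otimes>\<^bsub>weil_group E\<^esub> x = \<one>\<^bsub>weil_group E\<^esub>"
    using x by (intro bexI[of _ "(b, if b then - inverse (cnj z) else inverse z)"])
      (auto simp: weil_mult weil_one weil_carrier)
qed

lemma weil_inv:
  assumes "(b, z) \<in> carrier (weil_group E)"
  shows "inv\<^bsub>weil_group E\<^esub> (b, z) = (b, if b then - inverse (cnj z) else inverse z)"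
proof -
  let ?y = "(b, if b then - inverse (cnj z) else inverse z)"
  have "?y \<otimes>\<^bsub>weil_group E\<^esub> (b, z) = \<one>\<^bsub>weil_group E\<^esub>" "?y \<in> carrier (weil_group E)"
    using assms by (cases b; simp add: weil_mult weil_one weil_carrier)+
  then show ?thesis
    using group.inv_equality[OF weil_group_group _ assms] by blast
qed

lemma is_rep_carrier: "is_rep E n \<rho> \<Longrightarrow> g \<in> carrier (weil_group E) \<Longrightarrow> \<rho> g \<in> carrier_mat n n"
  by (simp add: is_rep_def)

lemma weil_one_carrier: "(False, 1) \<in> carrier (weil_group E)"
  by (simp add: weil_carrier)

lemma rep_one: "is_rep E n \<rho> \<Longrightarrow> \<rho> (False, 1) = 1\<^sub>m n"
  by (simp add: is_rep_def weil_one)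

lemma rep_dim_eq: "is_rep E n \<rho> \<Longrightarrow> rep_dim \<rho> = n"
  by (simp add: rep_dim_def rep_one)

lemma is_rep_rep_dim: "\<rho> \<in> reps E \<Longrightarrow> is_rep E (rep_dim \<rho>) \<rho>"
  by (auto simp: reps_def rep_dim_eq)

lemma repsI: "is_rep E n \<rho> \<Longrightarrow> \<rho> \<in> reps E"
  by (auto simp: reps_def)

lemma continuous_on_weil:
  fixes h :: "weil \<Rightarrow> 'b::topological_space"
  assumes "continuous_on (- {0}) (\<lambda>z. h (False, z))"
    and "E = Real_field \<Longrightarrow> continuous_on (- {0}) (\<lambda>z. h (True, z))"
  shows "continuous_on (carrier (weil_group E)) h"
proof -
  have c: "continuous_on ({b} \<times> (- {0})) h" if "continuous_on (- {0}) (\<lambda>z. h (b, z))" for b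
  proof -
    have "continuous_on ({b} \<times> (- {0::complex})) ((\<lambda>z. h (b, z)) \<circ> snd)"
      by (rule continuous_on_compose)
        (auto intro: continuous_intros continuous_on_subset[OF that])
    then show ?thesis
      by (rule continuous_on_eq) auto
  qed
  have op: "open ({b} \<times> (- {0::complex}))" for b :: bool
    by (rule open_Times) (auto intro: discrete_topology_class.open_discrete)
  show ?thesis
  proof (cases "E = Real_field")
    case True
    have "carrier (weil_group E) = ({False} \<times> (- {0})) \<union> ({True} \<times> (- {0}))"
      using True by (auto simp: weil_carrier)
    then show ?thesis
      using continuous_on_open_Un[OF op op c[OF assms(1)] c[OF assms(2)[OF True]]] by simp
  next
    case False
    have "carrier (weil_group E) = ({False} \<times> (- {0}))"
      using False by (auto simp: weil_carrier)
    then show ?thesis using c[OF assms(1)] by simp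
  qed
qed

section \<open>Exact sequences and traces\<close>

definition mat_tr :: "complex mat \<Rightarrow> complex" where
  "mat_tr A = (\<Sum>i<dim_row A. A $$ (i, i))"

lemma mat_tr_mult_commute:
  assumes "A \<in> carrier_mat n m" "B \<in> carrier_mat m n"
  shows "mat_tr (A * B) = mat_tr (B * A)"
proof -
  have "mat_tr (A * B) = (\<Sum>i<n. \<Sum>j<m. A $$ (i, j) * B $$ (j, i))"
    using assms by (simp add: mat_tr_def scalar_prod_def atLeast0LessThan)
  also have "\<dots> = (\<Sum>j<m. \<Sum>i<n. B $$ (j, i) * A $$ (i, j))"
    by (subst sum.swap) (simp add: mult.commute)
  also have "\<dots> = mat_tr (B * A)"
    using assms by (simp add: mat_tr_def scalar_prod_def atLeast0LessThan)
  finally show ?thesis .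
qed

lemma mat_tr_add:
  "A \<in> carrier_mat n n \<Longrightarrow> B \<in> carrier_mat n n \<Longrightarrow> mat_tr (A + B) = mat_tr A + mat_tr B"
  by (simp add: mat_tr_def sum.distrib)

lemma mat_eq_by_vec:
  fixes A B :: "complex mat"
  assumes "A \<in> carrier_mat n m" "B \<in> carrier_mat n m"
    and "\<And>j. j < m \<Longrightarrow> A *\<^sub>v unit_vec m j = B *\<^sub>v unit_vec m j"
  shows "A = B"
proof (rule eq_matI)
  fix i j assume "i < dim_row B" "j < dim_col B"
  then have ij: "i < n" "j < m" using assms by auto
  have "(A *\<^sub>v unit_vec m j) $ i = A $$ (i, j)" "(B *\<^sub>v unit_vec m j) $ i = B $$ (i, j)"
    using assms(1,2) ij by auto
  with assms(3)[OF ij(2)] show "A $$ (i, j) = B $$ (i, j)" by simp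
qed (use assms in auto)

lemma mat_solve:
  fixes A C :: "complex mat"
  assumes A: "A \<in> carrier_mat n m" and C: "C \<in> carrier_mat n k"
    and im: "\<And>j. j < k \<Longrightarrow> C *\<^sub>v unit_vec k j \<in> (\<lambda>v. A *\<^sub>v v) ` carrier_vec m"
  shows "\<exists>X\<in>carrier_mat m k. A * X = C"
proof -
  have "\<forall>j\<in>{..<k}. \<exists>v\<in>carrier_vec m. A *\<^sub>v v = C *\<^sub>v unit_vec k j"
    using im by fastforce
  then obtain f where f: "\<And>j. j < k \<Longrightarrow> f j \<in> carrier_vec m \<and> A *\<^sub>v f j = C *\<^sub>v unit_vec k j"
    using bchoice[of "{..<k}" "\<lambda>j v. v \<in> carrier_vec m \<and> A *\<^sub>v v = C *\<^sub>v unit_vec k j"]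
    by auto
  define X where "X = Matrix.mat m k (\<lambda>(i, j). f j $ i)"
  have X: "X \<in> carrier_mat m k" by (simp add: X_def)
  have "A * X = C"
  proof (rule mat_eq_by_vec[of _ n k])
    fix j assume j: "j < k"
    have "X *\<^sub>v unit_vec k j = f j"
      using f[OF j] j by (intro eq_vecI) (auto simp: X_def)
    then show "(A * X) *\<^sub>v unit_vec k j = C *\<^sub>v unit_vec k j"
      using f[OF j] by (simp add: assoc_mult_mat_vec[OF A X])
  qed (use A C X in auto)
  with X show ?thesis by blast
qed

text \<open>A short exact sequence together with a splitting of vector spaces: the retraction
  \<open>R\<close> and the section \<open>S\<close> are not asked to commute with the group. In this
  form exactness is a list of matrix identities, which survive Kronecker products and
  transposition.\<close>

definition split_exact :: "arch_field \<Rightarrow> weil_rep \<Rightarrow> weil_rep \<Rightarrow> weil_rep \<Rightarrow> nat \<Rightarrow> nat \<Rightarrow> nat \<Rightarrow>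
    complex mat \<Rightarrow> complex mat \<Rightarrow> complex mat \<Rightarrow> complex mat \<Rightarrow> bool" where
  "split_exact E \<rho>' \<rho> \<rho>'' m n k A R B S \<longleftrightarrow>
     A \<in> carrier_mat n m \<and> R \<in> carrier_mat m n \<and> B \<in> carrier_mat k n \<and> S \<in> carrier_mat n k \<and>
     is_rep E m \<rho>' \<and> is_rep E n \<rho> \<and> is_rep E k \<rho>'' \<and>
     (\<forall>g\<in>carrier (weil_group E). A * \<rho>' g = \<rho> g * A \<and> B * \<rho> g = \<rho>'' g * B) \<and>
     R * A = 1\<^sub>m m \<and> B * S = 1\<^sub>m k \<and> B * A = 0\<^sub>m k m \<and> A * R + S * B = 1\<^sub>m n"

lemma split_exact_imp:
  assumes "split_exact E \<rho>' \<rho> \<rho>'' m n k A R B S"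
  shows "short_exact E \<rho>' \<rho> \<rho>''"
proof -
  have c: "A \<in> carrier_mat n m" "R \<in> carrier_mat m n" "B \<in> carrier_mat k n" "S \<in> carrier_mat n k"
    and e: "R * A = 1\<^sub>m m" "B * S = 1\<^sub>m k" "B * A = 0\<^sub>m k m" "A * R + S * B = 1\<^sub>m n"
    using assms by (auto simp: split_exact_def)
  have inj: "inj_on (\<lambda>v. A *\<^sub>v v) (carrier_vec m)"
  proof (rule inj_onI)
    fix u v :: "complex Matrix.vec" assume *: "u \<in> carrier_vec m" "v \<in> carrier_vec m" "A *\<^sub>v u = A *\<^sub>v v"
    have "R * A *\<^sub>v u = R * A *\<^sub>v v"
      using * assoc_mult_mat_vec[OF c(2,1)] by simp
    then show "u = v" using * e(1) by simp
  qed
  have im: "(\<lambda>v. A *\<^sub>v v) ` carrier_vec m = {v \<in> carrier_vec n. B *\<^sub>v v = 0\<^sub>v k}"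
  proof (intro equalityI subsetI)
    fix v assume "v \<in> (\<lambda>v. A *\<^sub>v v) ` carrier_vec m"
    then obtain u where u: "u \<in> carrier_vec m" "v = A *\<^sub>v u" by auto
    have "B *\<^sub>v v = B * A *\<^sub>v u" using u assoc_mult_mat_vec[OF c(3,1)] by simp
    also have "\<dots> = 0\<^sub>v k" unfolding e(3) using u by (intro eq_vecI) auto
    finally show "v \<in> {v \<in> carrier_vec n. B *\<^sub>v v = 0\<^sub>v k}"
      using u c by auto
  next
    fix v assume v: "v \<in> {v \<in> carrier_vec n. B *\<^sub>v v = 0\<^sub>v k}"
    have "v = (A * R + S * B) *\<^sub>v v" using v e(4) by simp
    also have "\<dots> = A * R *\<^sub>v v + S * B *\<^sub>v v"
      using v c by (intro add_mult_distrib_mat_vec[of _ n n]) auto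
    also have "S * B *\<^sub>v v = S *\<^sub>v 0\<^sub>v k" using v assoc_mult_mat_vec[OF c(4,3)] by simp
    also have "\<dots> = 0\<^sub>v n" using c by (intro eq_vecI) auto
    also have "A * R *\<^sub>v v = A *\<^sub>v (R *\<^sub>v v)" using v c by simp
    finally have "v = A *\<^sub>v (R *\<^sub>v v)" using c v by auto
    then show "v \<in> (\<lambda>v. A *\<^sub>v v) ` carrier_vec m" using c v by auto
  qed
  have sur: "(\<lambda>v. B *\<^sub>v v) ` carrier_vec n = carrier_vec k"
  proof (intro equalityI subsetI)
    fix v assume v: "v \<in> (carrier_vec k :: complex Matrix.vec set)"
    have "v = B * S *\<^sub>v v" using v e(2) by simp
    also have "\<dots> = B *\<^sub>v (S *\<^sub>v v)" using v c by simp
    finally show "v \<in> (\<lambda>v. B *\<^sub>v v) ` carrier_vec n" using c v by auto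
  qed (use c in auto)
  have "is_rep E m \<rho>' \<and> is_rep E n \<rho> \<and> is_rep E k \<rho>''"
    and eq: "\<forall>g\<in>carrier (weil_group E). A * \<rho>' g = \<rho> g * A \<and> B * \<rho> g = \<rho>'' g * B"
    using assms unfolding split_exact_def by blast+
  then show ?thesis
    unfolding short_exact_def
    using eq inj im sur c(1,3) by blast
qed

text \<open>Surjectivity of \<open>B\<close> gives \<open>S\<close>. The columns of
  \<open>1 - S * B\<close> are killed by \<open>B\<close>, hence lie in the image of
  \<open>A\<close>, which yields \<open>R\<close>; then \<open>R * A = 1\<close> follows by
  cancelling the injective \<open>A\<close>.\<close>

lemma short_exact_split:
  assumes "short_exact E \<rho>' \<rho> \<rho>''"
  obtains m n k A R B S where "split_exact E \<rho>' \<rho> \<rho>'' m n k A R B S"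
proof -
  obtain m n k A B where *: "A \<in> carrier_mat n m" "B \<in> carrier_mat k n"
     "is_rep E m \<rho>' \<and> is_rep E n \<rho> \<and> is_rep E k \<rho>'' \<and>
        (\<forall>g\<in>carrier (weil_group E). A * \<rho>' g = \<rho> g * A \<and> B * \<rho> g = \<rho>'' g * B) \<and>
        inj_on (\<lambda>v. A *\<^sub>v v) (carrier_vec m) \<and>
        (\<lambda>v. A *\<^sub>v v) ` carrier_vec m = {v \<in> carrier_vec n. B *\<^sub>v v = 0\<^sub>v k} \<and>
        (\<lambda>v. B *\<^sub>v v) ` carrier_vec n = carrier_vec k"
    using assms unfolding short_exact_def by (elim exE bexE) (rule that)
  note c = *(1,2)
  from *(3) have r: "is_rep E m \<rho>'" "is_rep E n \<rho>" "is_rep E k \<rho>''"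
    and eq: "\<forall>g\<in>carrier (weil_group E). A * \<rho>' g = \<rho> g * A \<and> B * \<rho> g = \<rho>'' g * B"
    and inj: "inj_on (\<lambda>v. A *\<^sub>v v) (carrier_vec m)"
    and im: "(\<lambda>v. A *\<^sub>v v) ` carrier_vec m = {v \<in> carrier_vec n. B *\<^sub>v v = 0\<^sub>v k}"
    and sur: "(\<lambda>v. B *\<^sub>v v) ` carrier_vec n = carrier_vec k"
    by auto
  obtain S where S: "S \<in> carrier_mat n k" "B * S = 1\<^sub>m k"
    using mat_solve[OF c(2), of "1\<^sub>m k" k] sur by auto
  define C where "C = 1\<^sub>m n - S * B"
  have C: "C \<in> carrier_mat n n" using S c by (auto simp: C_def)
  have BC: "B * C = 0\<^sub>m k n"
  proof -
    have "B * C = B * 1\<^sub>m n - B * (S * B)"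
      unfolding C_def by (rule mult_minus_distrib_mat[of _ k n]) (use c S in auto)
    also have "B * (S * B) = B * S * B"
      using assoc_mult_mat[OF c(2) S(1) c(2)] by simp
    finally show ?thesis using c S by simp
  qed
  obtain R where R: "R \<in> carrier_mat m n" "A * R = C"
  proof -
    have "\<exists>X\<in>carrier_mat m n. A * X = C"
    proof (rule mat_solve[OF c(1) C])
      fix j assume j: "j < n"
      have "B *\<^sub>v (C *\<^sub>v unit_vec n j) = 0\<^sub>m k n *\<^sub>v unit_vec n j"
        using assoc_mult_mat_vec[OF c(2) C, of "unit_vec n j"] BC by simp
      also have "\<dots> = 0\<^sub>v k" by (intro eq_vecI) auto
      finally have "B *\<^sub>v (C *\<^sub>v unit_vec n j) = 0\<^sub>v k" .
      then show "C *\<^sub>v unit_vec n j \<in> (\<lambda>v. A *\<^sub>v v) ` carrier_vec m"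
        unfolding im using C by auto
    qed
    then show ?thesis using that by blast
  qed
  have BA: "B * A = 0\<^sub>m k m"
  proof (rule mat_eq_by_vec[of _ k m])
    fix j assume j: "j < m"
    have "A *\<^sub>v unit_vec m j \<in> {v \<in> carrier_vec n. B *\<^sub>v v = 0\<^sub>v k}"
      unfolding im[symmetric] by auto
    then have "B * A *\<^sub>v unit_vec m j = 0\<^sub>v k"
      using assoc_mult_mat_vec[OF c(2) c(1)] by simp
    also have "\<dots> = 0\<^sub>m k m *\<^sub>v unit_vec m j" by (intro eq_vecI) auto
    finally show "B * A *\<^sub>v unit_vec m j = 0\<^sub>m k m *\<^sub>v unit_vec m j" .
  qed (use c in auto)
  have RA: "R * A = 1\<^sub>m m"
  proof (rule mat_eq_by_vec[of _ m m])
    fix j assume j: "j < m"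
    let ?u = "unit_vec m j :: complex Matrix.vec"
    have "A *\<^sub>v (R * A *\<^sub>v ?u) = A * R * A *\<^sub>v ?u"
      using assoc_mult_mat_vec[OF c(1) mult_carrier_mat[OF R(1) c(1)], of ?u]
        assoc_mult_mat[OF c(1) R(1) c(1)] by simp
    also have "A * R * A = 1\<^sub>m n * A - S * B * A"
      unfolding R(2) C_def by (rule minus_mult_distrib_mat[of _ n n]) (use c S in auto)
    also have "S * B * A = S * (B * A)"
      using assoc_mult_mat[OF S(1) c(2) c(1)] .
    also have "1\<^sub>m n * A - S * (B * A) = A"
      using BA c S by auto
    finally have "A *\<^sub>v (R * A *\<^sub>v ?u) = A *\<^sub>v ?u" .
    with inj have "R * A *\<^sub>v ?u = ?u" by (rule inj_onD) (use R c in auto)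
    then show "R * A *\<^sub>v ?u = 1\<^sub>m m *\<^sub>v ?u" by simp
  qed (use c R in auto)
  have "A * R + S * B = 1\<^sub>m n"
    unfolding R(2) C_def using c S by (intro eq_matI) auto
  then have "split_exact E \<rho>' \<rho> \<rho>'' m n k A R B S"
    unfolding split_exact_def using c r eq S R RA BA by blast
  then show ?thesis by (rule that)
qed

lemma short_exact_reps:
  "short_exact E \<rho>' \<rho> \<rho>'' \<Longrightarrow> \<rho>' \<in> reps E \<and> \<rho> \<in> reps E \<and> \<rho>'' \<in> reps E"
  unfolding short_exact_def reps_def by blast

text \<open>Insert \<open>A * R + S * B = 1\<close> behind \<open>\<rho> g\<close> and rotate the
  trace: the first part becomes the trace of the subrepresentation, the second that of the
  quotient.\<close>

lemma mat_tr_short_exact: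
  assumes "short_exact E \<rho>' \<rho> \<rho>''" "g \<in> carrier (weil_group E)"
  shows "mat_tr (\<rho> g) = mat_tr (\<rho>' g) + mat_tr (\<rho>'' g)"
proof -
  obtain m n k A R B S where "split_exact E \<rho>' \<rho> \<rho>'' m n k A R B S"
    using assms(1) by (rule short_exact_split)
  then have c: "A \<in> carrier_mat n m" "R \<in> carrier_mat m n" "B \<in> carrier_mat k n" "S \<in> carrier_mat n k"
    and e: "R * A = 1\<^sub>m m" "B * S = 1\<^sub>m k" "A * R + S * B = 1\<^sub>m n"
    and q: "A * \<rho>' g = \<rho> g * A" "B * \<rho> g = \<rho>'' g * B"
    and r: "\<rho>' g \<in> carrier_mat m m" "\<rho> g \<in> carrier_mat n n" "\<rho>'' g \<in> carrier_mat k k"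
    using assms(2) by (auto simp: split_exact_def is_rep_def)
  have "\<rho> g = \<rho> g * (A * R + S * B)" using e r by simp
  also have "\<dots> = \<rho> g * (A * R) + \<rho> g * (S * B)"
    using c r by (intro mult_add_distrib_mat[of _ n n]) auto
  finally have "mat_tr (\<rho> g) = mat_tr (\<rho> g * (A * R) + \<rho> g * (S * B))"
    by (rule arg_cong)
  also have "\<dots> = mat_tr (\<rho> g * (A * R)) + mat_tr (\<rho> g * (S * B))"
    using c r by (intro mat_tr_add[of _ n]) auto
  also have "\<rho> g * (A * R) = A * (\<rho>' g * R)"
    using assoc_mult_mat[OF r(2) c(1,2)] assoc_mult_mat[OF c(1) r(1) c(2)] q(1) by simp
  also have "mat_tr (A * (\<rho>' g * R)) = mat_tr (\<rho>' g * R * A)"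
    using c r by (intro mat_tr_mult_commute[of _ n m]) auto
  also have "\<rho>' g * R * A = \<rho>' g" using c r e by (simp add: assoc_mult_mat[OF r(1) c(2) c(1)])
  also have "mat_tr (\<rho> g * (S * B)) = mat_tr (\<rho> g * S * B)"
    using assoc_mult_mat[OF r(2) c(4) c(3)] by simp
  also have "\<dots> = mat_tr (B * (\<rho> g * S))"
    using c r by (intro mat_tr_mult_commute[of _ n k]) auto
  also have "B * (\<rho> g * S) = B * \<rho> g * S"
    using assoc_mult_mat[OF c(3) r(2) c(4)] by simp
  also have "\<dots> = \<rho>'' g"
    unfolding q using c r e by (simp add: assoc_mult_mat[OF r(3) c(3) c(4)])
  finally show ?thesis .
qed

section \<open>Tensor products and duals\<close>

lemma kronecker_carrier:
  "A \<in> carrier_mat a b \<Longrightarrow> B \<in> carrier_mat c d \<Longrightarrow> kronecker A B \<in> carrier_mat (a * c) (b * d)"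
  by (rule carrier_matI) (simp_all add: kronecker_def)

lemma kronecker_index:
  "A \<in> carrier_mat a b \<Longrightarrow> B \<in> carrier_mat c d \<Longrightarrow> i < a * c \<Longrightarrow> k < b * d \<Longrightarrow>
    kronecker A B $$ (i, k) = A $$ (i div c, k div d) * B $$ (i mod c, k mod d)"
  by (simp add: kronecker_def)

lemma mod_less_factor: "(i::nat) < a * c \<Longrightarrow> i mod c < c"
  by (cases "c = 0") auto

lemma sum_div_mod:
  "(\<Sum>l<b * d. f (l div d) (l mod d)) = (\<Sum>p<b. \<Sum>q<(d::nat). f p q)"
proof -
  have lt: "p * d + q < b * d" if "p < b" "q < d" for p q :: nat
  proof -
    have "p * d + q < p * d + d" using that by simp
    also have "\<dots> = Suc p * d" by simp
    also have "\<dots> \<le> b * d" using that by (intro mult_right_mono) auto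
    finally show ?thesis .
  qed
  have "(\<Sum>p<b. \<Sum>q<d. f p q) = (\<Sum>(p, q)\<in>{..<b} \<times> {..<d}. f p q)"
    by (rule sum.cartesian_product)
  also have "\<dots> = (\<Sum>l<b * d. f (l div d) (l mod d))"
    by (rule sum.reindex_bij_witness[of _ "\<lambda>l. (l div d, l mod d)" "\<lambda>(p, q). p * d + q"])
      (auto simp: less_mult_imp_div_less lt mod_less_factor)
  finally show ?thesis by simp
qed

lemma kronecker_mult:
  assumes "A \<in> carrier_mat a b" "C \<in> carrier_mat b e" "B \<in> carrier_mat c d" "D \<in> carrier_mat d f"
  shows "kronecker A B * kronecker C D = kronecker (A * C) (B * D)"
proof (rule eq_matI)
  note k = kronecker_carrier[OF assms(1,3)] kronecker_carrier[OF assms(2,4)]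
    kronecker_carrier[OF mult_carrier_mat[OF assms(1,2)] mult_carrier_mat[OF assms(3,4)]]
  fix i j assume "i < dim_row (kronecker (A * C) (B * D))" "j < dim_col (kronecker (A * C) (B * D))"
  then have i: "i < a * c" and j: "j < e * f" using k by auto
  have bd: "i div c < a" "i mod c < c" "j div f < e" "j mod f < f"
    using i j by (auto simp: less_mult_imp_div_less mod_less_factor)
  have "(kronecker A B * kronecker C D) $$ (i, j) =
      (\<Sum>l<b * d. kronecker A B $$ (i, l) * kronecker C D $$ (l, j))"
    using k i j by (simp add: scalar_prod_def atLeast0LessThan)
  also have "\<dots> = (\<Sum>l<b * d. (A $$ (i div c, l div d) * B $$ (i mod c, l mod d)) *
      (C $$ (l div d, j div f) * D $$ (l mod d, j mod f)))"
    by (intro sum.cong refl arg_cong2[where f = "(*)"])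
      (simp_all add: kronecker_index[OF assms(1,3) i] kronecker_index[OF assms(2,4) _ j])
  also have "\<dots> = (\<Sum>p<b. \<Sum>q<d. (A $$ (i div c, p) * B $$ (i mod c, q)) *
      (C $$ (p, j div f) * D $$ (q, j mod f)))"
    by (rule sum_div_mod)
  also have "\<dots> = (\<Sum>p<b. A $$ (i div c, p) * C $$ (p, j div f)) *
      (\<Sum>q<d. B $$ (i mod c, q) * D $$ (q, j mod f))"
    by (simp add: sum_product mult_ac)
  also have "\<dots> = (A * C) $$ (i div c, j div f) * (B * D) $$ (i mod c, j mod f)"
    using assms bd by (simp add: scalar_prod_def atLeast0LessThan)
  also have "\<dots> = kronecker (A * C) (B * D) $$ (i, j)"
    using kronecker_index[OF mult_carrier_mat[OF assms(1,2)] mult_carrier_mat[OF assms(3,4)] i j] by simp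
  finally show "(kronecker A B * kronecker C D) $$ (i, j) = kronecker (A * C) (B * D) $$ (i, j)" .
qed (use assms in \<open>auto simp: kronecker_def\<close>)

lemma kronecker_one: "kronecker (1\<^sub>m a) (1\<^sub>m c) = 1\<^sub>m (a * c)"
proof (rule eq_matI)
  fix i j assume "i < dim_row (1\<^sub>m (a * c) :: complex mat)" "j < dim_col (1\<^sub>m (a * c) :: complex mat)"
  then have ij: "i < a * c" "j < a * c" by auto
  then have bd: "i div c < a" "i mod c < c" "j div c < a" "j mod c < c"
    by (auto simp: less_mult_imp_div_less mod_less_factor)
  have "i = j \<longleftrightarrow> i div c = j div c \<and> i mod c = j mod c"
    by (metis div_mult_mod_eq)
  then show "kronecker (1\<^sub>m a) (1\<^sub>m c) $$ (i, j) = 1\<^sub>m (a * c) $$ (i, j)"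
    using ij bd by (auto simp: kronecker_index[of _ a a _ c c])
qed (auto simp: kronecker_def)

lemma kronecker_add_left:
  assumes "A \<in> carrier_mat a b" "C \<in> carrier_mat a b" "B \<in> carrier_mat c d"
  shows "kronecker (A + C) B = kronecker A B + kronecker C B"
proof (rule eq_matI)
  note k = kronecker_carrier[OF assms(1,3)] kronecker_carrier[OF assms(2,3)]
  fix i j assume "i < dim_row (kronecker A B + kronecker C B)" "j < dim_col (kronecker A B + kronecker C B)"
  then have i: "i < a * c" and j: "j < b * d" using k by auto
  have bd: "i div c < a" "j div d < b"
    using i j by (auto simp: less_mult_imp_div_less mod_less_factor)
  have "(kronecker A B + kronecker C B) $$ (i, j) = (kronecker A B) $$ (i, j) + (kronecker C B) $$ (i, j)"
    using k i j by simp
  then show "kronecker (A + C) B $$ (i, j) = (kronecker A B + kronecker C B) $$ (i, j)"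
    using assms bd i j kronecker_index[OF assms(1,3) i j] kronecker_index[OF assms(2,3) i j]
      kronecker_index[OF add_carrier_mat[OF assms(2), of A] assms(3) i j] by (simp add: algebra_simps)
qed (use assms in \<open>simp_all add: kronecker_def\<close>)

lemma kronecker_add_right:
  assumes "A \<in> carrier_mat a b" "C \<in> carrier_mat a b" "B \<in> carrier_mat c d"
  shows "kronecker B (A + C) = kronecker B A + kronecker B C"
proof (rule eq_matI)
  note k = kronecker_carrier[OF assms(3,1)] kronecker_carrier[OF assms(3,2)]
  fix i j assume "i < dim_row (kronecker B A + kronecker B C)" "j < dim_col (kronecker B A + kronecker B C)"
  then have i: "i < c * a" and j: "j < d * b" using k by auto
  have bd: "i mod a < a" "j mod b < b"
    using i j by (auto simp: less_mult_imp_div_less mod_less_factor)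
  have "(kronecker B A + kronecker B C) $$ (i, j) = (kronecker B A) $$ (i, j) + (kronecker B C) $$ (i, j)"
    using k i j by simp
  then show "kronecker B (A + C) $$ (i, j) = (kronecker B A + kronecker B C) $$ (i, j)"
    using assms bd i j kronecker_index[OF assms(3,1) i j] kronecker_index[OF assms(3,2) i j]
      kronecker_index[OF assms(3) add_carrier_mat[OF assms(2), of A] i j] by (simp add: algebra_simps)
qed (use assms in \<open>simp_all add: kronecker_def\<close>)

lemma kronecker_zero_left:
  "B \<in> carrier_mat c d \<Longrightarrow> kronecker (0\<^sub>m a b) B = 0\<^sub>m (a * c) (b * d)"
  by (intro eq_matI) (auto simp: kronecker_def less_mult_imp_div_less)

lemma kronecker_zero_right:
  "B \<in> carrier_mat c d \<Longrightarrow> kronecker B (0\<^sub>m a b) = 0\<^sub>m (c * a) (d * b)"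
  by (intro eq_matI) (auto simp: kronecker_def mod_less_factor)

lemma is_rep_tensor:
  assumes r: "is_rep E m \<rho>" and s: "is_rep E n \<sigma>"
  shows "is_rep E (m * n) (rep_tensor \<rho> \<sigma>)"
  unfolding is_rep_def
proof (intro conjI ballI allI impI)
  let ?G = "weil_group E"
  fix g assume g: "g \<in> carrier ?G"
  show "rep_tensor \<rho> \<sigma> g \<in> carrier_mat (m * n) (m * n)"
    using is_rep_carrier[OF r g] is_rep_carrier[OF s g] by (simp add: rep_tensor_def kronecker_carrier)
  fix h assume h: "h \<in> carrier ?G"
  show "rep_tensor \<rho> \<sigma> (g \<otimes>\<^bsub>?G\<^esub> h) = rep_tensor \<rho> \<sigma> g * rep_tensor \<rho> \<sigma> h"
    using kronecker_mult[OF is_rep_carrier[OF r g] is_rep_carrier[OF r h]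
        is_rep_carrier[OF s g] is_rep_carrier[OF s h]] r s g h
    by (simp add: rep_tensor_def is_rep_def)
next
  show "rep_tensor \<rho> \<sigma> \<one>\<^bsub>weil_group E\<^esub> = 1\<^sub>m (m * n)"
    using r s by (simp add: rep_tensor_def is_rep_def kronecker_one)
next
  fix t :: real assume "0 < t"
  then show "rep_tensor \<rho> \<sigma> (False, complex_of_real t) = 1\<^sub>m (m * n)"
    using r s by (simp add: rep_tensor_def is_rep_def kronecker_one)
next
  fix i k assume ik: "i < m * n" "k < m * n"
  have "continuous_on (carrier (weil_group E))
      (\<lambda>g. \<rho> g $$ (i div n, k div n) * \<sigma> g $$ (i mod n, k mod n))"
    using r s ik by (intro continuous_on_mult)
      (auto simp: is_rep_def less_mult_imp_div_less mod_less_factor)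
  then show "continuous_on (carrier (weil_group E)) (\<lambda>g. rep_tensor \<rho> \<sigma> g $$ (i, k))"
    by (rule continuous_on_eq)
      (simp add: rep_tensor_def kronecker_index[OF is_rep_carrier[OF r] is_rep_carrier[OF s] ik])
qed

text \<open>The Kronecker products of the four maps with an identity matrix again satisfy the
  identities of \<open>split_exact\<close>, because the Kronecker product is multiplicative and
  additive.\<close>

lemma short_exact_tensor_right:
  assumes ex: "short_exact E \<rho>' \<rho> \<rho>''" and s: "is_rep E d \<sigma>"
  shows "short_exact E (rep_tensor \<rho>' \<sigma>) (rep_tensor \<rho> \<sigma>) (rep_tensor \<rho>'' \<sigma>)"
proof -
  obtain m n k A R B S where sp: "split_exact E \<rho>' \<rho> \<rho>'' m n k A R B S"
    using ex by (rule short_exact_split)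
  then have c: "A \<in> carrier_mat n m" "R \<in> carrier_mat m n" "B \<in> carrier_mat k n" "S \<in> carrier_mat n k"
    and r: "is_rep E m \<rho>'" "is_rep E n \<rho>" "is_rep E k \<rho>''"
    and e: "R * A = 1\<^sub>m m" "B * S = 1\<^sub>m k" "B * A = 0\<^sub>m k m" "A * R + S * B = 1\<^sub>m n"
    unfolding split_exact_def by blast+
  let ?I = "1\<^sub>m d :: complex mat"
  have i: "?I \<in> carrier_mat d d" by simp
  have "split_exact E (rep_tensor \<rho>' \<sigma>) (rep_tensor \<rho> \<sigma>) (rep_tensor \<rho>'' \<sigma>) (m * d) (n * d) (k * d)
      (kronecker A ?I) (kronecker R ?I) (kronecker B ?I) (kronecker S ?I)"
    unfolding split_exact_def
  proof (intro conjI ballI)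
    fix g assume g: "g \<in> carrier (weil_group E)"
    note rg = is_rep_carrier[OF r(1) g] is_rep_carrier[OF r(2) g] is_rep_carrier[OF r(3) g]
      is_rep_carrier[OF s g]
    have q: "A * \<rho>' g = \<rho> g * A" "B * \<rho> g = \<rho>'' g * B"
      using sp g unfolding split_exact_def by blast+
    show "kronecker A ?I * rep_tensor \<rho>' \<sigma> g = rep_tensor \<rho> \<sigma> g * kronecker A ?I"
      unfolding rep_tensor_def using q rg
      by (simp add: kronecker_mult[OF c(1) rg(1) i rg(4)] kronecker_mult[OF rg(2) c(1) rg(4) i])
    show "kronecker B ?I * rep_tensor \<rho> \<sigma> g = rep_tensor \<rho>'' \<sigma> g * kronecker B ?I"
      unfolding rep_tensor_def using q rg
      by (simp add: kronecker_mult[OF c(3) rg(2) i rg(4)] kronecker_mult[OF rg(3) c(3) rg(4) i])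
  next
    show "kronecker R ?I * kronecker A ?I = 1\<^sub>m (m * d)"
      by (simp add: kronecker_mult[OF c(2) c(1) i i] e kronecker_one)
    show "kronecker B ?I * kronecker S ?I = 1\<^sub>m (k * d)"
      by (simp add: kronecker_mult[OF c(3) c(4) i i] e kronecker_one)
    show "kronecker B ?I * kronecker A ?I = 0\<^sub>m (k * d) (m * d)"
      by (simp add: kronecker_mult[OF c(3) c(1) i i] e kronecker_zero_left[OF i])
    have "kronecker A ?I * kronecker R ?I + kronecker S ?I * kronecker B ?I = kronecker (A * R + S * B) ?I"
      using kronecker_add_left[OF mult_carrier_mat[OF c(1,2)] mult_carrier_mat[OF c(4,3)] i]
      by (simp add: kronecker_mult[OF c(1,2) i i] kronecker_mult[OF c(4,3) i i])
    then show "kronecker A ?I * kronecker R ?I + kronecker S ?I * kronecker B ?I = 1\<^sub>m (n * d)"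
      by (simp add: e kronecker_one)
  qed (intro kronecker_carrier c i is_rep_tensor r s)+
  then show ?thesis by (rule split_exact_imp)
qed

lemma short_exact_tensor_left:
  assumes ex: "short_exact E \<rho>' \<rho> \<rho>''" and s: "is_rep E d \<sigma>"
  shows "short_exact E (rep_tensor \<sigma> \<rho>') (rep_tensor \<sigma> \<rho>) (rep_tensor \<sigma> \<rho>'')"
proof -
  obtain m n k A R B S where sp: "split_exact E \<rho>' \<rho> \<rho>'' m n k A R B S"
    using ex by (rule short_exact_split)
  then have c: "A \<in> carrier_mat n m" "R \<in> carrier_mat m n" "B \<in> carrier_mat k n" "S \<in> carrier_mat n k"
    and r: "is_rep E m \<rho>'" "is_rep E n \<rho>" "is_rep E k \<rho>''"
    and e: "R * A = 1\<^sub>m m" "B * S = 1\<^sub>m k" "B * A = 0\<^sub>m k m" "A * R + S * B = 1\<^sub>m n"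
    unfolding split_exact_def by blast+
  let ?I = "1\<^sub>m d :: complex mat"
  have i: "?I \<in> carrier_mat d d" by simp
  have "split_exact E (rep_tensor \<sigma> \<rho>') (rep_tensor \<sigma> \<rho>) (rep_tensor \<sigma> \<rho>'') (d * m) (d * n) (d * k)
      (kronecker ?I A) (kronecker ?I R) (kronecker ?I B) (kronecker ?I S)"
    unfolding split_exact_def
  proof (intro conjI ballI)
    fix g assume g: "g \<in> carrier (weil_group E)"
    note rg = is_rep_carrier[OF r(1) g] is_rep_carrier[OF r(2) g] is_rep_carrier[OF r(3) g]
      is_rep_carrier[OF s g]
    have q: "A * \<rho>' g = \<rho> g * A" "B * \<rho> g = \<rho>'' g * B"
      using sp g unfolding split_exact_def by blast+
    show "kronecker ?I A * rep_tensor \<sigma> \<rho>' g = rep_tensor \<sigma> \<rho> g * kronecker ?I A"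
      unfolding rep_tensor_def using q rg
      by (simp add: kronecker_mult[OF i rg(4) c(1) rg(1)] kronecker_mult[OF rg(4) i rg(2) c(1)])
    show "kronecker ?I B * rep_tensor \<sigma> \<rho> g = rep_tensor \<sigma> \<rho>'' g * kronecker ?I B"
      unfolding rep_tensor_def using q rg
      by (simp add: kronecker_mult[OF i rg(4) c(3) rg(2)] kronecker_mult[OF rg(4) i rg(3) c(3)])
  next
    show "kronecker ?I R * kronecker ?I A = 1\<^sub>m (d * m)"
      by (simp add: kronecker_mult[OF i i c(2) c(1)] e kronecker_one)
    show "kronecker ?I B * kronecker ?I S = 1\<^sub>m (d * k)"
      by (simp add: kronecker_mult[OF i i c(3) c(4)] e kronecker_one)
    show "kronecker ?I B * kronecker ?I A = 0\<^sub>m (d * k) (d * m)"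
      by (simp add: kronecker_mult[OF i i c(3) c(1)] e kronecker_zero_right[OF i])
    have "kronecker ?I A * kronecker ?I R + kronecker ?I S * kronecker ?I B = kronecker ?I (A * R + S * B)"
      using kronecker_add_right[OF mult_carrier_mat[OF c(1,2)] mult_carrier_mat[OF c(4,3)] i]
      by (simp add: kronecker_mult[OF i i c(1,2)] kronecker_mult[OF i i c(4,3)])
    then show "kronecker ?I A * kronecker ?I R + kronecker ?I S * kronecker ?I B = 1\<^sub>m (d * n)"
      by (simp add: e kronecker_one)
  qed (intro kronecker_carrier c i is_rep_tensor r s)+
  then show ?thesis by (rule split_exact_imp)
qed

lemma continuous_on_weil_inv:
  "continuous_on (carrier (weil_group E)) (\<lambda>g. inv\<^bsub>weil_group E\<^esub> g)"
proof (rule continuous_on_weil)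
  have "continuous_on (- {0::complex}) (\<lambda>z. (False, inverse z))"
    by (intro continuous_intros) auto
  then show "continuous_on (- {0}) (\<lambda>z. inv\<^bsub>weil_group E\<^esub> (False, z))"
    by (rule continuous_on_eq) (simp add: weil_inv weil_carrier)
next
  assume E: "E = Real_field"
  have "continuous_on (- {0::complex}) (\<lambda>z. (True, - inverse (cnj z)))"
    by (intro continuous_intros) auto
  then show "continuous_on (- {0}) (\<lambda>z. inv\<^bsub>weil_group E\<^esub> (True, z))"
    by (rule continuous_on_eq) (simp add: weil_inv weil_carrier E)
qed

lemma weil_inv_carrier:
  "g \<in> carrier (weil_group E) \<Longrightarrow> inv\<^bsub>weil_group E\<^esub> g \<in> carrier (weil_group E)"
  by (rule group.inv_closed[OF weil_group_group])

lemma is_rep_dual: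
  assumes r: "is_rep E n \<rho>"
  shows "is_rep E n (rep_dual E \<rho>)"
  unfolding is_rep_def
proof (intro conjI ballI allI impI)
  let ?G = "weil_group E"
  fix g assume g: "g \<in> carrier ?G"
  note rg = is_rep_carrier[OF r weil_inv_carrier[OF g]]
  show "rep_dual E \<rho> g \<in> carrier_mat n n"
    using rg by (simp add: rep_dual_def)
  fix h assume h: "h \<in> carrier ?G"
  note rh = is_rep_carrier[OF r weil_inv_carrier[OF h]]
  have "\<rho> (inv\<^bsub>?G\<^esub> (g \<otimes>\<^bsub>?G\<^esub> h)) = \<rho> (inv\<^bsub>?G\<^esub> h) * \<rho> (inv\<^bsub>?G\<^esub> g)"
    using r g h by (simp add: is_rep_def group.inv_mult_group[OF weil_group_group] weil_inv_carrier)
  then show "rep_dual E \<rho> (g \<otimes>\<^bsub>?G\<^esub> h) = rep_dual E \<rho> g * rep_dual E \<rho> h"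
    using transpose_mult[OF rh rg] by (simp add: rep_dual_def)
next
  show "rep_dual E \<rho> \<one>\<^bsub>weil_group E\<^esub> = 1\<^sub>m n"
    using r by (simp add: rep_dual_def group.is_monoid[OF weil_group_group] monoid.inv_one is_rep_def)
next
  fix t :: real assume "0 < t"
  then have "\<rho> (False, complex_of_real (inverse t)) = 1\<^sub>m n"
    using r by (simp add: is_rep_def del: of_real_inverse)
  then show "rep_dual E \<rho> (False, complex_of_real t) = 1\<^sub>m n"
    using \<open>0 < t\<close> by (simp add: rep_dual_def weil_inv weil_carrier)
next
  fix i k assume ik: "i < n" "k < n"
  have "continuous_on (carrier (weil_group E)) (\<lambda>g. \<rho> (inv\<^bsub>weil_group E\<^esub> g) $$ (k, i))"
    by (rule continuous_on_compose2[OF _ continuous_on_weil_inv, of "carrier (weil_group E)" "\<lambda>g. \<rho> g $$ (k, i)"])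
      (use r ik in \<open>auto simp: is_rep_def weil_inv_carrier\<close>)
  then show "continuous_on (carrier (weil_group E)) (\<lambda>g. rep_dual E \<rho> g $$ (i, k))"
  proof (rule continuous_on_eq)
    fix g assume "g \<in> carrier (weil_group E)"
    from is_rep_carrier[OF r weil_inv_carrier[OF this]]
    show "\<rho> (inv\<^bsub>weil_group E\<^esub> g) $$ (k, i) = rep_dual E \<rho> g $$ (i, k)"
      using ik by (simp add: rep_dual_def)
  qed
qed

text \<open>Transposition reverses the arrows: the transpose of \<open>B\<close> becomes the
  inclusion, with retraction the transpose of \<open>S\<close>, and the transpose of
  \<open>A\<close> becomes the projection.\<close>

lemma short_exact_dual:
  assumes ex: "short_exact E \<rho>' \<rho> \<rho>''"
  shows "short_exact E (rep_dual E \<rho>'') (rep_dual E \<rho>) (rep_dual E \<rho>')"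
proof -
  obtain m n k A R B S where sp: "split_exact E \<rho>' \<rho> \<rho>'' m n k A R B S"
    using ex by (rule short_exact_split)
  then have c: "A \<in> carrier_mat n m" "R \<in> carrier_mat m n" "B \<in> carrier_mat k n" "S \<in> carrier_mat n k"
    and r: "is_rep E m \<rho>'" "is_rep E n \<rho>" "is_rep E k \<rho>''"
    and e: "R * A = 1\<^sub>m m" "B * S = 1\<^sub>m k" "B * A = 0\<^sub>m k m" "A * R + S * B = 1\<^sub>m n"
    unfolding split_exact_def by blast+
  have "split_exact E (rep_dual E \<rho>'') (rep_dual E \<rho>) (rep_dual E \<rho>') k n m
      (transpose_mat B) (transpose_mat S) (transpose_mat A) (transpose_mat R)"
    unfolding split_exact_def
  proof (intro conjI ballI)
    fix g assume "g \<in> carrier (weil_group E)"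
    then have g: "inv\<^bsub>weil_group E\<^esub> g \<in> carrier (weil_group E)" (is "?g \<in> _") by (rule weil_inv_carrier)
    note rg = is_rep_carrier[OF r(1) g] is_rep_carrier[OF r(2) g] is_rep_carrier[OF r(3) g]
    have q: "A * \<rho>' ?g = \<rho> ?g * A" "B * \<rho> ?g = \<rho>'' ?g * B"
      using sp g unfolding split_exact_def by blast+
    show "transpose_mat B * rep_dual E \<rho>'' g = rep_dual E \<rho> g * transpose_mat B"
      unfolding rep_dual_def using transpose_mult[OF rg(3) c(3)] transpose_mult[OF c(3) rg(2)] q by simp
    show "transpose_mat A * rep_dual E \<rho> g = rep_dual E \<rho>' g * transpose_mat A"
      unfolding rep_dual_def using transpose_mult[OF rg(2) c(1)] transpose_mult[OF c(1) rg(1)] q by simp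
  next
    show "transpose_mat S * transpose_mat B = 1\<^sub>m k"
      using transpose_mult[OF c(3,4)] e by simp
    show "transpose_mat A * transpose_mat R = 1\<^sub>m m"
      using transpose_mult[OF c(2,1)] e by simp
    show "transpose_mat A * transpose_mat B = 0\<^sub>m m k"
      using transpose_mult[OF c(3,1)] e by (simp add: zero_transpose_mat)
    have "transpose_mat B * transpose_mat S + transpose_mat R * transpose_mat A =
        transpose_mat (S * B) + transpose_mat (A * R)"
      using transpose_mult[OF c(4,3)] transpose_mult[OF c(1,2)] by simp
    also have "\<dots> = transpose_mat (S * B + A * R)"
      using c by (intro transpose_add[symmetric]) auto
    also have "S * B + A * R = A * R + S * B"
      using c by (intro comm_add_mat[of _ n n]) auto
    finally show "transpose_mat B * transpose_mat S + transpose_mat R * transpose_mat A = 1\<^sub>m n"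
      using e by simp
  qed (simp_all only: transpose_carrier_mat c is_rep_dual r)
  then show ?thesis by (rule split_exact_imp)
qed

section \<open>The structure of the Grothendieck ring\<close>

lemma virtual_group_simps [simp]:
  "x \<in> carrier (virtual_group E) \<longleftrightarrow> Poly_Mapping.keys x \<subseteq> reps E"
  "\<one>\<^bsub>virtual_group E\<^esub> = 0" "x \<otimes>\<^bsub>virtual_group E\<^esub> y = x + y"
  by (simp_all add: virtual_group_def)

lemma virtual_group_comm: "comm_group (virtual_group E)"
  by (simp add: virtual_group_def abelian_free_Abelian_group)

lemma relations_subgroup: "subgroup (exact_relations E) (virtual_group E)"
  unfolding exact_relations_def
proof (rule group.generate_is_subgroup[OF comm_group.axioms(2)[OF virtual_group_comm]], safe)
  fix \<rho>' \<rho> \<rho>'' assume "short_exact E \<rho>' \<rho> \<rho>''"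
  from short_exact_reps[OF this]
  show "frag_of \<rho> - frag_of \<rho>' - frag_of \<rho>'' \<in> carrier (virtual_group E)"
    using keys_diff[of "frag_of \<rho> - frag_of \<rho>'" "frag_of \<rho>''"] keys_diff[of "frag_of \<rho>" "frag_of \<rho>'"]
    by auto
qed

lemma relations_normal: "exact_relations E \<lhd> virtual_group E"
  by (rule comm_group.subgroup_imp_normal[OF virtual_group_comm relations_subgroup])

lemma relations_carrier: "x \<in> exact_relations E \<Longrightarrow> Poly_Mapping.keys x \<subseteq> reps E"
  using subgroup.mem_carrier[OF relations_subgroup] by fastforce

lemma relations_zero: "0 \<in> exact_relations E"
  using subgroup.one_closed[OF relations_subgroup] by simp

lemma relations_add: "x \<in> exact_relations E \<Longrightarrow> y \<in> exact_relations E \<Longrightarrow> x + y \<in> exact_relations E"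
  using subgroup.m_closed[OF relations_subgroup] by fastforce

lemma relations_minus: "x \<in> exact_relations E \<Longrightarrow> - x \<in> exact_relations E"
  using subgroup.m_inv_closed[OF relations_subgroup, of x E] relations_carrier[of x E]
  by (simp add: virtual_group_def)

lemma relations_diff: "x \<in> exact_relations E \<Longrightarrow> y \<in> exact_relations E \<Longrightarrow> x - y \<in> exact_relations E"
  using relations_add[OF _ relations_minus] by fastforce

lemma relations_exact:
  "short_exact E \<rho>' \<rho> \<rho>'' \<Longrightarrow> frag_of \<rho> - frag_of \<rho>' - frag_of \<rho>'' \<in> exact_relations E"
  unfolding exact_relations_def by (rule generate.incl) auto

lemma relations_induct [consumes 1, case_names zero exact minus add]:
  assumes x: "x \<in> exact_relations E"
    and "P 0"
    and gen: "\<And>\<rho>' \<rho> \<rho>''. short_exact E \<rho>' \<rho> \<rho>'' \<Longrightarrow> P (frag_of \<rho> - frag_of \<rho>' - frag_of \<rho>'')"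
    and minus: "\<And>a. P a \<Longrightarrow> P (- a)" and "\<And>a b. P a \<Longrightarrow> P b \<Longrightarrow> P (a + b)"
  shows "P x"
  using x unfolding exact_relations_def
proof (induction rule: generate.induct)
  case (inv h)
  then obtain \<rho>' \<rho> \<rho>'' where h: "short_exact E \<rho>' \<rho> \<rho>''" "h = frag_of \<rho> - frag_of \<rho>' - frag_of \<rho>''"
    by auto
  have "Poly_Mapping.keys h \<subseteq> reps E"
    using relations_carrier[OF relations_exact[OF h(1)]] h(2) by simp
  then have "inv\<^bsub>virtual_group E\<^esub> h = - h"
    by (simp add: virtual_group_def)
  then show ?case using minus[OF gen[OF h(1)]] h(2) by simp
qed (use assms in auto)

lemma frag_extend_fun_add:
  "frag_extend (\<lambda>i. f i + g i) x = frag_extend f x + frag_extend g x"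
  by (simp add: frag_extend_def frag_cmul_distrib2 sum.distrib)

lemma frag_extend_fun_minus:
  "frag_extend (\<lambda>i. - f i) x = - frag_extend f x"
proof -
  have "frag_extend (\<lambda>i. f i + - f i) x = frag_extend f x + frag_extend (\<lambda>i. - f i) x"
    by (rule frag_extend_fun_add)
  then show ?thesis by (simp add: frag_extend_eq_0 eq_neg_iff_add_eq_0 add.commute)
qed

lemma virtual_tensor_of: "virtual_tensor (frag_of \<rho>) (frag_of \<sigma>) = frag_of (rep_tensor \<rho> \<sigma>)"
  by (simp add: virtual_tensor_def)

lemma virtual_tensor_add_left: "virtual_tensor (x + x') y = virtual_tensor x y + virtual_tensor x' y"
  by (simp add: virtual_tensor_def frag_extend_add)

lemma virtual_tensor_add_right: "virtual_tensor x (y + y') = virtual_tensor x y + virtual_tensor x y'"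
  by (simp add: virtual_tensor_def frag_extend_add frag_extend_fun_add)

lemma virtual_tensor_minus_left: "virtual_tensor (- x) y = - virtual_tensor x y"
  by (simp add: virtual_tensor_def frag_extend_minus)

lemma virtual_tensor_minus_right: "virtual_tensor x (- y) = - virtual_tensor x y"
  by (simp add: virtual_tensor_def frag_extend_minus frag_extend_fun_minus)

lemma virtual_tensor_zero [simp]: "virtual_tensor 0 y = 0" "virtual_tensor x 0 = 0"
  using virtual_tensor_add_left[of 0 0 y] virtual_tensor_add_right[of x 0 0] by auto

lemma virtual_tensor_diff_left: "virtual_tensor (x - x') y = virtual_tensor x y - virtual_tensor x' y"
  using virtual_tensor_add_left[of x "- x'" y] by (simp add: virtual_tensor_minus_left)

lemma virtual_tensor_diff_right: "virtual_tensor x (y - y') = virtual_tensor x y - virtual_tensor x y'"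
  using virtual_tensor_add_right[of x y "- y'"] by (simp add: virtual_tensor_minus_right)

lemma keys_diff_subset:
  "Poly_Mapping.keys x \<subseteq> S \<Longrightarrow> Poly_Mapping.keys y \<subseteq> S \<Longrightarrow> Poly_Mapping.keys (x - y) \<subseteq> S"
  using keys_diff[of x y] by blast

lemma keys_add_subset:
  "Poly_Mapping.keys x \<subseteq> S \<Longrightarrow> Poly_Mapping.keys y \<subseteq> S \<Longrightarrow> Poly_Mapping.keys (x + y) \<subseteq> S"
  using keys_add[of x y] by blast

lemma keys_virtual_tensor:
  assumes "Poly_Mapping.keys x \<subseteq> reps E" "Poly_Mapping.keys y \<subseteq> reps E"
  shows "Poly_Mapping.keys (virtual_tensor x y) \<subseteq> reps E"
  using assms(1)
proof (induction x rule: frag_induction)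
  case (one \<rho>)
  show ?case
    using assms(2)
  proof (induction y rule: frag_induction)
    case (one \<sigma>)
    then show ?case
      using \<open>\<rho> \<in> reps E\<close> is_rep_tensor by (fastforce simp: virtual_tensor_of reps_def)
  qed (simp_all add: virtual_tensor_diff_right keys_diff_subset)
qed (simp_all add: virtual_tensor_diff_left keys_diff_subset)

lemma relations_tensor_left:
  assumes x: "x \<in> exact_relations E" and y: "Poly_Mapping.keys y \<subseteq> reps E"
  shows "virtual_tensor x y \<in> exact_relations E"
  using y
proof (induction y rule: frag_induction)
  case (one \<sigma>)
  then obtain d where s: "is_rep E d \<sigma>" by (auto simp: reps_def)
  show ?case using x
  proof (induction rule: relations_induct)
    case (exact \<rho>' \<rho> \<rho>'')
    from relations_exact[OF short_exact_tensor_right[OF this s]]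
    show ?case by (simp add: virtual_tensor_diff_left virtual_tensor_of)
  qed (auto simp: virtual_tensor_add_left virtual_tensor_minus_left
      intro: relations_add relations_minus relations_zero)
qed (auto simp: virtual_tensor_diff_right intro: relations_diff relations_zero)

lemma relations_tensor_right:
  assumes x: "x \<in> exact_relations E" and y: "Poly_Mapping.keys y \<subseteq> reps E"
  shows "virtual_tensor y x \<in> exact_relations E"
  using y
proof (induction y rule: frag_induction)
  case (one \<sigma>)
  then obtain d where s: "is_rep E d \<sigma>" by (auto simp: reps_def)
  show ?case using x
  proof (induction rule: relations_induct)
    case (exact \<rho>' \<rho> \<rho>'')
    from relations_exact[OF short_exact_tensor_left[OF this s]]
    show ?case by (simp add: virtual_tensor_diff_right virtual_tensor_of)
  qed (auto simp: virtual_tensor_add_right virtual_tensor_minus_right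
      intro: relations_add relations_minus relations_zero)
qed (auto simp: virtual_tensor_diff_left intro: relations_diff relations_zero)

lemma virtual_dual_simps [simp]:
  "virtual_dual E 0 = 0" "virtual_dual E (frag_of \<rho>) = frag_of (rep_dual E \<rho>)"
  "virtual_dual E (x + y) = virtual_dual E x + virtual_dual E y"
  "virtual_dual E (- x) = - virtual_dual E x"
  "virtual_dual E (x - y) = virtual_dual E x - virtual_dual E y"
  by (simp_all add: virtual_dual_def frag_extend_add frag_extend_minus frag_extend_diff)

lemma keys_virtual_dual:
  "Poly_Mapping.keys x \<subseteq> reps E \<Longrightarrow> Poly_Mapping.keys (virtual_dual E x) \<subseteq> reps E"
proof (induction x rule: frag_induction)
  case (one \<rho>)
  then show ?case using is_rep_dual by (fastforce simp: reps_def)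
qed (simp_all add: keys_diff_subset)

lemma relations_dual: "x \<in> exact_relations E \<Longrightarrow> virtual_dual E x \<in> exact_relations E"
proof (induction rule: relations_induct)
  case (exact \<rho>' \<rho> \<rho>'')
  from relations_exact[OF short_exact_dual[OF this]]
  show ?case by (simp add: algebra_simps)
qed (auto intro: relations_add relations_minus relations_zero)

section \<open>Cosets and the operations of the ring\<close>

lemma virtual_class_mem: "y \<in> virtual_class E x \<longleftrightarrow> y - x \<in> exact_relations E"
proof -
  have "y \<in> virtual_class E x \<longleftrightarrow> (\<exists>h\<in>exact_relations E. y = h + x)"
    by (auto simp: virtual_class_def r_coset_def)
  also have "\<dots> \<longleftrightarrow> y - x \<in> exact_relations E"
    by (metis add_diff_cancel_right' diff_add_cancel)
  finally show ?thesis .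
qed

lemma virtual_class_self: "x \<in> virtual_class E x"
  by (simp add: virtual_class_mem relations_zero)

lemma virtual_class_eq: "virtual_class E x = virtual_class E y \<longleftrightarrow> x - y \<in> exact_relations E"
proof
  assume "virtual_class E x = virtual_class E y"
  then show "x - y \<in> exact_relations E"
    using virtual_class_self[of x E] by (simp add: virtual_class_mem)
next
  assume *: "x - y \<in> exact_relations E"
  show "virtual_class E x = virtual_class E y"
    unfolding set_eq_iff virtual_class_mem
  proof
    fix z
    show "z - x \<in> exact_relations E \<longleftrightarrow> z - y \<in> exact_relations E"
      using relations_add[OF _ *, of "z - x"] relations_diff[OF _ *, of "z - y"] by (auto simp: algebra_simps)
  qed
qed

lemma virtual_class_member_carrier:
  "Poly_Mapping.keys x \<subseteq> reps E \<Longrightarrow> y \<in> virtual_class E x \<Longrightarrow> Poly_Mapping.keys y \<subseteq> reps E"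
  using keys_add_subset[OF relations_carrier, of "y - x" E x] by (simp add: virtual_class_mem)

lemma K_carrier: "carrier (K_ring E) = virtual_class E ` {x. Poly_Mapping.keys x \<subseteq> reps E}"
proof -
  have "carrier (virtual_group E) = {x. Poly_Mapping.keys x \<subseteq> reps E}" by auto
  then show ?thesis
    by (auto simp: K_ring_def carrier_FactGroup virtual_class_def)
qed

lemma K_carrierI [intro]: "Poly_Mapping.keys x \<subseteq> reps E \<Longrightarrow> virtual_class E x \<in> carrier (K_ring E)"
  by (auto simp: K_carrier)

lemma K_carrierE:
  assumes "U \<in> carrier (K_ring E)"
  obtains x where "Poly_Mapping.keys x \<subseteq> reps E" "U = virtual_class E x"
  using assms by (auto simp: K_carrier)

lemma K_add:
  assumes "Poly_Mapping.keys x \<subseteq> reps E" "Poly_Mapping.keys y \<subseteq> reps E"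
  shows "virtual_class E x \<oplus>\<^bsub>K_ring E\<^esub> virtual_class E y = virtual_class E (x + y)"
  using normal.rcos_sum[OF relations_normal, of x E y] assms
  by (simp add: K_ring_def virtual_class_def)

text \<open>Multiplication is a union over all representatives. The relations are stable under
  tensoring from either side, so all the cosets in the union coincide.\<close>

lemma K_mult:
  assumes "Poly_Mapping.keys x \<subseteq> reps E" "Poly_Mapping.keys y \<subseteq> reps E"
  shows "virtual_class E x \<otimes>\<^bsub>K_ring E\<^esub> virtual_class E y = virtual_class E (virtual_tensor x y)"
proof -
  have "virtual_class E (virtual_tensor x' y') = virtual_class E (virtual_tensor x y)"
    if "x' \<in> virtual_class E x" "y' \<in> virtual_class E y" for x' y'
  proof -
    have "virtual_tensor x' y' - virtual_tensor x y =
        virtual_tensor (x' - x) y' + virtual_tensor x (y' - y)"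
      by (simp add: virtual_tensor_diff_left virtual_tensor_diff_right)
    also have "\<dots> \<in> exact_relations E"
      using that assms virtual_class_member_carrier[OF assms(2) that(2)]
      by (intro relations_add relations_tensor_left relations_tensor_right) (auto simp: virtual_class_mem)
    finally show ?thesis by (simp add: virtual_class_eq)
  qed
  then have "(\<Union>x'\<in>virtual_class E x. \<Union>y'\<in>virtual_class E y. virtual_class E (virtual_tensor x' y')) =
      (\<Union>x'\<in>virtual_class E x. \<Union>y'\<in>virtual_class E y. virtual_class E (virtual_tensor x y))"
    by auto
  also have "\<dots> = virtual_class E (virtual_tensor x y)"
    using virtual_class_self[of x E] virtual_class_self[of y E] by auto
  finally show ?thesis by (simp add: K_ring_def)
qed

lemma K_dual_class:
  "K_dual E (virtual_class E x) = virtual_class E (virtual_dual E x)"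
proof -
  have "virtual_class E (virtual_dual E x') = virtual_class E (virtual_dual E x)"
    if "x' \<in> virtual_class E x" for x'
  proof -
    have "virtual_dual E (x' - x) \<in> exact_relations E"
      using that by (intro relations_dual) (simp add: virtual_class_mem)
    then show ?thesis by (simp add: virtual_class_eq)
  qed
  then have "K_dual E (virtual_class E x) = (\<Union>x'\<in>virtual_class E x. virtual_class E (virtual_dual E x))"
    unfolding K_dual_def by (intro SUP_cong refl)
  also have "\<dots> = virtual_class E (virtual_dual E x)"
    using virtual_class_self[of x E] by blast
  finally show ?thesis .
qed

lemma K_zero: "\<zero>\<^bsub>K_ring E\<^esub> = virtual_class E 0"
proof -
  have "virtual_class E 0 = exact_relations E"
    by (auto simp: virtual_class_mem)
  then show ?thesis by (simp add: K_ring_def)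
qed

lemma K_one: "\<one>\<^bsub>K_ring E\<^esub> = rep_class E rep_trivial"
  by (simp add: K_ring_def)

lemma K_abelian_group: "abelian_group (K_ring E)"
proof -
  have "add_monoid (K_ring E) = virtual_group E Mod exact_relations E"
    by (simp add: K_ring_def)
  moreover have "comm_group (virtual_group E Mod exact_relations E)"
    using comm_group.abelian_FactGroup[OF virtual_group_comm relations_subgroup] .
  ultimately have "comm_group (add_monoid (K_ring E))" by simp
  then show ?thesis
    by (intro abelian_group.intro abelian_monoid.intro abelian_group_axioms.intro comm_group.axioms(1))
qed

lemma K_a_inv:
  assumes "Poly_Mapping.keys x \<subseteq> reps E"
  shows "\<ominus>\<^bsub>K_ring E\<^esub> virtual_class E x = virtual_class E (- x)"
proof -
  interpret abelian_group "K_ring E" by (rule K_abelian_group)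
  have "virtual_class E (- x) \<oplus>\<^bsub>K_ring E\<^esub> virtual_class E x = \<zero>\<^bsub>K_ring E\<^esub>"
    using assms by (simp add: K_add K_zero)
  then show ?thesis
    using assms by (intro minus_equality) (simp_all add: K_carrierI)
qed

section \<open>Characters and dimensions of classes\<close>

definition virtual_char :: "(weil_rep \<Rightarrow>\<^sub>0 int) \<Rightarrow> weil \<Rightarrow> complex" where
  "virtual_char x g = (\<Sum>\<rho>\<in>Poly_Mapping.keys x. of_int (Poly_Mapping.lookup x \<rho>) * mat_tr (\<rho> g))"

lemma virtual_char_add: "virtual_char (x + y) g = virtual_char x g + virtual_char y g"
  unfolding virtual_char_def
  using setsum_keys_plus_distrib[of "\<lambda>\<rho> c. of_int c * mat_tr (\<rho> g)" x y] by (simp add: algebra_simps)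

lemma virtual_char_simps [simp]:
  "virtual_char 0 g = 0" "virtual_char (frag_of \<rho>) g = mat_tr (\<rho> g)"
  "virtual_char (- x) g = - virtual_char x g"
  "virtual_char (x - y) g = virtual_char x g - virtual_char y g"
proof -
  show "virtual_char 0 g = 0" "virtual_char (frag_of \<rho>) g = mat_tr (\<rho> g)"
    by (simp_all add: virtual_char_def)
  show *: "virtual_char (- x) g = - virtual_char x g" for x
    using virtual_char_add[of x "- x" g] by (simp add: virtual_char_def eq_neg_iff_add_eq_0 add.commute)
  show "virtual_char (x - y) g = virtual_char x g - virtual_char y g"
    using virtual_char_add[of x "- y" g] * by simp
qed

lemma virtual_char_relations:
  assumes "x \<in> exact_relations E" "g \<in> carrier (weil_group E)"
  shows "virtual_char x g = 0"
  using assms(1)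
proof (induction rule: relations_induct)
  case (exact \<rho>' \<rho> \<rho>'')
  then show ?case using mat_tr_short_exact[OF exact assms(2)] by simp
qed (auto simp: virtual_char_add)

lemma virtual_char_dim:
  assumes "Poly_Mapping.keys x \<subseteq> reps E"
  shows "virtual_char x (False, 1) = of_int (virtual_dim x)"
proof -
  have "mat_tr (\<rho> (False, 1)) = of_nat (rep_dim \<rho>)" if "\<rho> \<in> Poly_Mapping.keys x" for \<rho>
  proof -
    have "\<rho> (False, 1) = 1\<^sub>m (rep_dim \<rho>)"
      using that assms by (intro rep_one[of E] is_rep_rep_dim) auto
    then show ?thesis by (simp add: mat_tr_def)
  qed
  then show ?thesis by (simp add: virtual_char_def virtual_dim_def)
qed

text \<open>The representative is arbitrary: at elements of the group the value does not depend on
  it, because characters vanish on \<open>exact_relations\<close>.\<close>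

definition K_char :: "weil_class \<Rightarrow> weil \<Rightarrow> complex" where
  "K_char U g = virtual_char (SOME x. x \<in> U) g"

lemma K_char_class:
  assumes "g \<in> carrier (weil_group E)"
  shows "K_char (virtual_class E x) g = virtual_char x g"
proof -
  have "(SOME y. y \<in> virtual_class E x) \<in> virtual_class E x"
    using virtual_class_self by (rule someI)
  then show ?thesis
    using virtual_char_relations[OF _ assms] unfolding K_char_def virtual_class_mem
    by fastforce
qed

text \<open>The dimension is the value of the character at the identity, hence constant on the
  coset, as \<open>the_elem\<close> in \<open>K_dim\<close> requires.\<close>

lemma K_dim_class:
  assumes "Poly_Mapping.keys x \<subseteq> reps E"
  shows "K_dim (virtual_class E x) = virtual_dim x"
proof -
  have "virtual_dim y = virtual_dim x" if "y \<in> virtual_class E x" for y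
  proof -
    have "virtual_char y (False, 1) = virtual_char x (False, 1)"
      using virtual_char_relations[of "y - x" E "(False, 1)"] that weil_one_carrier
      by (simp add: virtual_class_mem)
    then show ?thesis
      using virtual_char_dim[OF assms] virtual_char_dim[OF virtual_class_member_carrier[OF assms that]] by simp
  qed
  then have "virtual_dim ` virtual_class E x = {virtual_dim x}"
    using virtual_class_self[of x E] by blast
  then show ?thesis by (simp add: K_dim_def)
qed

lemma K_dim_add:
  assumes "U \<in> carrier (K_ring E)" "V \<in> carrier (K_ring E)"
  shows "K_dim (U \<oplus>\<^bsub>K_ring E\<^esub> V) = K_dim U + K_dim V"
proof -
  obtain x y where xy: "Poly_Mapping.keys x \<subseteq> reps E" "U = virtual_class E x"
    "Poly_Mapping.keys y \<subseteq> reps E" "V = virtual_class E y"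
    using assms by (metis K_carrierE)
  have "complex_of_int (virtual_dim (x + y)) = of_int (virtual_dim x + virtual_dim y)"
    using virtual_char_add[of x y "(False, 1)"] virtual_char_dim[OF keys_add_subset[OF xy(1,3)]]
      virtual_char_dim[OF xy(1)] virtual_char_dim[OF xy(3)] by simp
  then have "virtual_dim (x + y) = virtual_dim x + virtual_dim y"
    by (simp only: of_int_eq_iff)
  then show ?thesis
    using xy by (simp add: K_add K_dim_class keys_add_subset)
qed

lemma rep_class_carrier: "\<rho> \<in> reps E \<Longrightarrow> rep_class E \<rho> \<in> carrier (K_ring E)"
  by (auto simp: rep_class_def)

lemma K_dim_rep_class: "is_rep E n \<rho> \<Longrightarrow> K_dim (rep_class E \<rho>) = int n"
  using K_dim_class[of "frag_of \<rho>" E] repsI[of E n \<rho>] rep_dim_eq[of E n \<rho>]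
  by (simp add: rep_class_def virtual_dim_def)

lemma rep_class_exact:
  assumes "short_exact E \<rho>' \<rho> \<rho>''"
  shows "rep_class E \<rho> = rep_class E \<rho>' \<oplus>\<^bsub>K_ring E\<^esub> rep_class E \<rho>''"
proof -
  have "frag_of \<rho> - (frag_of \<rho>' + frag_of \<rho>'') \<in> exact_relations E"
    using relations_exact[OF assms] by (simp add: diff_diff_eq)
  then show ?thesis
    using short_exact_reps[OF assms] by (simp add: rep_class_def K_add virtual_class_eq)
qed

lemma rep_class_tensor:
  "\<rho> \<in> reps E \<Longrightarrow> \<sigma> \<in> reps E \<Longrightarrow>
    rep_class E \<rho> \<otimes>\<^bsub>K_ring E\<^esub> rep_class E \<sigma> = rep_class E (rep_tensor \<rho> \<sigma>)"
  by (simp add: rep_class_def K_mult virtual_tensor_of)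

lemma rep_class_dual: "K_dual E (rep_class E \<rho>) = rep_class E (rep_dual E \<rho>)"
  by (simp add: rep_class_def K_dual_class)

lemma pairing_product_carrier:
  assumes "U \<in> carrier (K_ring E)" "V \<in> carrier (K_ring E)"
  shows "U \<otimes>\<^bsub>K_ring E\<^esub> K_dual E V \<in> carrier (K_ring E)"
proof -
  obtain x y where xy: "Poly_Mapping.keys x \<subseteq> reps E" "U = virtual_class E x"
    "Poly_Mapping.keys y \<subseteq> reps E" "V = virtual_class E y"
    using assms by (metis K_carrierE)
  then show ?thesis
    by (simp add: K_dual_class K_mult keys_virtual_dual keys_virtual_tensor K_carrierI)
qed

lemma pairing_product_add:
  assumes "U \<in> carrier (K_ring E)" "V \<in> carrier (K_ring E)" "W \<in> carrier (K_ring E)"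
  shows "(U \<oplus>\<^bsub>K_ring E\<^esub> V) \<otimes>\<^bsub>K_ring E\<^esub> K_dual E W =
      (U \<otimes>\<^bsub>K_ring E\<^esub> K_dual E W) \<oplus>\<^bsub>K_ring E\<^esub> (V \<otimes>\<^bsub>K_ring E\<^esub> K_dual E W)"
    and "W \<otimes>\<^bsub>K_ring E\<^esub> K_dual E (U \<oplus>\<^bsub>K_ring E\<^esub> V) =
      (W \<otimes>\<^bsub>K_ring E\<^esub> K_dual E U) \<oplus>\<^bsub>K_ring E\<^esub> (W \<otimes>\<^bsub>K_ring E\<^esub> K_dual E V)"
proof -
  obtain x y z where "Poly_Mapping.keys x \<subseteq> reps E" "U = virtual_class E x"
    "Poly_Mapping.keys y \<subseteq> reps E" "V = virtual_class E y"
    "Poly_Mapping.keys z \<subseteq> reps E" "W = virtual_class E z"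
    using assms by (metis K_carrierE)
  then show "(U \<oplus>\<^bsub>K_ring E\<^esub> V) \<otimes>\<^bsub>K_ring E\<^esub> K_dual E W =
      (U \<otimes>\<^bsub>K_ring E\<^esub> K_dual E W) \<oplus>\<^bsub>K_ring E\<^esub> (V \<otimes>\<^bsub>K_ring E\<^esub> K_dual E W)"
    "W \<otimes>\<^bsub>K_ring E\<^esub> K_dual E (U \<oplus>\<^bsub>K_ring E\<^esub> V) =
      (W \<otimes>\<^bsub>K_ring E\<^esub> K_dual E U) \<oplus>\<^bsub>K_ring E\<^esub> (W \<otimes>\<^bsub>K_ring E\<^esub> K_dual E V)"
    by (simp_all add: K_dual_class K_mult K_add keys_virtual_dual keys_virtual_tensor keys_add_subset
        virtual_tensor_add_left virtual_tensor_add_right)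
qed

section \<open>Characters of the unit circle and induced representations\<close>

definition eta_pow :: "int \<Rightarrow> complex \<Rightarrow> complex" where
  "eta_pow v z = eta z powi v"

lemma eta_nonzero: "z \<noteq> 0 \<Longrightarrow> eta z \<noteq> 0"
  by (simp add: eta_def)

lemma eta_mult: "eta (z * w) = eta z * eta w"
  by (simp add: eta_def norm_mult)

lemma eta_inverse: "eta (inverse z) = inverse (eta z)"
  by (simp add: eta_def norm_inverse divide_inverse)

lemma eta_cnj: "z \<noteq> 0 \<Longrightarrow> eta (cnj z) = inverse (eta z)"
proof -
  assume z: "z \<noteq> 0"
  have "eta (cnj z) * eta z = (z * cnj z) / (complex_of_real (cmod z))\<^sup>2"
    by (simp add: eta_def power2_eq_square)
  also have "z * cnj z = (complex_of_real (cmod z))\<^sup>2"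
    using complex_norm_square[of z] by simp
  finally show ?thesis
    using z eta_nonzero[OF z] by (simp add: field_simps)
qed

lemma eta_pow_mult: "eta_pow v (z * w) = eta_pow v z * eta_pow v w"
  by (simp add: eta_pow_def eta_mult power_int_mult_distrib)

lemma eta_pow_inverse: "eta_pow v (inverse z) = eta_pow (- v) z"
  by (simp add: eta_pow_def eta_inverse power_int_inverse power_int_minus)

lemma eta_pow_cnj: "z \<noteq> 0 \<Longrightarrow> eta_pow v (cnj z) = eta_pow (- v) z"
  by (simp add: eta_pow_def eta_cnj power_int_inverse power_int_minus)

lemma eta_pow_minus: "eta_pow v (- z) = (- 1) powi v * eta_pow v z"
  using eta_pow_mult[of v "- 1" z] by (simp add: eta_pow_def eta_def)

lemma eta_pow_add: "z \<noteq> 0 \<Longrightarrow> eta_pow (v + u) z = eta_pow v z * eta_pow u z"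
  by (simp add: eta_pow_def power_int_add eta_nonzero)

lemma eta_pow_nonneg [simp]: "t > 0 \<Longrightarrow> eta_pow v (complex_of_real t) = 1"
  by (simp add: eta_pow_def eta_def)

lemma eta_pow_one [simp]: "eta_pow v 1 = 1"
  by (simp add: eta_pow_def eta_def)

lemma eta_pow_0 [simp]: "eta_pow 0 z = 1"
  by (simp add: eta_pow_def)

lemma continuous_on_eta_pow: "continuous_on (- {0}) (eta_pow v)"
  unfolding eta_pow_def[abs_def] eta_def[abs_def]
  by (intro continuous_intros) auto

lemma minus_one_powi_sq: "(- 1 :: complex) powi v * (- 1) powi v = 1"
  by (simp flip: power_int_mult_distrib)

lemma minus_one_powi_uminus: "(- 1 :: complex) powi (- v) = (- 1) powi v"
  by (simp add: power_int_minus flip: power_int_inverse)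

definition mat2 :: "complex \<Rightarrow> complex \<Rightarrow> complex \<Rightarrow> complex \<Rightarrow> complex mat" where
  "mat2 a b c d = Matrix.mat 2 2 (\<lambda>(i, k). if i = 0 then (if k = 0 then a else b) else (if k = 0 then c else d))"

lemma mat2_carrier [simp]: "mat2 a b c d \<in> carrier_mat 2 2"
  by (simp add: mat2_def)

lemma mat2_dim [simp]: "dim_row (mat2 a b c d) = 2" "dim_col (mat2 a b c d) = 2"
  by (simp_all add: mat2_def)

lemma mat2_index [simp]:
  "mat2 a b c d $$ (0, 0) = a" "mat2 a b c d $$ (0, Suc 0) = b"
  "mat2 a b c d $$ (Suc 0, 0) = c" "mat2 a b c d $$ (Suc 0, Suc 0) = d"
  by (simp_all add: mat2_def)

lemma less_2: "(i::nat) < 2 \<longleftrightarrow> i = 0 \<or> i = Suc 0"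
  by auto

lemma mat2_eqI:
  assumes "A \<in> carrier_mat 2 2" "A $$ (0, 0) = a" "A $$ (0, Suc 0) = b"
    "A $$ (Suc 0, 0) = c" "A $$ (Suc 0, Suc 0) = d"
  shows "A = mat2 a b c d"
  by (rule eq_matI) (use assms in \<open>auto simp: mat2_def less_2\<close>)

lemma atLeast0_less_2: "{0..<2::nat} = {0, Suc 0}"
  by auto

lemma mat2_mult: "mat2 a b c d * mat2 a' b' c' d' =
    mat2 (a * a' + b * c') (a * b' + b * d') (c * a' + d * c') (c * b' + d * d')"
  by (rule mat2_eqI[OF mult_carrier_mat[OF mat2_carrier mat2_carrier]])
    (simp_all add: mat2_def scalar_prod_def atLeast0_less_2)

lemma mat2_one: "mat2 1 0 0 1 = 1\<^sub>m 2"
  by (rule mat2_eqI[symmetric]) auto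

lemma mat2_transpose: "transpose_mat (mat2 a b c d) = mat2 a c b d"
  by (rule mat2_eqI) (simp_all add: mat2_def)

lemma mat2_tr: "mat_tr (mat2 a b c d) = a + d"
  by (simp add: mat_tr_def mat2_def lessThan_Suc numeral_2_eq_2)

lemma mat11_mult: "Matrix.mat 1 1 (\<lambda>_. a) * Matrix.mat 1 1 (\<lambda>_. b) = Matrix.mat 1 1 (\<lambda>_. a * b :: complex)"
  by (rule eq_matI) (auto simp: scalar_prod_def)

lemma mat11_one: "Matrix.mat 1 1 (\<lambda>_. 1 :: complex) = 1\<^sub>m 1"
  by (rule eq_matI) auto

lemma rep_eta_apply: "rep_eta v (b, z) = Matrix.mat 1 1 (\<lambda>_. eta_pow v z)"
  by (simp add: rep_eta_def eta_pow_def)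

lemma is_rep_eta: "is_rep Complex_field 1 (rep_eta v)"
  unfolding is_rep_def
proof (intro conjI ballI allI impI)
  fix g h assume "g \<in> carrier (weil_group Complex_field)" "h \<in> carrier (weil_group Complex_field)"
  then show "rep_eta v (g \<otimes>\<^bsub>weil_group Complex_field\<^esub> h) = rep_eta v g * rep_eta v h"
    by (cases g; cases h) (simp add: weil_carrier weil_mult rep_eta_apply mat11_mult eta_pow_mult del: One_nat_def)
next
  fix i k :: nat assume "i < 1" "k < 1"
  then show "continuous_on (carrier (weil_group Complex_field)) (\<lambda>g. rep_eta v g $$ (i, k))"
    by (intro continuous_on_weil) (simp_all add: rep_eta_apply continuous_on_eta_pow)
qed (auto simp: rep_eta_apply weil_one mat11_one)

lemma is_rep_trivial: "is_rep E 1 rep_trivial"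
  by (auto simp: is_rep_def rep_trivial_def)

lemma rep_sign_apply: "rep_sign (b, z) = Matrix.mat 1 1 (\<lambda>_. if b then - 1 else 1)"
  by (simp add: rep_sign_def)

lemma is_rep_sign: "is_rep Real_field 1 rep_sign"
  unfolding is_rep_def
proof (intro conjI ballI allI impI)
  fix g h assume "g \<in> carrier (weil_group Real_field)" "h \<in> carrier (weil_group Real_field)"
  then show "rep_sign (g \<otimes>\<^bsub>weil_group Real_field\<^esub> h) = rep_sign g * rep_sign h"
    by (cases g; cases h) (auto simp add: weil_mult rep_sign_apply mat11_mult simp del: One_nat_def)
next
  fix i k :: nat assume "i < 1" "k < 1"
  then show "continuous_on (carrier (weil_group Real_field)) (\<lambda>g. rep_sign g $$ (i, k))"
    by (intro continuous_on_weil) (simp_all add: rep_sign_apply)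
qed (auto simp: rep_sign_apply weil_one mat11_one)

lemma rep_induced_False:
  assumes "z \<noteq> 0"
  shows "rep_induced v (False, z) = mat2 (eta_pow v z) 0 0 (eta_pow (- v) z)"
  by (rule mat2_eqI)
    (use assms in \<open>simp_all add: rep_induced_def weil_inv weil_carrier weil_mult Let_def
      eta_pow_def[symmetric] eta_pow_cnj\<close>)

text \<open>The entry at \<open>(0, 1)\<close> is the character at \<open>j z j = - cnj z\<close>;
  its sign comes from \<open>j\<^sup>2 = - 1\<close>.\<close>

lemma rep_induced_True:
  assumes "z \<noteq> 0"
  shows "rep_induced v (True, z) = mat2 0 ((- 1) powi v * eta_pow (- v) z) (eta_pow v z) 0"
  by (rule mat2_eqI)
    (use assms in \<open>simp_all add: rep_induced_def weil_inv weil_carrier weil_mult Let_def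
      eta_pow_def[symmetric] eta_pow_cnj eta_pow_minus\<close>)

lemmas rep_induced_apply = rep_induced_False rep_induced_True

lemma is_rep_induced: "is_rep Real_field 2 (rep_induced v)"
  unfolding is_rep_def
proof (intro conjI ballI allI impI)
  let ?G = "weil_group Real_field"
  fix g assume g: "g \<in> carrier ?G"
  obtain a z where [simp]: "g = (a, z)" by (cases g)
  have z: "z \<noteq> 0" using g by (simp add: weil_carrier)
  show "rep_induced v g \<in> carrier_mat 2 2"
    using z by (cases a) (simp_all add: rep_induced_apply)
  fix h assume h: "h \<in> carrier ?G"
  obtain b w where [simp]: "h = (b, w)" by (cases h)
  have w: "w \<noteq> 0" using h by (simp add: weil_carrier)
  show "rep_induced v (g \<otimes>\<^bsub>?G\<^esub> h) = rep_induced v g * rep_induced v h"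
    using z w minus_one_powi_sq[of v]
    by (cases a; cases b)
      (simp_all add: weil_mult rep_induced_apply mat2_mult eta_pow_mult eta_pow_cnj eta_pow_minus
        minus_one_powi_uminus mult_ac)
next
  fix i k :: nat assume "i < 2" "k < 2"
  have c1: "continuous_on (- {0}) (\<lambda>z. rep_induced v (False, z) $$ (i, k))"
    by (rule continuous_on_eq[of _ "\<lambda>z. mat2 (eta_pow v z) 0 0 (eta_pow (- v) z) $$ (i, k)"])
      (use \<open>i < 2\<close> \<open>k < 2\<close> in \<open>auto simp: less_2 rep_induced_apply continuous_on_eta_pow\<close>)
  have c2: "continuous_on (- {0}) (\<lambda>z. rep_induced v (True, z) $$ (i, k))"
    by (rule continuous_on_eq[of _ "\<lambda>z. mat2 0 ((- 1) powi v * eta_pow (- v) z) (eta_pow v z) 0 $$ (i, k)"])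
      (use \<open>i < 2\<close> \<open>k < 2\<close> in \<open>auto simp: less_2 rep_induced_apply continuous_on_eta_pow
        intro!: continuous_on_mult\<close>)
  from c1 c2 show "continuous_on (carrier (weil_group Real_field)) (\<lambda>g. rep_induced v g $$ (i, k))"
    by (rule continuous_on_weil)
qed (auto simp: rep_induced_apply weil_one mat2_one)

lemma rep_dual_induced:
  assumes "g \<in> carrier (weil_group Real_field)"
  shows "rep_dual Real_field (rep_induced v) g = rep_induced (- v) g"
proof -
  obtain a z where [simp]: "g = (a, z)" by (cases g)
  have z: "z \<noteq> 0" using assms by (simp add: weil_carrier)
  show ?thesis
    using assms z minus_one_powi_sq[of v]
    by (cases a) (simp_all add: rep_dual_def weil_inv rep_induced_apply mat2_transpose
        eta_pow_inverse eta_pow_minus eta_pow_cnj minus_one_powi_uminus)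
qed

lemma less_4: "(i::nat) < 4 \<longleftrightarrow> i = 0 \<or> i = 1 \<or> i = 2 \<or> i = 3"
  by auto

lemma atLeast0_less_4: "{0..<4::nat} = {0, 1, 2, 3}"
  by auto

lemma mat2_kronecker_index:
  assumes "i < 4" "k < 4"
  shows "kronecker (mat2 a b c d) (mat2 a' b' c' d') $$ (i, k) =
    mat2 a b c d $$ (i div 2, k div 2) * mat2 a' b' c' d' $$ (i mod 2, k mod 2)"
  using assms by (intro kronecker_index[of _ 2 2 _ 2 2]) auto

lemma kronecker_mat2_carrier: "kronecker (mat2 a b c d) (mat2 a' b' c' d') \<in> carrier_mat 4 4"
  using kronecker_carrier[OF mat2_carrier[of a b c d] mat2_carrier[of a' b' c' d']] by simp

lemma kronecker_mat2_dim [simp]: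
  "dim_row (kronecker (mat2 a b c d) (mat2 a' b' c' d')) = 4"
  "dim_col (kronecker (mat2 a b c d) (mat2 a' b' c' d')) = 4"
  using kronecker_mat2_carrier[of a b c d a' b' c' d'] by auto

text \<open>
  If \<open>e\<^sub>0, e\<^sub>1\<close> and \<open>f\<^sub>0, f\<^sub>1\<close> are the standard bases of the two factors, the subrepresentation is
  spanned by \<open>e\<^sub>0 \<otimes> f\<^sub>0, e\<^sub>1 \<otimes> f\<^sub>1\<close>, with complement spanned by \<open>e\<^sub>0 \<otimes> f\<^sub>1, \<plusminus> e\<^sub>1 \<otimes> f\<^sub>0\<close>.
\<close>

lemma short_exact_induced_tensor:
  "short_exact Real_field (rep_induced (a + c)) (rep_tensor (rep_induced a) (rep_induced c))
    (rep_induced (a - c))"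
proof -
  define s :: complex where "s = (- 1) powi c"
  have ss: "s * s = 1" unfolding s_def by (rule minus_one_powi_sq)
  have s1: "(- 1 :: complex) powi (a + c) = (- 1) powi a * s" "(- 1 :: complex) powi (a - c) = (- 1) powi a * s"
    by (simp_all add: s_def power_int_add diff_conv_add_uminus minus_one_powi_uminus del: add_uminus_conv_diff)
  define A where "A = Matrix.mat 4 2 (\<lambda>(i, k). if i = 0 \<and> k = 0 \<or> i = 3 \<and> k = Suc 0 then 1 else 0 :: complex)"
  define R where "R = Matrix.mat 2 4 (\<lambda>(k, i). if i = 0 \<and> k = 0 \<or> i = 3 \<and> k = Suc 0 then 1 else 0 :: complex)"
  define B where "B = Matrix.mat 2 4 (\<lambda>(k, i). if i = Suc 0 \<and> k = 0 then 1 else if i = 2 \<and> k = Suc 0 then s else 0)"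
  define S where "S = Matrix.mat 4 2 (\<lambda>(i, k). if i = Suc 0 \<and> k = 0 then 1 else if i = 2 \<and> k = Suc 0 then s else 0)"
  note d = A_def R_def B_def S_def
  have "split_exact Real_field (rep_induced (a + c)) (rep_tensor (rep_induced a) (rep_induced c))
    (rep_induced (a - c)) 2 4 2 A R B S"
    unfolding split_exact_def
  proof (intro conjI ballI)
    fix g assume g: "g \<in> carrier (weil_group Real_field)"
    obtain b z where [simp]: "g = (b, z)" by (cases g)
    have z: "z \<noteq> 0" using g by (simp add: weil_carrier)
    have T: "rep_tensor (rep_induced a) (rep_induced c) g \<in> carrier_mat 4 4"
      using z by (cases b) (simp_all add: rep_tensor_def rep_induced_apply kronecker_mat2_carrier)
    have e: "eta_pow (a + c) z = eta_pow a z * eta_pow c z"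
      "eta_pow (- a - c) z = eta_pow (- a) z * eta_pow (- c) z"
      "eta_pow (a - c) z = eta_pow a z * eta_pow (- c) z"
      "eta_pow (c - a) z = eta_pow (- a) z * eta_pow c z"
      using eta_pow_add[OF z, of a c] eta_pow_add[OF z, of "- a" "- c"]
        eta_pow_add[OF z, of a "- c"] eta_pow_add[OF z, of "- a" c] by (simp_all add: algebra_simps)
    show "A * rep_induced (a + c) g = rep_tensor (rep_induced a) (rep_induced c) g * A"
    proof (rule eq_matI)
      fix i k assume "i < dim_row (rep_tensor (rep_induced a) (rep_induced c) g * A)"
        "k < dim_col (rep_tensor (rep_induced a) (rep_induced c) g * A)"
      then have ik: "i < 4" "k < 2" using T by (auto simp: A_def)
      show "(A * rep_induced (a + c) g) $$ (i, k) = (rep_tensor (rep_induced a) (rep_induced c) g * A) $$ (i, k)"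
        using ik z T is_rep_carrier[OF is_rep_induced g, of "a + c"] unfolding less_2 less_4
        by (cases b) (auto simp: rep_tensor_def rep_induced_apply scalar_prod_def atLeast0_less_2
            atLeast0_less_4 A_def mat2_kronecker_index e s1 s_def[symmetric])
    qed (use T is_rep_carrier[OF is_rep_induced g, of "a + c"] in \<open>auto simp: A_def\<close>)
    show "B * rep_tensor (rep_induced a) (rep_induced c) g = rep_induced (a - c) g * B"
    proof (rule eq_matI)
      fix i k assume "i < dim_row (rep_induced (a - c) g * B)" "k < dim_col (rep_induced (a - c) g * B)"
      then have ik: "i < 2" "k < 4" using is_rep_carrier[OF is_rep_induced g, of "a - c"] by (auto simp: B_def)
      show "(B * rep_tensor (rep_induced a) (rep_induced c) g) $$ (i, k) = (rep_induced (a - c) g * B) $$ (i, k)"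
        using ik z T is_rep_carrier[OF is_rep_induced g, of "a - c"] ss unfolding less_2 less_4
        by (cases b) (auto simp: rep_tensor_def rep_induced_apply scalar_prod_def atLeast0_less_2
            atLeast0_less_4 B_def mat2_kronecker_index e s1 s_def[symmetric] mult_ac)
    qed (use T is_rep_carrier[OF is_rep_induced g, of "a - c"] in \<open>auto simp: B_def\<close>)
  next
    show "R * A = 1\<^sub>m 2"
      by (rule eq_matI) (auto simp: d less_2 scalar_prod_def atLeast0_less_4)
    show "B * S = 1\<^sub>m 2"
      by (rule eq_matI) (auto simp: d less_2 scalar_prod_def atLeast0_less_4 ss)
    show "B * A = 0\<^sub>m 2 2"
      by (rule eq_matI) (auto simp: d less_2 scalar_prod_def atLeast0_less_4)
    show "A * R + S * B = 1\<^sub>m 4"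
      by (rule eq_matI) (auto simp: d less_4 scalar_prod_def atLeast0_less_2 ss)
    show "is_rep Real_field 4 (rep_tensor (rep_induced a) (rep_induced c))"
      using is_rep_tensor[OF is_rep_induced is_rep_induced] by simp
  qed (simp_all add: d is_rep_induced)
  then show ?thesis by (rule split_exact_imp)
qed

text \<open>The trivial representation sits on the diagonal, and \<open>j\<close>, which swaps the
  two coordinates, acts by -1 on their difference. This removes the case distinction in the
  definition of \<open>I_class\<close>.\<close>

lemma short_exact_induced_0: "short_exact Real_field rep_trivial (rep_induced 0) rep_sign"
proof -
  define A where "A = Matrix.mat 2 1 (\<lambda>_. 1 :: complex)"
  define R where "R = Matrix.mat 1 2 (\<lambda>_. 1 / 2 :: complex)"
  define B where "B = Matrix.mat 1 2 (\<lambda>(_, k). if k = 0 then 1 else - 1 :: complex)"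
  define S where "S = Matrix.mat 2 1 (\<lambda>(k, _). if k = 0 then 1 / 2 else - 1 / 2 :: complex)"
  note d = A_def R_def B_def S_def
  have "split_exact Real_field rep_trivial (rep_induced 0) rep_sign 1 2 1 A R B S"
    unfolding split_exact_def
  proof (intro conjI ballI)
    fix g assume g: "g \<in> carrier (weil_group Real_field)"
    obtain b z where [simp]: "g = (b, z)" by (cases g)
    have z: "z \<noteq> 0" using g by (simp add: weil_carrier)
    note c = is_rep_carrier[OF is_rep_induced g, of 0]
    show "A * rep_trivial g = rep_induced 0 g * A"
      by (rule eq_matI; cases b)
        (use z in \<open>auto simp: A_def rep_trivial_def less_2 scalar_prod_def atLeast0_less_2 rep_induced_apply mat2_def\<close>)
    show "B * rep_induced 0 g = rep_sign g * B"
      by (rule eq_matI; cases b)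
        (use z in \<open>auto simp: B_def rep_sign_apply less_2 scalar_prod_def atLeast0_less_2 rep_induced_apply mat2_def\<close>)
  next
    show "R * A = 1\<^sub>m 1"
      by (rule eq_matI) (auto simp: d scalar_prod_def)
    show "B * S = 1\<^sub>m 1"
      by (rule eq_matI) (auto simp: d scalar_prod_def atLeast0_less_2)
    show "B * A = 0\<^sub>m 1 1"
      by (rule eq_matI) (auto simp: d scalar_prod_def atLeast0_less_2)
    show "A * R + S * B = 1\<^sub>m 2"
      by (rule eq_matI) (auto simp: d less_2 scalar_prod_def)
  qed (simp_all add: d is_rep_induced is_rep_trivial is_rep_sign del: One_nat_def)
  then show ?thesis by (rule split_exact_imp)
qed

section \<open>Identities between classes\<close>

lemma is_rep_zero: "is_rep E 0 (\<lambda>_. 1\<^sub>m 0)"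
  by (auto simp: is_rep_def)

text \<open>The exact sequence formed by three zero representations gives
  \<open>U = U + U\<close>.\<close>

lemma rep_class_zero: "rep_class E (\<lambda>_. 1\<^sub>m 0) = \<zero>\<^bsub>K_ring E\<^esub>"
proof -
  interpret abelian_group "K_ring E" by (rule K_abelian_group)
  have "split_exact E (\<lambda>_. 1\<^sub>m 0) (\<lambda>_. 1\<^sub>m 0) (\<lambda>_. 1\<^sub>m 0) 0 0 0 (1\<^sub>m 0) (1\<^sub>m 0) (1\<^sub>m 0) (1\<^sub>m 0)"
    unfolding split_exact_def
    by (intro conjI ballI is_rep_zero) (auto intro: eq_matI)
  from rep_class_exact[OF split_exact_imp[OF this]]
  show ?thesis
    using rep_class_carrier[OF repsI[OF is_rep_zero], of E] add.l_cancel_one' by metis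
qed

text \<open>Elements of \<open>reps E\<close> are functions on the whole type, so representations
  that agree on the group may be distinct generators. The exact sequence with identity inclusion and
  zero quotient identifies their classes.\<close>

lemma rep_class_cong:
  assumes r: "is_rep E n \<rho>" and s: "is_rep E n \<sigma>"
    and eq: "\<And>g. g \<in> carrier (weil_group E) \<Longrightarrow> \<rho> g = \<sigma> g"
  shows "rep_class E \<rho> = rep_class E \<sigma>"
proof -
  interpret abelian_group "K_ring E" by (rule K_abelian_group)
  have "split_exact E \<sigma> \<rho> (\<lambda>_. 1\<^sub>m 0) n n 0 (1\<^sub>m n) (1\<^sub>m n) (0\<^sub>m 0 n) (0\<^sub>m n 0)"
    unfolding split_exact_def
  proof (intro conjI ballI r s is_rep_zero)
    fix g assume g: "g \<in> carrier (weil_group E)"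
    note c = is_rep_carrier[OF s g]
    show "1\<^sub>m n * \<sigma> g = \<rho> g * 1\<^sub>m n" using eq[OF g] c by simp
    show "0\<^sub>m 0 n * \<rho> g = 1\<^sub>m 0 * 0\<^sub>m 0 n" using eq[OF g] c by (intro eq_matI) auto
  qed (auto intro: eq_matI)
  from rep_class_exact[OF split_exact_imp[OF this]]
  show ?thesis
    using rep_class_carrier[OF repsI[OF s]] by (simp add: rep_class_zero)
qed

lemma I_class_eq: "I_class v = rep_class Real_field (rep_induced v)"
  using rep_class_exact[OF short_exact_induced_0]
  by (simp add: I_class_def K_one sign_class_def)

lemma I_class_carrier: "I_class v \<in> carrier (K_ring Real_field)"
  unfolding I_class_eq by (intro rep_class_carrier repsI[OF is_rep_induced])

lemma eta_class_carrier: "eta_class v \<in> carrier (K_ring Complex_field)"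
  unfolding eta_class_def by (intro rep_class_carrier repsI[OF is_rep_eta])

lemma K_one_carrier: "\<one>\<^bsub>K_ring E\<^esub> \<in> carrier (K_ring E)"
  unfolding K_one by (intro rep_class_carrier repsI[OF is_rep_trivial])

lemma sign_class_carrier: "sign_class \<in> carrier (K_ring Real_field)"
  unfolding sign_class_def by (intro rep_class_carrier repsI[OF is_rep_sign])

lemma eta_class_product:
  "eta_class a \<otimes>\<^bsub>K_ring Complex_field\<^esub> K_dual Complex_field (eta_class b) = eta_class (a - b)"
proof -
  have "rep_class Complex_field (rep_tensor (rep_eta a) (rep_dual Complex_field (rep_eta b))) =
      rep_class Complex_field (rep_eta (a - b))"
  proof (rule rep_class_cong[of _ 1])
    fix g assume g: "g \<in> carrier (weil_group Complex_field)"
    obtain c z where [simp]: "g = (c, z)" by (cases g)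
    have z: "z \<noteq> 0" "\<not> c" using g by (simp_all add: weil_carrier)
    show "rep_tensor (rep_eta a) (rep_dual Complex_field (rep_eta b)) g = rep_eta (a - b) g"
      using z g eta_pow_add[OF z(1), of a "- b"]
      by (intro eq_matI)
        (auto simp: rep_tensor_def kronecker_def rep_dual_def rep_eta_apply weil_inv eta_pow_inverse)
  qed (use is_rep_tensor[OF is_rep_eta is_rep_dual[OF is_rep_eta], of a b] is_rep_eta in auto)
  then show ?thesis
    by (simp add: eta_class_def rep_class_dual rep_class_tensor repsI[OF is_rep_eta]
        repsI[OF is_rep_dual[OF is_rep_eta]])
qed

lemma rep_dual_induced_class:
  "K_dual Real_field (I_class b) = I_class (- b)"
  unfolding I_class_eq rep_class_dual
  by (intro rep_class_cong[of _ 2] is_rep_dual is_rep_induced rep_dual_induced)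

lemma I_class_product:
  "I_class a \<otimes>\<^bsub>K_ring Real_field\<^esub> K_dual Real_field (I_class b) =
    I_class (a - b) \<oplus>\<^bsub>K_ring Real_field\<^esub> I_class (a + b)"
  using rep_class_exact[OF short_exact_induced_tensor[of a "- b"]]
  unfolding rep_dual_induced_class
  by (simp add: I_class_eq rep_class_tensor repsI[OF is_rep_induced])

lemma K_dual_one: "K_dual E \<one>\<^bsub>K_ring E\<^esub> = \<one>\<^bsub>K_ring E\<^esub>"
  unfolding K_one rep_class_dual
  by (intro rep_class_cong[of _ 1] is_rep_dual is_rep_trivial) (simp add: rep_dual_def rep_trivial_def)

lemma one_I_product:
  "\<one>\<^bsub>K_ring Real_field\<^esub> \<otimes>\<^bsub>K_ring Real_field\<^esub> K_dual Real_field (I_class b) = I_class (- b)"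
  "I_class b \<otimes>\<^bsub>K_ring Real_field\<^esub> K_dual Real_field \<one>\<^bsub>K_ring Real_field\<^esub> = I_class b"
  "\<one>\<^bsub>K_ring E\<^esub> \<otimes>\<^bsub>K_ring E\<^esub> K_dual E \<one>\<^bsub>K_ring E\<^esub> = \<one>\<^bsub>K_ring E\<^esub>"
proof -
  have l: "rep_class E (rep_tensor rep_trivial \<rho>) = rep_class E \<rho>" if r: "is_rep E n \<rho>" for E n \<rho>
  proof (rule rep_class_cong[OF _ r])
    show "is_rep E n (rep_tensor rep_trivial \<rho>)" using is_rep_tensor[OF is_rep_trivial r] by simp
    fix g assume "g \<in> carrier (weil_group E)"
    from is_rep_carrier[OF r this] show "rep_tensor rep_trivial \<rho> g = \<rho> g"
      by (intro eq_matI) (auto simp: rep_tensor_def rep_trivial_def kronecker_def)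
  qed
  have r: "rep_class E (rep_tensor \<rho> rep_trivial) = rep_class E \<rho>" if r: "is_rep E n \<rho>" for E n \<rho>
  proof (rule rep_class_cong[OF _ r])
    show "is_rep E n (rep_tensor \<rho> rep_trivial)" using is_rep_tensor[OF r is_rep_trivial] by simp
    fix g assume "g \<in> carrier (weil_group E)"
    from is_rep_carrier[OF r this] show "rep_tensor \<rho> rep_trivial g = \<rho> g"
      by (intro eq_matI) (auto simp: rep_tensor_def rep_trivial_def kronecker_def)
  qed
  note repI = repsI[OF is_rep_induced] repsI[OF is_rep_trivial]
  show "\<one>\<^bsub>K_ring Real_field\<^esub> \<otimes>\<^bsub>K_ring Real_field\<^esub> K_dual Real_field (I_class b) = I_class (- b)"
    by (simp only: rep_dual_induced_class) (simp add: I_class_eq K_one rep_class_tensor repI l[OF is_rep_induced])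
  show "I_class b \<otimes>\<^bsub>K_ring Real_field\<^esub> K_dual Real_field \<one>\<^bsub>K_ring Real_field\<^esub> = I_class b"
    by (simp add: K_dual_one) (simp add: I_class_eq K_one rep_class_tensor repI r[OF is_rep_induced])
  show "\<one>\<^bsub>K_ring E\<^esub> \<otimes>\<^bsub>K_ring E\<^esub> K_dual E \<one>\<^bsub>K_ring E\<^esub> = \<one>\<^bsub>K_ring E\<^esub>"
    by (simp add: K_dual_one) (simp add: K_one rep_class_tensor repI r[OF is_rep_trivial])
qed

lemma K_dim_basis: "K_dim (eta_class v) = 1" "K_dim (I_class v) = 2" "K_dim \<one>\<^bsub>K_ring E\<^esub> = 1"
  using K_dim_rep_class[OF is_rep_eta] K_dim_rep_class[OF is_rep_induced] K_dim_rep_class[OF is_rep_trivial]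
  by (simp_all add: eta_class_def I_class_eq K_one)

text \<open>Block matrices, with the evident inclusion and projection. An actual representation in
  the class of the sum is what effectiveness of sums calls for.\<close>

lemma rep_direct_sum:
  assumes r: "is_rep E m \<rho>" and s: "is_rep E n \<sigma>"
  obtains \<tau> where "is_rep E (m + n) \<tau>" "rep_class E \<tau> = rep_class E \<rho> \<oplus>\<^bsub>K_ring E\<^esub> rep_class E \<sigma>"
proof -
  define \<tau> where "\<tau> = (\<lambda>g. four_block_mat (\<rho> g) (0\<^sub>m m n) (0\<^sub>m n m) (\<sigma> g))"
  have rep: "is_rep E (m + n) \<tau>"
    unfolding is_rep_def
  proof (intro conjI ballI allI impI)
    fix g assume g: "g \<in> carrier (weil_group E)"
    note cg = is_rep_carrier[OF r g] is_rep_carrier[OF s g]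
    show "\<tau> g \<in> carrier_mat (m + n) (m + n)"
      using cg by (simp add: \<tau>_def)
    fix h assume h: "h \<in> carrier (weil_group E)"
    note ch = is_rep_carrier[OF r h] is_rep_carrier[OF s h]
    have "\<tau> g * \<tau> h = four_block_mat (\<rho> g * \<rho> h + 0\<^sub>m m n * 0\<^sub>m n m) (\<rho> g * 0\<^sub>m m n + 0\<^sub>m m n * \<sigma> h)
        (0\<^sub>m n m * \<rho> h + \<sigma> g * 0\<^sub>m n m) (0\<^sub>m n m * 0\<^sub>m m n + \<sigma> g * \<sigma> h)"
      unfolding \<tau>_def by (rule mult_four_block_mat) (use cg ch in auto)
    also have "\<dots> = four_block_mat (\<rho> g * \<rho> h) (0\<^sub>m m n) (0\<^sub>m n m) (\<sigma> g * \<sigma> h)"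
      using cg ch by simp
    also have "\<dots> = \<tau> (g \<otimes>\<^bsub>weil_group E\<^esub> h)"
      using r s g h by (simp add: \<tau>_def is_rep_def)
    finally show "\<tau> (g \<otimes>\<^bsub>weil_group E\<^esub> h) = \<tau> g * \<tau> h" by simp
  next
    show "\<tau> \<one>\<^bsub>weil_group E\<^esub> = 1\<^sub>m (m + n)"
      using rep_one[OF r] rep_one[OF s] by (simp add: \<tau>_def weil_one four_block_one_mat)
  next
    fix t :: real assume "0 < t"
    then show "\<tau> (False, complex_of_real t) = 1\<^sub>m (m + n)"
      using r s by (simp add: \<tau>_def is_rep_def four_block_one_mat)
  next
    fix i k assume ik: "i < m + n" "k < m + n"
    have "continuous_on (carrier (weil_group E)) (\<lambda>g. if i < m then (if k < m then \<rho> g $$ (i, k) else 0)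
        else (if k < m then 0 else \<sigma> g $$ (i - m, k - m)))"
      using r s ik by (cases "i < m"; cases "k < m") (auto simp: is_rep_def)
    then show "continuous_on (carrier (weil_group E)) (\<lambda>g. \<tau> g $$ (i, k))"
    proof (rule continuous_on_eq)
      fix g assume g: "g \<in> carrier (weil_group E)"
      note cg = is_rep_carrier[OF r g] is_rep_carrier[OF s g]
      show "(if i < m then (if k < m then \<rho> g $$ (i, k) else 0)
        else (if k < m then 0 else \<sigma> g $$ (i - m, k - m))) = \<tau> g $$ (i, k)"
        using cg ik by (auto simp: \<tau>_def)
    qed
  qed
  define A where "A = Matrix.mat (m + n) m (\<lambda>(i, k). if i = k then 1 else 0 :: complex)"
  define R where "R = Matrix.mat m (m + n) (\<lambda>(i, k). if i = k then 1 else 0 :: complex)"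
  define B where "B = Matrix.mat n (m + n) (\<lambda>(i, k). if k = m + i then 1 else 0 :: complex)"
  define S where "S = Matrix.mat (m + n) n (\<lambda>(k, i). if k = m + i then 1 else 0 :: complex)"
  note d = A_def R_def B_def S_def
  have "split_exact E \<rho> \<tau> \<sigma> m (m + n) n A R B S"
    unfolding split_exact_def
  proof (intro conjI ballI r s rep)
    fix g assume g: "g \<in> carrier (weil_group E)"
    note cg = is_rep_carrier[OF r g] is_rep_carrier[OF s g]
    have ct: "\<tau> g \<in> carrier_mat (m + n) (m + n)" using is_rep_carrier[OF rep g] .
    show "A * \<rho> g = \<tau> g * A"
    proof (rule eq_matI)
      fix i j assume "i < dim_row (\<tau> g * A)" "j < dim_col (\<tau> g * A)"
      then have i: "i < m + n" and j: "j < m" using ct by (auto simp: A_def)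
      have "(\<tau> g * A) $$ (i, j) = (\<Sum>k = 0..<m + n. if k = j then \<tau> g $$ (i, k) else 0)"
        using i j ct by (simp add: A_def scalar_prod_def if_distrib[of "\<lambda>x. _ * x"] cong: if_cong)
      also have "\<dots> = \<tau> g $$ (i, j)" using j by simp
      also have "\<dots> = (if i < m then \<rho> g $$ (i, j) else 0)"
        using i j cg by (simp add: \<tau>_def)
      also have "\<dots> = (\<Sum>k = 0..<m. if k = i then \<rho> g $$ (k, j) else 0)" by simp
      also have "\<dots> = (A * \<rho> g) $$ (i, j)"
        using i j cg by (simp add: A_def scalar_prod_def if_distrib[of "\<lambda>x. x * _"] cong: if_cong)
      finally show "(A * \<rho> g) $$ (i, j) = (\<tau> g * A) $$ (i, j)" by simp
    qed (use cg ct in \<open>auto simp: A_def\<close>)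
    show "B * \<tau> g = \<sigma> g * B"
    proof (rule eq_matI)
      fix i j assume "i < dim_row (\<sigma> g * B)" "j < dim_col (\<sigma> g * B)"
      then have i: "i < n" and j: "j < m + n" using cg by (auto simp: B_def)
      have "(B * \<tau> g) $$ (i, j) = (\<Sum>k = 0..<m + n. if k = m + i then \<tau> g $$ (k, j) else 0)"
        using i j ct by (auto simp: B_def scalar_prod_def simp del: sum.delta sum.delta' intro!: sum.cong sum.neutral)
      also have "\<dots> = \<tau> g $$ (m + i, j)" using i by simp
      also have "\<dots> = (if m \<le> j then \<sigma> g $$ (i, j - m) else 0)"
        using i j cg by (simp add: \<tau>_def)
      also have "\<dots> = (\<Sum>k = 0..<n. if k = j - m then (if m \<le> j then \<sigma> g $$ (i, k) else 0) else 0)"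
        using j by (subst sum.delta) auto
      also have "\<dots> = (\<sigma> g * B) $$ (i, j)"
        using i j cg by (auto simp: B_def scalar_prod_def simp del: sum.delta sum.delta' intro!: sum.cong sum.neutral)
      finally show "(B * \<tau> g) $$ (i, j) = (\<sigma> g * B) $$ (i, j)" .
    qed (use cg ct in \<open>auto simp: B_def\<close>)
  next
    show "R * A = 1\<^sub>m m"
    proof (rule eq_matI)
      fix i j assume "i < dim_row (1\<^sub>m m :: complex mat)" "j < dim_col (1\<^sub>m m :: complex mat)"
      then have "(R * A) $$ (i, j) = (\<Sum>k = 0..<m + n. if k = i then (if i = j then 1 else 0) else 0)"
        by (auto simp: d scalar_prod_def simp del: sum.delta sum.delta' intro!: sum.cong sum.neutral)
      then show "(R * A) $$ (i, j) = 1\<^sub>m m $$ (i, j)"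
        using \<open>i < dim_row _\<close> \<open>j < dim_col _\<close> by simp
    qed (simp_all add: d)
    show "B * S = 1\<^sub>m n"
    proof (rule eq_matI)
      fix i j assume "i < dim_row (1\<^sub>m n :: complex mat)" "j < dim_col (1\<^sub>m n :: complex mat)"
      then have "(B * S) $$ (i, j) = (\<Sum>k = 0..<m + n. if k = m + i then (if i = j then 1 else 0) else 0)"
        by (auto simp: d scalar_prod_def simp del: sum.delta sum.delta' intro!: sum.cong sum.neutral)
      then show "(B * S) $$ (i, j) = 1\<^sub>m n $$ (i, j)"
        using \<open>i < dim_row _\<close> \<open>j < dim_col _\<close> by simp
    qed (simp_all add: d)
    show "B * A = 0\<^sub>m n m"
    proof (rule eq_matI)
      fix i j assume "i < dim_row (0\<^sub>m n m :: complex mat)" "j < dim_col (0\<^sub>m n m :: complex mat)"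
      then show "(B * A) $$ (i, j) = 0\<^sub>m n m $$ (i, j)"
        by (auto simp: d scalar_prod_def intro!: sum.neutral)
    qed (simp_all add: d)
    show "A * R + S * B = 1\<^sub>m (m + n)"
    proof (rule eq_matI)
      fix i j assume "i < dim_row (1\<^sub>m (m + n) :: complex mat)" "j < dim_col (1\<^sub>m (m + n) :: complex mat)"
      then have ij: "i < m + n" "j < m + n" by auto
      have "(A * R) $$ (i, j) = (\<Sum>k = 0..<m. if k = i then (if i = j then 1 else 0) else 0)"
        using ij by (auto simp: d scalar_prod_def simp del: sum.delta sum.delta' intro!: sum.cong sum.neutral)
      moreover have "(S * B) $$ (i, j) = (\<Sum>k = 0..<n. if k = i - m then (if m \<le> i \<and> i = j then 1 else 0) else 0)"
        using ij by (auto simp: d scalar_prod_def simp del: sum.delta sum.delta' intro!: sum.cong sum.neutral)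
      moreover have "\<dots> = (if m \<le> i \<and> i = j then 1 else 0)"
        using ij by (subst sum.delta) auto
      ultimately show "(A * R + S * B) $$ (i, j) = 1\<^sub>m (m + n) $$ (i, j)"
        using ij by (simp add: d)
    qed (simp_all add: d)
  qed (simp_all add: d)
  from rep_class_exact[OF split_exact_imp[OF this]] show ?thesis
    using rep by (rule that[rotated])
qed

section \<open>Additive functionals on the Grothendieck group\<close>

lemma infinite_unit_circle: "infinite {z::complex. cmod z = 1}"
proof
  assume "finite {z::complex. cmod z = 1}"
  moreover have "(\<lambda>t. Complex t (sqrt (1 - t\<^sup>2))) ` {0..1} \<subseteq> {z. cmod z = 1}"
  proof safe
    fix t :: real assume "t \<in> {0..1}"
    then have "t\<^sup>2 \<le> 1" by (simp add: power_le_one)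
    then show "cmod (Complex t (sqrt (1 - t\<^sup>2))) = 1" by (simp add: cmod_def)
  qed
  ultimately have "finite ((\<lambda>t. Complex t (sqrt (1 - t\<^sup>2))) ` {0..1})"
    by (rule rev_finite_subset)
  then have "finite {0..1::real}"
    by (rule finite_imageD) (auto simp: inj_on_def)
  then show False using infinite_Icc[of 0 "1::real"] by simp
qed

text \<open>Multiplication by a power of \<open>z\<close> turns the sum into a polynomial that has
  the whole unit circle among its roots.\<close>

lemma laurent_polynomial_zero:
  fixes c :: "int \<Rightarrow> complex"
  assumes T: "finite T" and zero: "\<And>z. cmod z = 1 \<Longrightarrow> (\<Sum>k\<in>T. c k * z powi k) = 0" and k: "k \<in> T"
  shows "c k = 0"
proof -
  obtain N where N: "\<forall>k\<in>T. - int N \<le> k"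
  proof -
    have "\<forall>k\<in>T. - int (\<Sum>j\<in>T. nat \<bar>j\<bar>) \<le> k"
    proof
      fix k assume "k \<in> T"
      then have "nat \<bar>k\<bar> \<le> (\<Sum>j\<in>T. nat \<bar>j\<bar>)" by (intro member_le_sum) (use T in auto)
      then show "- int (\<Sum>j\<in>T. nat \<bar>j\<bar>) \<le> k" by linarith
    qed
    then show ?thesis using that by blast
  qed
  define p where "p = (\<Sum>k\<in>T. monom (c k) (nat (k + int N)))"
  have "poly p z = 0" if z: "cmod z = 1" for z
  proof -
    have z0: "z \<noteq> 0" using z by auto
    have "poly p z = (\<Sum>k\<in>T. c k * z ^ nat (k + int N))"
      by (simp add: p_def poly_sum poly_monom)
    also have "\<dots> = (\<Sum>k\<in>T. z ^ N * (c k * z powi k))"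
    proof (rule sum.cong[OF refl])
      fix k assume "k \<in> T"
      then have "0 \<le> k + int N" using N by auto
      then have "z ^ nat (k + int N) = z powi (k + int N)" by (simp add: power_int_def)
      also have "\<dots> = z powi k * z ^ N" using z0 by (simp add: power_int_add)
      finally show "c k * z ^ nat (k + int N) = z ^ N * (c k * z powi k)" by simp
    qed
    also have "\<dots> = 0" using zero[OF z] by (simp flip: sum_distrib_left)
    finally show ?thesis .
  qed
  then have "{z. cmod z = 1} \<subseteq> {z. poly p z = 0}" by auto
  with infinite_unit_circle have "infinite {z. poly p z = 0}" using finite_subset by blast
  then have "p = 0" using poly_roots_finite by blast
  then have "0 = coeff p (nat (k + int N))" by simp
  also have "\<dots> = (\<Sum>j\<in>T. if nat (j + int N) = nat (k + int N) then c j else 0)"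
    by (simp add: p_def coeff_sum)
  also have "\<dots> = (\<Sum>j\<in>T. if j = k then c j else 0)"
  proof (intro sum.cong refl if_cong)
    fix j assume "j \<in> T"
    then have "0 \<le> j + int N" "0 \<le> k + int N" using N k by auto
    then show "nat (j + int N) = nat (k + int N) \<longleftrightarrow> j = k" by auto
  qed
  also have "\<dots> = c k" using T k by simp
  finally show ?thesis by simp
qed

lemma sum_fun_apply: "(\<Sum>i\<in>S. f i) x = (\<Sum>i\<in>S. f i x :: 'b::comm_monoid_add)"
  by (induction S rule: infinite_finite_induct) auto

text \<open>
  The characters of the unit circle are linearly independent functions, so a functional with prescribed
  values on them exists; composed with the character of a virtual representation it yields additive
  maps on the Grothendieck group without decomposing representations into irreducible ones.
\<close>

lemma circle_functional:
  fixes f :: "int \<Rightarrow> real"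
  obtains L :: "(complex \<Rightarrow> complex) \<Rightarrow> real"
  where "\<And>u v. L (\<lambda>z. u z + v z) = L u + L v"
    and "\<And>k. L (\<lambda>z. if z = 0 then 0 else eta_pow k z) = f k"
proof -
  define sc :: "real \<Rightarrow> (complex \<Rightarrow> complex) \<Rightarrow> complex \<Rightarrow> complex" where "sc = (\<lambda>r u z. of_real r * u z)"
  interpret vector_space_pair sc "(*) :: real \<Rightarrow> real \<Rightarrow> real"
    by unfold_locales (auto simp: sc_def algebra_simps fun_eq_iff)
  \<comment> \<open>At 0, outside the group, the value is fixed to 0: functions are compared on the
    whole plane, but characters of classes are controlled only at nonzero \<open>z\<close>.\<close>
  define e :: "int \<Rightarrow> complex \<Rightarrow> complex" where "e = (\<lambda>k z. if z = 0 then 0 else eta_pow k z)"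
  have e1: "e k z = z powi k" if "cmod z = 1" for k z
    using that by (auto simp: e_def eta_pow_def eta_def)
  have indep_coeff: "r k = 0"
    if T: "finite T" and s: "(\<Sum>k\<in>T. sc (r k) (e k)) = 0" and k: "k \<in> T" for T r k
  proof -
    have "(\<Sum>k\<in>T. of_real (r k) * z powi k) = 0" if z: "cmod z = 1" for z
    proof -
      have "(\<Sum>k\<in>T. sc (r k) (e k)) z = 0" using s by simp
      then show ?thesis by (simp add: sum_fun_apply sc_def e1[OF z])
    qed
    from laurent_polynomial_zero[OF T this k] show "r k = 0" by simp
  qed
  have inj: "inj e"
  proof (rule injI, rule ccontr)
    fix k l assume kl: "e k = e l" "k \<noteq> l"
    have "sc 1 (e k) + sc (- 1) (e l) = 0" using kl by (simp add: sc_def fun_eq_iff)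
    then show False
      using indep_coeff[of "{k, l}" "\<lambda>j. if j = k then 1 else - 1" k] kl(2) by simp
  qed
  have ind: "vs1.independent (range e)"
    unfolding vs1.dependent_explicit
  proof safe
    fix t u v assume t: "finite t" "t \<subseteq> range e" and s: "(\<Sum>v\<in>t. sc (u v) v) = 0" and v': "v \<in> t" "u v \<noteq> 0"
    obtain k where v: "e k \<in> t" "u (e k) \<noteq> 0" using v' t(2) by auto
    define T where "T = e -` t"
    have T: "finite T" "t = e ` T" using t finite_vimageI[OF t(1) inj] by (auto simp: T_def)
    have "(\<Sum>k\<in>T. sc (u (e k)) (e k)) = 0"
      using s sum.reindex[of e T "\<lambda>v. sc (u v) v"] inj T(2) by (simp add: inj_on_def inj_def)
    from indep_coeff[OF T(1) this, of k] v show False by (simp add: T_def)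
  qed
  obtain L where L: "Vector_Spaces.linear sc (*) L" "\<forall>x\<in>range e. L x = f (inv_into UNIV e x)"
    using linear_independent_extend[OF ind, of "\<lambda>x. f (inv_into UNIV e x)"] by blast
  interpret L: Vector_Spaces.linear sc "(*)" L by fact
  show ?thesis
  proof
    show "L (\<lambda>z. u z + v z) = L u + L v" for u v
      using L.add[of u v] by (simp add: plus_fun_def)
    show "L (\<lambda>z. if z = 0 then 0 else eta_pow k z) = f k" for k
    proof -
      have "L (e k) = f k" using L(2) inj by (simp add: inv_f_f)
      then show ?thesis unfolding e_def .
    qed
  qed
qed

lemma K_char_add:
  assumes "U \<in> carrier (K_ring E)" "V \<in> carrier (K_ring E)" "g \<in> carrier (weil_group E)"
  shows "K_char (U \<oplus>\<^bsub>K_ring E\<^esub> V) g = K_char U g + K_char V g"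
proof -
  obtain x y where "Poly_Mapping.keys x \<subseteq> reps E" "U = virtual_class E x"
    "Poly_Mapping.keys y \<subseteq> reps E" "V = virtual_class E y"
    using assms by (metis K_carrierE)
  then show ?thesis using assms(3) by (simp add: K_add K_char_class virtual_char_add)
qed

lemma K_char_rep_class: "g \<in> carrier (weil_group E) \<Longrightarrow> K_char (rep_class E \<rho>) g = mat_tr (\<rho> g)"
  by (simp add: rep_class_def K_char_class)

lemma mat_tr_11: "mat_tr (Matrix.mat 1 1 (\<lambda>_. a)) = a"
  by (simp add: mat_tr_def)

lemma K_functional_Complex:
  fixes f :: "int \<Rightarrow> real"
  obtains J where "additive_map (K_ring Complex_field) J" "\<And>v. J (eta_class v) = f v"
proof -
  obtain L where L: "\<And>u v. L (\<lambda>z. u z + v z) = L u + L v"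
    "\<And>k. L (\<lambda>z. if z = 0 then 0 else eta_pow k z) = f k"
    using circle_functional[of f] by metis
  define J where "J = (\<lambda>U. L (\<lambda>z. if z = 0 then 0 else K_char U (False, z)))"
  show ?thesis
  proof
    show "additive_map (K_ring Complex_field) J"
      unfolding additive_map_def
    proof safe
      fix U V assume UV: "U \<in> carrier (K_ring Complex_field)" "V \<in> carrier (K_ring Complex_field)"
      have "(\<lambda>z. if z = 0 then 0 else K_char (U \<oplus>\<^bsub>K_ring Complex_field\<^esub> V) (False, z)) =
          (\<lambda>z. (if z = 0 then 0 else K_char U (False, z)) + (if z = 0 then 0 else K_char V (False, z)))"
        using K_char_add[OF UV] by (auto simp: fun_eq_iff weil_carrier)
      then show "J (U \<oplus>\<^bsub>K_ring Complex_field\<^esub> V) = J U + J V"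
        by (simp add: J_def L(1))
    qed
    show "J (eta_class v) = f v" for v
    proof -
      have "(\<lambda>z. if z = 0 then 0 else K_char (eta_class v) (False, z)) =
          (\<lambda>z. if z = 0 then 0 else eta_pow v z)"
        by (auto simp: fun_eq_iff eta_class_def K_char_rep_class weil_carrier rep_eta_apply mat_tr_11
            simp del: One_nat_def)
      then show ?thesis by (simp add: J_def L(2))
    qed
  qed
qed

text \<open>Two functionals are combined. On the subgroup of index 2 the character of
  \<open>I_class v\<close> is \<open>eta_pow v + eta_pow (- v)\<close>, so the circle functional
  takes half the values of the even function \<open>f\<close>. At \<open>j\<close> every
  \<open>I_class v\<close> has trace 0 while \<open>1 - sign_class\<close> has trace 2, whence the
  weight \<open>d / 2\<close>. As \<open>1 - sign_class\<close> vanishes on the subgroup, the two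
  prescriptions do not interfere.\<close>

lemma K_functional_Real:
  fixes f :: "int \<Rightarrow> real"
  assumes even: "\<And>v. f (- v) = f v"
  obtains J where "additive_map (K_ring Real_field) J" "\<And>v. J (I_class v) = f v"
    "J (\<one>\<^bsub>K_ring Real_field\<^esub> \<ominus>\<^bsub>K_ring Real_field\<^esub> sign_class) = d"
proof -
  obtain L where L: "\<And>u v. L (\<lambda>z. u z + v z) = L u + L v"
    "\<And>k. L (\<lambda>z. if z = 0 then 0 else eta_pow k z) = f k / 2"
    using circle_functional[of "\<lambda>k. f k / 2"] by metis
  have L0: "L (\<lambda>z. 0) = 0" using L(1)[of "\<lambda>z. 0" "\<lambda>z. 0"] by simp
  define J where "J = (\<lambda>U. L (\<lambda>z. if z = 0 then 0 else K_char U (False, z)) + d / 2 * Re (K_char U (True, 1)))"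
  have T1: "(True, 1) \<in> carrier (weil_group Real_field)" by (simp add: weil_carrier)
  show ?thesis
  proof
    show "additive_map (K_ring Real_field) J"
      unfolding additive_map_def
    proof safe
      fix U V assume UV: "U \<in> carrier (K_ring Real_field)" "V \<in> carrier (K_ring Real_field)"
      have "(\<lambda>z. if z = 0 then 0 else K_char (U \<oplus>\<^bsub>K_ring Real_field\<^esub> V) (False, z)) =
          (\<lambda>z. (if z = 0 then 0 else K_char U (False, z)) + (if z = 0 then 0 else K_char V (False, z)))"
        using K_char_add[OF UV] by (auto simp: fun_eq_iff weil_carrier)
      then show "J (U \<oplus>\<^bsub>K_ring Real_field\<^esub> V) = J U + J V"
        using K_char_add[OF UV T1] by (simp add: J_def L(1) algebra_simps)
    qed
    show "J (I_class v) = f v" for v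
    proof -
      have "(\<lambda>z. if z = 0 then 0 else K_char (I_class v) (False, z)) =
          (\<lambda>z. (if z = 0 then 0 else eta_pow v z) + (if z = 0 then 0 else eta_pow (- v) z))"
        by (auto simp: fun_eq_iff I_class_eq K_char_rep_class weil_carrier rep_induced_apply mat2_tr)
      moreover have "K_char (I_class v) (True, 1) = 0"
        using T1 by (simp add: I_class_eq K_char_rep_class rep_induced_apply mat2_tr)
      ultimately show ?thesis using even[of v] by (simp add: J_def L(1) L(2))
    qed
    have ms: "K_char (\<one>\<^bsub>K_ring Real_field\<^esub> \<ominus>\<^bsub>K_ring Real_field\<^esub> sign_class) g =
        mat_tr (rep_trivial g) - mat_tr (rep_sign g)" if g: "g \<in> carrier (weil_group Real_field)" for g
    proof -
      have k: "Poly_Mapping.keys (frag_of rep_trivial) \<subseteq> reps Real_field"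
        "Poly_Mapping.keys (- frag_of rep_sign) \<subseteq> reps Real_field"
        "Poly_Mapping.keys (frag_of rep_sign) \<subseteq> reps Real_field"
        using repsI[OF is_rep_trivial] repsI[OF is_rep_sign] by auto
      have "\<one>\<^bsub>K_ring Real_field\<^esub> \<ominus>\<^bsub>K_ring Real_field\<^esub> sign_class =
          virtual_class Real_field (frag_of rep_trivial + - frag_of rep_sign)"
        unfolding a_minus_def K_one sign_class_def rep_class_def K_a_inv[OF k(3)] K_add[OF k(1,2)] ..
      then show ?thesis using g by (simp add: K_char_class virtual_char_add)
    qed
    have "(\<lambda>z. if z = 0 then 0 else K_char (\<one>\<^bsub>K_ring Real_field\<^esub> \<ominus>\<^bsub>K_ring Real_field\<^esub> sign_class) (False, z)) = (\<lambda>z. 0)"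
      using mat_tr_11[of 1]
      by (auto simp: fun_eq_iff ms weil_carrier rep_trivial_def rep_sign_apply mat11_one simp del: One_nat_def)
    moreover have "K_char (\<one>\<^bsub>K_ring Real_field\<^esub> \<ominus>\<^bsub>K_ring Real_field\<^esub> sign_class) (True, 1) = 2"
      using mat_tr_11[of 1] mat_tr_11[of "- 1"]
      by (simp add: ms T1 rep_trivial_def rep_sign_apply mat11_one del: One_nat_def)
    ultimately show "J (\<one>\<^bsub>K_ring Real_field\<^esub> \<ominus>\<^bsub>K_ring Real_field\<^esub> sign_class) = d"
      by (simp add: J_def L0)
  qed
qed

text \<open>The functionals constructed above prove that an additive map with the prescribed values
  exists, so that the choice in \<open>J_form\<close> yields one.\<close>

lemma is_J_J_form: "is_J E F (J_form E F)"
proof -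
  have "\<exists>J. is_J E F J"
  proof (cases E)
    case Complex_field
    obtain J where "additive_map (K_ring Complex_field) J" "\<And>v. J (eta_class v) = J_eta F v"
      using K_functional_Complex[of "J_eta F"] by metis
    then show ?thesis
      using Complex_field by (intro exI[of _ J]) (simp add: is_J_def additive_map_def)
  next
    case Real_field
    have even: "J_eta F (- v) = J_eta F v" for v by (simp add: J_eta_def)
    show ?thesis
    proof (rule K_functional_Real[of "J_eta F", OF even])
      fix J assume "additive_map (K_ring Real_field) J" "\<And>v. J (I_class v) = J_eta F v"
        "J (\<one>\<^bsub>K_ring Real_field\<^esub> \<ominus>\<^bsub>K_ring Real_field\<^esub> sign_class) =
          (LBINT t:{0<..}. F t * (exp (- t / 2) / (1 + exp (- t))))"
      then show ?thesis
        using Real_field by (intro exI[of _ J]) (simp add: is_J_def additive_map_def)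
    qed
  qed
  then show ?thesis unfolding J_form_def by (rule someI_ex)
qed

lemma J_form_additive: "additive_map (K_ring E) (J_form E F)"
  using is_J_J_form[of E F] by (simp add: is_J_def additive_map_def)

lemma J_form_eta: "J_form Complex_field F (eta_class v) = J_eta F v"
  using is_J_J_form[of Complex_field F] by (simp add: is_J_def)

lemma J_form_I: "J_form Real_field F (I_class v) = J_eta F v"
  using is_J_J_form[of Real_field F] by (simp add: is_J_def)

definition sign_integral :: "(real \<Rightarrow> real) \<Rightarrow> real" where
  "sign_integral F = (LBINT t:{0<..}. F t * (exp (- t / 2) / (1 + exp (- t))))"

text \<open>Twice the class 1 is the sum of \<open>I_class 0\<close> and
  \<open>1 - sign_class\<close>, the classes at which the values are prescribed.\<close>

lemma additive_map_K_one:
  assumes J: "additive_map (K_ring Real_field) J"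
  shows "J \<one>\<^bsub>K_ring Real_field\<^esub> =
    (J (I_class 0) + J (\<one>\<^bsub>K_ring Real_field\<^esub> \<ominus>\<^bsub>K_ring Real_field\<^esub> sign_class)) / 2"
proof -
  let ?R = "K_ring Real_field"
  interpret abelian_group ?R by (rule K_abelian_group)
  note c = K_one_carrier[of Real_field] sign_class_carrier
  have "J (\<one>\<^bsub>?R\<^esub> \<ominus>\<^bsub>?R\<^esub> sign_class) = J \<one>\<^bsub>?R\<^esub> - J sign_class"
    using J c additive_map_minus[OF J c(2)] by (simp add: additive_map_def a_minus_def)
  moreover have "J (I_class 0) = J \<one>\<^bsub>?R\<^esub> + J sign_class"
    using J c by (simp add: additive_map_def I_class_def)
  ultimately show ?thesis by simp
qed

lemma J_form_one: "J_form Real_field F \<one>\<^bsub>K_ring Real_field\<^esub> = (J_eta F 0 + sign_integral F) / 2"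
  using is_J_J_form[of Real_field F] J_form_I[of F 0]
  by (simp add: additive_map_K_one[OF J_form_additive] is_J_def sign_integral_def)

lemma K_pairing_add:
  assumes "U \<in> carrier (K_ring E)" "V \<in> carrier (K_ring E)" "W \<in> carrier (K_ring E)"
  shows "K_pairing E F (U \<oplus>\<^bsub>K_ring E\<^esub> V) W = K_pairing E F U W + K_pairing E F V W"
    and "K_pairing E F W (U \<oplus>\<^bsub>K_ring E\<^esub> V) = K_pairing E F W U + K_pairing E F W V"
  using J_form_additive[of E F] assms unfolding additive_map_def
  by (simp_all add: K_pairing_def pairing_product_add pairing_product_carrier)

lemma K_pairing_eta: "K_pairing Complex_field F (eta_class a) (eta_class b) = J_eta F (a - b)"
  by (simp add: K_pairing_def eta_class_product J_form_eta)

lemma K_pairing_I: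
  "K_pairing Real_field F (I_class a) (I_class b) = J_eta F (a - b) + J_eta F (a + b)"
  "K_pairing Real_field F \<one>\<^bsub>K_ring Real_field\<^esub> (I_class b) = J_eta F b"
  "K_pairing Real_field F (I_class b) \<one>\<^bsub>K_ring Real_field\<^esub> = J_eta F b"
  "K_pairing Real_field F \<one>\<^bsub>K_ring Real_field\<^esub> \<one>\<^bsub>K_ring Real_field\<^esub> = (J_eta F 0 + sign_integral F) / 2"
proof -
  show "K_pairing Real_field F (I_class a) (I_class b) = J_eta F (a - b) + J_eta F (a + b)"
    using J_form_additive[of Real_field F] I_class_carrier
    by (simp add: K_pairing_def I_class_product additive_map_def J_form_I)
  have "J_eta F (- b) = J_eta F b" by (simp add: J_eta_def)
  then show "K_pairing Real_field F \<one>\<^bsub>K_ring Real_field\<^esub> (I_class b) = J_eta F b"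
    by (simp add: K_pairing_def one_I_product J_form_I)
qed (simp_all add: K_pairing_def one_I_product J_form_I J_form_one)

lemma effective_add:
  assumes "effective E U" "effective E V"
  shows "effective E (U \<oplus>\<^bsub>K_ring E\<^esub> V)"
proof -
  obtain \<rho> m \<sigma> n where r: "is_rep E m \<rho>" "U = rep_class E \<rho>" and s: "is_rep E n \<sigma>" "V = rep_class E \<sigma>"
    using assms by (auto simp: effective_def reps_def)
  obtain \<tau> where "is_rep E (m + n) \<tau>" "rep_class E \<tau> = rep_class E \<rho> \<oplus>\<^bsub>K_ring E\<^esub> rep_class E \<sigma>"
    using rep_direct_sum[OF r(1) s(1)] by blast
  then show ?thesis
    using r s repsI unfolding effective_def by metis
qed

lemma effective_zero: "effective E \<zero>\<^bsub>K_ring E\<^esub>"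
  unfolding effective_def rep_class_zero[symmetric] using repsI[OF is_rep_zero] by blast

lemma effective_basis: "effective Complex_field (eta_class v)" "effective Real_field (I_class v)"
  unfolding effective_def eta_class_def I_class_eq
  using repsI[OF is_rep_eta] repsI[OF is_rep_induced] by blast+

section \<open>The quadratic forms on the filtered pieces\<close>

text \<open>The Toeplitz coefficients on the characters of exponents \<open>w - 2 * i\<close>. Two
  of these differ by an even exponent, whence the factor 2; \<open>t\<close> stands for
  \<open>ln r\<close>.\<close>

definition shifted_J :: "(real \<Rightarrow> real) \<Rightarrow> real \<Rightarrow> int \<Rightarrow> real" where
  "shifted_J F t k = J_eta F (2 * k) - F 0 * t"

definition shifted_pairing :: "arch_field \<Rightarrow> (real \<Rightarrow> real) \<Rightarrow> real \<Rightarrow> weil_class \<Rightarrow> weil_class \<Rightarrow> real" where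
  "shifted_pairing E F t U V = K_pairing E F U V
    - F 0 * (real (field_degree E) / 2) * t * (of_int (K_dim U) * of_int (K_dim V))"

lemma J_eta_minus: "J_eta F (- v) = J_eta F v"
  by (simp add: J_eta_def)

lemma shifted_J_minus: "shifted_J F t (- k) = shifted_J F t k"
  using J_eta_minus[of F "2 * k"] by (simp add: shifted_J_def)

lemma shifted_pairing_additive:
  assumes "W \<in> carrier (K_ring E)"
  shows "additive_map (K_ring E) (\<lambda>U. shifted_pairing E F t U W)"
    and "additive_map (K_ring E) (shifted_pairing E F t W)"
  using assms unfolding additive_map_def shifted_pairing_def
  by (auto simp: K_pairing_add K_dim_add algebra_simps)

text \<open>For the real field and even \<open>w\<close> the index \<open>w div 2\<close> gives
  \<open>I_class 0\<close>, and the class 1 is appended at the next index; \<open>K_rank\<close>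
  cuts it off when \<open>w\<close> is odd.\<close>

definition K_basis :: "arch_field \<Rightarrow> nat \<Rightarrow> nat \<Rightarrow> weil_class" where
  "K_basis E w i = (case E of
      Complex_field \<Rightarrow> eta_class (int w - 2 * int i)
    | Real_field \<Rightarrow> if i \<le> w div 2 then I_class (int w - 2 * int i) else \<one>\<^bsub>K_ring Real_field\<^esub>)"

definition K_rank :: "arch_field \<Rightarrow> nat \<Rightarrow> nat" where
  "K_rank E w = (case E of
      Complex_field \<Rightarrow> Suc w
    | Real_field \<Rightarrow> (if even w then Suc (Suc (w div 2)) else Suc (w div 2)))"

lemma K_basis_carrier: "K_basis E w i \<in> carrier (K_ring E)"
  by (cases E) (auto simp: K_basis_def eta_class_carrier I_class_carrier K_one_carrier)

text \<open>The prescribed functionals on the Grothendieck group interpolate. In the real case the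
  value at 1 is half the sum of \<open>f m\<close> and the value at \<open>1 - sign_class\<close>,
  which is why the latter is taken to be \<open>2 * f (Suc m) - f m\<close>.\<close>

lemma K_separated: "\<exists>h. additive_map (K_ring E) h \<and> (\<forall>i<K_rank E w. h (K_basis E w i) = f i)"
proof (cases E)
  case Complex_field
  obtain h where h: "additive_map (K_ring Complex_field) h"
    "\<And>v. h (eta_class v) = f (nat ((int w - v) div 2))"
    using K_functional_Complex[of "\<lambda>v. f (nat ((int w - v) div 2))"] by metis
  have "h (K_basis E w i) = f i" for i
    using Complex_field by (simp add: K_basis_def h(2))
  then show ?thesis using h(1) Complex_field by blast
next
  case Real_field
  define m where "m = w div 2"
  show ?thesis
  proof (rule K_functional_Real[of "\<lambda>v. f (nat ((int w - \<bar>v\<bar>) div 2))" "2 * f (Suc m) - f m"])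
    fix h assume h: "additive_map (K_ring Real_field) h"
      "\<And>v. h (I_class v) = f (nat ((int w - \<bar>v\<bar>) div 2))"
      "h (\<one>\<^bsub>K_ring Real_field\<^esub> \<ominus>\<^bsub>K_ring Real_field\<^esub> sign_class) = 2 * f (Suc m) - f m"
    have "h (K_basis E w i) = f i" if i: "i < K_rank E w" for i
    proof (cases "i \<le> w div 2")
      case True
      then have "\<bar>int w - 2 * int i\<bar> = int w - 2 * int i" by linarith
      then show ?thesis using True Real_field by (simp add: K_basis_def h(2))
    next
      case False
      then have ev: "even w" and i: "i = Suc m"
        using i Real_field by (auto simp: K_rank_def m_def split: if_splits)
      have "nat (int w div 2) = m" by (simp add: m_def nat_div_distrib)
      then have "h \<one>\<^bsub>K_ring Real_field\<^esub> = f (Suc m)"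
        by (simp add: additive_map_K_one[OF h(1)] h(2,3))
      then show ?thesis using False Real_field i by (simp add: K_basis_def)
    qed
    then show ?thesis using h(1) Real_field by blast
  qed simp
qed

lemma K_biadditive:
  "biadditive_form (K_ring E) (K_basis E w) (K_rank E w) (shifted_pairing E F t)"
  by (intro biadditive_form.intro separated_family.intro separated_family_axioms.intro
      biadditive_form_axioms.intro K_abelian_group K_basis_carrier K_separated shifted_pairing_additive)

lemma K_le_generate: "K_le E w = generate (add_monoid (K_ring E)) (K_basis E w ` {..<K_rank E w})"
proof (cases E)
  case Complex_field
  have "{eta_class v | v. \<bar>v\<bar> \<le> int w \<and> [v = int w] (mod 2)} = (\<lambda>i. eta_class (int w - 2 * int i)) ` {..<Suc w}"
  proof (intro equalityI subsetI)
    fix U assume "U \<in> {eta_class v | v. \<bar>v\<bar> \<le> int w \<and> [v = int w] (mod 2)}"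
    then obtain v where v: "U = eta_class v" "\<bar>v\<bar> \<le> int w" "[v = int w] (mod 2)" by blast
    from v(3) have "even (int w - v)"
      by (meson cong_iff_dvd_diff cong_sym)
    then obtain k where k: "int w - v = 2 * k" by blast
    then have "int w - 2 * int (nat k) = v" "nat k < Suc w"
      using v(2) by auto
    with v(1) have "U = eta_class (int w - 2 * int (nat k))" "nat k < Suc w" by simp_all
    then show "U \<in> (\<lambda>i. eta_class (int w - 2 * int i)) ` {..<Suc w}" by blast
  next
    fix U assume "U \<in> (\<lambda>i. eta_class (int w - 2 * int i)) ` {..<Suc w}"
    then obtain i where "U = eta_class (int w - 2 * int i)" "i < Suc w" by auto
    then show "U \<in> {eta_class v | v. \<bar>v\<bar> \<le> int w \<and> [v = int w] (mod 2)}"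
      by (auto intro!: exI[of _ "int w - 2 * int i"] simp: cong_iff_dvd_diff)
  qed
  then show ?thesis
    by (simp add: Complex_field K_le_def K_rank_def K_basis_def[abs_def])
next
  case Real_field
  have I: "{I_class v | v. 0 \<le> v \<and> v \<le> int w \<and> [v = int w] (mod 2)} =
      (\<lambda>i. I_class (int w - 2 * int i)) ` {..<Suc (w div 2)}"
  proof (intro equalityI subsetI)
    fix U assume "U \<in> {I_class v | v. 0 \<le> v \<and> v \<le> int w \<and> [v = int w] (mod 2)}"
    then obtain v where v: "U = I_class v" "0 \<le> v" "v \<le> int w" "[v = int w] (mod 2)" by blast
    from v(4) have "even (int w - v)"
      by (meson cong_iff_dvd_diff cong_sym)
    then obtain k where k: "int w - v = 2 * k" by blast
    then have "int w - 2 * int (nat k) = v" "nat k < Suc (w div 2)"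
      using v(2,3) by auto
    with v(1) have "U = I_class (int w - 2 * int (nat k))" "nat k < Suc (w div 2)" by simp_all
    then show "U \<in> (\<lambda>i. I_class (int w - 2 * int i)) ` {..<Suc (w div 2)}" by blast
  next
    fix U assume "U \<in> (\<lambda>i. I_class (int w - 2 * int i)) ` {..<Suc (w div 2)}"
    then obtain i where i: "U = I_class (int w - 2 * int i)" "i < Suc (w div 2)" by auto
    then have "2 * i \<le> w" by linarith
    with i show "U \<in> {I_class v | v. 0 \<le> v \<and> v \<le> int w \<and> [v = int w] (mod 2)}"
      by (auto intro!: exI[of _ "int w - 2 * int i"] simp: cong_iff_dvd_diff)
  qed
  have "K_basis Real_field w ` {..<Suc (w div 2)} = (\<lambda>i. I_class (int w - 2 * int i)) ` {..<Suc (w div 2)}"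
    by (intro image_cong) (auto simp: K_basis_def)
  moreover have "K_basis Real_field w (Suc (w div 2)) = \<one>\<^bsub>K_ring Real_field\<^esub>"
    by (simp add: K_basis_def)
  ultimately have "K_basis Real_field w ` {..<K_rank Real_field w} =
      {I_class v | v. 0 \<le> v \<and> v \<le> int w \<and> [v = int w] (mod 2)} \<union>
      (if even w then {\<one>\<^bsub>K_ring Real_field\<^esub>} else {})"
    unfolding I by (simp add: K_rank_def lessThan_Suc[of "Suc (w div 2)"])
  then show ?thesis
    by (simp add: Real_field K_le_def)
qed

lemma pd_iff:
  "positive_definite_on (K_ring E) (K_le E w)
      (\<lambda>U. K_pairing E F U U - F 0 * (real (field_degree E) / 2) * t * (real_of_int (K_dim U))\<^sup>2) \<longleftrightarrow>
    (\<forall>x :: nat \<Rightarrow> real. (\<exists>i<K_rank E w. x i \<noteq> 0) \<longrightarrow>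
      0 < (\<Sum>i<K_rank E w. \<Sum>j<K_rank E w. x i * x j * shifted_pairing E F t (K_basis E w i) (K_basis E w j)))"
  unfolding K_le_generate
  by (rule biadditive_form.positive_definite_on_iff[OF K_biadditive])
    (simp add: shifted_pairing_def power2_eq_square)

lemma shifted_pairing_eta:
  "shifted_pairing Complex_field F t (eta_class (int w - 2 * int i)) (eta_class (int w - 2 * int j)) =
    shifted_J F t (int i - int j)"
  using J_eta_minus[of F "2 * (int i - int j)"]
  by (simp add: shifted_pairing_def K_pairing_eta K_dim_basis field_degree_def shifted_J_def algebra_simps)

lemma shifted_pairing_I:
  "shifted_pairing Real_field F t (I_class (int w - 2 * int i)) (I_class (int w - 2 * int j)) =
    shifted_J F t (int i - int j) + shifted_J F t (int w - int i - int j)"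
  using J_eta_minus[of F "2 * (int i - int j)"]
  by (simp add: shifted_pairing_def K_pairing_I K_dim_basis field_degree_def shifted_J_def algebra_simps)

lemma shifted_pairing_one:
  "shifted_pairing Real_field F t \<one>\<^bsub>K_ring Real_field\<^esub> (I_class (2 * k)) = shifted_J F t k"
  "shifted_pairing Real_field F t (I_class (2 * k)) \<one>\<^bsub>K_ring Real_field\<^esub> = shifted_J F t k"
  "shifted_pairing Real_field F t \<one>\<^bsub>K_ring Real_field\<^esub> \<one>\<^bsub>K_ring Real_field\<^esub> =
    (shifted_J F t 0 + sign_integral F) / 2"
  by (simp_all add: shifted_pairing_def K_pairing_I K_dim_basis field_degree_def shifted_J_def algebra_simps
      add_divide_distrib diff_divide_distrib)

text \<open>
  The coordinates of the restriction to \<open>\<complex>\<^sup>\<times>\<close> of \<open>\<Sum>i. x i I\<^bsub>w - 2 i\<^esub> + y 1\<close> in the basis \<open>\<eta>\<^bsup>w - 2 k\<^esup>\<close>.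
\<close>

definition restriction :: "nat \<Rightarrow> (nat \<Rightarrow> real) \<Rightarrow> real \<Rightarrow> nat \<Rightarrow> real" where
  "restriction w x y k = (\<Sum>i\<le>w div 2. x i * ((if k = i then 1 else 0) + (if k = w - i then 1 else 0)))
    + (if 2 * k = w then y else 0)"

lemma sum_restriction:
  "(\<Sum>k\<le>w. restriction w x y k * \<phi> k) =
    (\<Sum>i\<le>w div 2. x i * (\<phi> i + \<phi> (w - i))) + (if even w then y * \<phi> (w div 2) else 0)"
proof -
  have "(\<Sum>k\<le>w. (\<Sum>i\<le>w div 2. x i * ((if k = i then 1 else 0) + (if k = w - i then 1 else 0))) * \<phi> k) =
      (\<Sum>i\<le>w div 2. \<Sum>k\<le>w. x i * ((if k = i then 1 else 0) + (if k = w - i then 1 else 0)) * \<phi> k)"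
    unfolding sum_distrib_right by (rule sum.swap)
  also have "\<dots> = (\<Sum>i\<le>w div 2. x i * (\<phi> i + \<phi> (w - i)))"
  proof (rule sum.cong[OF refl])
    fix i assume i: "i \<in> {..w div 2}"
    have "(\<Sum>k\<le>w. x i * ((if k = i then 1 else 0) + (if k = w - i then 1 else 0)) * \<phi> k) =
        (\<Sum>k\<le>w. (if k = i then x i * \<phi> k else 0) + (if k = w - i then x i * \<phi> k else 0))"
      by (intro sum.cong refl) (simp add: algebra_simps)
    also have "\<dots> = x i * (\<phi> i + \<phi> (w - i))"
      using i by (simp add: sum.distrib algebra_simps)
    finally show "(\<Sum>k\<le>w. x i * ((if k = i then 1 else 0) + (if k = w - i then 1 else 0)) * \<phi> k) =
        x i * (\<phi> i + \<phi> (w - i))" .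
  qed
  moreover have "(\<Sum>k\<le>w. (if 2 * k = w then y else 0) * \<phi> k) = (if even w then y * \<phi> (w div 2) else 0)"
  proof (cases "even w")
    case True
    have "(\<Sum>k\<le>w. (if 2 * k = w then y else 0) * \<phi> k) = (\<Sum>k\<le>w. if k = w div 2 then y * \<phi> k else 0)"
      using True by (intro sum.cong) auto
    then show ?thesis using True by simp
  next
    case False
    then have "2 * k \<noteq> w" for k by auto
    then show ?thesis using False by simp
  qed
  ultimately show ?thesis
    by (simp add: restriction_def distrib_right sum.distrib)
qed

definition real_form :: "nat \<Rightarrow> (int \<Rightarrow> real) \<Rightarrow> (nat \<Rightarrow> real) \<Rightarrow> real" where
  "real_form w T x = (\<Sum>i\<le>w div 2. \<Sum>j\<le>w div 2. x i * x j * (T (int i - int j) + T (int w - int i - int j)))"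

text \<open>\<open>sum_restriction\<close> is applied in each of the two variables. A pair of
  indices contributes the values of \<open>T\<close> at \<open>i - j\<close>, at
  \<open>w - i - j\<close> and at their negatives, equal in pairs by evenness; hence the factor
  2.\<close>

lemma toeplitz_form_restriction:
  assumes even: "\<And>k. T (- k) = T k"
  shows "toeplitz_form w T (restriction w x y) = 2 * real_form w T x +
    (if even w then 4 * y * (\<Sum>i\<le>w div 2. x i * T (int (w div 2) - int i)) + y\<^sup>2 * T 0 else 0)"
proof -
  define m where "m = w div 2"
  have e: "T (a - b) = T (b - a)" for a b using even[of "a - b"] by simp
  define \<psi> where "\<psi> k = (\<Sum>l\<le>w. restriction w x y l * T (int k - int l))" for k
  have \<psi>: "\<psi> k = (\<Sum>j\<le>m. x j * (T (int k - int j) + T (int k - int (w - j)))) +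
      (if even w then y * T (int k - int m) else 0)" for k
    unfolding \<psi>_def m_def by (rule sum_restriction)
  have "toeplitz_form w T (restriction w x y) = (\<Sum>k\<le>w. restriction w x y k * \<psi> k)"
    by (simp add: toeplitz_form_def \<psi>_def sum_distrib_left mult.assoc)
  also have "\<dots> = (\<Sum>i\<le>m. x i * (\<psi> i + \<psi> (w - i))) + (if even w then y * \<psi> m else 0)"
    unfolding m_def by (rule sum_restriction)
  also have "(\<Sum>i\<le>m. x i * (\<psi> i + \<psi> (w - i))) = 2 * real_form w T x +
      (if even w then 2 * y * (\<Sum>i\<le>m. x i * T (int m - int i)) else 0)"
  proof -
    have "x i * (\<psi> i + \<psi> (w - i)) =
        (\<Sum>j\<le>m. 2 * (x i * x j * (T (int i - int j) + T (int w - int i - int j)))) +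
        (if even w then 2 * y * (x i * T (int m - int i)) else 0)" if i: "i \<le> m" for i
    proof -
      have wi: "int (w - i) = int w - int i" using i by (simp add: m_def of_nat_diff)
      have "\<psi> i + \<psi> (w - i) = (\<Sum>j\<le>m. x j * (T (int i - int j) + T (int i - int (w - j)) +
          (T (int (w - i) - int j) + T (int (w - i) - int (w - j))))) +
          (if even w then y * (T (int i - int m) + T (int (w - i) - int m)) else 0)"
        unfolding \<psi> by (simp add: sum.distrib algebra_simps)
      also have "(\<Sum>j\<le>m. x j * (T (int i - int j) + T (int i - int (w - j)) +
          (T (int (w - i) - int j) + T (int (w - i) - int (w - j))))) =
          (\<Sum>j\<le>m. 2 * (x j * (T (int i - int j) + T (int w - int i - int j))))"
      proof (rule sum.cong[OF refl])
        fix j assume "j \<in> {..m}"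
        then have wj: "int (w - j) = int w - int j" by (simp add: m_def of_nat_diff)
        have "T (int i - (int w - int j)) = T (int w - int i - int j)"
          using e[of "int i" "int w - int j"] by (simp add: algebra_simps)
        moreover have "T (int w - int i - (int w - int j)) = T (int i - int j)"
          using e[of "int j" "int i"] by simp
        ultimately show "x j * (T (int i - int j) + T (int i - int (w - j)) +
          (T (int (w - i) - int j) + T (int (w - i) - int (w - j)))) =
          2 * (x j * (T (int i - int j) + T (int w - int i - int j)))"
          unfolding wi wj by simp
      qed
      also have "(if even w then y * (T (int i - int m) + T (int (w - i) - int m)) else 0) =
          (if even w then 2 * y * T (int m - int i) else 0)"
      proof (cases "even w")
        case True
        then have "int w = 2 * int m" by (auto simp: m_def)
        then have "int (w - i) - int m = int m - int i" unfolding wi by simp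
        then show ?thesis using True e[of "int i" "int m"] by simp
      qed simp
      finally show ?thesis
        by (simp add: algebra_simps sum_distrib_left)
    qed
    then have "(\<Sum>i\<le>m. x i * (\<psi> i + \<psi> (w - i))) =
        (\<Sum>i\<le>m. (\<Sum>j\<le>m. 2 * (x i * x j * (T (int i - int j) + T (int w - int i - int j)))) +
        (if even w then 2 * y * (x i * T (int m - int i)) else 0))"
      by (intro sum.cong) auto
    then show ?thesis
      by (simp add: sum.distrib real_form_def m_def sum_distrib_left)
  qed
  also have "(if even w then y * \<psi> m else 0) =
      (if even w then 2 * y * (\<Sum>i\<le>m. x i * T (int m - int i)) + y\<^sup>2 * T 0 else 0)"
  proof (cases "even w")
    case True
    then have w: "int w = 2 * int m" by (auto simp: m_def)
    have "(\<Sum>j\<le>m. x j * (T (int m - int j) + T (int m - int (w - j)))) = (\<Sum>j\<le>m. 2 * (x j * T (int m - int j)))"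
    proof (rule sum.cong[OF refl])
      fix j assume "j \<in> {..m}"
      then have "int (w - j) = int w - int j" by (simp add: m_def of_nat_diff)
      then have q: "int m - int (w - j) = int j - int m" using w by simp
      show "x j * (T (int m - int j) + T (int m - int (w - j))) = 2 * (x j * T (int m - int j))"
        unfolding q using e[of "int j" "int m"] by simp
    qed
    then show ?thesis
      using True by (simp add: \<psi> power2_eq_square algebra_simps sum_distrib_left)
  qed simp
  finally show ?thesis by (simp add: m_def)
qed

text \<open>Every pairing of basis classes other than that of 1 with itself involves only classes
  \<open>I_v\<close>, on which the functional is given by the values for the complex field. The
  exception contributes half of \<open>J_eta F 0\<close>, which fits the same pattern, and half of
  the sign integral.\<close>

lemma real_pairing_sum:
  "(\<Sum>i<K_rank Real_field w. \<Sum>j<K_rank Real_field w.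
      x i * x j * shifted_pairing Real_field F t (K_basis Real_field w i) (K_basis Real_field w j)) =
    toeplitz_form w (shifted_J F t) (restriction w x (if even w then x (Suc (w div 2)) else 0)) / 2
    + (if even w then (x (Suc (w div 2)))\<^sup>2 * sign_integral F / 2 else 0)"
proof -
  define m where "m = w div 2"
  let ?b = "\<lambda>i j. shifted_pairing Real_field F t (K_basis Real_field w i) (K_basis Real_field w j)"
  have b: "?b i j = shifted_J F t (int i - int j) + shifted_J F t (int w - int i - int j)"
    if "i \<le> m" "j \<le> m" for i j
    using that by (simp add: K_basis_def shifted_pairing_I m_def)
  have main: "(\<Sum>i\<le>m. \<Sum>j\<le>m. x i * x j * ?b i j) = real_form w (shifted_J F t) x"
    unfolding real_form_def m_def[symmetric] by (intro sum.cong refl) (simp add: b)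
  note tf = toeplitz_form_restriction[of "shifted_J F t", OF shifted_J_minus]
  show ?thesis
  proof (cases "even w")
    case False
    then have "{..<K_rank Real_field w} = {..m}" by (auto simp: K_rank_def m_def)
    then show ?thesis using False main by (simp add: tf)
  next
    case True
    then have w: "int w = 2 * int m" by (auto simp: m_def)
    have r: "{..<K_rank Real_field w} = insert (Suc m) {..m}"
      using True by (auto simp: K_rank_def m_def)
    have one: "K_basis Real_field w (Suc m) = \<one>\<^bsub>K_ring Real_field\<^esub>" by (simp add: K_basis_def m_def)
    have bi: "K_basis Real_field w i = I_class (2 * (int m - int i))" if "i \<le> m" for i
      using that w by (simp add: K_basis_def m_def[symmetric] algebra_simps)
    have b1: "?b (Suc m) j = shifted_J F t (int m - int j)" "?b j (Suc m) = shifted_J F t (int m - int j)"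
      if "j \<le> m" for j
      unfolding one bi[OF that] by (rule shifted_pairing_one)+
    have s: "(\<Sum>i<K_rank Real_field w. \<Sum>j<K_rank Real_field w. x i * x j * ?b i j) =
        x (Suc m) * x (Suc m) * ?b (Suc m) (Suc m) + (\<Sum>j\<le>m. x (Suc m) * x j * ?b (Suc m) j) +
        (\<Sum>i\<le>m. x i * x (Suc m) * ?b i (Suc m)) + (\<Sum>i\<le>m. \<Sum>j\<le>m. x i * x j * ?b i j)"
      unfolding r by (simp add: sum.distrib)
    have "(\<Sum>j\<le>m. x (Suc m) * x j * ?b (Suc m) j) =
        x (Suc m) * (\<Sum>j\<le>m. x j * shifted_J F t (int m - int j))"
      "(\<Sum>i\<le>m. x i * x (Suc m) * ?b i (Suc m)) =
        x (Suc m) * (\<Sum>j\<le>m. x j * shifted_J F t (int m - int j))"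
      unfolding sum_distrib_left by (intro sum.cong refl; simp add: b1)+
    then show ?thesis
      unfolding s main using True
      by (simp add: tf one shifted_pairing_one m_def[symmetric] power2_eq_square algebra_simps add_divide_distrib)
  qed
qed

lemma complex_pairing_sum:
  "(\<Sum>i<K_rank Complex_field w. \<Sum>j<K_rank Complex_field w.
      x i * x j * shifted_pairing Complex_field F t (K_basis Complex_field w i) (K_basis Complex_field w j)) =
    toeplitz_form w (shifted_J F t) x"
  by (simp add: K_rank_def K_basis_def shifted_pairing_eta toeplitz_form_def lessThan_Suc_atMost)

text \<open>The middle weight is halved because \<open>I_class 0\<close> restricts to twice the
  trivial character.\<close>

definition half_weights :: "nat \<Rightarrow> (nat \<Rightarrow> real) \<Rightarrow> nat \<Rightarrow> real" where
  "half_weights w X i = (if i \<le> w div 2 then (if 2 * i = w then X i / 2 else X i) else 0)"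

lemma restriction_half_weights:
  assumes sym: "\<And>i. i \<le> w \<Longrightarrow> X (w - i) = X i" and k: "k \<le> w"
  shows "restriction w (half_weights w X) 0 k = X k"
proof -
  have "restriction w (half_weights w X) 0 k =
      (\<Sum>i\<le>w div 2. (if i = k then half_weights w X i else 0) + (if i = w - k then half_weights w X i else 0))"
    unfolding restriction_def using k by (auto intro!: sum.cong simp: half_weights_def)
  also have "\<dots> = (if k \<le> w div 2 then half_weights w X k else 0) +
      (if w - k \<le> w div 2 then half_weights w X (w - k) else 0)"
    by (simp add: sum.distrib)
  also have "\<dots> = X k"
    using sym[OF k] k by (auto simp: half_weights_def)
  finally show ?thesis .
qed

text \<open>For the complex field the vector itself is tested. For the real field a symmetric vector
  is the restriction of a combination of classes \<open>I_v\<close> with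
  \<open>half_weights\<close>; its coordinate at the class 1 is 0, so the sign integral drops
  out.\<close>

lemma pd_imp_toeplitz_pos:
  assumes pd: "positive_definite_on (K_ring E) (K_le E w)
      (\<lambda>U. K_pairing E F U U - F 0 * (real (field_degree E) / 2) * t * (real_of_int (K_dim U))\<^sup>2)"
    and sym: "\<And>i. i \<le> w \<Longrightarrow> X (w - i) = X i" and nz: "\<exists>i\<le>w. X i \<noteq> 0"
  shows "0 < toeplitz_form w (shifted_J F t) X"
proof (cases E)
  case Complex_field
  have "\<exists>i<K_rank E w. X i \<noteq> 0"
    using nz Complex_field by (auto simp: K_rank_def less_Suc_eq_le)
  then show ?thesis
    using pd[unfolded pd_iff, rule_format, of X] Complex_field by (simp add: complex_pairing_sum)
next
  case Real_field
  let ?x = "half_weights w X"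
  obtain i where i: "i \<le> w div 2" "X i \<noteq> 0"
  proof -
    obtain i where i: "i \<le> w" "X i \<noteq> 0" using nz by blast
    show ?thesis
    proof (cases "i \<le> w div 2")
      case False
      then have "w - i \<le> w div 2" by linarith
      then show ?thesis using that[of "w - i"] sym[OF i(1)] i by simp
    qed (use i that in blast)
  qed
  then have "?x i \<noteq> 0" by (simp add: half_weights_def)
  moreover have "i < K_rank E w" using i Real_field by (auto simp: K_rank_def)
  ultimately have "\<exists>i<K_rank E w. ?x i \<noteq> 0" by blast
  then have "0 < (\<Sum>i<K_rank E w. \<Sum>j<K_rank E w. ?x i * ?x j * shifted_pairing E F t (K_basis E w i) (K_basis E w j))"
    using pd[unfolded pd_iff] by blast
  also have "\<dots> = toeplitz_form w (shifted_J F t) (restriction w ?x 0) / 2"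
  proof -
    have "?x (Suc (w div 2)) = 0" by (simp add: half_weights_def)
    then show ?thesis unfolding Real_field real_pairing_sum by simp
  qed
  also have "toeplitz_form w (shifted_J F t) (restriction w ?x 0) = toeplitz_form w (shifted_J F t) X"
    by (intro toeplitz_form_cong restriction_half_weights sym)
  finally show ?thesis by simp
qed

text \<open>For the real field an element of zero restriction is a multiple of
  \<open>1 - sign_class\<close>. The Toeplitz form vanishes there, and strict positivity comes from
  the sign integral.\<close>

lemma toeplitz_pos_imp_pd:
  assumes pos: "\<And>X. \<exists>i\<le>w. X i \<noteq> 0 \<Longrightarrow> 0 < toeplitz_form w (shifted_J F t) X"
    and D: "0 < sign_integral F"
  shows "positive_definite_on (K_ring E) (K_le E w)
      (\<lambda>U. K_pairing E F U U - F 0 * (real (field_degree E) / 2) * t * (real_of_int (K_dim U))\<^sup>2)"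
  unfolding pd_iff
proof (intro allI impI)
  fix x :: "nat \<Rightarrow> real" assume nz: "\<exists>i<K_rank E w. x i \<noteq> 0"
  show "0 < (\<Sum>i<K_rank E w. \<Sum>j<K_rank E w. x i * x j * shifted_pairing E F t (K_basis E w i) (K_basis E w j))"
  proof (cases E)
    case Complex_field
    then have "\<exists>i\<le>w. x i \<noteq> 0" using nz by (auto simp: K_rank_def less_Suc_eq_le)
    then show ?thesis unfolding Complex_field complex_pairing_sum by (rule pos)
  next
    case Real_field
    define y where "y = (if even w then x (Suc (w div 2)) else 0)"
    let ?X = "restriction w x y"
    have eq: "(\<Sum>i<K_rank E w. \<Sum>j<K_rank E w. x i * x j * shifted_pairing E F t (K_basis E w i) (K_basis E w j)) =
        toeplitz_form w (shifted_J F t) ?X / 2 + y\<^sup>2 * sign_integral F / 2"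
      unfolding Real_field real_pairing_sum y_def by simp
    show ?thesis
    proof (cases "\<exists>i\<le>w. ?X i \<noteq> 0")
      case True
      then show ?thesis unfolding eq using pos[OF True] D by (simp add: add_pos_nonneg)
    next
      case False
      \<comment> \<open>In the middle \<open>I_class 0\<close> counts twice and the class 1 once. So
        a vanishing restriction leaves only a middle coordinate with
        \<open>y = - 2 * x i\<close>.\<close>
      have Xi: "?X i = (if 2 * i = w then 2 * x i + y else x i)" if i: "i \<le> w div 2" for i
      proof -
        have "?X i = (\<Sum>j\<le>w div 2. (if j = i then x j else 0) + (if j = i \<and> 2 * i = w then x j else 0)) +
            (if 2 * i = w then y else 0)"
          unfolding restriction_def using i by (intro arg_cong2[where f = "(+)"] sum.cong refl) auto
        also have "\<dots> = (if 2 * i = w then 2 * x i + y else x i)"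
          unfolding sum.distrib using i by (cases "2 * i = w") simp_all
        finally show ?thesis .
      qed
      have "y \<noteq> 0"
      proof
        assume y0: "y = 0"
        have "x i = 0" if "i \<le> w div 2" for i
        proof -
          have "?X i = 0" using False that by (metis div_le_dividend le_trans)
          then show ?thesis using Xi[OF that] y0 by (auto split: if_splits)
        qed
        moreover obtain i where i: "i < K_rank E w" "x i \<noteq> 0" using nz by blast
        ultimately have "\<not> i \<le> w div 2" by blast
        then have "even w" "i = Suc (w div 2)"
          using i(1) Real_field by (auto simp: K_rank_def split: if_splits)
        then show False using y0 i(2) by (simp add: y_def)
      qed
      moreover have "toeplitz_form w (shifted_J F t) ?X = 0"
        using toeplitz_form_cong[of w ?X "\<lambda>_. 0"] False by (simp add: toeplitz_form_def)
      ultimately show ?thesis unfolding eq using D by simp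
    qed
  qed
qed

lemma effective_finsum:
  assumes "\<And>i. i \<in> S \<Longrightarrow> f i \<in> carrier (K_ring E) \<and> effective E (f i)" "finite S"
  shows "effective E (finsum (K_ring E) f S)"
proof -
  interpret abelian_group "K_ring E" by (rule K_abelian_group)
  from assms(2,1) show ?thesis
  proof (induction S rule: finite_induct)
    case (insert a S)
    then show ?case by (simp add: Pi_def effective_add)
  qed (simp add: effective_zero)
qed

lemma effective_nat_pow:
  assumes "effective E U"
  shows "effective E (add_pow (K_ring E) (k::nat) U)"
proof -
  interpret abelian_group "K_ring E" by (rule K_abelian_group)
  show ?thesis
    by (induction k) (simp_all add: effective_zero add.nat_pow_Suc effective_add assms)
qed

text \<open>In the real case the weights of the \<open>I_v\<close> are those of
  \<open>half_weights\<close>, natural numbers because the middle multiplicity is even, and the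
  class 1 gets weight 0. The element is built without reference to \<open>F\<close> and
  \<open>t\<close>, so one \<open>U\<close> serves them all.\<close>

lemma effective_element:
  fixes N :: "nat \<Rightarrow> nat"
  assumes sym: "\<And>i. i \<le> w \<Longrightarrow> N (w - i) = N i" and ev: "\<And>i. i \<le> w \<Longrightarrow> even (N i)"
  shows "\<exists>U\<in>K_le E w. effective E U \<and>
    (\<forall>F t. K_pairing E F U U - F 0 * (real (field_degree E) / 2) * t * (real_of_int (K_dim U))\<^sup>2 =
      real (field_degree E) / 2 * toeplitz_form w (shifted_J F t) (\<lambda>i. real (N i)))"
proof -
  interpret abelian_group "K_ring E" by (rule K_abelian_group)
  define c :: "nat \<Rightarrow> nat" where "c i = (case E of Complex_field \<Rightarrow> N i
    | Real_field \<Rightarrow> if i \<le> w div 2 then (if 2 * i = w then N i div 2 else N i) else 0)" for i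
  let ?e = "K_basis E w" and ?n = "K_rank E w"
  have sf: "separated_family (K_ring E) ?e ?n"
    using K_biadditive[of E w "\<lambda>_. 0" 0] by (rule biadditive_form.axioms(1))
  define U where "U = separated_family.comb (K_ring E) ?e ?n (\<lambda>i. int (c i))"
  have "U \<in> K_le E w"
    unfolding U_def K_le_generate by (rule separated_family.comb_span[OF sf])
  moreover have "effective E U"
  proof -
    have "U = finsum (K_ring E) (\<lambda>i. add_pow (K_ring E) (c i) (?e i)) {..<?n}"
      unfolding U_def separated_family.comb_def[OF sf] by (simp add: add_pow_int_ge)
    moreover have "effective E (add_pow (K_ring E) (c i) (?e i))" for i
    proof (cases "c i = 0")
      case False
      then have "effective E (?e i)"
        by (cases E) (auto simp: K_basis_def c_def effective_basis split: if_splits)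
      then show ?thesis by (rule effective_nat_pow)
    qed (simp add: effective_zero)
    ultimately show ?thesis
      using K_basis_carrier by (auto intro!: effective_finsum)
  qed
  moreover have "K_pairing E F U U - F 0 * (real (field_degree E) / 2) * t * (real_of_int (K_dim U))\<^sup>2 =
      real (field_degree E) / 2 * toeplitz_form w (shifted_J F t) (\<lambda>i. real (N i))" for F t
  proof -
    have "K_pairing E F U U - F 0 * (real (field_degree E) / 2) * t * (real_of_int (K_dim U))\<^sup>2 =
        shifted_pairing E F t U U"
      by (simp add: shifted_pairing_def power2_eq_square)
    also have "\<dots> = (\<Sum>i<?n. \<Sum>j<?n. real (c i) * real (c j) * shifted_pairing E F t (?e i) (?e j))"
      unfolding U_def using biadditive_form.B_comb[OF K_biadditive[of E w F t], of "\<lambda>i. int (c i)"] by simp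
    also have "\<dots> = real (field_degree E) / 2 * toeplitz_form w (shifted_J F t) (\<lambda>i. real (N i))"
    proof (cases E)
      case Complex_field
      then show ?thesis by (simp add: complex_pairing_sum c_def field_degree_def)
    next
      case Real_field
      have hw: "(\<lambda>i. real (c i)) = half_weights w (\<lambda>i. real (N i))"
      proof
        fix i
        show "real (c i) = half_weights w (\<lambda>i. real (N i)) i"
          using ev[of i] Real_field by (auto simp: c_def half_weights_def real_of_nat_div)
      qed
      have "toeplitz_form w (shifted_J F t) (restriction w (half_weights w (\<lambda>i. real (N i))) 0) =
          toeplitz_form w (shifted_J F t) (\<lambda>i. real (N i))"
        using sym by (intro toeplitz_form_cong restriction_half_weights) auto
      moreover have "c (Suc (w div 2)) = 0" by (simp add: c_def Real_field)
      ultimately show ?thesis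
        unfolding Real_field using real_pairing_sum[where w = w and x = "\<lambda>i. real (c i)" and F = F and t = t]
        by (simp add: hw field_degree_def)
    qed
    finally show ?thesis .
  qed
  ultimately show ?thesis by blast
qed

section \<open>Comparison with the limit form\<close>

lemma J_eta_sech_half: "J_eta sech_half (2 * k) = M_seq k"
proof -
  have "\<bar>of_int (2 * k)\<bar> / 2 = real (nat \<bar>k\<bar>)" by simp
  then show ?thesis
    by (simp only: J_eta_integrand sech_half_simps M_seq_def m_val_D_int D_int_def)
qed

text \<open>For fixed \<open>F 0\<close> the function enters \<open>J_eta\<close> through a positive
  kernel and with positive sign, so \<open>POS_bound\<close> passes to the integrals.\<close>

lemma J_eta_test_function_le:
  assumes F: "test_function F" and P: "POS F"
  shows "J_eta F (2 * k) \<le> F 0 * M_seq k"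
proof -
  define s where "s = \<bar>real_of_int (2 * k)\<bar> / 2"
  have s: "0 \<le> s" by (simp add: s_def)
  obtain C where C: "\<And>t. t > 0 \<Longrightarrow> \<bar>F t - F 0\<bar> \<le> C * t"
    using test_function_near_0[OF F] by blast
  have "(LBINT t:{0<..}. F 0 * psi_integrand sech_half s t) \<le> (LBINT t:{0<..}. psi_integrand F s t)"
  proof (rule set_integral_mono)
    show "set_integrable lborel {0<..} (\<lambda>t. F 0 * psi_integrand sech_half s t)"
      by (intro set_integrable_mult_right sech_integrable s)
    show "set_integrable lborel {0<..} (psi_integrand F s)"
      by (rule psi_integrand_integrable[OF test_function_measurable[OF F] s C])
    fix t :: real assume "t \<in> {0<..}"
    then have t: "t > 0" by simp
    have "F t * (exp (- t / 2) * (exp (- s * t) / (1 - exp (- t)))) \<le>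
        (F 0 * sech_half t) * (exp (- t / 2) * (exp (- s * t) / (1 - exp (- t))))"
      using t by (intro mult_right_mono POS_bound[OF F P]) auto
    then show "F 0 * psi_integrand sech_half s t \<le> psi_integrand F s t"
      unfolding psi_integrand_def sech_half_simps(1) by (simp add: algebra_simps)
  qed
  then have "F 0 * (LBINT t:{0<..}. psi_integrand sech_half s t) \<le> (LBINT t:{0<..}. psi_integrand F s t)"
    by simp
  then show ?thesis
    unfolding J_eta_sech_half[symmetric] J_eta_integrand s_def[symmetric]
    by (simp add: sech_half_simps algebra_simps)
qed

lemma toeplitz_form_shifted_J_le:
  assumes F: "test_function F" and P: "POS F" and x: "\<And>i. i \<le> w \<Longrightarrow> 0 \<le> x i"
  shows "toeplitz_form w (shifted_J F t) x \<le> F 0 * toeplitz_form w (\<lambda>k. M_seq k - t) x"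
proof -
  have "toeplitz_form w (shifted_J F t) x \<le> (\<Sum>i\<le>w. \<Sum>j\<le>w. x i * x j * (F 0 * (M_seq (int i - int j) - t)))"
    unfolding toeplitz_form_def
  proof (intro sum_mono mult_left_mono)
    fix i j assume "i \<in> {..w}" "j \<in> {..w}"
    then show "0 \<le> x i * x j" using x by simp
    show "shifted_J F t (int i - int j) \<le> F 0 * (M_seq (int i - int j) - t)"
      using J_eta_test_function_le[OF F P, of "int i - int j"] by (simp add: shifted_J_def algebra_simps)
  qed
  also have "\<dots> = F 0 * toeplitz_form w (\<lambda>k. M_seq k - t) x"
    unfolding toeplitz_form_def sum_distrib_left by (intro sum.cong refl) simp
  finally show ?thesis .
qed

text \<open>The constant is the same for all \<open>l \<ge> 1\<close>, since stretching by
  \<open>l\<close> only flattens \<open>odlyzko_g\<close>. A common dominating function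
  results.\<close>

lemma odlyzko_F_near_0:
  assumes l: "l \<ge> 1" and t: "t > 0"
  shows "\<bar>odlyzko_F l t - odlyzko_F l 0\<bar> \<le> (pi\<^sup>2 + 1) * t"
proof -
  have "\<bar>odlyzko_g (t / l) - 1\<bar> \<le> pi\<^sup>2 * min \<bar>t / l\<bar> 1"
    unfolding odlyzko_g_eq by (intro bump_conv_near_0) auto
  also have "\<dots> \<le> pi\<^sup>2 * t"
  proof (rule mult_left_mono)
    have "t / l \<le> t / 1" using l t by (intro divide_left_mono) auto
    then show "min \<bar>t / l\<bar> 1 \<le> t" using l t by simp
  qed simp
  finally have A: "\<bar>odlyzko_g (t / l) - 1\<bar> \<le> pi\<^sup>2 * t" .
  have "odlyzko_F l t - odlyzko_F l 0 = (odlyzko_g (t / l) - 1) * sech_half t + (sech_half t - sech_half 0)"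
    by (simp add: odlyzko_F_simps odlyzko_F_eq[of l t] sech_half_simps algebra_simps)
  also have "\<bar>\<dots>\<bar> \<le> \<bar>(odlyzko_g (t / l) - 1) * sech_half t\<bar> + \<bar>sech_half t - sech_half 0\<bar>"
    by (rule abs_triangle_ineq)
  also have "\<bar>(odlyzko_g (t / l) - 1) * sech_half t\<bar> \<le> (pi\<^sup>2 * t) * 1"
    unfolding abs_mult using sech_half_simps(2,3)[of t] t by (intro mult_mono A) auto
  finally show ?thesis using sech_half_lipschitz[OF t] by (simp add: algebra_simps)
qed

lemma odlyzko_F_tendsto: "((\<lambda>l. odlyzko_F l t) \<longlongrightarrow> sech_half t) at_top"
proof -
  have "((\<lambda>l. t / l) \<longlongrightarrow> 0) at_top" by real_asymp
  moreover have "isCont odlyzko_g 0"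
    using continuous_odlyzko_g[of UNIV] by (simp add: continuous_on_eq_continuous_at)
  ultimately have "((\<lambda>l. odlyzko_g (t / l)) \<longlongrightarrow> odlyzko_g 0) at_top"
    by (rule isCont_tendsto_compose[rotated])
  moreover have "odlyzko_g 0 = 1" by (simp add: odlyzko_g_eq bump_conv_simps)
  ultimately show ?thesis
    unfolding odlyzko_F_eq by (auto intro!: tendsto_eq_intros)
qed

lemma J_eta_odlyzko_F_tendsto: "((\<lambda>l. J_eta (odlyzko_F l) v) \<longlongrightarrow> J_eta sech_half v) at_top"
proof -
  define s where "s = \<bar>real_of_int v\<bar> / 2"
  have s: "0 \<le> s" by (simp add: s_def)
  \<comment> \<open>The constant of \<open>psi_integrand_bound\<close> for the value 1 at 0 and the
    uniform Lipschitz constant of \<open>odlyzko_F_near_0\<close>.\<close>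
  define K where "K = 1 * (s + 2) + 4 * (pi\<^sup>2 + 1)"
  have "((\<lambda>l. LBINT t:{0<..}. psi_integrand (odlyzko_F l) s t) \<longlongrightarrow> (LBINT t:{0<..}. psi_integrand sech_half s t)) at_top"
    unfolding set_lebesgue_integral_def
  proof (rule integral_dominated_convergence_at_top[where w = "\<lambda>t. indicator {0<..} t *\<^sub>R (K * exp (- (1 / 4 * t)))"])
    have [measurable]: "psi_integrand (odlyzko_F l) s \<in> borel_measurable borel"
      "psi_integrand sech_half s \<in> borel_measurable borel" for l
      by (intro psi_integrand_measurable; simp)+
    show "(\<lambda>t. indicator {0<..} t *\<^sub>R psi_integrand sech_half s t) \<in> borel_measurable lborel"
      "\<And>l. (\<lambda>t. indicator {0<..} t *\<^sub>R psi_integrand (odlyzko_F l) s t) \<in> borel_measurable lborel"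
      by measurable
    show "integrable lborel (\<lambda>t. indicator {0<..} t *\<^sub>R (K * exp (- (1 / 4 * t))))"
      unfolding set_integrable_def[symmetric] by (intro set_integrable_mult_right exp_integral(1)) simp
    show "AE t in lborel. ((\<lambda>l. indicator {0<..} t *\<^sub>R psi_integrand (odlyzko_F l) s t) \<longlongrightarrow>
        indicator {0<..} t *\<^sub>R psi_integrand sech_half s t) at_top"
      unfolding psi_integrand_def
      by (intro AE_I2 tendsto_intros odlyzko_F_tendsto)
    show "\<forall>\<^sub>F l in at_top. AE t in lborel. norm (indicator {0<..} t *\<^sub>R psi_integrand (odlyzko_F l) s t) \<le>
        indicator {0<..} t *\<^sub>R (K * exp (- (1 / 4 * t)))"
      using eventually_ge_at_top[of 1]
    proof eventually_elim
      case (elim l)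
      show ?case
      proof (intro AE_I2)
        fix t :: real
        show "norm (indicator {0<..} t *\<^sub>R psi_integrand (odlyzko_F l) s t) \<le>
            indicator {0<..} t *\<^sub>R (K * exp (- (1 / 4 * t)))"
        proof (cases "t > 0")
          case True
          then show ?thesis
            using psi_integrand_bound[OF True s odlyzko_F_near_0[OF elim True]]
            by (simp add: K_def odlyzko_F_simps)
        qed simp
      qed
    qed
  qed
  then show ?thesis
    unfolding J_eta_integrand s_def[symmetric] sech_half_simps(1) odlyzko_F_simps(1)
    by (intro tendsto_intros)
qed

lemma sign_integral_pos:
  assumes l: "l > 0"
  shows "0 < sign_integral (odlyzko_F l)"
proof -
  define f where "f t = indicator {0<..} t *\<^sub>R (odlyzko_F l t * (exp (- t / 2) / (1 + exp (- t))))" for t :: real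
  have [measurable]: "f \<in> borel_measurable borel" unfolding f_def[abs_def] by measurable
  have nonneg: "0 \<le> f t" for t
    by (simp add: f_def odlyzko_F_simps indicator_def add_nonneg_nonneg)
  have "integrable lborel (\<lambda>t. odlyzko_F l t * exp (0 * \<bar>t\<bar>))" by (rule odlyzko_F_exp_integrable[OF l])
  then have "integrable lborel (odlyzko_F l)" by simp
  then have int: "integrable lborel f"
  proof (rule Bochner_Integration.integrable_bound)
    show "AE t in lborel. norm (f t) \<le> norm (odlyzko_F l t)"
    proof (intro AE_I2)
      fix t :: real
      show "norm (f t) \<le> norm (odlyzko_F l t)"
      proof (cases "t > 0")
        case True
        have "exp (- t / 2) / (1 + exp (- t)) \<le> 1"
          using True by (intro iffD2[OF divide_le_eq_1_pos] add_pos_pos) (auto simp: add_increasing2)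
        then show ?thesis
          using True odlyzko_F_simps(2)[of l t]
          by (simp add: f_def abs_mult mult_left_le add_nonneg_nonneg del: times_divide_eq_right)
      qed (simp add: f_def)
    qed
  qed simp
  \<comment> \<open>On this half of the support the cosine in \<open>bump_conv\<close> is still
    positive, so its first term is positive and its second nonnegative. An interval of positive
    measure is enough.\<close>
  have pos: "0 < f t" if t: "t \<in> {0<..<l / 2}" for t
  proof -
    define u where "u = t / l"
    have u: "0 < u" "u < 1 / 2" using t l by (auto simp: u_def field_simps)
    have "pi * u < pi * (1 / 2)" using u by (intro mult_strict_left_mono) auto
    then have "0 < cos (pi * u)" using u by (intro cos_gt_zero) auto
    then have "0 < (1 - u) * cos (pi * u)" using u by (intro mult_pos_pos) auto
    moreover have "0 \<le> sin (pi * u) / pi" using sin_pi_bounds(1)[of u] u by simp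
    ultimately have "0 < bump_conv u" by (simp add: bump_conv_def)
    then have "0 < odlyzko_F l t"
      using u sech_half_simps(2)[of t] by (simp add: odlyzko_F_eq odlyzko_g_eq flip: u_def)
    then show ?thesis
      using t by (simp add: f_def add_pos_pos)
  qed
  have "integral\<^sup>L lborel f \<noteq> 0"
  proof
    assume "integral\<^sup>L lborel f = 0"
    then have "AE t in lborel. f t = 0"
      using integral_nonneg_eq_0_iff_AE[OF int] nonneg by simp
    then have "AE t in lborel. t \<notin> {0<..<l / 2}"
      by eventually_elim (use pos in force)
    then have "{0<..<l / 2} \<in> null_sets lborel"
      using AE_iff_null_sets[of "{0<..<l / 2}" lborel] by simp
    then show False using l by (simp add: null_sets_def)
  qed
  moreover have "0 \<le> integral\<^sup>L lborel f" by (rule Bochner_Integration.integral_nonneg) (rule nonneg)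
  moreover have "sign_integral (odlyzko_F l) = integral\<^sup>L lborel f"
    by (simp add: sign_integral_def set_lebesgue_integral_def f_def[abs_def])
  ultimately show ?thesis by linarith
qed

lemma odlyzko_F_pd_eventually:
  assumes pos: "\<And>z. \<exists>i\<le>w. z i \<noteq> 0 \<Longrightarrow> 0 < toeplitz_form w (\<lambda>k. M_seq k - t) z"
  shows "\<forall>\<^sub>F l in at_top. positive_definite_on (K_ring E) (K_le E w)
    (\<lambda>U. K_pairing E (odlyzko_F l) U U
      - odlyzko_F l 0 * (real (field_degree E) / 2) * t * (real_of_int (K_dim U))\<^sup>2)"
proof -
  have "((\<lambda>l. shifted_J (odlyzko_F l) t k) \<longlongrightarrow> M_seq k - t) at_top" for k
    using J_eta_odlyzko_F_tendsto[of "2 * k"] unfolding shifted_J_def odlyzko_F_simps(1) J_eta_sech_half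
    by (auto intro!: tendsto_intros)
  then have "\<forall>\<^sub>F l in at_top. \<forall>z. (\<exists>i\<le>w. z i \<noteq> 0) \<longrightarrow> 0 < toeplitz_form w (shifted_J (odlyzko_F l) t) z"
    using pos by (intro toeplitz_pos_eventually[where S = "\<lambda>l. shifted_J (odlyzko_F l) t" and T = "\<lambda>k. M_seq k - t"]) blast+
  then show ?thesis
    using eventually_gt_at_top[of 0]
  proof eventually_elim
    case (elim l)
    then show ?case by (intro toeplitz_pos_imp_pd sign_integral_pos) auto
  qed
qed

theorem proposition6p5:
  fixes w :: nat and r :: real and E :: arch_field
  assumes "r \<ge> 1"
  shows
    "((\<exists>F. test_function F \<and> (\<forall>x. 0 \<le> F x) \<and> POS F \<and>
         positive_definite_on (K_ring E) (K_le E w)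
           (\<lambda>U. K_pairing E F U U
              - F 0 * (real (field_degree E) / 2) * ln r * (real_of_int (K_dim U))\<^sup>2))
      \<longleftrightarrow> r < r_bound w) \<and>
     ((\<forall>\<^sub>F l in at_top.
         positive_definite_on (K_ring E) (K_le E w)
           (\<lambda>U. K_pairing E (odlyzko_F l) U U
              - (real (field_degree E) / 2) * ln r * (real_of_int (K_dim U))\<^sup>2))
      \<longleftrightarrow> r < r_bound w) \<and>
     (r > r_bound w \<longrightarrow>
       (\<exists>U\<in>K_le E w. effective E U \<and>
          (\<forall>F. test_function F \<and> (\<exists>x. F x \<noteq> 0) \<and> (\<forall>x. 0 \<le> F x) \<and> POS F \<longrightarrow>
             K_pairing E F U U
               - F 0 * (real (field_degree E) / 2) * ln r * (real_of_int (K_dim U))\<^sup>2 < 0)))"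
proof -
  define t where "t = ln r"
  let ?q = "\<lambda>F U. K_pairing E F U U - F 0 * (real (field_degree E) / 2) * t * (real_of_int (K_dim U))\<^sup>2"
  let ?pd = "\<lambda>F. positive_definite_on (K_ring E) (K_le E w) (?q F)"
  obtain x \<mu> where x0: "\<And>i. i \<le> w \<Longrightarrow> 0 \<le> x i" and xs: "\<And>i. i \<le> w \<Longrightarrow> x (w - i) = x i"
    and x1: "(\<Sum>i\<le>w. x i) = 1" and xm: "\<And>i. i \<le> w \<Longrightarrow> toeplitz_apply w M_seq x i = \<mu>"
    using equilibrium_vector[of w] by blast
  have rb: "r_bound w = exp \<mu>" by (rule r_bound_equilibrium[OF x1 xm])
  have r: "r = exp t" using assms by (simp add: t_def)
  have form: "toeplitz_form w (\<lambda>k. M_seq k - t) x = \<mu> - t"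
    by (rule toeplitz_form_equilibrium[OF x1 xm])
  have xnz: "\<exists>i\<le>w. x i \<noteq> 0"
  proof (rule ccontr)
    assume "\<not> (\<exists>i\<le>w. x i \<noteq> 0)"
    then have "(\<Sum>i\<le>w. x i) = 0" by simp
    with x1 show False by simp
  qed
  have necessary: "t < \<mu>" if F: "test_function F" "\<forall>x. 0 \<le> F x" "POS F" and pd: "?pd F" for F
  proof (rule ccontr)
    assume "\<not> t < \<mu>"
    then have "F 0 * (\<mu> - t) \<le> 0" using F(2) by (simp add: mult_nonneg_nonpos)
    moreover have "0 < toeplitz_form w (shifted_J F t) x"
      by (rule pd_imp_toeplitz_pos[OF pd xs xnz])
    moreover have "toeplitz_form w (shifted_J F t) x \<le> F 0 * (\<mu> - t)"
      using toeplitz_form_shifted_J_le[OF F(1,3), of w x t] x0 form by simp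
    ultimately show False by linarith
  qed
  have sufficient: "\<forall>\<^sub>F l in at_top. ?pd (odlyzko_F l)" if "t < \<mu>"
    by (intro odlyzko_F_pd_eventually toeplitz_form_shift_pos[OF x1 xm that])
  \<comment> \<open>Beyond being large, \<open>l\<close> has to be positive for
    \<open>odlyzko_F l\<close> to be known as a test function satisfying (POS).\<close>
  have witness: "\<exists>l>0. ?pd (odlyzko_F l)" if "\<forall>\<^sub>F l in at_top. ?pd (odlyzko_F l)"
    using eventually_happens[OF eventually_conj[OF eventually_gt_at_top[of 0] that]] by auto
  note odl = test_function_odlyzko_F POS_odlyzko_F odlyzko_F_simps(2)
  have i: "(\<exists>F. test_function F \<and> (\<forall>x. 0 \<le> F x) \<and> POS F \<and> ?pd F) \<longleftrightarrow> t < \<mu>"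
  proof
    assume "t < \<mu>"
    then obtain l where "l > 0" "?pd (odlyzko_F l)" using witness sufficient by blast
    then show "\<exists>F. test_function F \<and> (\<forall>x. 0 \<le> F x) \<and> POS F \<and> ?pd F"
      using odl by blast
  qed (use necessary in blast)
  have ii: "(\<forall>\<^sub>F l in at_top. ?pd (odlyzko_F l)) \<longleftrightarrow> t < \<mu>"
  proof
    assume "\<forall>\<^sub>F l in at_top. ?pd (odlyzko_F l)"
    then obtain l where "l > 0" "?pd (odlyzko_F l)" using witness by blast
    then show "t < \<mu>" using necessary odl by blast
  qed (rule sufficient)
  have iii: "\<exists>U\<in>K_le E w. effective E U \<and>
      (\<forall>F. test_function F \<and> (\<exists>x. F x \<noteq> 0) \<and> (\<forall>x. 0 \<le> F x) \<and> POS F \<longrightarrow> ?q F U < 0)"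
    if "\<mu> < t"
  proof -
    have "toeplitz_form w (\<lambda>k. M_seq k - t) x < 0" using form that by simp
    then obtain N :: "nat \<Rightarrow> nat" where N: "\<And>i. i \<le> w \<Longrightarrow> N (w - i) = N i" "\<And>i. i \<le> w \<Longrightarrow> even (N i)"
      "toeplitz_form w (\<lambda>k. M_seq k - t) (\<lambda>i. real (N i)) < 0"
      using toeplitz_negative_nat[of w x "\<lambda>k. M_seq k - t"] x0 xs by blast
    obtain U where U: "U \<in> K_le E w" "effective E U"
      "\<And>F. ?q F U = real (field_degree E) / 2 * toeplitz_form w (shifted_J F t) (\<lambda>i. real (N i))"
      using effective_element[of w N E, OF N(1,2)] by blast
    have "?q F U < 0" if F: "test_function F" "\<exists>x. F x \<noteq> 0" "\<forall>x. 0 \<le> F x" "POS F" for F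
    proof -
      \<comment> \<open>A nonzero nonnegative \<open>F\<close> is positive at some point, where
        \<open>POS_bound\<close> forces \<open>0 < F 0\<close>. This makes the upper bound by
        \<open>F 0\<close> times a negative number strict.\<close>
      obtain y where y: "0 < F y" using F(2,3) by (metis less_eq_real_def)
      have "0 < F 0 * sech_half y" using y POS_bound[OF F(1,4), of y] by linarith
      then have F0: "0 < F 0" using sech_half_simps(2)[of y] by (simp add: zero_less_mult_iff)
      have "toeplitz_form w (shifted_J F t) (\<lambda>i. real (N i)) \<le>
          F 0 * toeplitz_form w (\<lambda>k. M_seq k - t) (\<lambda>i. real (N i))"
        by (rule toeplitz_form_shifted_J_le[OF F(1,4)]) simp
      also have "\<dots> < 0" using F0 N(3) by (rule mult_pos_neg)
      finally have "toeplitz_form w (shifted_J F t) (\<lambda>i. real (N i)) < 0" .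
      moreover have "0 < real (field_degree E) / 2" by (cases E) (simp_all add: field_degree_def)
      ultimately show ?thesis unfolding U(3) by (intro mult_pos_neg)
    qed
    with U(1,2) show ?thesis by blast
  qed
  have "r < r_bound w \<longleftrightarrow> t < \<mu>" "r_bound w < r \<longleftrightarrow> \<mu> < t" by (simp_all add: rb r)
  then show ?thesis
    using i ii iii unfolding t_def[symmetric] odlyzko_F_simps(1) mult_1 by blast
qed

end
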